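(* Let $\mathcal{L}=(i_1,\ldots,i_k)$ be any signature with $i_k\ge1$ and let $\mathbf{X}=(X_t,t\ge0)$ be an exchangeable combinatorial Lévy process on $\mathcal{L}_{\mathbb{N}}$ with rate measure $\mu$. Then there exist a unique measure $\nu_0$ on $\mathcal{E}_{\mathcal{L}}$ satisfying $$\nu_0(\{\mathbf{0}_{\mathcal{L}}\})=0\quad\text{and}\quad\int_{\mathcal{E}_{\mathcal{L}}}\bigl(1-W(\{\mathbf{0}^{\mathcal{L}}_{[i_k]}\})\bigr)\,\nu_0(dW)<\infty,$$ and, for each $q=1,\ldots,i_k$ and each partition $\lambda\vdash q$, a measure $\mu_\lambda$ on $\mathcal{L}_{\mathbb{N}}$ satisfying (i) $\mu_\lambda(\{\mathbf{0}^{\mathcal{L}}_{\mathbb{N}}\})=0$ and $\mu_\lambda(\{M\in\mathcal{L}_{\mathbb{N}}:M|_{[n]}\ne\mathbf{0}^{\mathcal{L}}_{[n]}\})<\infty$ for all $n\in\mathbb{N}$, (ii) $M^*_{s_\lambda}=M$ for $\mu_\lambda$-almost every $M\in\mathcal{L}_{\mathbb{N}}$, (iii) $s_M=s_\lambda$ for $\mu_\lambda$-almost every $M\in\mathcal{L}_{\mathbb{N}}$, such that $$\mu=\nu_0^*+\sum_{q=1}^{i_k}\sum_{\lambda\vdash q}\mu_\lambda^*.$$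
   Context: Structures. A signature is a finite list $\mathcal{L}=(i_1,\ldots,i_k)$ of integers $0\le i_1\le\cdots\le i_k$. For $S\subseteq\mathbb{N}=\{1,2,\ldots\}$, an $\mathcal{L}$-structure over $S$ is $M=(S;M_1,\ldots,M_k)$ with $M_j\subseteq S^{i_j}$ (with $S^0:=\{\odot\}$ a one-point set); $\mathcal{L}_S$ is the set of these, $M_j(a)=\mathbf{1}\{a\in M_j\}$, $\mathbf{0}_S^{\mathcal{L}}=(S;\emptyset,\ldots,\emptyset)$. $M\triangle M'$ is the componentwise symmetric difference. $M|_{S'}=(S';M_1\cap S'^{i_1},\ldots,M_k\cap S'^{i_k})$; $[n]=\{1,\ldots,n\}$. For an injection $\varphi:S'\to S$, $M^\varphi\in\mathcal{L}_{S'}$ has $(a_1,\ldots,a_{i_j})\in M_j^\varphi$ iff $(\varphi(a_1),\ldots,\varphi(a_{i_j}))\in M_j$. $\mathcal{L}_{\mathbb{N}}$ has the topology of $d(M,M')=1/(1+\sup\{n:M|_{[n]}=M'|_{[n]}\})$ and its Borel $\sigma$-field. Lévy processes. A combinatorial Lévy process on $\mathcal{L}_{\mathbb{N}}$ is a process $(X_t)_{t\ge0}$ with $X_0=\mathbf{0}^{\mathcal{L}}_{\mathbb{N}}$, $X_{t+s}\triangle X_s=_{\mathcal D}X_t$, independent increments $X_{t_1}\triangle X_{t_0},\ldots,X_{t_r}\triangle X_{t_{r-1}}$ ($0\le t_0\le\cdots\le t_r$), and càdlàg paths. It is exchangeable if $(X_t^\sigma)_{t\ge0}=_{\mathcal D}(X_t)_{t\ge0}$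 (finite-dimensional distributions) for all permutations $\sigma$ of $\mathbb{N}$. Its rate measure is the unique measure $\mu$ on $\mathcal{L}_{\mathbb{N}}$ with $\mu(\{\mathbf{0}^{\mathcal{L}}_{\mathbb{N}}\})=0$, $\mu(\{M:M|_{[n]}\ne\mathbf{0}^{\mathcal{L}}_{[n]}\})<\infty$ for all $n$, and $\frac1t\mathbb{P}\{X_t\in d\Delta\}\to\mu(d\Delta)$ vaguely on $\mathcal{L}_{\mathbb{N}}\setminus\{\mathbf{0}^{\mathcal{L}}_{\mathbb{N}}\}$ as $t\downarrow0$. Limits. For $A\in\mathcal{L}_{[m]}$, $M\in\mathcal{L}_{\mathbb{N}}$: $\delta(A;M)=\lim_{n\to\infty}\frac{1}{n(n-1)\cdots(n-m+1)}\sum_{\varphi:[m]\to[n]\text{ injective}}\mathbf{1}\{(M|_{[n]})^\varphi=A\}$, if it exists. If all $\delta(A;M)$ exist, the combinatorial limit $\|M\|$ is the unique probability measure on $\mathcal{L}_{\mathbb{N}}$ with $\|M\|(\{A^*:A^*|_{[m]}=A\})=\delta(A;M)$ for $A\in\mathcal{L}_{[m]}$, $m\in\mathbb{N}$. $\mathcal{E}_{\mathcal{L}}$ is the space of probability measures on $\mathcal{L}_{\mathbb{N}}$ that are exchangeable (invariant under $M\mapsto M^\sigma$ for all permutations $\sigma$ of $\mathbb{N}$) and dissociated (under which $M|_T$ and $M|_{T'}$ are independent for disjoint $T,T'$), with metric $\sum_n2^{-n}\sum_{A\in\mathcal{L}_{[n]}}|W(A)-W'(A)|$, $W(A)=W(\{A\}):=W(\{A^*:A^*|_{[n]}=A\})$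 for $A\in\mathcal{L}_{[n]}$, and its Borel $\sigma$-field. $\mathbf{0}_{\mathcal{L}}\in\mathcal{E}_{\mathcal{L}}$ is the point mass at $\mathbf{0}^{\mathcal{L}}_{\mathbb{N}}$. For a measure $\nu$ on $\mathcal{E}_{\mathcal{L}}$, $\nu^*(\mathcal{B})=\int W(\mathcal{B})\,\nu(dW)$. Multisets. A finite multiset $s=\{s_1^{m_1},\ldots,s_r^{m_r}\}$ of $\mathbb{N}$ has distinct elements $\{s\}=\{s_1<\cdots<s_r\}$ with multiplicities $m_i\ge1$; $|s|=\sum m_i$; $s\preceq s'$ means every element has multiplicity in $s$ at most that in $s'$; $s\cap s'$ takes minimum multiplicities. A tuple $a\in\mathbb{N}^{i}$ is identified, when needed, with the multiset of its entries ($|a|=i$). $\lambda(s)$ is the partition of $|s|$ obtained by listing the multiplicities in nonincreasing order. For $\lambda=(\lambda_1\ge\cdots\ge\lambda_r\ge1)\vdash q$ (i.e. $\sum\lambda_i=q$), $s_\lambda=\{1^{\lambda_1},\ldots,r^{\lambda_r}\}$. Substructures. $M^*_s=(\mathbb{N};M^*_{s,1},\ldots,M^*_{s,k})$ where for $a\in\mathbb{N}^{i_j}$, $M^*_{s,j}(a)=M_j(a)$ if ($|a|\le|s|$, $a\preceq s$ and $\{a\}=\{s\}$) or if ($|a|>|s|$ and $s\preceq a$), and $M^*_{s,j}(a)=0$ otherwise. Limits of substructures. Let $q=|s|$ and $\lambda(s)=(\lambda_1,\ldots,\lambda_r)$. For $j$ with $i_j\ge q$, let $w_1,\ldots,w_{k_j}$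 (any fixed order), $k_j=\binom{i_j}{q}q!/\prod_l\lambda_l!$, be the words of length $i_j$ with exactly $i_j-q$ entries $*$ and whose remaining entries form the multiset $s$. Encode $M^*_{s,j}$ as the structure $(\mathbb{N};M^*_{s,j,1},\ldots,M^*_{s,j,k_j})$ of signature $(i_j-q,\ldots,i_j-q)$, where $b\in M^*_{s,j,l}$ iff the tuple obtained by replacing the $*$'s of $w_l$ from left to right by the entries of $b$ belongs to $M_j$; $\|M^*_{s,j}\|$ denotes its combinatorial limit. If $i_j<q$, $M^*_{s,j}$ is encoded as the null structure, with trivial limit regarded as zero. $\|M\|_s=(\|M^*_{s,1}\|,\ldots,\|M^*_{s,k}\|)$, and $\|M\|_s=\mathbf{0}$ iff for every $j$ with $i_j\ge q$ the limit $\|M^*_{s,j}\|$ is the point mass at the empty structure. If $\|M\|_{s'}$ exists for all finite multisets $s'$ of $\mathbb{N}$ (including $\emptyset$), $s_M:=\bigcap\{s':\|M\|_{s'}\ne\mathbf{0}\}$; a condition on $s_M$ includes that it is defined. Symmetrized measures. For $s$ with $\lambda(s)=\lambda=(\lambda_1,\ldots,\lambda_r)$, write $s=\{\tilde s_1^{\lambda_1},\ldots,\tilde s_r^{\lambda_r}\}$ with $\tilde s_i<\tilde s_{i+1}$ whenever $\lambda_i=\lambda_{i+1}$, and let $\sigma_{s,\lambda}(i)=\tilde s_i$, $i=1,\ldots,r$, extended to a permutation of $\mathbb{N}$ by the order-preserving bijection $\mathbb{N}\setminus[r]\to\mathbb{N}\setminus\{s\}$. Then $\mu_\lambda^*(\cdot)=\sum_{s:\lambda(s)=\lambda}\mu_\lambda(\{M\in\mathcal{L}_{\mathbb{N}}:M^{\sigma_{s,\lambda}^{-1}}\in\cdot\})$.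 *)

theory Defs
  imports "HOL-Probability.Probability" "HOL-Combinatorics.Permutations"
begin

text \<open>
  Throughout, the natural numbers of the mathematical text are \<open>{1, 2, ...}\<close>.  A permutation of them
  is a function with \<open>\<sigma> permutes NN\<close>.
\<close>

abbreviation NN :: "nat set" where
  "NN \<equiv> {1..}"


section \<open>Structures\<close>

definition is_signature :: "nat list \<Rightarrow> bool" where
  "is_signature L \<longleftrightarrow> sorted L"

definition tuples :: "nat set \<Rightarrow> nat \<Rightarrow> nat list set" where
  "tuples S i = {a. length a = i \<and> set a \<subseteq> S}"

text \<open>
  A structure is the list of its relations.  The base set \<open>S\<close> is not stored, it only appears in
  \<open>structures L S\<close>.  The empty list is the single point of \<open>S\<^sup>0\<close>.
\<close>

type_synonym struc = "nat list set list"

definition structures :: "nat list \<Rightarrow> nat set \<Rightarrow> struc set" where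
  "structures L S = {M. length M = length L \<and> (\<forall>j<length L. M ! j \<subseteq> tuples S (L ! j))}"

definition zero_struct :: "nat list \<Rightarrow> struc" where
  "zero_struct L = replicate (length L) {}"

definition struct_diff :: "struc \<Rightarrow> struc \<Rightarrow> struc" where
  "struct_diff M M' = map2 sym_diff M M'"

definition restr :: "nat set \<Rightarrow> struc \<Rightarrow> struc" where
  "restr S' M = map (\<lambda>R. {a \<in> R. set a \<subseteq> S'}) M"

text \<open>The structure \<open>M\<^sup>\<phi>\<close> over \<open>S'\<close>, for an injection \<open>\<phi>\<close> defined on \<open>S'\<close>.\<close>

definition relabel :: "nat list \<Rightarrow> nat set \<Rightarrow> (nat \<Rightarrow> nat) \<Rightarrow> struc \<Rightarrow> struc" where
  "relabel L S' \<phi> M = map (\<lambda>j. {a \<in> tuples S' (L ! j). map \<phi> a \<in> M ! j}) [0..<length L]"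

text \<open>
  The supremum over \<open>n\<close> is infinite exactly when the structures are equal.  The supremum of the empty
  set is 0.
\<close>

definition struct_dist :: "struc \<Rightarrow> struc \<Rightarrow> real" where
  "struct_dist M M' =
     (if M = M' then 0
      else 1 / (1 + real (Sup {n. 1 \<le> n \<and> restr {1..n} M = restr {1..n} M'})))"

definition struct_top :: "nat list \<Rightarrow> nat set \<Rightarrow> struc topology" where
  "struct_top L S = Metric_space.mtopology (structures L S) struct_dist"

definition borel_sigma :: "'a topology \<Rightarrow> 'a measure" where
  "borel_sigma T = sigma (topspace T) {U. openin T U}"

definition struct_borel :: "nat list \<Rightarrow> nat set \<Rightarrow> struc measure" where
  "struct_borel L S = borel_sigma (struct_top L S)"


section \<open>Combinatorial Levy processes\<close>

definition combinatorial_levy ::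
  "nat list \<Rightarrow> 'w measure \<Rightarrow> (real \<Rightarrow> 'w \<Rightarrow> struc) \<Rightarrow> bool" where
  "combinatorial_levy L P X \<longleftrightarrow>
     prob_space P \<and>
     (\<forall>t\<ge>0. X t \<in> measurable P (struct_borel L NN)) \<and>
     (\<forall>\<omega>\<in>space P. X 0 \<omega> = zero_struct L) \<and>
     (\<forall>t\<ge>0. \<forall>s\<ge>0.
        distr P (struct_borel L NN) (\<lambda>\<omega>. struct_diff (X (t + s) \<omega>) (X s \<omega>))
        = distr P (struct_borel L NN) (X t)) \<and>
     (\<forall>(\<tau> :: nat \<Rightarrow> real) r. 0 \<le> \<tau> 0 \<and> (\<forall>i<r. \<tau> i \<le> \<tau> (Suc i)) \<longrightarrow>
        prob_space.indep_vars P (\<lambda>_. struct_borel L NN)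
          (\<lambda>i \<omega>. struct_diff (X (\<tau> (Suc i)) \<omega>) (X (\<tau> i) \<omega>)) {..<r}) \<and>
     (\<forall>\<omega>\<in>space P.
        (\<forall>t\<ge>0. limitin (struct_top L NN) (\<lambda>u. X u \<omega>) (X t \<omega>) (at_right t)) \<and>
        (\<forall>t>0. \<exists>M. limitin (struct_top L NN) (\<lambda>u. X u \<omega>) M (at_left t)))"

definition exchangeable_process ::
  "nat list \<Rightarrow> 'w measure \<Rightarrow> (real \<Rightarrow> 'w \<Rightarrow> struc) \<Rightarrow> bool" where
  "exchangeable_process L P X \<longleftrightarrow>
     (\<forall>\<sigma>. \<sigma> permutes NN \<longrightarrow>
       (\<forall>J. finite J \<and> J \<subseteq> {0..} \<longrightarrow>
         distr P (Pi\<^sub>M J (\<lambda>_. struct_borel L NN)) (\<lambda>\<omega>. \<lambda>t\<in>J. relabel L NN \<sigma> (X t \<omega>))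
         = distr P (Pi\<^sub>M J (\<lambda>_. struct_borel L NN)) (\<lambda>\<omega>. \<lambda>t\<in>J. X t \<omega>)))"

text \<open>
  The last conjunct is vague convergence on the complement of the zero structure.  The test functions
  are the continuous functions with compact support there, extended by the value 0 at the zero
  structure.
\<close>

definition rate_measure ::
  "nat list \<Rightarrow> 'w measure \<Rightarrow> (real \<Rightarrow> 'w \<Rightarrow> struc) \<Rightarrow> struc measure \<Rightarrow> bool" where
  "rate_measure L P X \<mu> \<longleftrightarrow>
     sets \<mu> = sets (struct_borel L NN) \<and>
     emeasure \<mu> {zero_struct L} = 0 \<and>
     (\<forall>n\<ge>1. emeasure \<mu> {M \<in> structures L NN. restr {1..n} M \<noteq> zero_struct L} < \<infinity>) \<and>
     (let T = subtopology (struct_top L NN) (structures L NN - {zero_struct L}) in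
      \<forall>(f :: struc \<Rightarrow> real) K.
        continuous_map T euclideanreal f \<and> compactin T K \<and>
        (\<forall>M \<in> structures L NN - K. f M = 0) \<longrightarrow>
        ((\<lambda>t. (\<integral>\<omega>. f (X t \<omega>) \<partial>P) / t) \<longlongrightarrow> (\<integral>M. f M \<partial>\<mu>)) (at_right 0))"


section \<open>Combinatorial limits\<close>

definition density_seq :: "nat list \<Rightarrow> nat \<Rightarrow> struc \<Rightarrow> struc \<Rightarrow> nat \<Rightarrow> real" where
  "density_seq L m A M n =
     (\<Sum>\<phi> \<in> {\<phi> \<in> {1..m} \<rightarrow>\<^sub>E {1..n}. inj_on \<phi> {1..m}}.
        of_bool (relabel L {1..m} \<phi> (restr {1..n} M) = A))
     / (\<Prod>i<m. real n - real i)"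

definition struct_density :: "nat list \<Rightarrow> nat \<Rightarrow> struc \<Rightarrow> struc \<Rightarrow> real" where
  "struct_density L m A M = lim (density_seq L m A M)"

definition has_limit :: "nat list \<Rightarrow> struc \<Rightarrow> bool" where
  "has_limit L M \<longleftrightarrow>
     (\<forall>m\<ge>1. \<forall>A \<in> structures L {1..m}. convergent (density_seq L m A M))"

definition cylinder :: "nat list \<Rightarrow> nat \<Rightarrow> struc \<Rightarrow> struc set" where
  "cylinder L m A = {M \<in> structures L NN. restr {1..m} M = A}"

text \<open>Only meaningful under \<open>has_limit L M\<close>.\<close>

definition comb_limit :: "nat list \<Rightarrow> struc \<Rightarrow> struc measure" where
  "comb_limit L M =
     (THE W. prob_space W \<and> sets W = sets (struct_borel L NN) \<and>
        (\<forall>m\<ge>1. \<forall>A \<in> structures L {1..m}. measure W (cylinder L m A) = struct_density L m A M))"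

definition exchangeable_measure :: "nat list \<Rightarrow> struc measure \<Rightarrow> bool" where
  "exchangeable_measure L W \<longleftrightarrow>
     (\<forall>\<sigma>. \<sigma> permutes NN \<longrightarrow> distr W (struct_borel L NN) (relabel L NN \<sigma>) = W)"

definition dissociated :: "nat list \<Rightarrow> struc measure \<Rightarrow> bool" where
  "dissociated L W \<longleftrightarrow>
     (\<forall>T T'. T \<subseteq> NN \<and> T' \<subseteq> NN \<and> T \<inter> T' = {} \<longrightarrow>
        prob_space.indep_var W (struct_borel L T) (restr T) (struct_borel L T') (restr T'))"

definition ergodic_measures :: "nat list \<Rightarrow> struc measure set" where
  "ergodic_measures L =
     {W. prob_space W \<and> sets W = sets (struct_borel L NN) \<and>
         exchangeable_measure L W \<and> dissociated L W}"

definition limit_dist :: "nat list \<Rightarrow> struc measure \<Rightarrow> struc measure \<Rightarrow> real" where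
  "limit_dist L W W' =
     (\<Sum>\<^sub>\<infinity>n\<in>{1..}. (1/2)^n *
        (\<Sum>A \<in> structures L {1..n}. \<bar>measure W (cylinder L n A) - measure W' (cylinder L n A)\<bar>))"

definition ergodic_borel :: "nat list \<Rightarrow> struc measure measure" where
  "ergodic_borel L =
     borel_sigma (Metric_space.mtopology (ergodic_measures L) (limit_dist L))"

definition zero_limit :: "nat list \<Rightarrow> struc measure" where
  "zero_limit L = return (struct_borel L NN) (zero_struct L)"

text \<open>The value \<open>\<nu>\<^sup>*(B)\<close>.\<close>

definition mixture :: "struc measure measure \<Rightarrow> struc set \<Rightarrow> ennreal" where
  "mixture \<nu> B = (\<integral>\<^sup>+ W. emeasure W B \<partial>\<nu>)"


section \<open>Multisets and partitions\<close>

definition nat_multisets :: "nat multiset set" where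
  "nat_multisets = {s. set_mset s \<subseteq> NN}"

definition partitions :: "nat \<Rightarrow> nat list set" where
  "partitions q = {p. sorted_wrt (\<ge>) p \<and> (\<forall>x \<in> set p. 1 \<le> x) \<and> sum_list p = q}"

text \<open>
  The distinct elements of \<open>s\<close> by nonincreasing multiplicity.  As \<^const>\<open>sort_key\<close> is stable,
  elements of equal multiplicity stay in increasing order.
\<close>

definition by_mult :: "nat multiset \<Rightarrow> nat list" where
  "by_mult s = sort_key (\<lambda>x. - int (count s x)) (sorted_list_of_set (set_mset s))"

definition mult_partition :: "nat multiset \<Rightarrow> nat list" where
  "mult_partition s = map (count s) (by_mult s)"

definition canonical_mset :: "nat list \<Rightarrow> nat multiset" where
  "canonical_mset p = (\<Sum>i<length p. replicate_mset (p ! i) (Suc i))"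

text \<open>
  The permutation \<open>\<sigma>\<^bsub>s,\<lambda>\<^esub>\<close> for \<open>\<lambda> = mult_partition s\<close>.  The value at 0, which is not an element of \<open>NN\<close>,
  is set to 0 so that the function is a permutation in the sense of \<^const>\<open>permutes\<close>.
\<close>

definition sort_perm :: "nat multiset \<Rightarrow> nat \<Rightarrow> nat" where
  "sort_perm s i =
     (let r = length (by_mult s) in
      if i = 0 then 0
      else if i \<le> r then by_mult s ! (i - 1)
      else enumerate (NN - set_mset s) (i - r - 1))"


section \<open>Substructures and their limits\<close>

definition substruct :: "nat multiset \<Rightarrow> struc \<Rightarrow> struc" where
  "substruct s M =
     map (\<lambda>R. {a \<in> R. (length a \<le> size s \<and> mset a \<subseteq># s \<and> set a = set_mset s) \<or>
                       (length a > size s \<and> s \<subseteq># mset a)}) M"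

text \<open>Words of length \<open>i\<close> over \<open>s\<close>, for \<open>size s \<le> i\<close>.  The entry \<open>None\<close> stands for the symbol \<open>*\<close>.\<close>

definition words :: "nat multiset \<Rightarrow> nat \<Rightarrow> nat option list set" where
  "words s i = {w. mset w = image_mset Some s + replicate_mset (i - size s) None}"

definition word_list :: "nat multiset \<Rightarrow> nat \<Rightarrow> nat option list list" where
  "word_list s i = (SOME ws. distinct ws \<and> set ws = words s i)"

fun fill :: "nat option list \<Rightarrow> nat list \<Rightarrow> nat list" where
  "fill [] b = []"
| "fill (Some x # w) b = x # fill w b"
| "fill (None # w) b = hd b # fill w (tl b)"

definition encode_sig :: "nat multiset \<Rightarrow> nat \<Rightarrow> nat list" where
  "encode_sig s i = replicate (length (word_list s i)) (i - size s)"

definition encode_rel :: "nat multiset \<Rightarrow> nat \<Rightarrow> nat list set \<Rightarrow> struc" where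
  "encode_rel s i R =
     map (\<lambda>w. {b \<in> tuples NN (i - size s). fill w b \<in> R}) (word_list s i)"

definition encoded_sub :: "nat list \<Rightarrow> nat multiset \<Rightarrow> struc \<Rightarrow> nat \<Rightarrow> struc" where
  "encoded_sub L s M j = encode_rel s (L ! j) (substruct s M ! j)"

text \<open>Components \<open>j\<close> with \<open>L ! j < size s\<close> have a trivial limit that counts as zero.\<close>

definition sub_limit_exists :: "nat list \<Rightarrow> nat multiset \<Rightarrow> struc \<Rightarrow> bool" where
  "sub_limit_exists L s M \<longleftrightarrow>
     (\<forall>j<length L. size s \<le> L ! j \<longrightarrow>
        has_limit (encode_sig s (L ! j)) (encoded_sub L s M j))"

definition sub_limit_zero :: "nat list \<Rightarrow> nat multiset \<Rightarrow> struc \<Rightarrow> bool" where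
  "sub_limit_zero L s M \<longleftrightarrow>
     (\<forall>j<length L. size s \<le> L ! j \<longrightarrow>
        comb_limit (encode_sig s (L ! j)) (encoded_sub L s M j)
        = zero_limit (encode_sig s (L ! j)))"

text \<open>
  The condition \<open>s\<^sub>M = s\<close>, which includes that \<open>s\<^sub>M\<close> is defined.  On multisets, \<^const>\<open>Inf\<close> is the
  pointwise minimum of the multiplicities.
\<close>

definition s_index_is :: "nat list \<Rightarrow> struc \<Rightarrow> nat multiset \<Rightarrow> bool" where
  "s_index_is L M s \<longleftrightarrow>
     (\<forall>s' \<in> nat_multisets. sub_limit_exists L s' M) \<and>
     {s' \<in> nat_multisets. \<not> sub_limit_zero L s' M} \<noteq> {} \<and>
     Inf {s' \<in> nat_multisets. \<not> sub_limit_zero L s' M} = s"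

text \<open>
  The value \<open>\<mu>\<^sub>\<lambda>\<^sup>*(B)\<close>.  The sum over the countably many \<open>s\<close> with \<open>\<lambda>(s) = p\<close> is written as an
  integral with respect to counting measure.
\<close>

definition symmetrized :: "nat list \<Rightarrow> nat list \<Rightarrow> struc measure \<Rightarrow> struc set \<Rightarrow> ennreal" where
  "symmetrized L p \<mu> B =
     (\<integral>\<^sup>+ s. emeasure \<mu> {M \<in> structures L NN. relabel L NN (inv (sort_perm s)) M \<in> B}
        \<partial>count_space {s \<in> nat_multisets. mult_partition s = p})"


section \<open>The two distances are metrics\<close>

text \<open>
  The constant \<^const>\<open>Metric_space.mtopology\<close> describes the metric topology only for a distance that
  is a metric.  This holds for both uses above.
\<close>

lemma structures_eqI:
  assumes "M \<in> structures L S" "M' \<in> structures L S" "S \<subseteq> NN"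
    and "\<And>n. 1 \<le> n \<Longrightarrow> restr {1..n} M = restr {1..n} M'"
  shows "M = M'"
proof (rule nth_equalityI)
  show "length M = length M'" using assms(1,2) by (simp add: structures_def)
next
  fix j assume j: "j < length M"
  have sub: "M ! j \<subseteq> tuples S (L ! j)" "M' ! j \<subseteq> tuples S (L ! j)" "j < length M'"
    using assms(1,2) j by (auto simp: structures_def)
  have "a \<in> M ! j \<longleftrightarrow> a \<in> M' ! j" if "set a \<subseteq> NN" for a
  proof -
    define n where "n = Max (insert 1 (set a))"
    have "set a \<subseteq> {1..n}" using that by (auto simp: n_def)
    moreover have "1 \<le> n" by (simp add: n_def)
    ultimately have "{a \<in> M ! j. set a \<subseteq> {1..n}} = {a \<in> M' ! j. set a \<subseteq> {1..n}}"
      using arg_cong[where f = "\<lambda>N. N ! j", OF assms(4)[of n]] j sub(3)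
      by (simp add: restr_def)
    then show ?thesis using \<open>set a \<subseteq> {1..n}\<close> by blast
  qed
  moreover have "set a \<subseteq> NN" if "a \<in> M ! j \<or> a \<in> M' ! j" for a
    using that sub(1,2) assms(3) unfolding tuples_def by blast
  ultimately show "M ! j = M' ! j" by blast
qed

lemma restr_restr: "restr T (restr S M) = restr (S \<inter> T) M"
  by (auto simp: restr_def)

lemma restr_mono:
  assumes "restr {1..n} M = restr {1..n} M'" "m \<le> (n::nat)"
  shows "restr {1..m} M = restr {1..m} M'"
proof -
  have "{1..n} \<inter> {1..m} = {1..m}" using assms(2) by auto
  then show ?thesis using arg_cong[OF assms(1), of "restr {1..m}"] by (simp only: restr_restr)
qed

lemma struct_dist_le_iff:
  assumes "M \<in> structures L S" "M' \<in> structures L S" "S \<subseteq> NN"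
  shows "struct_dist M M' \<le> 1 / (1 + real n) \<longleftrightarrow> restr {1..n} M = restr {1..n} M' \<or> n = 0"
proof (cases "M = M'")
  case True then show ?thesis by (simp add: struct_dist_def)
next
  case False
  let ?A = "{n. 1 \<le> n \<and> restr {1..n} M = restr {1..n} M'}"
  obtain k where k: "1 \<le> k" "restr {1..k} M \<noteq> restr {1..k} M'"
    using structures_eqI[OF assms] False by blast
  have sub: "?A \<subseteq> {..<k}"
  proof
    fix n assume "n \<in> ?A"
    then have "restr {1..n} M = restr {1..n} M'" by blast
    then have "\<not> k \<le> n" using k(2) restr_mono by blast
    then show "n \<in> {..<k}" by simp
  qed
  then have fin: "finite ?A" by (rule finite_subset) simp
  have *: "n \<le> Sup ?A \<longleftrightarrow> restr {1..n} M = restr {1..n} M' \<or> n = 0"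
  proof (cases "?A = {}")
    case True
    then have "Sup ?A = 0" by (simp only: Sup_nat_empty)
    moreover have "n \<notin> ?A" using True by blast
    ultimately show ?thesis by (cases "n = 0") simp_all
  next
    case ne: False
    have S: "Sup ?A = Max ?A" using ne fin by (simp only: Sup_nat_def if_False)
    have mem: "Max ?A \<in> ?A" using Max_in[OF fin ne] .
    show ?thesis
    proof
      assume "n \<le> Sup ?A"
      then show "restr {1..n} M = restr {1..n} M' \<or> n = 0"
        using mem restr_mono[of "Max ?A" M M' n] unfolding S by blast
    next
      assume "restr {1..n} M = restr {1..n} M' \<or> n = 0"
      then have "n \<in> ?A \<or> n = 0" by (cases "n = 0") simp_all
      then show "n \<le> Sup ?A" unfolding S using Max_ge[OF fin] by blast
    qed
  qed
  have "struct_dist M M' \<le> 1 / (1 + real n) \<longleftrightarrow> n \<le> Sup ?A"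
    using False by (simp only: struct_dist_def if_False) (simp add: field_simps)
  then show ?thesis using * by blast
qed

lemma Metric_space_structures:
  assumes "S \<subseteq> NN"
  shows "Metric_space (structures L S) struct_dist"
proof
  show "0 \<le> struct_dist x y" for x y by (simp add: struct_dist_def)
  show "struct_dist x y = struct_dist y x" for x y by (simp add: struct_dist_def eq_commute)
  show "struct_dist x y = 0 \<longleftrightarrow> x = y" for x y
    using of_nat_0_le_iff[of "Sup {n. 1 \<le> n \<and> restr {1..n} x = restr {1..n} y}", where 'a = real]
    unfolding struct_dist_def by (cases "x = y") (simp_all add: add_nonneg_eq_0_iff)
  fix x y z assume xyz: "x \<in> structures L S" "y \<in> structures L S" "z \<in> structures L S"
  show "struct_dist x z \<le> struct_dist x y + struct_dist y z"
  proof (cases "x = y \<or> y = z")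
    case True then show ?thesis by (auto simp: struct_dist_def)
  next
    case False
    define a where "a = Sup {n. 1 \<le> n \<and> restr {1..n} x = restr {1..n} y}"
    define b where "b = Sup {n. 1 \<le> n \<and> restr {1..n} y = restr {1..n} z}"
    have a: "struct_dist x y = 1 / (1 + real a)" and b: "struct_dist y z = 1 / (1 + real b)"
      using False by (simp_all add: struct_dist_def a_def b_def)
    have ra: "restr {1..a} x = restr {1..a} y \<or> a = 0"
      using struct_dist_le_iff[OF xyz(1,2) assms, of a] a by (metis order_refl)
    have rb: "restr {1..b} y = restr {1..b} z \<or> b = 0"
      using struct_dist_le_iff[OF xyz(2,3) assms, of b] b by (metis order_refl)
    let ?c = "min a b"
    have "restr {1..?c} x = restr {1..?c} z \<or> ?c = 0"
      using ra rb restr_mono[of a x y ?c] restr_mono[of b y z ?c] by auto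
    then have "struct_dist x z \<le> 1 / (1 + real ?c)"
      using struct_dist_le_iff[OF xyz(1,3) assms] by blast
    also have "\<dots> \<le> struct_dist x y + struct_dist y z"
      unfolding a b by (cases "a \<le> b") (simp_all add: min_absorb1 min_absorb2)
    finally show ?thesis .
  qed
qed

lemma finite_structures:
  assumes "finite S" shows "finite (structures L S)"
proof -
  have "finite {a. length a = i \<and> set a \<subseteq> S}" for i
    using finite_lists_length_eq[OF assms, of i] by (simp add: conj_commute)
  then have "finite (\<Union>i\<in>set L. Pow (tuples S i))" (is "finite ?B")
    by (simp add: tuples_def)
  moreover have "structures L S \<subseteq> {M. set M \<subseteq> ?B \<and> length M = length L}"
    by (force simp: structures_def in_set_conv_nth)
  ultimately show ?thesis
    using finite_lists_length_eq finite_subset by blast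
qed

lemma restr_in_structures:
  assumes "M \<in> structures L S" shows "restr T M \<in> structures L (S \<inter> T)"
proof -
  have len: "length M = length L" and sub: "\<And>j. j < length L \<Longrightarrow> M ! j \<subseteq> tuples S (L ! j)"
    using assms by (simp_all add: structures_def)
  have "restr T M ! j \<subseteq> tuples (S \<inter> T) (L ! j)" if "j < length L" for j
    using sub[OF that] that len by (auto simp: restr_def tuples_def)
  then show ?thesis using len by (simp add: structures_def restr_def)
qed

lemma topspace_struct_top:
  "S \<subseteq> NN \<Longrightarrow> topspace (struct_top L S) = structures L S"
  unfolding struct_top_def by (simp add: Metric_space.topspace_mtopology Metric_space_structures)

lemma openin_struct_top_iff:
  assumes "S \<subseteq> NN"
  shows "openin (struct_top L S) U \<longleftrightarrow> U \<subseteq> structures L S \<and>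
    (\<forall>M\<in>U. \<exists>n\<ge>1. {M' \<in> structures L S. restr {1..n} M' = restr {1..n} M} \<subseteq> U)"
proof -
  interpret Metric_space "structures L S" struct_dist by (rule Metric_space_structures[OF assms])
  have 1: "\<exists>n\<ge>1. {M' \<in> structures L S. restr {1..n} M' = restr {1..n} M} \<subseteq> U"
    if U: "U \<subseteq> structures L S" "M \<in> U" "r > 0" "mball M r \<subseteq> U" for M r
  proof -
    obtain k where k: "inverse (real (Suc k)) < r" using reals_Archimedean[OF U(3)] by blast
    define n where "n = Suc k"
    have n: "1 / (1 + real n) < r" "n \<ge> 1"
    proof -
      have "1 / (1 + real n) \<le> inverse (real (Suc k))" by (simp add: n_def field_simps)
      then show "1 / (1 + real n) < r" using k by linarith
    qed (simp add: n_def)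
    show ?thesis
    proof (intro exI conjI subsetI)
      show "1 \<le> n" by fact
      fix M' assume "M' \<in> {M' \<in> structures L S. restr {1..n} M' = restr {1..n} M}"
      then have "M' \<in> structures L S" "struct_dist M M' \<le> 1 / (1 + real n)"
        using struct_dist_le_iff[of M L S M' n] U assms by auto
      then have "M' \<in> mball M r" using U(1,2) n(1) by auto
      then show "M' \<in> U" using U(4) by blast
    qed
  qed
  have 2: "mball M (1 / (1 + real n)) \<subseteq> U"
    if "U \<subseteq> structures L S" "M \<in> U"
      "{M' \<in> structures L S. restr {1..n} M' = restr {1..n} M} \<subseteq> U" "n \<ge> 1" for M n
  proof
    fix M' assume M': "M' \<in> mball M (1 / (1 + real n))"
    then have "restr {1..n} M = restr {1..n} M'"
      using struct_dist_le_iff[of M L S M' n] assms that(4) by auto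
    then show "M' \<in> U" using that(3) M' by auto
  qed
  show ?thesis
  proof
    assume "openin (struct_top L S) U"
    then show "U \<subseteq> structures L S \<and>
      (\<forall>M\<in>U. \<exists>n\<ge>1. {M' \<in> structures L S. restr {1..n} M' = restr {1..n} M} \<subseteq> U)"
      unfolding struct_top_def openin_mtopology using 1 by meson
  next
    assume *: "U \<subseteq> structures L S \<and>
      (\<forall>M\<in>U. \<exists>n\<ge>1. {M' \<in> structures L S. restr {1..n} M' = restr {1..n} M} \<subseteq> U)"
    have "\<exists>r>0. mball M r \<subseteq> U" if "M \<in> U" for M
    proof -
      obtain n where "n \<ge> 1" "{M' \<in> structures L S. restr {1..n} M' = restr {1..n} M} \<subseteq> U"
        using * \<open>M \<in> U\<close> by blast
      then have "mball M (1 / (1 + real n)) \<subseteq> U" using 2[of M n] * \<open>M \<in> U\<close> by blast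
      then show ?thesis by (intro exI[of _ "1 / (1 + real n)"]) auto
    qed
    then show "openin (struct_top L S) U"
      unfolding struct_top_def openin_mtopology using * by blast
  qed
qed

lemma space_struct_borel: "S \<subseteq> NN \<Longrightarrow> space (struct_borel L S) = structures L S"
  unfolding struct_borel_def borel_sigma_def
  by (simp only: space_measure_of_conv topspace_struct_top)

lemma sets_struct_borel:
  assumes "S \<subseteq> NN"
  shows "sets (struct_borel L S) = sigma_sets (structures L S) {U. openin (struct_top L S) U}"
proof -
  have "{U. openin (struct_top L S) U} \<subseteq> Pow (structures L S)"
    using openin_subset[of "struct_top L S"] topspace_struct_top[OF assms, of L] by blast
  then show ?thesis
    unfolding struct_borel_def borel_sigma_def topspace_struct_top[OF assms]
    by (rule sets_measure_of)
qed

lemma sets_struct_borel_cylinder: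
  "sets (struct_borel L NN)
   = sigma_sets (structures L NN) {cylinder L n A |n A. 1 \<le> n \<and> A \<in> structures L {1..n}}"
  (is "_ = sigma_sets _ ?C")
proof -
  have "openin (struct_top L NN) U \<Longrightarrow> U \<in> sigma_sets (structures L NN) ?C" for U
  proof -
    assume U: "openin (struct_top L NN) U"
    let ?D = "{C \<in> ?C. C \<subseteq> U}"
    have cnt: "countable ?C"
    proof -
      have "?C \<subseteq> (\<Union>n. (cylinder L n) ` structures L {1..n})" by blast
      moreover have "countable (\<Union>n. (cylinder L n) ` structures L {1..n})"
        by (rule countable_UN[OF countableI_type], rule countable_image, rule countable_finite,
            rule finite_structures, rule finite_atLeastAtMost)
      ultimately show ?thesis by (rule countable_subset)
    qed
    then have cntD: "countable ?D" by (rule countable_subset[rotated]) blast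
    have "U = \<Union>?D"
    proof
      show "U \<subseteq> \<Union>?D"
      proof
        fix M assume "M \<in> U"
        then obtain n where n: "n \<ge> 1" "M \<in> structures L NN"
          "{M' \<in> structures L NN. restr {1..n} M' = restr {1..n} M} \<subseteq> U"
          using U unfolding openin_struct_top_iff[OF order_refl] by blast
        have "restr {1..n} M \<in> structures L (NN \<inter> {1..n})"
          by (rule restr_in_structures[OF n(2)])
        also have "NN \<inter> {1..n} = {1..n}" by auto
        finally have "cylinder L n (restr {1..n} M) \<in> ?D"
          using n by (auto simp: cylinder_def)
        moreover have "M \<in> cylinder L n (restr {1..n} M)" using n by (simp add: cylinder_def)
        ultimately show "M \<in> \<Union>?D" by (rule UnionI)
      qed
    qed blast
    also have "\<dots> \<in> sigma_sets (structures L NN) ?C"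
      using cntD by (rule sigma_sets_UNION) (blast intro: sigma_sets.Basic)
    finally show "U \<in> sigma_sets (structures L NN) ?C" .
  qed
  moreover have "openin (struct_top L NN) C" if C: "C \<in> ?C" for C
  proof -
    from C obtain n A where "1 \<le> n" "C = cylinder L n A" by blast
    then show ?thesis
      unfolding openin_struct_top_iff[OF order_refl] by (auto simp: cylinder_def)
  qed
  ultimately show ?thesis
    unfolding sets_struct_borel[OF order_refl]
    by (intro sigma_sets_eqI) (auto intro: sigma_sets.Basic)
qed

lemma measure_eqI_cylinder:
  assumes "prob_space W" "prob_space W'"
    and "sets W = sets (struct_borel L NN)" "sets W' = sets (struct_borel L NN)"
    and eq: "\<And>n A. 1 \<le> n \<Longrightarrow> A \<in> structures L {1..n} \<Longrightarrow>
       measure W (cylinder L n A) = measure W' (cylinder L n A)"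
  shows "W = W'"
proof -
  interpret W: prob_space W by fact
  interpret W': prob_space W' by fact
  let ?C = "{cylinder L n A |n A. 1 \<le> n \<and> A \<in> structures L {1..n}}"
  have sub: "?C \<subseteq> Pow (structures L NN)" by (auto simp: cylinder_def)
  have int: "cylinder L n A \<inter> cylinder L m B \<in> insert {} ?C"
    if "1 \<le> n" "A \<in> structures L {1..n}" "1 \<le> m" "B \<in> structures L {1..m}" "n \<le> m" for n m A B
  proof (cases "restr {1..n} B = A")
    case True
    have "cylinder L n A \<inter> cylinder L m B = cylinder L m B"
      using True restr_restr[of "{1..n}" "{1..m}"] \<open>n \<le> m\<close> by (auto simp: cylinder_def Int_absorb1)
    then show ?thesis using that by auto
  next
    case False
    then have "cylinder L n A \<inter> cylinder L m B = {}"
      using restr_restr[of "{1..n}" "{1..m}"] \<open>n \<le> m\<close> by (auto simp: cylinder_def Int_absorb1)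
    then show ?thesis by simp
  qed
  show ?thesis
  proof (rule measure_eqI_generator_eq_countable[where E = "insert {} ?C" and \<Omega> = "structures L NN"
        and A = "cylinder L 1 ` structures L {1..1}"])
    show "Int_stable (insert {} ?C)"
    proof (rule Int_stableI)
      fix a b assume "a \<in> insert {} ?C" "b \<in> insert {} ?C"
      then consider "a = {} \<or> b = {}" | n A m B where "a = cylinder L n A" "b = cylinder L m B"
        "1 \<le> n" "A \<in> structures L {1..n}" "1 \<le> m" "B \<in> structures L {1..m}" by blast
      then show "a \<inter> b \<in> insert {} ?C"
      proof cases
        case 1 then show ?thesis by auto
      next
        case (2 n A m B)
        then show ?thesis
          using int[of n A m B] int[of m B n A] by (cases "n \<le> m") (auto simp: Int_commute)
      qed
    qed
    show "insert {} ?C \<subseteq> Pow (structures L NN)" using sub by blast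
    have *: "sigma_sets (structures L NN) (insert {} ?C) = sigma_sets (structures L NN) ?C"
      by (rule sigma_sets_eqI) (auto intro: sigma_sets.Basic sigma_sets.Empty)
    show "sets W = sigma_sets (structures L NN) (insert {} ?C)"
      "sets W' = sigma_sets (structures L NN) (insert {} ?C)"
      unfolding * using assms(3,4) sets_struct_borel_cylinder by simp_all
    show "emeasure W X = emeasure W' X" if "X \<in> insert {} ?C" for X
      using that eq by (auto simp: W.emeasure_eq_measure W'.emeasure_eq_measure)
    show "emeasure W a \<noteq> \<infinity>" for a by simp
    show "cylinder L 1 ` structures L {1..1} \<subseteq> insert {} ?C" by blast
    show "\<Union>(cylinder L 1 ` structures L {1..1}) = structures L NN"
    proof (intro equalityI subsetI)
      fix M assume M: "M \<in> structures L NN"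
      have "restr {1..1} M \<in> structures L (NN \<inter> {1..1})"
        by (rule restr_in_structures[OF M])
      also have "NN \<inter> {1..1} = {1..1}" by auto
      finally show "M \<in> \<Union>(cylinder L 1 ` structures L {1..1})"
        using M by (auto simp: cylinder_def)
    qed (auto simp: cylinder_def)
    show "countable (cylinder L 1 ` structures L {1..1})"
      by (intro countable_image countable_finite finite_structures) simp
  qed
qed

lemma limit_dist_summand:
  assumes "prob_space W" "sets W = sets (struct_borel L NN)"
    and "prob_space W'" "sets W' = sets (struct_borel L NN)"
  shows "(\<lambda>n. (1/2)^n * (\<Sum>A \<in> structures L {1..n}.
           \<bar>measure W (cylinder L n A) - measure W' (cylinder L n A)\<bar>)) summable_on {1..}"
    (is "?f summable_on _")
proof -
  have total: "(\<Sum>A \<in> structures L {1..n}. measure V (cylinder L n A)) \<le> 1"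
    if "prob_space V" "sets V = sets (struct_borel L NN)" "1 \<le> n" for V n
  proof -
    interpret V: prob_space V by fact
    have "cylinder L n A \<in> sets V" if "A \<in> structures L {1..n}" for A
      using that \<open>1 \<le> n\<close> unfolding \<open>sets V = _\<close> sets_struct_borel_cylinder
      by (blast intro: sigma_sets.Basic)
    then have "(\<Sum>A \<in> structures L {1..n}. measure V (cylinder L n A))
               = measure V (\<Union>A \<in> structures L {1..n}. cylinder L n A)"
      by (intro V.finite_measure_finite_Union[symmetric] finite_structures)
         (auto simp: disjoint_family_on_def cylinder_def)
    also have "\<dots> \<le> 1" by simp
    finally show ?thesis .
  qed
  have bound: "norm (?f n) \<le> 2 * (1/2)^n" if "n \<in> {1..}" for n
  proof -
    have "(\<Sum>A \<in> structures L {1..n}. \<bar>measure W (cylinder L n A) - measure W' (cylinder L n A)\<bar>)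
      \<le> (\<Sum>A \<in> structures L {1..n}. measure W (cylinder L n A) + measure W' (cylinder L n A))"
      by (rule sum_mono) (simp add: abs_le_iff add_increasing add_increasing2)
    also have "\<dots> \<le> 2"
      using total[OF assms(1,2), of n] total[OF assms(3,4), of n] that by (simp add: sum.distrib)
    finally show ?thesis by (simp add: sum_nonneg)
  qed
  have "summable (\<lambda>n. 2 * (1/2::real)^n)" by (intro summable_mult summable_geometric) simp
  then have "(\<lambda>n. 2 * (1/2::real)^n) summable_on UNIV"
    by (subst summable_on_UNIV_nonneg_real_iff) auto
  then have "(\<lambda>n. 2 * (1/2::real)^n) summable_on {1..}" by (rule summable_on_subset) simp
  then show ?thesis by (rule summable_on_comparison_test) (use bound in auto)
qed

lemma Metric_space_ergodic: "Metric_space (ergodic_measures L) (limit_dist L)"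
proof
  show "0 \<le> limit_dist L x y" for x y
    unfolding limit_dist_def by (intro infsum_nonneg mult_nonneg_nonneg sum_nonneg) auto
  show "limit_dist L x y = limit_dist L y x" for x y
    unfolding limit_dist_def by (simp only: abs_minus_commute)
  let ?t = "\<lambda>W W' n. (1/2::real)^n *
        (\<Sum>A \<in> structures L {1..n}. \<bar>measure W (cylinder L n A) - measure W' (cylinder L n A)\<bar>)"
  have summ: "?t x y summable_on {1..}" if "x \<in> ergodic_measures L" "y \<in> ergodic_measures L" for x y
    using limit_dist_summand[of x L y] that unfolding ergodic_measures_def by blast
  have nn: "0 \<le> ?t x y n" for x y n by (intro mult_nonneg_nonneg sum_nonneg) auto
  show "limit_dist L x y = 0 \<longleftrightarrow> x = y"
    if xy: "x \<in> ergodic_measures L" "y \<in> ergodic_measures L" for x y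
  proof
    assume 0: "limit_dist L x y = 0"
    have "measure x (cylinder L n A) = measure y (cylinder L n A)"
      if nA: "1 \<le> n" "A \<in> structures L {1..n}" for n A
    proof -
      have "?t x y n = 0"
      proof (rule nonneg_infsum_le_0D[OF _ summ[OF xy]])
        show "infsum (?t x y) {1..} \<le> 0" using 0 unfolding limit_dist_def by simp
        show "0 \<le> ?t x y m" for m by (rule nn)
        show "n \<in> {1..}" using nA(1) by simp
      qed
      then have "(\<Sum>A \<in> structures L {1..n}. \<bar>measure x (cylinder L n A) - measure y (cylinder L n A)\<bar>) = 0"
        by simp
      then have "\<bar>measure x (cylinder L n A) - measure y (cylinder L n A)\<bar> = 0"
        using nA(2) by (subst (asm) sum_nonneg_eq_0_iff) (auto intro: finite_structures)
      then show ?thesis by simp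
    qed
    then show "x = y"
      using xy unfolding ergodic_measures_def by (intro measure_eqI_cylinder[of x y L]) auto
  qed (simp add: limit_dist_def)
  fix x y z
  assume xyz: "x \<in> ergodic_measures L" "y \<in> ergodic_measures L" "z \<in> ergodic_measures L"
  have "limit_dist L x z \<le> infsum (\<lambda>n. ?t x y n + ?t y z n) {1..}"
    unfolding limit_dist_def
  proof (rule infsum_mono[OF summ[OF xyz(1,3)] summable_on_add[OF summ[OF xyz(1,2)] summ[OF xyz(2,3)]]])
    fix n :: nat
    show "?t x z n \<le> ?t x y n + ?t y z n"
      unfolding distrib_left[symmetric] sum.distrib[symmetric]
      by (intro mult_left_mono sum_mono) auto
  qed
  also have "\<dots> = limit_dist L x y + limit_dist L y z"
    unfolding limit_dist_def by (rule infsum_add[OF summ[OF xyz(1,2)] summ[OF xyz(2,3)]])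
  finally show "limit_dist L x z \<le> limit_dist L x y + limit_dist L y z" .
qed

end

theory Submission
  imports Defs
begin

text \<open>
  The process enters through its rate measure \<open>\<mu>\<close>, which is exchangeable, has no mass at the zero structure, and
  is finite on \<open>{M. M|[n] \<noteq> 0}\<close> for every \<open>n\<close>.  Exchangeability passes to the limit because the
  indicator of a clopen event that excludes the zero structure is a test function for vague convergence
  (\<open>rate_measure_exchangeable\<close>).  The statement is then one about such measures \<open>\<mu>\<close>.

  \<^emph>\<open>Sampling.\<close>  The density of a pattern in \<open>M|[n]\<close> is an average over uniform permutations of \<open>{1..n}\<close>.
  Independent samples of a fixed size overlap with probability \<open>O(1/n)\<close>, which has two consequences.  For a
  single structure whose densities converge, the limit is automatically exchangeable and dissociated
  (\<open>comb_limit_ergodic\<close>; that it is a measure at all is compactness).  For a random structure whose law is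
  finite and invariant under the permutations that fix a finite set \<open>S\<close>, the densities form an \<open>L\<^sup>2\<close> Cauchy
  sequence with rate \<open>O(1/n)\<close>, hence converge almost surely (\<open>AE_convergent\<close>), and the mean of the limit is
  the probability to see the pattern at any fixed place outside \<open>S\<close> (\<open>integral_h_eq_limit\<close>).  As
  \<open>{M. M|[n] \<noteq> 0}\<close> has finite measure and is invariant under the permutations that fix \<open>{1..n}\<close>, all limits
  \<open>\<parallel>M\<parallel>\<^sub>s\<close> exist for \<open>\<mu>\<close>-almost every \<open>M\<close>.

  \<^emph>\<open>The part with \<open>\<parallel>M\<parallel> \<noteq> 0\<close>.\<close>  Apply the last fact to a pattern far away from \<open>[n]\<close> on the event
  \<open>M|[n] \<noteq> 0\<close> and let \<open>n\<close> tend to infinity: on \<open>{\<parallel>M\<parallel> \<noteq> 0}\<close> the measure \<open>\<mu>\<close> is the mixture of the limits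
  \<open>\<parallel>M\<parallel>\<close> (\<open>mixture_limit_law\<close>), so \<open>\<nu>\<^sub>0\<close> is the image of \<open>\<mu>\<close> there under \<open>M \<mapsto> \<parallel>M\<parallel>\<close>.

  \<^emph>\<open>The part with \<open>\<parallel>M\<parallel> = 0\<close>.\<close>  Call \<open>s\<close> dense in \<open>M\<close> if \<open>\<parallel>M\<parallel>\<^sub>s \<noteq> 0\<close>.  The event that \<open>s\<close> is dense is a countable
  union of events of finite measure that depend on no label outside \<open>s\<close>.  On such an event, a pattern of
  density zero does not occur at all outside \<open>s\<close>; therefore, if \<open>s\<close> and \<open>s'\<close> are dense, so is the part of \<open>s'\<close> supported by
  \<open>s\<close> (\<open>AE_dense_restrict\<close>).  The supports of the dense multisets are thus closed under intersection.  The
  entries of every tuple of \<open>M\<close> form a dense multiset, so there are dense multisets, and if \<open>\<emptyset>\<close> is not among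
  them then \<open>s\<^sub>M\<close>, their intersection, is nonempty (\<open>AE_index\<close>).  That \<open>M = M\<^sup>*\<^sub>s\<close> for \<open>s = s\<^sub>M\<close> is then immediate, and
  \<open>\<mu>\<^sub>\<lambda>\<close> is \<open>\<mu>\<close> restricted to \<open>{M. s\<^sub>M = s\<^sub>\<lambda>}\<close>; exchangeability turns its symmetrization into the restriction of
  \<open>\<mu>\<close> to \<open>{M. \<lambda>(s\<^sub>M) = \<lambda>}\<close>.

  \<^emph>\<open>Uniqueness.\<close>  By the law of large numbers, \<open>\<parallel>M\<parallel> = W\<close> for \<open>W\<close>-almost every \<open>M\<close> if \<open>W\<close> is exchangeable and
  dissociated (\<open>AE_comb_limit_eq\<close>), while the symmetrized measures only charge structures with \<open>\<parallel>M\<parallel> = 0\<close>.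
  Hence \<open>\<nu>\<^sub>0(E) = \<mu>{M. \<parallel>M\<parallel> \<in> E}\<close> whenever \<open>E\<close> does not contain the trivial limit.
\<close>

section \<open>Averages over the symmetric group\<close>

text \<open>
  Densities are averages over injections \<open>[m] \<rightarrow> [n]\<close>.  Averaging over the permutations of \<open>[n]\<close> gives the same
  value and serves all \<open>m\<close> at once; invariance properties become substitutions in the sum.
\<close>

definition perm_avg :: "nat \<Rightarrow> ((nat \<Rightarrow> nat) \<Rightarrow> real) \<Rightarrow> real" where
  "perm_avg n h = (\<Sum>\<tau> | \<tau> permutes {1..n}. h \<tau>) / fact n"

text \<open>
  A function of injections \<open>[m] \<rightarrow> \<nat>\<close>, represented as a function of arbitrary maps.
\<close>

definition depends_on :: "nat \<Rightarrow> ((nat \<Rightarrow> nat) \<Rightarrow> 'a) \<Rightarrow> bool" where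
  "depends_on m h \<longleftrightarrow> (\<forall>\<tau> \<tau>'. (\<forall>i\<in>{1..m}. \<tau> i = \<tau>' i) \<longrightarrow> h \<tau> = h \<tau>')"

lemma depends_onD: "depends_on m h \<Longrightarrow> (\<And>i. i \<in> {1..m} \<Longrightarrow> \<tau> i = \<tau>' i) \<Longrightarrow> h \<tau> = h \<tau>'"
  unfolding depends_on_def by blast

lemma finite_perms [simp]: "finite {\<tau>. \<tau> permutes {1..n::nat}}"
  by (rule finite_permutations) simp

lemma card_perms: "card {\<tau>. \<tau> permutes {1..n::nat}} = fact n"
  by (rule card_permutations) simp_all

lemma perm_avg_const [simp]: "perm_avg n (\<lambda>_. c) = c"
  using card_perms[of n] by (simp add: perm_avg_def)

lemma perm_avg_cong:
  "(\<And>\<tau>. \<tau> permutes {1..n} \<Longrightarrow> h \<tau> = h' \<tau>) \<Longrightarrow> perm_avg n h = perm_avg n h'"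
  unfolding perm_avg_def by (intro arg_cong2[where f = "(/)"] sum.cong) auto

lemma perm_avg_add: "perm_avg n (\<lambda>\<tau>. h \<tau> + h' \<tau>) = perm_avg n h + perm_avg n h'"
  by (simp add: perm_avg_def sum.distrib add_divide_distrib)

lemma perm_avg_diff: "perm_avg n (\<lambda>\<tau>. h \<tau> - h' \<tau>) = perm_avg n h - perm_avg n h'"
  by (simp add: perm_avg_def sum_subtractf diff_divide_distrib)

lemma perm_avg_cmult: "perm_avg n (\<lambda>\<tau>. c * h \<tau>) = c * perm_avg n h"
  by (simp add: perm_avg_def sum_distrib_left[symmetric])

lemma perm_avg_multc: "perm_avg n (\<lambda>\<tau>. h \<tau> * c) = perm_avg n h * c"
  using perm_avg_cmult[of n c h] by (simp add: mult.commute)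

lemma perm_avg_sum: "perm_avg n (\<lambda>\<tau>. \<Sum>i\<in>I. h i \<tau>) = (\<Sum>i\<in>I. perm_avg n (h i))"
  by (simp add: perm_avg_def sum_divide_distrib[symmetric] sum.swap[of _ I])

lemma perm_avg_mono:
  "(\<And>\<tau>. \<tau> permutes {1..n} \<Longrightarrow> h \<tau> \<le> h' \<tau>) \<Longrightarrow> perm_avg n h \<le> perm_avg n h'"
  unfolding perm_avg_def by (intro divide_right_mono sum_mono) auto

lemma perm_avg_nonneg: "(\<And>\<tau>. \<tau> permutes {1..n} \<Longrightarrow> 0 \<le> h \<tau>) \<Longrightarrow> 0 \<le> perm_avg n h"
  using perm_avg_mono[of n "\<lambda>_. 0" h] by simp

lemma perm_avg_le: "(\<And>\<tau>. \<tau> permutes {1..n} \<Longrightarrow> h \<tau> \<le> c) \<Longrightarrow> perm_avg n h \<le> c"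
  using perm_avg_mono[of n h "\<lambda>_. c"] by simp

lemma perm_avg_abs: "\<bar>perm_avg n h\<bar> \<le> perm_avg n (\<lambda>\<tau>. \<bar>h \<tau>\<bar>)"
  unfolding perm_avg_def by (simp add: divide_right_mono)

lemma perm_avg_swap:
  "perm_avg n (\<lambda>\<tau>. perm_avg k (\<lambda>\<rho>. h \<tau> \<rho>)) = perm_avg k (\<lambda>\<rho>. perm_avg n (\<lambda>\<tau>. h \<tau> \<rho>))"
  unfolding perm_avg_def sum_divide_distrib[symmetric] by (subst sum.swap) simp

lemma perm_avg_compose_left:
  assumes "\<rho> permutes {1..n}" shows "perm_avg n (\<lambda>\<tau>. h (\<rho> \<circ> \<tau>)) = perm_avg n h"
  unfolding perm_avg_def using setum_permutations_compose_left[OF assms, of h] by simp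

lemma perm_avg_compose_right:
  assumes "\<rho> permutes {1..n}" shows "perm_avg n (\<lambda>\<tau>. h (\<tau> \<circ> \<rho>)) = perm_avg n h"
  unfolding perm_avg_def using sum_permutations_compose_right[OF assms, of h] by simp

lemma extend_to_permutation:
  assumes "finite V" "inj_on \<phi> T" "T \<subseteq> V" "\<phi> ` T \<subseteq> V"
  obtains \<rho> where "\<rho> permutes V" "\<And>i. i \<in> T \<Longrightarrow> \<rho> i = \<phi> i"
proof -
  have "card (\<phi> ` T) = card T" using assms(2) by (rule card_image)
  then have "card (V - T) = card (V - \<phi> ` T)"
    using assms by (simp add: card_Diff_subset finite_subset)
  then obtain g where g: "bij_betw g (V - T) (V - \<phi> ` T)"
    using assms(1) by (metis finite_Diff finite_same_card_bij)
  define \<rho> where "\<rho> i = (if i \<in> T then \<phi> i else if i \<in> V then g i else i)" for i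
  have "bij_betw \<rho> T (\<phi> ` T)" using assms(2) by (auto simp: bij_betw_def \<rho>_def inj_on_def)
  moreover have "bij_betw \<rho> (V - T) (V - \<phi> ` T)"
    using g by (subst bij_betw_cong[of _ _ g]) (auto simp: \<rho>_def)
  ultimately have "bij_betw \<rho> (T \<union> (V - T)) (\<phi> ` T \<union> (V - \<phi> ` T))"
    by (rule bij_betw_combine) blast
  moreover have "T \<union> (V - T) = V" "\<phi> ` T \<union> (V - \<phi> ` T) = V" using assms by auto
  ultimately have "bij_betw \<rho> V V" by simp
  then have "\<rho> permutes V"
    using assms(3) by (intro bij_imp_permutes) (auto simp: \<rho>_def)
  then show ?thesis using that by (simp add: \<rho>_def)
qed

text \<open>
  The partial injection \<open>\<sigma>\<close> extends to a permutation, so this is right invariance.  Exchangeability of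
  combinatorial limits is an instance.
\<close>

lemma perm_avg_marginal:
  assumes dep: "depends_on m h" and inj: "inj_on \<sigma> {1..m}" and into: "\<sigma> ` {1..m} \<subseteq> {1..n}"
  shows "perm_avg n (\<lambda>\<tau>. h (\<tau> \<circ> \<sigma>)) = perm_avg n h"
proof -
  have "card (\<sigma> ` {1..m}) \<le> card {1..n}" by (rule card_mono) (use into in auto)
  then have "m \<le> n" using card_image[OF inj] by simp
  then obtain \<rho> where \<rho>: "\<rho> permutes {1..n}" "\<And>i. i \<in> {1..m} \<Longrightarrow> \<rho> i = \<sigma> i"
    using extend_to_permutation[OF _ inj, of "{1..n}"] into by auto
  have "perm_avg n (\<lambda>\<tau>. h (\<tau> \<circ> \<sigma>)) = perm_avg n (\<lambda>\<tau>. h (\<tau> \<circ> \<rho>))"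
    using \<rho>(2) by (intro perm_avg_cong depends_onD[OF dep]) simp
  also have "\<dots> = perm_avg n h" by (rule perm_avg_compose_right[OF \<rho>(1)])
  finally show ?thesis .
qed

text \<open>
  Left multiplication by transpositions permutes the possible values of \<open>\<tau> i\<close>.
\<close>

lemma perm_avg_point:
  assumes "i \<in> {1..n}" "x \<in> {1..n}"
  shows "perm_avg n (\<lambda>\<tau>. of_bool (\<tau> i = x)) = 1 / n"
proof -
  have eq: "perm_avg n (\<lambda>\<tau>. of_bool (\<tau> i = y)) = perm_avg n (\<lambda>\<tau>. of_bool (\<tau> i = x))"
    if "y \<in> {1..n}" for y
  proof -
    have p: "Transposition.transpose x y permutes {1..n}"
      using that assms by (intro permutes_swap_id)
    have "(Transposition.transpose x y \<circ> \<tau>) i = y \<longleftrightarrow> \<tau> i = x" for \<tau> :: "nat \<Rightarrow> nat"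
      by (auto simp: Transposition.transpose_def)
    then show ?thesis
      using perm_avg_compose_left[OF p, of "\<lambda>\<tau>. of_bool (\<tau> i = y)"] by simp
  qed
  have "1 = perm_avg n (\<lambda>\<tau>. \<Sum>y\<in>{1..n}. of_bool (\<tau> i = y))"
  proof -
    have "perm_avg n (\<lambda>\<tau>. \<Sum>y\<in>{1..n}. of_bool (\<tau> i = y)) = perm_avg n (\<lambda>\<tau>. 1)"
    proof (rule perm_avg_cong)
      fix \<tau> assume "\<tau> permutes {1..n}"
      then have "\<tau> i \<in> {1..n}" using assms(1) permutes_in_image by metis
      then show "(\<Sum>y\<in>{1..n}. of_bool (\<tau> i = y)) = (1::real)"
        by (simp add: of_bool_def)
    qed
    then show ?thesis by simp
  qed
  also have "\<dots> = n * perm_avg n (\<lambda>\<tau>. of_bool (\<tau> i = x))"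
    unfolding perm_avg_sum using eq by (simp del: sum_of_bool_eq)
  finally show ?thesis using assms by (auto simp: field_simps)
qed

text \<open>
  A union bound over the \<open>m\<close> sampled labels.  All errors of order \<open>1/n\<close> below come from here.
\<close>

lemma perm_avg_hit_le:
  assumes "finite S" "n \<ge> 1"
  shows "perm_avg n (\<lambda>\<tau>. of_bool (\<tau> ` {1..m} \<inter> S \<noteq> {})) \<le> m * card S / n"
proof (cases "m \<le> n")
  case True
  have "perm_avg n (\<lambda>\<tau>. of_bool (\<tau> ` {1..m} \<inter> S \<noteq> {}))
    \<le> perm_avg n (\<lambda>\<tau>. \<Sum>i\<in>{1..m}. \<Sum>x\<in>S \<inter> {1..n}. of_bool (\<tau> i = x))"
  proof (rule perm_avg_mono)
    fix \<tau> assume \<tau>: "\<tau> permutes {1..n}"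
    show "of_bool (\<tau> ` {1..m} \<inter> S \<noteq> {}) \<le> (\<Sum>i\<in>{1..m}. \<Sum>x\<in>S \<inter> {1..n}. of_bool (\<tau> i = x) :: real)"
    proof (cases "\<tau> ` {1..m} \<inter> S = {}")
      case False
      then obtain i where i: "i \<in> {1..m}" "\<tau> i \<in> S" by blast
      then have "\<tau> i \<in> S \<inter> {1..n}" using permutes_in_image[OF \<tau>, of i] True by auto
      then have "1 \<le> (\<Sum>x\<in>S \<inter> {1..n}. of_bool (\<tau> i = x) :: real)"
        by (simp add: of_bool_def)
      also have "\<dots> \<le> (\<Sum>i\<in>{1..m}. \<Sum>x\<in>S \<inter> {1..n}. of_bool (\<tau> i = x) :: real)"
        using i by (intro member_le_sum sum_nonneg) auto
      finally show ?thesis using False by simp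
    qed (simp add: sum_nonneg)
  qed
  also have "\<dots> = (\<Sum>i\<in>{1..m}. \<Sum>x\<in>S \<inter> {1..n}. 1 / n)"
    unfolding perm_avg_sum by (intro sum.cong refl perm_avg_point) (use True in auto)
  also have "\<dots> = m * card (S \<inter> {1..n}) / n" by simp
  also have "\<dots> \<le> m * card S / n"
    using card_mono[OF assms(1), of "S \<inter> {1..n}"]
    by (intro divide_right_mono) (auto simp del: of_nat_mult simp flip: of_nat_mult)
  finally show ?thesis .
next
  case False
  show ?thesis
  proof (cases "S = {}")
    case False
    then have "1 \<le> card S" using assms(1) by (simp add: Suc_le_eq card_gt_0_iff)
    then have "n \<le> m * card S" using \<open>\<not> m \<le> n\<close> by (metis le_trans mult_le_mono nat_le_linear nat_mult_1_right)
    then have "1 \<le> m * card S / n" using assms(2) by (simp add: field_simps flip: of_nat_mult)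
    moreover have "perm_avg n (\<lambda>\<tau>. of_bool (\<tau> ` {1..m} \<inter> S \<noteq> {})) \<le> 1" by (rule perm_avg_le) simp
    ultimately show ?thesis by linarith
  qed simp
qed

text \<open>Two bounded functions that agree off a small set of permutations have close averages.\<close>

text \<open>
  The form in which the union bound is used: \<open>S\<close> collects the labels that a sample should avoid.
\<close>

lemma perm_avg_close:
  assumes S: "finite S" "n \<ge> 1"
    and c: "\<And>\<tau>. \<tau> permutes {1..n} \<Longrightarrow> \<bar>h \<tau> - h' \<tau>\<bar> \<le> c"
    and eq: "\<And>\<tau>. \<tau> permutes {1..n} \<Longrightarrow> \<tau> ` {1..m} \<inter> S = {} \<Longrightarrow> h \<tau> = h' \<tau>"
  shows "\<bar>perm_avg n h - perm_avg n h'\<bar> \<le> c * (m * card S / n)"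
proof -
  have c0: "0 \<le> c" using c[OF permutes_id] by linarith
  have "\<bar>perm_avg n h - perm_avg n h'\<bar> \<le> perm_avg n (\<lambda>\<tau>. \<bar>h \<tau> - h' \<tau>\<bar>)"
    using perm_avg_abs[of n "\<lambda>\<tau>. h \<tau> - h' \<tau>"] by (simp add: perm_avg_diff)
  also have "\<dots> \<le> perm_avg n (\<lambda>\<tau>. c * of_bool (\<tau> ` {1..m} \<inter> S \<noteq> {}))"
  proof (rule perm_avg_mono)
    fix \<tau> assume \<tau>: "\<tau> permutes {1..n}"
    show "\<bar>h \<tau> - h' \<tau>\<bar> \<le> c * of_bool (\<tau> ` {1..m} \<inter> S \<noteq> {})"
      using c[OF \<tau>] eq[OF \<tau>] by (cases "\<tau> ` {1..m} \<inter> S = {}") auto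
  qed
  also have "\<dots> \<le> c * (m * card S / n)"
    unfolding perm_avg_cmult by (intro mult_left_mono perm_avg_hit_le S c0)
  finally show ?thesis .
qed

text \<open>
  A permutation of \<open>[n + 1]\<close> is one of \<open>[n]\<close> followed by a transposition of \<open>n + 1\<close> and some \<open>b\<close>.  Only the \<open>m\<close>
  values of \<open>b\<close> among the sampled labels change the sample.
\<close>

lemma perm_avg_Suc_close:
  assumes dep: "depends_on m h" and h: "\<And>\<tau>. 0 \<le> h \<tau>" "\<And>\<tau>. h \<tau> \<le> (1::real)" and mn: "m \<le> n"
  shows "\<bar>perm_avg (Suc n) h - perm_avg n h\<bar> \<le> m / Suc n"
proof -
  let ?t = "\<lambda>b. Transposition.transpose (Suc n) b"
  have ins: "{1..Suc n} = insert (Suc n) {1..n}" by auto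
  have "perm_avg (Suc n) h =
      (\<Sum>b\<in>{1..Suc n}. \<Sum>q | q permutes {1..n}. h (?t b \<circ> q)) / fact (Suc n)"
    unfolding perm_avg_def by (subst (1 2) ins, subst sum_over_permutations_insert) simp_all
  also have "\<dots> = (\<Sum>b\<in>{1..Suc n}. perm_avg n (\<lambda>q. h (?t b \<circ> q))) / Suc n"
    by (simp add: perm_avg_def sum_divide_distrib[symmetric] field_simps)
  also have "\<dots> = perm_avg n (\<lambda>q. \<Sum>b\<in>{1..Suc n}. h (?t b \<circ> q)) / Suc n"
    by (simp only: perm_avg_sum)
  finally have "(perm_avg (Suc n) h - perm_avg n h) * Suc n
    = perm_avg n (\<lambda>q. \<Sum>b\<in>{1..Suc n}. h (?t b \<circ> q)) - Suc n * perm_avg n h"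
    by (simp add: field_simps del: of_nat_Suc)
  also have "\<dots> = perm_avg n (\<lambda>q. \<Sum>b\<in>{1..Suc n}. (h (?t b \<circ> q) - h q))"
    unfolding perm_avg_cmult[symmetric] perm_avg_diff[symmetric] by (simp add: sum_subtractf)
  finally have e: "(perm_avg (Suc n) h - perm_avg n h) * Suc n
    = perm_avg n (\<lambda>q. \<Sum>b\<in>{1..Suc n}. (h (?t b \<circ> q) - h q))" .
  have "\<bar>perm_avg n (\<lambda>q. \<Sum>b\<in>{1..Suc n}. (h (?t b \<circ> q) - h q))\<bar> \<le>
     perm_avg n (\<lambda>q. \<bar>\<Sum>b\<in>{1..Suc n}. (h (?t b \<circ> q) - h q)\<bar>)" by (rule perm_avg_abs)
  also have "\<dots> \<le> m"
  proof (rule perm_avg_le)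
    fix q assume q: "q permutes {1..n}"
    have "h (?t b \<circ> q) = h q" if "b \<notin> q ` {1..m}" for b
    proof (rule depends_onD[OF dep])
      fix i assume i: "i \<in> {1..m}"
      then have "q i \<le> n" using permutes_in_image[OF q, of i] mn by auto
      moreover have "q i \<noteq> b" using that i by auto
      ultimately show "(?t b \<circ> q) i = q i" by (simp add: Transposition.transpose_def)
    qed
    then have "(\<Sum>b\<in>{1..Suc n}. (h (?t b \<circ> q) - h q)) = (\<Sum>b\<in>{1..Suc n} \<inter> q ` {1..m}. (h (?t b \<circ> q) - h q))"
      by (intro sum.mono_neutral_right) auto
    also have "\<bar>\<dots>\<bar> \<le> (\<Sum>b\<in>{1..Suc n} \<inter> q ` {1..m}. 1)"
      by (rule order_trans[OF sum_abs], rule sum_mono) (use h in \<open>auto simp: abs_le_iff; smt (verit)\<close>)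
    also have "\<dots> \<le> m"
      using card_mono[of "q ` {1..m}" "{1..Suc n} \<inter> q ` {1..m}"] card_image_le[of "{1..m}" q] by simp
    finally show "\<bar>\<Sum>b\<in>{1..Suc n}. (h (?t b \<circ> q) - h q)\<bar> \<le> m" .
  qed
  finally have "\<bar>(perm_avg (Suc n) h - perm_avg n h) * Suc n\<bar> \<le> m" using e by simp
  then have "\<bar>perm_avg (Suc n) h - perm_avg n h\<bar> * real (Suc n) \<le> m"
    by (simp only: abs_mult abs_of_nat)
  then show ?thesis by (simp add: pos_le_divide_eq del: of_nat_Suc)
qed

text \<open>
  This slow variation turns convergence along a subsequence into convergence.
\<close>

lemma perm_avg_interpolate:
  assumes dep: "depends_on m h" and h: "\<And>\<tau>. 0 \<le> h \<tau>" "\<And>\<tau>. h \<tau> \<le> (1::real)"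
    and mn: "m \<le> n" and n0: "0 < n"
  shows "\<bar>perm_avg (n + d) h - perm_avg n h\<bar> \<le> m * d / n"
proof (induction d)
  case (Suc d)
  have "\<bar>perm_avg (Suc (n + d)) h - perm_avg (n + d) h\<bar> \<le> m / Suc (n + d)"
    by (rule perm_avg_Suc_close[OF dep h]) (use mn in auto)
  also have "\<dots> \<le> m / n" using n0 by (intro divide_left_mono) auto
  finally have "\<bar>perm_avg (n + Suc d) h - perm_avg n h\<bar> \<le> m / n + m * d / n"
    using Suc by simp
  also have "\<dots> = real m * real (Suc d) / n" by (simp add: add_divide_distrib algebra_simps)
  finally show ?case .
qed simp

text \<open>
  Where \<open>\<sigma>\<close> stays inside \<open>[n]\<close> it agrees with a permutation of \<open>[n]\<close>, which the average absorbs; a sample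
  rarely meets the at most \<open>r\<close> remaining labels.  The hypothesis on \<open>r\<close> is made for the permutations that
  sort a multiset: they move infinitely many labels, but boundedly many out of each \<open>[n]\<close>.
\<close>

lemma perm_avg_relabel_close:
  assumes dep: "depends_on m h" and h: "\<And>\<tau>. 0 \<le> h \<tau>" "\<And>\<tau>. h \<tau> \<le> (1::real)"
    and inj: "inj \<sigma>" and r: "\<And>n. card {i \<in> {1..n}. \<sigma> i \<notin> {1..n}} \<le> r" and n: "n \<ge> 1"
    and mn: "m \<le> n"
  shows "\<bar>perm_avg n (\<lambda>\<tau>. h (\<sigma> \<circ> \<tau>)) - perm_avg n h\<bar> \<le> m * r / n"
proof -
  define B where "B = {i \<in> {1..n}. \<sigma> i \<notin> {1..n}}"
  have fin: "finite B" by (simp add: B_def)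
  obtain \<rho> where \<rho>: "\<rho> permutes {1..n}" "\<And>i. i \<in> {1..n} - B \<Longrightarrow> \<rho> i = \<sigma> i"
    by (rule extend_to_permutation[of "{1..n}" \<sigma> "{1..n} - B"])
       (use inj in \<open>auto simp: B_def inj_on_def inj_def\<close>)
  have "\<bar>perm_avg n (\<lambda>\<tau>. h (\<sigma> \<circ> \<tau>)) - perm_avg n (\<lambda>\<tau>. h (\<rho> \<circ> \<tau>))\<bar> \<le> 1 * (m * card B / n)"
  proof (rule perm_avg_close[OF fin n])
    fix \<tau> assume \<tau>: "\<tau> permutes {1..n}"
    show "\<bar>h (\<sigma> \<circ> \<tau>) - h (\<rho> \<circ> \<tau>)\<bar> \<le> 1"
      using h[of "\<sigma> \<circ> \<tau>"] h[of "\<rho> \<circ> \<tau>"] by linarith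
    assume a: "\<tau> ` {1..m} \<inter> B = {}"
    show "h (\<sigma> \<circ> \<tau>) = h (\<rho> \<circ> \<tau>)"
    proof (rule depends_onD[OF dep])
      fix i assume i: "i \<in> {1..m}"
      then have "\<tau> i \<in> {1..n}" "\<tau> i \<notin> B" using a permutes_in_image[OF \<tau>, of i] mn by (simp, blast)
      then have "\<tau> i \<in> {1..n} - B" by blast
      then show "(\<sigma> \<circ> \<tau>) i = (\<rho> \<circ> \<tau>) i" using \<rho>(2) by simp
    qed
  qed
  also have "\<dots> \<le> m * r / n"
    using r[of n] unfolding B_def by (auto intro!: divide_right_mono mult_left_mono)
  finally show ?thesis using perm_avg_compose_left[OF \<rho>(1), of h] by simp
qed

lemma perm_avg_relabel_tendsto:
  assumes dep: "depends_on m h" and h: "\<And>\<tau>. 0 \<le> h \<tau>" "\<And>\<tau>. h \<tau> \<le> (1::real)"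
    and inj: "inj \<sigma>" and r: "\<And>n. card {i \<in> {1..n}. \<sigma> i \<notin> {1..n}} \<le> r"
  shows "(\<lambda>n. perm_avg n (\<lambda>\<tau>. h (\<sigma> \<circ> \<tau>))) \<longlonglongrightarrow> l \<longleftrightarrow> (\<lambda>n. perm_avg n h) \<longlonglongrightarrow> l"
proof -
  have "(\<lambda>n. perm_avg n (\<lambda>\<tau>. h (\<sigma> \<circ> \<tau>)) - perm_avg n h) \<longlonglongrightarrow> 0"
  proof (rule Lim_null_comparison)
    show "\<forall>\<^sub>F n in sequentially. norm (perm_avg n (\<lambda>\<tau>. h (\<sigma> \<circ> \<tau>)) - perm_avg n h) \<le> m * r / n"
      using eventually_ge_at_top[of "Suc m"]
      by eventually_elim (use perm_avg_relabel_close[OF dep h inj r] in auto)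
    show "(\<lambda>n. real (m * r) / n) \<longlonglongrightarrow> 0" by (rule lim_const_over_n)
  qed
  from Lim_transform[OF _ this] Lim_transform2[OF _ this] show ?thesis by blast
qed

text \<open>Sampling without replacement from disjoint positions is asymptotically independent.\<close>

text \<open>
  Replace the second of two independent samples \<open>\<tau>\<close>, \<open>\<rho>\<close> by \<open>\<tau> \<circ> \<rho>\<close>.  Unless \<open>\<rho>\<close> maps into \<open>T\<close>, the restrictions
  of \<open>\<tau>\<close> to \<open>T\<close> and of \<open>\<tau> \<circ> \<rho>\<close> to \<open>T'\<close> together form one sample of the positions \<open>T \<union> T'\<close>.
\<close>

lemma perm_avg_product_close:
  assumes dep: "\<And>\<tau> \<tau>'. (\<And>i. i \<in> T \<Longrightarrow> \<tau> i = \<tau>' i) \<Longrightarrow> h \<tau> = h \<tau>'"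
    and dep': "\<And>\<tau> \<tau>'. (\<And>i. i \<in> T' \<Longrightarrow> \<tau> i = \<tau>' i) \<Longrightarrow> h' \<tau> = h' \<tau>'"
    and h: "\<And>\<tau>. 0 \<le> h \<tau>" "\<And>\<tau>. h \<tau> \<le> (1::real)" and h': "\<And>\<tau>. 0 \<le> h' \<tau>" "\<And>\<tau>. h' \<tau> \<le> (1::real)"
    and T: "T \<inter> T' = {}" "T \<subseteq> {1..m::nat}" "T' \<subseteq> {1..m}" and mn: "m \<le> n" "n \<ge> 1"
  shows "\<bar>perm_avg n h * perm_avg n h' - perm_avg n (\<lambda>\<tau>. h \<tau> * h' \<tau>)\<bar> \<le> m * m / n"
proof -
  have "{1..m} \<subseteq> {1..n}" using mn by simp
  then have TV: "T \<subseteq> {1..n}" "T' \<subseteq> {1..n}" using T by blast+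
  then have "finite T" "finite T'" by (auto intro: finite_subset)
  note TV = TV this
  have "perm_avg n h * perm_avg n h' = perm_avg n (\<lambda>\<tau>. perm_avg n (\<lambda>\<rho>. h \<tau> * h' \<rho>))"
    by (simp add: perm_avg_cmult perm_avg_multc)
  also have "\<dots> = perm_avg n (\<lambda>\<tau>. perm_avg n (\<lambda>\<rho>. h \<tau> * h' (\<tau> \<circ> \<rho>)))"
  proof (rule perm_avg_cong)
    fix \<tau> assume "\<tau> permutes {1..n}"
    from perm_avg_compose_left[OF this, of "\<lambda>\<rho>. h \<tau> * h' \<rho>"]
    show "perm_avg n (\<lambda>\<rho>. h \<tau> * h' \<rho>) = perm_avg n (\<lambda>\<rho>. h \<tau> * h' (\<tau> \<circ> \<rho>))" by simp
  qed
  also have "\<dots> = perm_avg n (\<lambda>\<rho>. perm_avg n (\<lambda>\<tau>. h \<tau> * h' (\<tau> \<circ> \<rho>)))" by (rule perm_avg_swap)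
  finally have e: "perm_avg n h * perm_avg n h' = perm_avg n (\<lambda>\<rho>. perm_avg n (\<lambda>\<tau>. h \<tau> * h' (\<tau> \<circ> \<rho>)))" .
  let ?c = "perm_avg n (\<lambda>\<tau>. h \<tau> * h' \<tau>)"
  have "\<bar>perm_avg n (\<lambda>\<rho>. perm_avg n (\<lambda>\<tau>. h \<tau> * h' (\<tau> \<circ> \<rho>))) - perm_avg n (\<lambda>\<rho>. ?c)\<bar>
    \<le> 1 * (m * card T / n)"
  proof (rule perm_avg_close[OF TV(3) mn(2)])
    fix \<rho> assume \<rho>: "\<rho> permutes {1..n}"
    have hh: "0 \<le> h \<tau> * h' \<tau>'" "h \<tau> * h' \<tau>' \<le> 1" for \<tau> \<tau>'
      using h h' by (auto intro: mult_le_one)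
    have "0 \<le> perm_avg n (\<lambda>\<tau>. h \<tau> * h' (\<tau> \<circ> \<rho>))" "perm_avg n (\<lambda>\<tau>. h \<tau> * h' (\<tau> \<circ> \<rho>)) \<le> 1"
      "0 \<le> ?c" "?c \<le> 1"
      by (rule perm_avg_nonneg perm_avg_le, rule hh)+
    then show "\<bar>perm_avg n (\<lambda>\<tau>. h \<tau> * h' (\<tau> \<circ> \<rho>)) - ?c\<bar> \<le> 1" by linarith
    assume a: "\<rho> ` {1..m} \<inter> T = {}"
    define \<phi> where "\<phi> i = (if i \<in> T then i else \<rho> i)" for i
    have "inj_on \<phi> (T \<union> T')"
    proof (rule inj_onI)
      fix i j assume ij: "i \<in> T \<union> T'" "j \<in> T \<union> T'" "\<phi> i = \<phi> j"
      have "\<rho> k \<notin> T" if "k \<in> T'" for k using a T(3) that by blast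
      then show "i = j"
        using ij injD[OF permutes_inj[OF \<rho>], of i j] unfolding \<phi>_def by (metis Un_iff)
    qed
    moreover have "\<phi> ` (T \<union> T') \<subseteq> {1..n}"
    proof (rule image_subsetI)
      fix i assume "i \<in> T \<union> T'"
      then have "i \<in> {1..n}" using TV by blast
      then show "\<phi> i \<in> {1..n}" unfolding \<phi>_def using permutes_in_image[OF \<rho>, of i] by simp
    qed
    ultimately obtain \<pi> where \<pi>: "\<pi> permutes {1..n}" "\<And>i. i \<in> T \<union> T' \<Longrightarrow> \<pi> i = \<phi> i"
      using extend_to_permutation[of "{1..n}" \<phi> "T \<union> T'"] TV by auto
    have "h \<tau> * h' (\<tau> \<circ> \<rho>) = h (\<tau> \<circ> \<pi>) * h' (\<tau> \<circ> \<pi>)" for \<tau>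
    proof -
      have "h \<tau> = h (\<tau> \<circ> \<pi>)" by (rule dep) (simp add: \<pi>(2) \<phi>_def)
      moreover have "h' (\<tau> \<circ> \<rho>) = h' (\<tau> \<circ> \<pi>)"
        by (rule dep') (use T in \<open>auto simp: \<pi>(2) \<phi>_def\<close>)
      ultimately show ?thesis by simp
    qed
    then show "perm_avg n (\<lambda>\<tau>. h \<tau> * h' (\<tau> \<circ> \<rho>)) = ?c"
      using perm_avg_compose_right[OF \<pi>(1), of "\<lambda>\<tau>. h \<tau> * h' \<tau>"] by simp
  qed
  also have "\<dots> \<le> m * m / n"
    using card_mono[OF _ T(2)] by (auto intro!: divide_right_mono mult_left_mono)
  finally show ?thesis using e by simp
qed

text \<open>
  The sum over injections is invariant under left multiplication by permutations.  After averaging over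
  these, each injection contributes the same amount.
\<close>

lemma injection_avg_eq_perm_avg:
  assumes dep: "depends_on m h" and mn: "m \<le> n"
  shows "(\<Sum>\<phi> \<in> {\<phi> \<in> {1..m} \<rightarrow>\<^sub>E {1..n}. inj_on \<phi> {1..m}}. h \<phi>) / (\<Prod>i<m. real n - real i)
    = perm_avg n h"
proof -
  let ?I = "{\<phi> \<in> {1..m} \<rightarrow>\<^sub>E {1..n}. inj_on \<phi> {1..m}}"
  have fin: "finite ?I" by (rule finite_subset[OF _ finite_PiE[of "{1..m}" "\<lambda>_. {1..n}"]]) auto
  have cardI: "real (card ?I) = (\<Prod>i<m. real n - real i)"
  proof -
    have "card ?I = (\<Prod>i<m. n - i)"
      using card_inj_on_subset_funcset[of "{1..m}" "{1..n}" "{1..m}"] by (simp add: atLeast0LessThan)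
    also have "real \<dots> = (\<Prod>i<m. real n - real i)"
      unfolding of_nat_prod using mn by (intro prod.cong) auto
    finally show ?thesis .
  qed
  have pos: "(\<Prod>i<m. real n - real i) > 0" using mn by (intro prod_pos) auto
  have "(\<Sum>\<phi>\<in>?I. h \<phi>) = perm_avg n (\<lambda>\<tau>. \<Sum>\<phi>\<in>?I. h \<phi>)" by simp
  also have "\<dots> = perm_avg n (\<lambda>\<tau>. \<Sum>\<phi>\<in>?I. h (\<tau> \<circ> \<phi>))"
  proof (rule perm_avg_cong)
    fix \<tau> assume \<tau>: "\<tau> permutes {1..n}"
    define f where "f \<phi> = restrict (\<tau> \<circ> \<phi>) {1..m}" for \<phi> :: "nat \<Rightarrow> nat"
    define g where "g \<phi> = restrict (inv \<tau> \<circ> \<phi>) {1..m}" for \<phi> :: "nat \<Rightarrow> nat"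
    note inv = permutes_inverses[OF \<tau>]
    have inI: "restrict (\<rho> \<circ> \<phi>) {1..m} \<in> ?I" if "\<rho> permutes {1..n}" "\<phi> \<in> ?I" for \<rho> \<phi>
    proof -
      have "(\<rho> \<circ> \<phi>) i \<in> {1..n}" if "i \<in> {1..m}" for i
        using that \<open>\<phi> \<in> ?I\<close> permutes_in_image[OF \<open>\<rho> permutes {1..n}\<close>] by (simp add: PiE_iff)
      moreover have "inj_on (\<rho> \<circ> \<phi>) {1..m}"
        using that(2) permutes_inj_on[OF that(1)] by (auto intro: comp_inj_on)
      ultimately show ?thesis by (simp add: PiE_iff)
    qed
    have "(\<Sum>\<phi>\<in>?I. h (\<tau> \<circ> \<phi>)) = (\<Sum>\<phi>\<in>?I. h (f \<phi>))"
      by (intro sum.cong refl depends_onD[OF dep]) (simp add: f_def)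
    also have "\<dots> = (\<Sum>\<phi>\<in>?I. h \<phi>)"
    proof (rule sum.reindex_bij_witness[of _ g f])
      fix \<phi> assume \<phi>: "\<phi> \<in> ?I"
      show "f \<phi> \<in> ?I" "g \<phi> \<in> ?I"
        unfolding f_def g_def using inI[OF \<tau> \<phi>] inI[OF permutes_inv[OF \<tau>] \<phi>] by auto
      show "g (f \<phi>) = \<phi>" "f (g \<phi>) = \<phi>"
        using \<phi> inv by (auto simp: f_def g_def fun_eq_iff PiE_iff extensional_def)
    qed simp
    finally show "(\<Sum>\<phi>\<in>?I. h \<phi>) = (\<Sum>\<phi>\<in>?I. h (\<tau> \<circ> \<phi>))" by simp
  qed
  also have "\<dots> = (\<Sum>\<phi>\<in>?I. perm_avg n (\<lambda>\<tau>. h (\<tau> \<circ> \<phi>)))" by (rule perm_avg_sum)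
  also have "\<dots> = (\<Sum>\<phi>\<in>?I. perm_avg n h)"
    by (intro sum.cong refl perm_avg_marginal[OF dep]) (auto simp: PiE_iff)
  also have "\<dots> = real (card ?I) * perm_avg n h" by simp
  finally have "(\<Sum>\<phi>\<in>?I. h \<phi>) = (\<Prod>i<m. real n - real i) * perm_avg n h" by (simp only: cardI)
  then show ?thesis using pos mn by simp
qed

section \<open>Structures as a compact space\<close>

(* keeps index sets in the form {1..} and {1..n} *)
declare One_nat_def [simp del]

lemma length_structures: "M \<in> structures L S \<Longrightarrow> length M = length L"
  by (simp add: structures_def)

lemma nth_structures: "M \<in> structures L S \<Longrightarrow> j < length L \<Longrightarrow> M ! j \<subseteq> tuples S (L ! j)"
  by (simp add: structures_def)

lemma length_relabel [simp]: "length (relabel L S \<phi> M) = length L"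
  by (simp add: relabel_def)

lemma nth_relabel [simp]:
  "j < length L \<Longrightarrow> relabel L S \<phi> M ! j = {a \<in> tuples S (L ! j). map \<phi> a \<in> M ! j}"
  by (simp add: relabel_def)

lemma length_restr [simp]: "length (restr S M) = length M"
  by (simp add: restr_def)

lemma nth_restr [simp]: "j < length M \<Longrightarrow> restr S M ! j = {a \<in> M ! j. set a \<subseteq> S}"
  by (simp add: restr_def)

lemma length_zero_struct [simp]: "length (zero_struct L) = length L"
  by (simp add: zero_struct_def)

lemma nth_zero_struct [simp]: "j < length L \<Longrightarrow> zero_struct L ! j = {}"
  by (simp add: zero_struct_def)

lemma relabel_in_structures [simp]: "relabel L S \<phi> M \<in> structures L S"
  by (auto simp: structures_def)

lemma zero_in_structures [simp]: "zero_struct L \<in> structures L S"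
  by (auto simp: structures_def)

lemma restr_zero [simp]: "restr S (zero_struct L) = zero_struct L"
  by (rule nth_equalityI) auto

lemma relabel_zero [simp]: "relabel L S \<phi> (zero_struct L) = zero_struct L"
  by (rule nth_equalityI) auto

lemma restr_relabel:
  "T \<subseteq> S \<Longrightarrow> restr T (relabel L S \<phi> M) = relabel L T \<phi> M"
  by (rule nth_equalityI) (auto simp: tuples_def)

lemma relabel_restr:
  assumes "length M = length L" "\<phi> ` S \<subseteq> T"
  shows "relabel L S \<phi> (restr T M) = relabel L S \<phi> M"
  using assms by (intro nth_equalityI) (auto simp: tuples_def)

lemma relabel_relabel:
  assumes "\<phi> ` S \<subseteq> S'"
  shows "relabel L S \<phi> (relabel L S' \<psi> M) = relabel L S (\<psi> \<circ> \<phi>) M"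
  using assms by (intro nth_equalityI) (auto simp: tuples_def)

lemma relabel_id:
  assumes "M \<in> structures L S" shows "relabel L S id M = M"
  using assms by (intro nth_equalityI) (auto simp: structures_def)

lemma relabel_cong:
  "(\<And>i. i \<in> S \<Longrightarrow> \<phi> i = \<psi> i) \<Longrightarrow> relabel L S \<phi> M = relabel L S \<psi> M"
proof (intro nth_equalityI; clarsimp)
  fix j assume a: "\<And>i. i \<in> S \<Longrightarrow> \<phi> i = \<psi> i"
  have "map \<phi> a = map \<psi> a" if "a \<in> tuples S (L ! j)" for a
    using that a by (auto simp: tuples_def)
  then show "{a \<in> tuples S (L ! j). map \<phi> a \<in> M ! j} = {a \<in> tuples S (L ! j). map \<psi> a \<in> M ! j}"
    by (metis (no_types, lifting))
qed

lemma depends_on_relabel: "depends_on m (\<lambda>\<tau>. Q (relabel L {1..m} \<tau> M))"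
  unfolding depends_on_def by (auto intro!: arg_cong[where f = Q] relabel_cong)

lemma restr_all: "M \<in> structures L S \<Longrightarrow> restr S M = M"
  by (rule nth_equalityI) (auto simp: structures_def tuples_def)

lemma eq_zero_iff:
  "length M = length L \<Longrightarrow> M = zero_struct L \<longleftrightarrow> (\<forall>j<length L. M ! j = {})"
  by (auto simp: list_eq_iff_nth_eq)

lemma NN_Int [simp]: "NN \<inter> {1..n} = {1..n}" "{1..n} \<inter> NN = {1..n}"
  by auto

lemma restr_in_structures_nat:
  "M \<in> structures L NN \<Longrightarrow> restr {1..n} M \<in> structures L {1..n}"
  using restr_in_structures[of M L NN "{1..n}"] by (simp only: NN_Int)

lemma structures_mono: "S \<subseteq> T \<Longrightarrow> structures L S \<subseteq> structures L T"
  by (force simp: structures_def tuples_def)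

lemma permutes_NN_image: "\<sigma> permutes NN \<Longrightarrow> A \<subseteq> NN \<Longrightarrow> \<sigma> ` A \<subseteq> NN"
  using permutes_image by blast

lemma permutes_NN: "\<tau> permutes {1..n::nat} \<Longrightarrow> \<tau> permutes NN"
  by (rule permutes_subset) auto

lemma relabel_perm_relabel:
  "\<sigma> permutes NN \<Longrightarrow> relabel L NN \<sigma> (relabel L NN \<tau> M) = relabel L NN (\<tau> \<circ> \<sigma>) M"
  by (intro relabel_relabel permutes_NN_image) auto

lemma relabel_eq_zero_iff:
  assumes \<sigma>: "\<sigma> permutes NN" and M: "M \<in> structures L NN"
  shows "relabel L NN \<sigma> M = zero_struct L \<longleftrightarrow> M = zero_struct L"
proof
  assume "relabel L NN \<sigma> M = zero_struct L"
  then have "relabel L NN (inv \<sigma>) (relabel L NN \<sigma> M) = zero_struct L" by simp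
  then show "M = zero_struct L"
    using relabel_perm_relabel[OF permutes_inv[OF \<sigma>], of L \<sigma> M] relabel_id[OF M]
      permutes_inv_o(1)[OF \<sigma>] by simp
qed simp

text \<open>
  Finite structures with property \<open>P\<close>, ordered by restriction, form a tree; a branch of it is a structure on
  the natural numbers.
\<close>

lemma konig:
  assumes base: "\<exists>A\<in>structures L {1..0::nat}. P 0 A"
    and step: "\<And>n A. A \<in> structures L {1..n} \<Longrightarrow> P n A \<Longrightarrow>
      \<exists>A'\<in>structures L {1..Suc n}. restr {1..n} A' = A \<and> P (Suc n) A'"
  shows "\<exists>M\<in>structures L NN. \<forall>n. P n (restr {1..n} M)"
proof -
  obtain A where A: "\<And>n. A n \<in> structures L {1..n}" "\<And>n. P n (A n)"
      "\<And>n. restr {1..n} (A (Suc n)) = A n"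
  proof -
    have "\<exists>A. \<forall>n. (A n \<in> structures L {1..n} \<and> P n (A n)) \<and> restr {1..n} (A (Suc n)) = A n"
    proof (rule dependent_nat_choice)
      show "\<exists>x. x \<in> structures L {1..0} \<and> P 0 x" using base by blast
      show "\<exists>y. (y \<in> structures L {1..Suc n} \<and> P (Suc n) y) \<and> restr {1..n} y = x"
        if "x \<in> structures L {1..n} \<and> P n x" for x n
        using step[of x n] that by blast
    qed
    then show ?thesis using that by blast
  qed
  have co: "restr {1..n} (A (n + d)) = A n" for n d
  proof (induction d)
    case 0 then show ?case using restr_all[OF A(1)] by simp
  next
    case (Suc d)
    have "restr {1..n} (restr {1..n + d} (A (Suc (n + d)))) = restr {1..n} (A (n + d))"
      by (simp only: A(3))
    moreover have "{1..n + d} \<inter> {1..n} = {1..n}" by auto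
    ultimately show ?case using Suc by (simp only: restr_restr add_Suc_right)
  qed
  have co': "n \<le> k \<Longrightarrow> restr {1..n} (A k) = A n" for n k using co[of n "k - n"] by simp
  define M where "M = map (\<lambda>j. \<Union>n. A n ! j) [0..<length L]"
  have len: "length (A n) = length L" for n by (rule length_structures[OF A(1)])
  have M: "M \<in> structures L NN"
    using nth_structures[OF A(1)] by (fastforce simp: M_def structures_def tuples_def)
  have "restr {1..n} M = A n" for n
  proof (rule nth_equalityI)
    show "length (restr {1..n} M) = length (A n)" by (simp add: M_def len)
  next
    fix j assume "j < length (restr {1..n} M)"
    then have j: "j < length L" by (simp add: M_def)
    have "a \<in> A n ! j" if a: "a \<in> A k ! j" "set a \<subseteq> {1..n}" for a k
    proof (cases "n \<le> k")
      case True
      from co'[OF True] have "A n ! j = restr {1..n} (A k) ! j" by simp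
      then show ?thesis using a j len by simp
    next
      case False
      then have "A k ! j = restr {1..k} (A n) ! j" using co'[of k n] by simp
      then show ?thesis using a j len by simp
    qed
    moreover have "set a \<subseteq> {1..n}" if "a \<in> A n ! j" for a
      using nth_structures[OF A(1) j, of n] that by (auto simp: tuples_def)
    ultimately show "restr {1..n} M ! j = A n ! j" using j by (auto simp: M_def)
  qed
  then show ?thesis using M A(2) by metis
qed

text \<open>
  If a cover has no finite subcover, then among the finitely many refinements of a cylinder without finite
  subcover there is another one.  The structure found by \<open>konig\<close> has a neighbourhood inside a single member of
  the cover, a contradiction.
\<close>

lemma compact_space_struct_top: "compact_space (struct_top L NN)"
  unfolding compact_space_def compactin_def topspace_struct_top[OF order_refl]
proof (intro conjI allI impI order_refl)
  fix \<U> assume U: "Ball \<U> (openin (struct_top L NN)) \<and> structures L NN \<subseteq> \<Union> \<U>"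
  define P where "P n A \<longleftrightarrow> \<not> (\<exists>\<F>. finite \<F> \<and> \<F> \<subseteq> \<U> \<and> cylinder L n A \<subseteq> \<Union>\<F>)" for n A
  have fin: "\<exists>\<F>. finite \<F> \<and> \<F> \<subseteq> \<U> \<and> (\<Union>A\<in>I. cylinder L n A) \<subseteq> \<Union>\<F>"
    if "finite I" "\<And>A. A \<in> I \<Longrightarrow> \<not> P n A" for I n
  proof -
    have "\<forall>A\<in>I. \<exists>\<F>. finite \<F> \<and> \<F> \<subseteq> \<U> \<and> cylinder L n A \<subseteq> \<Union>\<F>" using that(2) unfolding P_def by blast
    then obtain F where F: "\<forall>A\<in>I. finite (F A) \<and> F A \<subseteq> \<U> \<and> cylinder L n A \<subseteq> \<Union>(F A)"
      by (metis bchoice)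
    show ?thesis
    proof (intro exI[of _ "\<Union>A\<in>I. F A"] conjI)
      show "(\<Union>A\<in>I. cylinder L n A) \<subseteq> \<Union>(\<Union>A\<in>I. F A)" using F by blast
    qed (use F that(1) in auto)
  qed
  show "\<exists>\<F>. finite \<F> \<and> \<F> \<subseteq> \<U> \<and> structures L NN \<subseteq> \<Union> \<F>"
  proof (rule ccontr)
    assume neg: "\<not> ?thesis"
    have "\<exists>M\<in>structures L NN. \<forall>n. P n (restr {1..n} M)"
    proof (rule konig)
      show "\<exists>A\<in>structures L {1..0}. P 0 A"
      proof (rule ccontr)
        assume "\<not> ?thesis"
        then have "\<exists>\<F>. finite \<F> \<and> \<F> \<subseteq> \<U> \<and> (\<Union>A\<in>structures L {1..0::nat}. cylinder L 0 A) \<subseteq> \<Union>\<F>"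
          by (intro fin finite_structures finite_atLeastAtMost) blast
        then obtain \<F> where "finite \<F>" "\<F> \<subseteq> \<U>" "(\<Union>A\<in>structures L {1..0::nat}. cylinder L 0 A) \<subseteq> \<Union>\<F>"
          by (elim exE conjE)
        note F = this
        have "structures L NN \<subseteq> (\<Union>A\<in>structures L {1..0::nat}. cylinder L 0 A)"
          using restr_in_structures_nat[of _ L 0] unfolding cylinder_def by blast
        from order_trans[OF this F(3)] show False using neg F(1,2) by metis
      qed
    next
      fix n A assume A: "A \<in> structures L {1..n}" "P n A"
      let ?I = "{A' \<in> structures L {1..Suc n}. restr {1..n} A' = A}"
      show "\<exists>A'\<in>structures L {1..Suc n}. restr {1..n} A' = A \<and> P (Suc n) A'"
      proof (rule ccontr)
        assume "\<not> ?thesis"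
        then have "\<exists>\<F>. finite \<F> \<and> \<F> \<subseteq> \<U> \<and> (\<Union>A\<in>?I. cylinder L (Suc n) A) \<subseteq> \<Union>\<F>"
          by (intro fin finite_subset[OF _ finite_structures[of "{1..Suc n}" L]]) auto
        then obtain \<F> where "finite \<F>" "\<F> \<subseteq> \<U>" "(\<Union>A\<in>?I. cylinder L (Suc n) A) \<subseteq> \<Union>\<F>"
          by (elim exE conjE)
        note F = this
        have "cylinder L n A \<subseteq> (\<Union>A\<in>?I. cylinder L (Suc n) A)"
        proof
          fix M assume M: "M \<in> cylinder L n A"
          then have "restr {1..Suc n} M \<in> structures L {1..Suc n}"
            using restr_in_structures_nat by (auto simp: cylinder_def)
          moreover have "restr {1..n} (restr {1..Suc n} M) = A"
          proof -
            have "{1..Suc n} \<inter> {1..n} = {1..n}" by auto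
            then show ?thesis using M by (simp only: restr_restr) (simp add: cylinder_def)
          qed
          ultimately show "M \<in> (\<Union>A\<in>?I. cylinder L (Suc n) A)" using M by (auto simp: cylinder_def)
        qed
        from order_trans[OF this F(3)] show False using A(2) F(1,2) unfolding P_def by metis
      qed
    qed
    then obtain M where M: "M \<in> structures L NN" "\<And>n. P n (restr {1..n} M)" by blast
    then obtain V where V: "V \<in> \<U>" "M \<in> V" using U by blast
    then obtain n where "{M' \<in> structures L NN. restr {1..n} M' = restr {1..n} M} \<subseteq> V"
      using U openin_struct_top_iff[of NN L V] by blast
    then have "cylinder L n (restr {1..n} M) \<subseteq> \<Union>{V}" by (simp add: cylinder_def)
    then show False using M(2)[of n] V(1) unfolding P_def by blast
  qed
qed

text \<open>
  The predicates that can be decided on some \<open>[n]\<close> define clopen events.  They are closed under Boolean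
  operations and relabelling, which spares explicit cylinders.
\<close>

definition fin_det :: "nat list \<Rightarrow> (struc \<Rightarrow> bool) \<Rightarrow> bool" where
  "fin_det L Q \<longleftrightarrow> (\<exists>n. \<forall>M\<in>structures L NN. \<forall>M'\<in>structures L NN.
     restr {1..n} M = restr {1..n} M' \<longrightarrow> Q M = Q M')"

lemma fin_detI:
  assumes "\<And>M M'. M \<in> structures L NN \<Longrightarrow> M' \<in> structures L NN \<Longrightarrow>
     restr {1..n} M = restr {1..n} M' \<Longrightarrow> Q M = Q M'"
  shows "fin_det L Q"
  using assms unfolding fin_det_def by blast

lemma fin_detE:
  assumes "fin_det L Q"
  obtains n where "n \<ge> 1" "n \<ge> k" "\<And>M M'. M \<in> structures L NN \<Longrightarrow> M' \<in> structures L NN \<Longrightarrow>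
     restr {1..n} M = restr {1..n} M' \<Longrightarrow> Q M = Q M'"
proof -
  obtain n where n: "\<And>M M'. M \<in> structures L NN \<Longrightarrow> M' \<in> structures L NN \<Longrightarrow>
     restr {1..n} M = restr {1..n} M' \<Longrightarrow> Q M = Q M'"
    using assms unfolding fin_det_def by blast
  show ?thesis
  proof (rule that[of "Suc (n + k)"])
    fix M M' assume "M \<in> structures L NN" "M' \<in> structures L NN"
      "restr {1..Suc (n + k)} M = restr {1..Suc (n + k)} M'"
    then show "Q M = Q M'" using n[of M M'] restr_mono[of "Suc (n + k)" M M' n] by simp
  qed auto
qed

lemma fin_det_not: "fin_det L Q \<Longrightarrow> fin_det L (\<lambda>M. \<not> Q M)"
  unfolding fin_det_def by metis

lemma fin_det_const: "fin_det L (\<lambda>_. c)"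
  unfolding fin_det_def by blast

lemma fin_det_conj:
  assumes "fin_det L Q" "fin_det L R" shows "fin_det L (\<lambda>M. Q M \<and> R M)"
proof -
  from assms(1) obtain n where n: "\<And>M M'. M \<in> structures L NN \<Longrightarrow> M' \<in> structures L NN \<Longrightarrow>
     restr {1..n} M = restr {1..n} M' \<Longrightarrow> Q M = Q M'" unfolding fin_det_def by blast
  from assms(2) obtain k where k: "k \<ge> n" "\<And>M M'. M \<in> structures L NN \<Longrightarrow> M' \<in> structures L NN \<Longrightarrow>
     restr {1..k} M = restr {1..k} M' \<Longrightarrow> R M = R M'" using fin_detE[of L R n] by metis
  show ?thesis
    by (rule fin_detI[of L k]) (metis n k restr_mono)
qed

lemma fin_det_disj: "fin_det L Q \<Longrightarrow> fin_det L R \<Longrightarrow> fin_det L (\<lambda>M. Q M \<or> R M)"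
  using fin_det_not[OF fin_det_conj[OF fin_det_not fin_det_not], of L Q R] by simp

lemma fin_det_bex:
  assumes "finite F" "\<And>x. x \<in> F \<Longrightarrow> fin_det L (Q x)"
  shows "fin_det L (\<lambda>M. \<exists>x\<in>F. Q x M)"
  using assms by (induction F rule: finite_induct) (auto intro: fin_det_const fin_det_disj)

lemma fin_det_mem:
  assumes "j < length L" shows "fin_det L (\<lambda>M. a \<in> M ! j)"
proof (cases "set a \<subseteq> NN")
  case True
  define n where "n = Max (insert 1 (set a))"
  have a: "set a \<subseteq> {1..n}" using True by (auto simp: n_def)
  have "a \<in> M ! j \<longleftrightarrow> a \<in> restr {1..n} M ! j" if "M \<in> structures L NN" for M
    using that assms a by (simp add: structures_def)
  then show ?thesis by (intro fin_detI[of L n]) simp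
next
  case False
  have "a \<notin> M ! j" if "M \<in> structures L NN" for M
    using nth_structures[OF that assms] False by (auto simp: tuples_def)
  then show ?thesis by (intro fin_detI[of L 0]) simp
qed

lemma fin_det_restr: "fin_det L (\<lambda>M. R (restr {1..n} M))"
  by (rule fin_detI[of L n]) simp

lemma fin_det_relabel_fin:
  assumes "finite S" "\<phi> ` S \<subseteq> NN" shows "fin_det L (\<lambda>M. R (relabel L S \<phi> M))"
proof -
  define n where "n = Max (insert 0 (\<phi> ` S))"
  have S: "\<phi> ` S \<subseteq> {1..n}" using assms by (auto simp: n_def)
  show ?thesis
  proof (rule fin_detI[of L n])
    fix M M' assume "M \<in> structures L NN" "M' \<in> structures L NN" "restr {1..n} M = restr {1..n} M'"
    then have "relabel L S \<phi> M = relabel L S \<phi> M'"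
      using relabel_restr[OF length_structures S] by metis
    then show "R (relabel L S \<phi> M) = R (relabel L S \<phi> M')" by simp
  qed
qed

text \<open>
  The restriction of \<open>M\<^sup>\<sigma>\<close> to \<open>[n]\<close> depends on finitely many labels only, though not on the first \<open>n\<close>.
\<close>

lemma fin_det_relabel:
  assumes "fin_det L Q" "\<sigma> permutes NN" shows "fin_det L (\<lambda>M. Q (relabel L NN \<sigma> M))"
proof -
  from assms(1) obtain n where n: "\<And>M M'. M \<in> structures L NN \<Longrightarrow> M' \<in> structures L NN \<Longrightarrow>
     restr {1..n} M = restr {1..n} M' \<Longrightarrow> Q M = Q M'" unfolding fin_det_def by blast
  have "\<sigma> ` {1..n} \<subseteq> NN" using assms(2) by (intro permutes_NN_image) auto
  then have "fin_det L (\<lambda>M. relabel L {1..n} \<sigma> M = A)" for A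
    by (intro fin_det_relabel_fin[where R = "\<lambda>N. N = A"]) auto
  then have "fin_det L (\<lambda>M. \<exists>A\<in>{A\<in>structures L {1..n}. \<exists>M\<in>structures L NN. A = restr {1..n} M \<and> Q M}. relabel L {1..n} \<sigma> M = A)"
    by (rule fin_det_bex[rotated]) (rule finite_subset[OF _ finite_structures[of "{1..n}" L]], auto)
  moreover have "(\<exists>A\<in>{A\<in>structures L {1..n}. \<exists>M\<in>structures L NN. A = restr {1..n} M \<and> Q M}. relabel L {1..n} \<sigma> M = A)
     \<longleftrightarrow> Q (relabel L NN \<sigma> M)" for M
  proof -
    have e: "restr {1..n} (relabel L NN \<sigma> M) = relabel L {1..n} \<sigma> M" by (rule restr_relabel) auto
    note N = relabel_in_structures[of L NN \<sigma> M]
    show ?thesis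
    proof
      assume "Q (relabel L NN \<sigma> M)"
      then show "\<exists>A\<in>{A\<in>structures L {1..n}. \<exists>M\<in>structures L NN. A = restr {1..n} M \<and> Q M}. relabel L {1..n} \<sigma> M = A"
        using N e by (auto intro!: exI[of _ "relabel L NN \<sigma> M"] bexI[of _ "relabel L NN \<sigma> M"])
    next
      assume "\<exists>A\<in>{A\<in>structures L {1..n}. \<exists>M\<in>structures L NN. A = restr {1..n} M \<and> Q M}. relabel L {1..n} \<sigma> M = A"
      then obtain M' where "M' \<in> structures L NN" "relabel L {1..n} \<sigma> M = restr {1..n} M'" "Q M'" by blast
      then show "Q (relabel L NN \<sigma> M)" using n[OF N, of M'] e by simp
    qed
  qed
  ultimately show ?thesis by simp
qed

lemma openin_fin_det:
  assumes "fin_det L Q" shows "openin (struct_top L NN) {M \<in> structures L NN. Q M}"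
proof -
  obtain n where n: "n \<ge> 1" "\<And>M M'. M \<in> structures L NN \<Longrightarrow> M' \<in> structures L NN \<Longrightarrow>
     restr {1..n} M = restr {1..n} M' \<Longrightarrow> Q M = Q M'" using fin_detE[OF assms] by metis
  show ?thesis
    unfolding openin_struct_top_iff[OF order_refl]
  proof (intro conjI ballI)
    fix M assume "M \<in> {M \<in> structures L NN. Q M}"
    then have "{M' \<in> structures L NN. restr {1..n} M' = restr {1..n} M} \<subseteq> {M \<in> structures L NN. Q M}"
      using n(2) by blast
    then show "\<exists>n\<ge>1. {M' \<in> structures L NN. restr {1..n} M' = restr {1..n} M} \<subseteq> {M \<in> structures L NN. Q M}"
      using n(1) by blast
  qed blast
qed

lemma closedin_fin_det:
  assumes "fin_det L Q" shows "closedin (struct_top L NN) {M \<in> structures L NN. Q M}"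
proof -
  have "structures L NN - {M \<in> structures L NN. Q M} = {M \<in> structures L NN. \<not> Q M}" by blast
  then show ?thesis
    using openin_fin_det[OF fin_det_not[OF assms]]
    by (simp add: closedin_def topspace_struct_top Collect_restrict)
qed

lemma compactin_fin_det:
  "fin_det L Q \<Longrightarrow> compactin (struct_top L NN) {M \<in> structures L NN. Q M}"
  by (rule closedin_compact_space[OF compact_space_struct_top closedin_fin_det])

abbreviation SB :: "nat list \<Rightarrow> struc measure" where
  "SB L \<equiv> struct_borel L NN"

lemma space_SB [simp]: "space (SB L) = structures L NN"
  by (rule space_struct_borel) simp

lemma sets_fin_det: "fin_det L Q \<Longrightarrow> {M \<in> structures L NN. Q M} \<in> sets (SB L)"
  unfolding sets_struct_borel[OF order_refl]
  by (rule sigma_sets.Basic, rule CollectI, rule openin_fin_det)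

lemma pred_fin_det [measurable (raw)]: "fin_det L Q \<Longrightarrow> Measurable.pred (SB L) Q"
  by (simp add: pred_def sets_fin_det)

lemma sets_cylinder: "cylinder L n A \<in> sets (SB L)"
  unfolding cylinder_def by (rule sets_fin_det[OF fin_det_restr[where R = "\<lambda>N. N = A"]])

text \<open>
  Every open set is a countable union of cylinders.
\<close>

lemma measurable_struct_borel:
  assumes T: "T \<subseteq> NN" and f: "\<And>x. x \<in> space M \<Longrightarrow> f x \<in> structures L T"
    and m: "\<And>n A. n \<ge> 1 \<Longrightarrow> {x \<in> space M. restr {1..n} (f x) = A} \<in> sets M"
  shows "f \<in> measurable M (struct_borel L T)"
proof (rule measurable_sigma_sets[OF sets_struct_borel[OF T]])
  show "{U. openin (struct_top L T) U} \<subseteq> Pow (structures L T)"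
    using openin_subset topspace_struct_top[OF T] by blast
  show "f \<in> space M \<rightarrow> structures L T" using f by blast
  fix U assume "U \<in> {U. openin (struct_top L T) U}"
  then have U: "openin (struct_top L T) U" by simp
  let ?D = "\<lambda>n. {A \<in> structures L {1..n}. {M' \<in> structures L T. restr {1..n} M' = A} \<subseteq> U}"
  have "f -` U \<inter> space M = (\<Union>n\<in>{1..}. \<Union>A\<in>?D n. {x \<in> space M. restr {1..n} (f x) = A})"
  proof (intro equalityI subsetI)
    fix x assume x: "x \<in> f -` U \<inter> space M"
    then obtain n where n: "n \<ge> 1" "{M' \<in> structures L T. restr {1..n} M' = restr {1..n} (f x)} \<subseteq> U"
      using U unfolding openin_struct_top_iff[OF T] by blast
    have "f x \<in> structures L NN" using f x structures_mono[OF T] by blast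
    then have "restr {1..n} (f x) \<in> structures L {1..n}" by (rule restr_in_structures_nat)
    then have "restr {1..n} (f x) \<in> ?D n" using n(2) by simp
    then show "x \<in> (\<Union>n\<in>{1..}. \<Union>A\<in>?D n. {x \<in> space M. restr {1..n} (f x) = A})"
      using x n(1) by blast
  next
    fix x assume "x \<in> (\<Union>n\<in>{1..}. \<Union>A\<in>?D n. {x \<in> space M. restr {1..n} (f x) = A})"
    then show "x \<in> f -` U \<inter> space M" using f by blast
  qed
  also have "\<dots> \<in> sets M"
    by (intro sets.countable_UN'' countableI_type sets.finite_UN m
        finite_subset[OF _ finite_structures[of "{1.._}" L]]) auto
  finally show "f -` U \<inter> space M \<in> sets M" .
qed

lemma measurable_relabel [measurable]:
  assumes "\<sigma> permutes NN" shows "relabel L NN \<sigma> \<in> measurable (SB L) (SB L)"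
proof (rule measurable_struct_borel[OF order_refl])
  fix n :: nat and A
  have "{M \<in> structures L NN. restr {1..n} (relabel L NN \<sigma> M) = A} \<in> sets (SB L)"
    by (intro sets_fin_det fin_det_relabel[OF fin_det_restr[where R = "\<lambda>N. N = A"]] assms)
  then show "{x \<in> space (SB L). restr {1..n} (relabel L NN \<sigma> x) = A} \<in> sets (SB L)" by simp
qed simp

lemma measurable_restr:
  assumes "T \<subseteq> NN" shows "restr T \<in> measurable (SB L) (struct_borel L T)"
proof (rule measurable_struct_borel[OF assms])
  fix M assume "M \<in> space (SB L)"
  then have "restr T M \<in> structures L (NN \<inter> T)" using restr_in_structures by simp
  moreover have "NN \<inter> T = T" using assms by blast
  ultimately show "restr T M \<in> structures L T" by simp
next
  fix n :: nat and A
  have "restr {1..n} (restr T M) = restr T (restr {1..n} M)" for M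
    by (simp only: restr_restr Int_commute)
  then have "{M \<in> structures L NN. restr {1..n} (restr T M) = A} \<in> sets (SB L)"
    using sets_fin_det[OF fin_det_restr[where R = "\<lambda>N. restr T N = A"]] by simp
  then show "{x \<in> space (SB L). restr {1..n} (restr T x) = A} \<in> sets (SB L)" by simp
qed

section \<open>Combinatorial limits are dissociated exchangeable measures\<close>

lemma density_seq_eq_perm_avg:
  assumes M: "length M = length L" and mn: "m \<le> n"
  shows "density_seq L m A M n = perm_avg n (\<lambda>\<tau>. of_bool (relabel L {1..m} \<tau> M = A))"
proof -
  have "(\<Sum>\<phi> \<in> {\<phi> \<in> {1..m} \<rightarrow>\<^sub>E {1..n}. inj_on \<phi> {1..m}}.
          of_bool (relabel L {1..m} \<phi> (restr {1..n} M) = A) :: real)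
      = (\<Sum>\<phi> \<in> {\<phi> \<in> {1..m} \<rightarrow>\<^sub>E {1..n}. inj_on \<phi> {1..m}}. of_bool (relabel L {1..m} \<phi> M = A))"
  proof (rule sum.cong[OF refl])
    fix \<phi> assume "\<phi> \<in> {\<phi> \<in> {1..m} \<rightarrow>\<^sub>E {1..n}. inj_on \<phi> {1..m}}"
    then have "\<phi> ` {1..m} \<subseteq> {1..n}" by (auto simp: PiE_iff)
    from relabel_restr[OF M this]
    show "of_bool (relabel L {1..m} \<phi> (restr {1..n} M) = A) = (of_bool (relabel L {1..m} \<phi> M = A) :: real)"
      by simp
  qed
  moreover have "depends_on m (\<lambda>\<tau>. of_bool (relabel L {1..m} \<tau> M = A) :: real)"
    by (rule depends_on_relabel)
  ultimately show ?thesis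
    unfolding density_seq_def by (simp only: injection_avg_eq_perm_avg[OF _ mn])
qed

lemma restr_relabel_nat: "restr {1..m} (relabel L NN \<tau> M) = relabel L {1..m} \<tau> M"
  by (rule restr_relabel) auto

lemma has_limit_iff:
  assumes M: "length M = length L"
  shows "has_limit L M \<longleftrightarrow> (\<forall>m\<ge>1. \<forall>A\<in>structures L {1..m}.
    convergent (\<lambda>n. perm_avg n (\<lambda>\<tau>. of_bool (relabel L {1..m} \<tau> M = A))))"
proof -
  have "convergent (density_seq L m A M) \<longleftrightarrow>
      convergent (\<lambda>n. perm_avg n (\<lambda>\<tau>. of_bool (relabel L {1..m} \<tau> M = A)))" for m A
  proof (rule convergent_cong)
    show "\<forall>\<^sub>F n in sequentially. density_seq L m A M n = perm_avg n (\<lambda>\<tau>. of_bool (relabel L {1..m} \<tau> M = A))"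
      using eventually_ge_at_top[of m] by eventually_elim (rule density_seq_eq_perm_avg[OF M])
  qed
  then show ?thesis unfolding has_limit_def by simp
qed

text \<open>
  Reduces limits of sampling frequencies of clopen events to those of cylinders.
\<close>

lemma fin_det_sum:
  assumes n: "\<And>M M'. M \<in> structures L NN \<Longrightarrow> M' \<in> structures L NN \<Longrightarrow>
     restr {1..n} M = restr {1..n} M' \<Longrightarrow> Q M = Q M'"
    and N: "N \<in> structures L NN"
  shows "(of_bool (Q N) :: real) =
    (\<Sum>A\<in>{A \<in> structures L {1..n}. \<exists>M\<in>structures L NN. restr {1..n} M = A \<and> Q M}. of_bool (restr {1..n} N = A))"
    (is "_ = sum _ ?I")
proof -
  have fin: "finite ?I" by (rule finite_subset[OF _ finite_structures[of "{1..n}" L]]) auto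
  have "(\<Sum>A\<in>?I. of_bool (restr {1..n} N = A) :: real) = of_bool (restr {1..n} N \<in> ?I)"
  proof (cases "restr {1..n} N \<in> ?I")
    case True
    have "(\<Sum>A\<in>?I. of_bool (restr {1..n} N = A) :: real) = (\<Sum>A\<in>{restr {1..n} N}. of_bool (restr {1..n} N = A))"
      by (rule sum.mono_neutral_right[OF fin]) (use True in auto)
    then show ?thesis using True by simp
  next
    case False
    then have "(\<Sum>A\<in>?I. of_bool (restr {1..n} N = A) :: real) = (\<Sum>A\<in>?I. 0)"
      by (intro sum.cong refl) auto
    then show ?thesis using False by simp
  qed
  also have "restr {1..n} N \<in> ?I \<longleftrightarrow> Q N"
    using restr_in_structures_nat[OF N] N n by blast
  finally show ?thesis by simp
qed

lemma has_limit_convergent: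
  assumes lim: "has_limit L M" and M: "length M = length L" and Q: "fin_det L Q"
  shows "convergent (\<lambda>n. perm_avg n (\<lambda>\<tau>. of_bool (Q (relabel L NN \<tau> M))))"
proof -
  obtain m where m: "m \<ge> 1" "\<And>M M'. M \<in> structures L NN \<Longrightarrow> M' \<in> structures L NN \<Longrightarrow>
     restr {1..m} M = restr {1..m} M' \<Longrightarrow> Q M = Q M'" using fin_detE[OF Q] by metis
  have "convergent (\<lambda>n. \<Sum>A\<in>{A \<in> structures L {1..m}. \<exists>M\<in>structures L NN. restr {1..m} M = A \<and> Q M}.
      perm_avg n (\<lambda>\<tau>. of_bool (relabel L {1..m} \<tau> M = A)))"
    using lim m(1) by (intro convergent_sum) (auto simp: has_limit_iff[OF M])
  then show ?thesis
    by (subst fin_det_sum[OF m(2) relabel_in_structures], simp_all add: perm_avg_sum restr_relabel_nat)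
qed

definition sample_limit :: "nat list \<Rightarrow> struc \<Rightarrow> struc set \<Rightarrow> real" where
  "sample_limit L M B = lim (\<lambda>n. perm_avg n (\<lambda>\<tau>. of_bool (relabel L NN \<tau> M \<in> B)))"

lemma fin_det_cong:
  assumes "\<And>M. M \<in> structures L NN \<Longrightarrow> Q M = Q' M" "fin_det L Q"
  shows "fin_det L Q'"
proof -
  obtain n where "\<And>M M'. M \<in> structures L NN \<Longrightarrow> M' \<in> structures L NN \<Longrightarrow>
     restr {1..n} M = restr {1..n} M' \<Longrightarrow> Q M = Q M'" using fin_detE[OF assms(2)] by metis
  then show ?thesis using assms(1) by (intro fin_detI[of L n]) metis
qed

text \<open>
  The algebra of clopen events.
\<close>

definition det_sets :: "nat list \<Rightarrow> struc set set" where
  "det_sets L = {{M \<in> structures L NN. Q M} |Q. fin_det L Q}"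

lemma det_sets_iff: "B \<in> det_sets L \<longleftrightarrow> B \<subseteq> structures L NN \<and> fin_det L (\<lambda>M. M \<in> B)"
proof
  assume "B \<in> det_sets L"
  then obtain Q where Q: "fin_det L Q" "B = {M \<in> structures L NN. Q M}" unfolding det_sets_def by blast
  then show "B \<subseteq> structures L NN \<and> fin_det L (\<lambda>M. M \<in> B)"
    by (auto intro: fin_det_cong[of L Q])
next
  assume "B \<subseteq> structures L NN \<and> fin_det L (\<lambda>M. M \<in> B)"
  then have "B = {M \<in> structures L NN. M \<in> B}" "fin_det L (\<lambda>M. M \<in> B)" by blast+
  then show "B \<in> det_sets L" unfolding det_sets_def by (intro CollectI exI[of _ "\<lambda>M. M \<in> B"] conjI)
qed

lemma cylinder_det: "cylinder L m A \<in> det_sets L"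
  unfolding det_sets_def cylinder_def
  by (intro CollectI exI[of _ "\<lambda>M. restr {1..m} M = A"] conjI refl fin_det_restr[where R = "\<lambda>N. N = A"])

lemma ring_det_sets: "ring_of_sets (structures L NN) (det_sets L)"
proof (rule ring_of_setsI)
  fix a b assume "a \<in> det_sets L" "b \<in> det_sets L"
  then show "a \<union> b \<in> det_sets L" "a - b \<in> det_sets L"
    unfolding det_sets_iff by (auto intro: fin_det_disj fin_det_conj fin_det_not)
qed (auto simp: det_sets_iff fin_det_const)

lemma sigma_det_sets: "sigma_sets (structures L NN) (det_sets L) = sets (SB L)"
proof
  have "det_sets L \<subseteq> sets (SB L)" unfolding det_sets_def using sets_fin_det by blast
  then show "sigma_sets (structures L NN) (det_sets L) \<subseteq> sets (SB L)"
    using sets.sigma_sets_subset[of "det_sets L" "SB L"] by simp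
  have "{cylinder L n A |n A. 1 \<le> n \<and> A \<in> structures L {1..n}} \<subseteq> det_sets L"
    using cylinder_det by auto
  then show "sets (SB L) \<subseteq> sigma_sets (structures L NN) (det_sets L)"
    unfolding sets_struct_borel_cylinder by (intro sigma_sets_mono) (auto intro: sigma_sets.Basic)
qed

text \<open>
  The limiting sampling frequencies are finitely additive on the algebra of clopen events.  By compactness, a
  decreasing sequence of such events with empty intersection is eventually empty, so Caratheodory's
  theorem applies.
\<close>

lemma sample_limit_extends:
  assumes lim: "has_limit L M" and M: "length M = length L"
  obtains W where "prob_space W" "sets W = sets (SB L)"
    "\<And>B. B \<in> det_sets L \<Longrightarrow> measure W B = sample_limit L M B"
proof -
  interpret ring_of_sets "structures L NN" "det_sets L" by (rule ring_det_sets)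
  let ?s = "sample_limit L M"
  have conv: "(\<lambda>n. perm_avg n (\<lambda>\<tau>. of_bool (relabel L NN \<tau> M \<in> B))) \<longlonglongrightarrow> ?s B"
    if "B \<in> det_sets L" for B
    using has_limit_convergent[OF lim M, of "\<lambda>N. N \<in> B"] that unfolding sample_limit_def det_sets_iff
    by (simp add: convergent_LIMSEQ_iff)
  have pos: "0 \<le> ?s B" if "B \<in> det_sets L" for B
    by (rule LIMSEQ_le_const[OF conv[OF that]]) (auto intro!: perm_avg_nonneg)
  have s0: "?s {} = 0" and s1: "?s (structures L NN) = 1"
    unfolding sample_limit_def by simp_all
  have add: "?s (B \<union> C) = ?s B + ?s C" if "B \<in> det_sets L" "C \<in> det_sets L" "B \<inter> C = {}" for B C
  proof (rule LIMSEQ_unique[OF conv])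
    show "B \<union> C \<in> det_sets L" using that by blast
    have "(\<lambda>n. perm_avg n (\<lambda>\<tau>. of_bool (relabel L NN \<tau> M \<in> B)) + perm_avg n (\<lambda>\<tau>. of_bool (relabel L NN \<tau> M \<in> C)))
      \<longlonglongrightarrow> ?s B + ?s C" by (intro tendsto_add conv that)
    moreover have "of_bool (N \<in> B) + of_bool (N \<in> C) = (of_bool (N \<in> B \<union> C) :: real)" for N
      using that(3) by auto
    ultimately show "(\<lambda>n. perm_avg n (\<lambda>\<tau>. of_bool (relabel L NN \<tau> M \<in> B \<union> C))) \<longlonglongrightarrow> ?s B + ?s C"
      by (simp only: perm_avg_add[symmetric])
  qed
  have "\<exists>\<mu> :: struc set \<Rightarrow> ennreal. (\<forall>B \<in> det_sets L. \<mu> B = ennreal (?s B)) \<and>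
      measure_space (structures L NN) (sigma_sets (structures L NN) (det_sets L)) \<mu>"
  proof (rule caratheodory_empty_continuous)
    show "positive (det_sets L) (\<lambda>B. ennreal (?s B))" by (simp add: positive_def s0)
    show "additive (det_sets L) (\<lambda>B. ennreal (?s B))"
      unfolding additive_def using add pos by (simp add: ennreal_plus)
    fix A :: "nat \<Rightarrow> struc set"
    assume A: "range A \<subseteq> det_sets L" "decseq A" "(\<Inter>i. A i) = {}"
    have "\<exists>i. A i = {}"
    proof (rule ccontr)
      assume "\<nexists>i. A i = {}"
      moreover have "closedin (struct_top L NN) (A n)" for n
      proof -
        have "A n \<in> det_sets L" using A(1) by blast
        then obtain Q where "A n = {M \<in> structures L NN. Q M}" "fin_det L Q" unfolding det_sets_def by auto
        then show ?thesis using closedin_fin_det by simp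
      qed
      ultimately have "(\<Inter>n. A n) \<noteq> {}"
        by (intro compact_space_imp_nest[OF compact_space_struct_top] A(2)) auto
      then show False using A(3) by simp
    qed
    then obtain i where i: "A i = {}" by blast
    have "A n = {}" if "i \<le> n" for n using decseqD[OF A(2) that] i by simp
    then have "\<forall>\<^sub>F n in sequentially. ennreal (?s (A n)) = 0"
      unfolding eventually_sequentially using s0 by (intro exI[of _ i]) simp
    then show "(\<lambda>n. ennreal (?s (A n))) \<longlonglongrightarrow> 0" by (rule tendsto_eventually)
  qed simp
  then obtain \<mu> where \<mu>: "\<And>B. B \<in> det_sets L \<Longrightarrow> \<mu> B = ennreal (?s B)"
      "measure_space (structures L NN) (sets (SB L)) \<mu>"
    unfolding sigma_det_sets by blast
  define W where "W = measure_of (structures L NN) (sets (SB L)) \<mu>"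
  have setsW: "sets W = sets (SB L)"
    unfolding W_def using sets.sigma_algebra_axioms[of "SB L"] sets.space_closed[of "SB L"]
    by (simp add: sigma_algebra.sigma_sets_eq)
  have emW: "emeasure W B = \<mu> B" if "B \<in> sets (SB L)" for B
    unfolding W_def using \<mu>(2) that
    by (intro emeasure_measure_of_sigma) (auto simp: measure_space_def)
  have dsub: "det_sets L \<subseteq> sets (SB L)" unfolding sigma_det_sets[symmetric] by auto
  have top: "structures L NN \<in> det_sets L" by (auto simp: det_sets_iff intro: fin_detI)
  have spW: "space W = structures L NN" using sets_eq_imp_space_eq[OF setsW] by simp
  have "prob_space W"
    by (rule prob_spaceI) (use emW[of "structures L NN"] dsub top \<mu>(1)[OF top] s1 in \<open>auto simp: spW\<close>)
  moreover have "measure W B = ?s B" if "B \<in> det_sets L" for B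
    using emW[of B] \<mu>(1)[OF that] dsub that pos[OF that] by (auto simp: measure_def)
  ultimately show ?thesis using that setsW by blast
qed

text \<open>
  The combinatorial limit is given as a definite description; existence is \<open>sample_limit_extends\<close> and
  uniqueness holds because cylinders determine a probability measure.
\<close>

lemma comb_limit_props:
  assumes lim: "has_limit L M" and M: "length M = length L"
  shows "prob_space (comb_limit L M)" (is ?A) and "sets (comb_limit L M) = sets (SB L)" (is ?B)
    and "\<And>Q. fin_det L Q \<Longrightarrow> (\<lambda>n. perm_avg n (\<lambda>\<tau>. of_bool (Q (relabel L NN \<tau> M))))
      \<longlonglongrightarrow> measure (comb_limit L M) {N \<in> structures L NN. Q N}"
proof -
  let ?R = "\<lambda>W. prob_space W \<and> sets W = sets (SB L) \<and>
        (\<forall>m\<ge>1. \<forall>A \<in> structures L {1..m}. measure W (cylinder L m A) = struct_density L m A M)"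
  have lim_eq: "struct_density L m A M = sample_limit L M (cylinder L m A)" for m A
  proof -
    have c: "relabel L {1..m} \<tau> M = A \<longleftrightarrow> relabel L NN \<tau> M \<in> cylinder L m A" for \<tau>
      by (simp add: cylinder_def restr_relabel_nat)
    have "\<forall>\<^sub>F n in sequentially. density_seq L m A M n =
        perm_avg n (\<lambda>\<tau>. of_bool (relabel L NN \<tau> M \<in> cylinder L m A))"
      using eventually_ge_at_top[of m] by eventually_elim (simp add: density_seq_eq_perm_avg[OF M] c)
    then have "(density_seq L m A M \<longlonglongrightarrow> x) \<longleftrightarrow>
        (\<lambda>n. perm_avg n (\<lambda>\<tau>. of_bool (relabel L NN \<tau> M \<in> cylinder L m A))) \<longlonglongrightarrow> x" for x
      by (rule tendsto_cong)
    then show ?thesis unfolding struct_density_def sample_limit_def lim_def by simp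
  qed
  obtain W where W: "prob_space W" "sets W = sets (SB L)"
    "\<And>B. B \<in> det_sets L \<Longrightarrow> measure W B = sample_limit L M B"
    using sample_limit_extends[OF lim M] by blast
  have "?R W" using W lim_eq cylinder_det by simp
  moreover have "W' = W" if "?R W'" for W'
    using that \<open>?R W\<close> by (intro measure_eqI_cylinder[of W' W L]) auto
  ultimately have eq: "comb_limit L M = W" unfolding comb_limit_def by (rule the_equality)
  show ?A ?B using W(1,2) unfolding eq by auto
  fix Q assume Q: "fin_det L Q"
  have "measure W {N \<in> structures L NN. Q N} = sample_limit L M {N \<in> structures L NN. Q N}"
    by (rule W(3)) (use Q in \<open>auto simp: det_sets_def\<close>)
  then show "(\<lambda>n. perm_avg n (\<lambda>\<tau>. of_bool (Q (relabel L NN \<tau> M))))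
      \<longlonglongrightarrow> measure (comb_limit L M) {N \<in> structures L NN. Q N}"
    using has_limit_convergent[OF lim M Q] unfolding eq
    by (simp add: sample_limit_def convergent_LIMSEQ_iff)
qed

lemma fin_det_relabel_eq:
  "\<sigma> permutes NN \<Longrightarrow> fin_det L (\<lambda>N. relabel L {1..m} \<sigma> N = A)"
  by (rule fin_det_relabel_fin[where R = "\<lambda>N. N = A"], simp, rule permutes_NN_image) auto

lemma measure_distr_cylinder:
  assumes "sets W = sets (SB L)" "\<sigma> permutes NN"
  shows "measure (distr W (SB L) (relabel L NN \<sigma>)) (cylinder L m A)
    = measure W {N \<in> structures L NN. relabel L {1..m} \<sigma> N = A}"
proof -
  have "relabel L NN \<sigma> \<in> measurable W (SB L)"
    using measurable_relabel[OF assms(2)] measurable_cong_sets[OF assms(1) refl] by blast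
  then have "measure (distr W (SB L) (relabel L NN \<sigma>)) (cylinder L m A)
    = measure W (relabel L NN \<sigma> -` cylinder L m A \<inter> space W)"
    by (rule measure_distr) (rule sets_cylinder)
  also have "relabel L NN \<sigma> -` cylinder L m A \<inter> space W = {N \<in> structures L NN. relabel L {1..m} \<sigma> N = A}"
    using sets_eq_imp_space_eq[OF assms(1)] by (auto simp: cylinder_def restr_relabel_nat)
  finally show ?thesis .
qed

lemma prob_space_distr_relabel:
  assumes "prob_space W" "sets W = sets (SB L)" "\<sigma> permutes NN"
  shows "prob_space (distr W (SB L) (relabel L NN \<sigma>))"
  using measurable_relabel[OF assms(3)] measurable_cong_sets[OF assms(2) refl]
  by (intro prob_space.prob_space_distr[OF assms(1)]) blast

text \<open>
  Sampling \<open>M\<close> with \<open>\<tau>\<close> and relabelling by \<open>\<sigma>\<close> amounts to sampling with \<open>\<tau> \<circ> \<sigma>\<close>.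
\<close>

lemma comb_limit_exchangeable:
  assumes lim: "has_limit L M" and M: "length M = length L"
  shows "exchangeable_measure L (comb_limit L M)"
  unfolding exchangeable_measure_def
proof (intro allI impI)
  fix \<sigma> :: "nat \<Rightarrow> nat" assume \<sigma>: "\<sigma> permutes NN"
  note W = comb_limit_props[OF lim M]
  let ?W = "comb_limit L M"
  show "distr ?W (SB L) (relabel L NN \<sigma>) = ?W"
  proof (rule measure_eqI_cylinder)
    show "prob_space (distr ?W (SB L) (relabel L NN \<sigma>))" by (rule prob_space_distr_relabel[OF W(1,2) \<sigma>])
    fix m :: nat and A assume "1 \<le> m" "A \<in> structures L {1..m}"
    let ?h = "\<lambda>\<tau>. of_bool (relabel L {1..m} \<tau> M = A) :: real"
    have 1: "(\<lambda>n. perm_avg n (\<lambda>\<tau>. ?h (\<tau> \<circ> \<sigma>))) \<longlonglongrightarrow> measure ?W {N \<in> structures L NN. relabel L {1..m} \<sigma> N = A}"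
    proof -
      have "\<sigma> ` {1..m} \<subseteq> NN" using \<sigma> by (intro permutes_NN_image) auto
      then have "relabel L {1..m} \<sigma> (relabel L NN \<tau> M) = relabel L {1..m} (\<tau> \<circ> \<sigma>) M" for \<tau>
        by (rule relabel_relabel)
      then show ?thesis using W(3)[OF fin_det_relabel_eq[OF \<sigma>, of L m A]] by simp
    qed
    have 2: "(\<lambda>n. perm_avg n ?h) \<longlonglongrightarrow> measure ?W (cylinder L m A)"
      using W(3)[OF fin_det_restr[where R = "\<lambda>N. N = A"], of m]
      by (simp add: cylinder_def restr_relabel_nat)
    have "\<forall>\<^sub>F n in sequentially. perm_avg n (\<lambda>\<tau>. ?h (\<tau> \<circ> \<sigma>)) = perm_avg n ?h"
      using eventually_ge_at_top[of "Max (insert 1 (\<sigma> ` {1..m}))"]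
    proof eventually_elim
      case (elim n)
      have "\<sigma> ` {1..m} \<subseteq> NN" using \<sigma> by (intro permutes_NN_image) auto
      moreover have "k \<le> n" if "k \<in> \<sigma> ` {1..m}" for k
      proof -
        have "k \<le> Max (insert 1 (\<sigma> ` {1..m}))" using that by (intro Max_ge) auto
        then show ?thesis using elim by linarith
      qed
      ultimately have "\<sigma> ` {1..m} \<subseteq> {1..n}" by (auto 0 3)
      then show ?case
        by (rule perm_avg_marginal[OF depends_on_relabel inj_on_subset[OF permutes_inj[OF \<sigma>] subset_UNIV]])
    qed
    then have "(\<lambda>n. perm_avg n ?h) \<longlonglongrightarrow> measure ?W {N \<in> structures L NN. relabel L {1..m} \<sigma> N = A}"
      by (rule Lim_transform_eventually[OF 1])
    then show "measure (distr ?W (SB L) (relabel L NN \<sigma>)) (cylinder L m A) = measure ?W (cylinder L m A)"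
      unfolding measure_distr_cylinder[OF W(2) \<sigma>] using 2 by (rule LIMSEQ_unique)
  qed (use W in auto)
qed

text \<open>
  Dissociation comes from the sampling procedure: samples at disjoint positions are asymptotically independent.
\<close>

lemma comb_limit_product:
  assumes lim: "has_limit L M" and M: "length M = length L"
    and T: "T \<subseteq> NN" "T' \<subseteq> NN" "T \<inter> T' = {}"
  shows "measure (comb_limit L M) {N \<in> structures L NN. R (restr {1..k} (restr T N)) \<and> R' (restr {1..k} (restr T' N))}
    = measure (comb_limit L M) {N \<in> structures L NN. R (restr {1..k} (restr T N))}
    * measure (comb_limit L M) {N \<in> structures L NN. R' (restr {1..k} (restr T' N))}"
proof -
  note W = comb_limit_props[OF lim M]
  let ?W = "comb_limit L M"
  have fd: "fin_det L (\<lambda>N. R (restr {1..k} (restr T N)))" for R T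
  proof -
    have "restr {1..k} (restr T N) = restr T (restr {1..k} N)" for N
      by (simp only: restr_restr Int_commute)
    then show ?thesis using fin_det_restr[where R = "\<lambda>N. R (restr T N)"] by simp
  qed
  define h where "h = (\<lambda>\<tau>. of_bool (R (relabel L (T \<inter> {1..k}) \<tau> M)) :: real)"
  define h' where "h' = (\<lambda>\<tau>. of_bool (R' (relabel L (T' \<inter> {1..k}) \<tau> M)) :: real)"
  have eq: "restr {1..k} (restr U (relabel L NN \<tau> M)) = relabel L (U \<inter> {1..k}) \<tau> M" if "U \<subseteq> NN" for U \<tau>
    unfolding restr_restr by (rule restr_relabel) (use that in auto)
  have 1: "(\<lambda>n. perm_avg n h) \<longlonglongrightarrow> measure ?W {N \<in> structures L NN. R (restr {1..k} (restr T N))}"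
    using W(3)[OF fd, of R T] by (simp add: eq T h_def)
  have 2: "(\<lambda>n. perm_avg n h') \<longlonglongrightarrow> measure ?W {N \<in> structures L NN. R' (restr {1..k} (restr T' N))}"
    using W(3)[OF fd, of R' T'] by (simp add: eq T h'_def)
  have 3: "(\<lambda>n. perm_avg n (\<lambda>\<tau>. h \<tau> * h' \<tau>)) \<longlonglongrightarrow>
      measure ?W {N \<in> structures L NN. R (restr {1..k} (restr T N)) \<and> R' (restr {1..k} (restr T' N))}"
    using W(3)[OF fin_det_conj[OF fd fd], of R T R' T'] by (simp add: eq T h_def h'_def of_bool_conj)
  have "(\<lambda>n. perm_avg n h * perm_avg n h' - perm_avg n (\<lambda>\<tau>. h \<tau> * h' \<tau>)) \<longlonglongrightarrow> 0"
  proof (rule Lim_null_comparison)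
    show "\<forall>\<^sub>F n in sequentially. norm (perm_avg n h * perm_avg n h' - perm_avg n (\<lambda>\<tau>. h \<tau> * h' \<tau>)) \<le> real (k * k) / n"
      using eventually_ge_at_top[of "Suc k"]
    proof eventually_elim
      case (elim n)
      have "\<bar>perm_avg n h * perm_avg n h' - perm_avg n (\<lambda>\<tau>. h \<tau> * h' \<tau>)\<bar> \<le> real k * real k / n"
      proof (rule perm_avg_product_close[of "T \<inter> {1..k}" h "T' \<inter> {1..k}" h' k n])
        show "h \<tau> = h \<tau>'" if "\<And>i. i \<in> T \<inter> {1..k} \<Longrightarrow> \<tau> i = \<tau>' i" for \<tau> \<tau>'
          unfolding h_def by (subst relabel_cong[OF that]) auto
        show "h' \<tau> = h' \<tau>'" if "\<And>i. i \<in> T' \<inter> {1..k} \<Longrightarrow> \<tau> i = \<tau>' i" for \<tau> \<tau>'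
          unfolding h'_def by (subst relabel_cong[OF that]) auto
      qed (use T elim in \<open>auto simp: h_def h'_def\<close>)
      then show ?case by simp
    qed
    show "(\<lambda>n. real (k * k) / n) \<longlonglongrightarrow> 0" by (rule lim_const_over_n)
  qed
  moreover have "(\<lambda>n. perm_avg n h * perm_avg n h' - perm_avg n (\<lambda>\<tau>. h \<tau> * h' \<tau>)) \<longlonglongrightarrow>
      measure ?W {N \<in> structures L NN. R (restr {1..k} (restr T N))}
      * measure ?W {N \<in> structures L NN. R' (restr {1..k} (restr T' N))}
      - measure ?W {N \<in> structures L NN. R (restr {1..k} (restr T N)) \<and> R' (restr {1..k} (restr T' N))}"
    by (intro tendsto_diff tendsto_mult 1 2 3)
  ultimately show ?thesis using LIMSEQ_unique by fastforce
qed

text \<open>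
  The events seen on finitely many labels of \<open>T\<close> are stable under intersection and generate the \<open>\<sigma>\<close>-algebra of
  the restriction to \<open>T\<close>.
\<close>

lemma comb_limit_dissociated:
  assumes lim: "has_limit L M" and M: "length M = length L"
  shows "dissociated L (comb_limit L M)"
  unfolding dissociated_def
proof (intro allI impI)
  fix T T' :: "nat set" assume T: "T \<subseteq> NN \<and> T' \<subseteq> NN \<and> T \<inter> T' = {}"
  note W = comb_limit_props[OF lim M]
  let ?W = "comb_limit L M" and ?\<Omega> = "structures L NN"
  interpret prob_space ?W by (rule W(1))
  have sp: "space ?W = ?\<Omega>" using sets_eq_imp_space_eq[OF W(2)] by simp
  define G where "G U = {{N \<in> ?\<Omega>. R (restr {1..k} (restr U N))} |R k. True}" for U
  have fd: "fin_det L (\<lambda>N. R (restr {1..k} (restr U N)))" for R U k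
  proof -
    have "restr {1..k} (restr U N) = restr U (restr {1..k} N)" for N
      by (simp only: restr_restr Int_commute)
    then show ?thesis using fin_det_restr[where R = "\<lambda>N. R (restr U N)"] by simp
  qed
  have Gev: "G U \<subseteq> events" for U unfolding G_def W(2) using sets_fin_det[OF fd] by blast
  have raise: "\<exists>R'. \<forall>N. R (restr {1..k} (restr U N)) = R' (restr {1..l} (restr U N))" if "k \<le> l" for R k l U
  proof (intro exI[of _ "\<lambda>N. R (restr {1..k} N)"] allI)
    fix N
    have "{1..l} \<inter> {1..k} = {1..k}" using that by auto
    then have "restr {1..k} (restr {1..l} (restr U N)) = restr {1..k} (restr U N)"
      by (metis restr_restr)
    then show "R (restr {1..k} (restr U N)) = R (restr {1..k} (restr {1..l} (restr U N)))" by simp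
  qed
  have common: "\<exists>R R' k. a = {N \<in> ?\<Omega>. R (restr {1..k} (restr U N))} \<and> b = {N \<in> ?\<Omega>. R' (restr {1..k} (restr V N))}"
    if "a \<in> G U" "b \<in> G V" for a b U V
  proof -
    from that obtain R k R' l where ab: "a = {N \<in> ?\<Omega>. R (restr {1..k} (restr U N))}"
      "b = {N \<in> ?\<Omega>. R' (restr {1..l} (restr V N))}" unfolding G_def by blast
    obtain R1 where "\<forall>N. R (restr {1..k} (restr U N)) = R1 (restr {1..max k l} (restr U N))"
      using raise[OF max.cobounded1, of R k U l] by (elim exE)
    moreover obtain R2 where "\<forall>N. R' (restr {1..l} (restr V N)) = R2 (restr {1..max k l} (restr V N))"
      using raise[OF max.cobounded2, of R' l V k] by (elim exE)
    ultimately show ?thesis using ab by blast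
  qed
  have int: "Int_stable (G U)" for U
  proof (rule Int_stableI)
    fix a b assume "a \<in> G U" "b \<in> G U"
    from common[OF this] obtain R R' k where "a = {N \<in> ?\<Omega>. R (restr {1..k} (restr U N))}"
      "b = {N \<in> ?\<Omega>. R' (restr {1..k} (restr U N))}" by blast
    then have "a \<inter> b = {N \<in> ?\<Omega>. (\<lambda>N. R N \<and> R' N) (restr {1..k} (restr U N))}" by auto
    then show "a \<inter> b \<in> G U" unfolding G_def
      by (intro CollectI exI[of _ "\<lambda>N. R N \<and> R' N"] exI[of _ k]) simp
  qed
  have "indep_set (G T) (G T')"
  proof (rule indep_setI[OF Gev Gev])
    fix a b assume "a \<in> G T" "b \<in> G T'"
    from common[OF this] obtain R R' k where "a = {N \<in> ?\<Omega>. R (restr {1..k} (restr T N))}"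
      "b = {N \<in> ?\<Omega>. R' (restr {1..k} (restr T' N))}" by blast
    moreover from this have "a \<inter> b = {N \<in> ?\<Omega>. R (restr {1..k} (restr T N)) \<and> R' (restr {1..k} (restr T' N))}" by auto
    ultimately show "prob (a \<inter> b) = prob a * prob b"
      using comb_limit_product[OF lim M, of T T' R k R'] T by simp
  qed
  then have ind: "indep_set (sigma_sets ?\<Omega> (G T)) (sigma_sets ?\<Omega> (G T'))"
    using indep_set_sigma_sets[OF _ int int] sp by simp
  have sub: "sigma_sets ?\<Omega> {restr U -` A \<inter> ?\<Omega> |A. A \<in> sets (struct_borel L U)} \<subseteq> sigma_sets ?\<Omega> (G U)"
    if U: "U \<subseteq> NN" for U
  proof -
    have GP: "G U \<subseteq> Pow ?\<Omega>" unfolding G_def by blast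
    have "restr U \<in> measurable (sigma ?\<Omega> (G U)) (struct_borel L U)"
    proof (rule measurable_struct_borel[OF U])
      fix N assume "N \<in> space (sigma ?\<Omega> (G U))"
      then have "restr U N \<in> structures L (NN \<inter> U)" using restr_in_structures GP by simp
      moreover have "NN \<inter> U = U" using U by blast
      ultimately show "restr U N \<in> structures L U" by simp
    next
      fix n :: nat and A
      have "{x \<in> ?\<Omega>. restr {1..n} (restr U x) = A} \<in> G U" unfolding G_def
        by (intro CollectI exI[of _ "\<lambda>N. N = A"] exI[of _ n]) simp
      then show "{x \<in> space (sigma ?\<Omega> (G U)). restr {1..n} (restr U x) = A} \<in> sets (sigma ?\<Omega> (G U))"
        using GP by auto
    qed
    then have "restr U -` A \<inter> ?\<Omega> \<in> sigma_sets ?\<Omega> (G U)" if "A \<in> sets (struct_borel L U)" for A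
      using measurable_sets[OF _ that, of "restr U" "sigma ?\<Omega> (G U)"] GP by simp
    then show ?thesis by (intro sigma_sets_mono) blast
  qed
  have mr: "restr U \<in> measurable ?W (struct_borel L U)" if "U \<subseteq> NN" for U
    using measurable_restr[OF that] measurable_cong_sets[OF W(2) refl] by blast
  show "indep_var (struct_borel L T) (restr T) (struct_borel L T') (restr T')"
    unfolding indep_var_eq sp
  proof (intro conjI)
    let ?A = "sigma_sets ?\<Omega> {restr T -` A \<inter> ?\<Omega> |A. A \<in> sets (struct_borel L T)}"
    let ?B = "sigma_sets ?\<Omega> {restr T' -` A \<inter> ?\<Omega> |A. A \<in> sets (struct_borel L T')}"
    have A: "?A \<subseteq> sigma_sets ?\<Omega> (G T)" and B: "?B \<subseteq> sigma_sets ?\<Omega> (G T')" using sub T by auto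
    show "indep_set ?A ?B"
    proof (rule indep_setI)
      show "?A \<subseteq> events" by (rule order_trans[OF A indep_setD_ev1[OF ind]])
      show "?B \<subseteq> events" by (rule order_trans[OF B indep_setD_ev2[OF ind]])
      show "prob (a \<inter> b) = prob a * prob b" if "a \<in> ?A" "b \<in> ?B" for a b
        by (rule indep_setD[OF ind subsetD[OF A that(1)] subsetD[OF B that(2)]])
    qed
  qed (use mr T in auto)
qed

lemma comb_limit_ergodic:
  "has_limit L M \<Longrightarrow> length M = length L \<Longrightarrow> comb_limit L M \<in> ergodic_measures L"
  using comb_limit_props[of L M] comb_limit_exchangeable comb_limit_dissociated
  by (simp add: ergodic_measures_def)

lemma measure_zero_limit_cylinder:
  "measure (zero_limit L) (cylinder L m A) = of_bool (A = zero_struct L)"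
  using measure_return[OF sets_cylinder, of L "zero_struct L" m A]
  by (auto simp: zero_limit_def cylinder_def indicator_def)

lemma comb_limit_eq_zero_iff:
  assumes lim: "has_limit L M" and M: "length M = length L"
  shows "comb_limit L M = zero_limit L \<longleftrightarrow>
    (\<forall>m. (\<lambda>n. perm_avg n (\<lambda>\<tau>. of_bool (relabel L {1..m} \<tau> M \<noteq> zero_struct L))) \<longlonglongrightarrow> 0)"
proof -
  note W = comb_limit_props[OF lim M]
  let ?W = "comb_limit L M"
  interpret W: prob_space ?W by (rule W(1))
  have sp: "space ?W = structures L NN" using sets_eq_imp_space_eq[OF W(2)] by simp
  let ?p = "\<lambda>m n. perm_avg n (\<lambda>\<tau>. of_bool (relabel L {1..m} \<tau> M \<noteq> zero_struct L))"
  have l: "?p m \<longlonglongrightarrow> 1 - measure ?W (cylinder L m (zero_struct L))" for m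
  proof -
    have "{N \<in> structures L NN. restr {1..m} N \<noteq> zero_struct L} = space ?W - cylinder L m (zero_struct L)"
      by (auto simp: sp cylinder_def)
    moreover have "cylinder L m (zero_struct L) \<in> sets ?W" unfolding W(2) by (rule sets_cylinder)
    ultimately show ?thesis
      using W(3)[OF fin_det_restr[where R = "\<lambda>N. N \<noteq> zero_struct L"], of m]
      by (simp add: restr_relabel_nat W.prob_compl)
  qed
  have l0: "?p m \<longlonglongrightarrow> 0 \<longleftrightarrow> measure ?W (cylinder L m (zero_struct L)) = 1" for m
    using l[of m] LIMSEQ_unique[OF l[of m], of 0] by auto
  show ?thesis unfolding l0
  proof
    assume "?W = zero_limit L"
    then show "\<forall>m. measure ?W (cylinder L m (zero_struct L)) = 1"
      using measure_zero_limit_cylinder[of L _ "zero_struct L"] by simp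
  next
    assume 1: "\<forall>m. measure ?W (cylinder L m (zero_struct L)) = 1"
    show "?W = zero_limit L"
    proof (rule measure_eqI_cylinder[OF W(1) _ W(2)])
      show "prob_space (zero_limit L)" unfolding zero_limit_def by (rule prob_space_return) simp
      show "sets (zero_limit L) = sets (SB L)" by (simp add: zero_limit_def)
      fix n :: nat and A assume "1 \<le> n" "A \<in> structures L {1..n}"
      show "measure ?W (cylinder L n A) = measure (zero_limit L) (cylinder L n A)"
      proof (cases "A = zero_struct L")
        case True then show ?thesis using 1 measure_zero_limit_cylinder[of L n A] by simp
      next
        case False
        have "measure ?W (cylinder L n A) + measure ?W (cylinder L n (zero_struct L))
          = measure ?W (cylinder L n A \<union> cylinder L n (zero_struct L))"
        proof (rule W.finite_measure_Union[symmetric])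
          show "cylinder L n A \<inter> cylinder L n (zero_struct L) = {}" using False by (auto simp: cylinder_def)
        qed (auto simp: W(2) sets_cylinder)
        also have "\<dots> \<le> 1" by simp
        finally have "measure ?W (cylinder L n A) \<le> 0" using 1 by simp
        then show ?thesis using False measure_zero_limit_cylinder[of L n A]
          by (simp add: measure_le_0_iff)
      qed
    qed
  qed
qed

lemma has_limit_zero: "has_limit L (zero_struct L)"
  by (simp add: has_limit_iff convergent_const)

lemma comb_limit_zero: "comb_limit L (zero_struct L) = zero_limit L"
  by (simp add: comb_limit_eq_zero_iff[OF has_limit_zero])

section \<open>Convergence of sampling averages\<close>

lemma integrable_perm_avg:
  fixes f :: "(nat \<Rightarrow> nat) \<Rightarrow> 'a \<Rightarrow> real"
  assumes "\<And>\<tau>. \<tau> permutes {1..n} \<Longrightarrow> integrable \<rho> (f \<tau>)"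
  shows "integrable \<rho> (\<lambda>M. perm_avg n (\<lambda>\<tau>. f \<tau> M))"
    and "(\<integral>M. perm_avg n (\<lambda>\<tau>. f \<tau> M) \<partial>\<rho>) = perm_avg n (\<lambda>\<tau>. \<integral>M. f \<tau> M \<partial>\<rho>)"
proof -
  have i: "integrable \<rho> (\<lambda>M. \<Sum>\<tau> | \<tau> permutes {1..n}. f \<tau> M)"
    using assms by (intro Bochner_Integration.integrable_sum) simp
  then show "integrable \<rho> (\<lambda>M. perm_avg n (\<lambda>\<tau>. f \<tau> M))"
    unfolding perm_avg_def by simp
  have "(\<integral>M. (\<Sum>\<tau> | \<tau> permutes {1..n}. f \<tau> M) \<partial>\<rho>) = (\<Sum>\<tau> | \<tau> permutes {1..n}. \<integral>M. f \<tau> M \<partial>\<rho>)"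
    using assms by (intro Bochner_Integration.integral_sum) simp
  then show "(\<integral>M. perm_avg n (\<lambda>\<tau>. f \<tau> M) \<partial>\<rho>) = perm_avg n (\<lambda>\<tau>. \<integral>M. f \<tau> M \<partial>\<rho>)"
    unfolding perm_avg_def by simp
qed

lemma measurable_perm_avg [measurable]:
  fixes f :: "(nat \<Rightarrow> nat) \<Rightarrow> 'a \<Rightarrow> real"
  assumes "\<And>\<tau>. \<tau> permutes {1..n} \<Longrightarrow> f \<tau> \<in> borel_measurable \<rho>"
  shows "(\<lambda>M. perm_avg n (\<lambda>\<tau>. f \<tau> M)) \<in> borel_measurable \<rho>"
  unfolding perm_avg_def using assms by (intro borel_measurable_divide borel_measurable_sum) auto

lemma fourth_power_gap:
  "(\<lambda>k. real m * ((real k + 2)^4 - (real k + 1)^4) / (real k + 1)^4) \<longlonglongrightarrow> 0"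
  by real_asymp

text \<open>
  The quotient of consecutive fourth powers tends to 1, so a slowly varying sequence changes little between
  them.
\<close>

lemma tendsto_of_fourth_powers:
  fixes u :: "nat \<Rightarrow> real"
  assumes conv: "(\<lambda>k. u ((k + 1)^4)) \<longlonglongrightarrow> l"
    and slow: "\<And>n d. m \<le> n \<Longrightarrow> 0 < n \<Longrightarrow> \<bar>u (n + d) - u n\<bar> \<le> real m * real d / real n"
  shows "u \<longlonglongrightarrow> l"
proof (rule LIMSEQ_I)
  fix e :: real assume e: "e > 0"
  obtain K1 where K1: "\<And>k. k \<ge> K1 \<Longrightarrow> \<bar>u ((k + 1)^4) - l\<bar> < e / 2"
    using LIMSEQ_D[OF conv, of "e / 2"] e by auto
  obtain K2 where K2: "\<And>k. k \<ge> K2 \<Longrightarrow> \<bar>real m * ((real k + 2)^4 - (real k + 1)^4) / (real k + 1)^4\<bar> < e / 2"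
    using LIMSEQ_D[OF fourth_power_gap[of m], of "e / 2"] e by auto
  define K where "K = max m (max K1 K2)"
  show "\<exists>no. \<forall>n\<ge>no. norm (u n - l) < e"
  proof (intro exI[of _ "(K + 1)^4"] allI impI)
    fix n assume n: "(K + 1)^4 \<le> n"
    \<comment> \<open>the largest fourth power not above \<open>n\<close> is \<open>(k + 1)^4\<close>\<close>
    define k where "k = (LEAST k. n < (k + 2)^4)"
    have "n < (n + 2)^4" by (rule less_le_trans[OF _ self_le_power]) auto
    then have k1: "n < (k + 2)^4" unfolding k_def by (rule LeastI)
    have k2: "(k + 1)^4 \<le> n"
    proof (cases k)
      case 0
      have "(1::nat) \<le> (K + 1)^4" by simp
      then show ?thesis using order_trans[OF _ n, of 1] 0 by simp
    next
      case (Suc k')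
      then have "\<not> n < (k' + 2)^4" using not_less_Least[of k' "\<lambda>k. n < (k + 2)^4"] by (simp add: k_def)
      moreover have "k' + 2 = k + 1" using Suc by simp
      ultimately show ?thesis by (simp only: not_less)
    qed
    have "(K + 1)^4 < (k + 2)^4" using n k1 by linarith
    then have "K + 1 < k + 2" by (rule power_less_imp_less_base) simp
    then have kK: "K \<le> k" by simp
    have mk: "m \<le> (k + 1)^4"
    proof -
      have "m \<le> k + 1" using kK by (simp add: K_def)
      also have "\<dots> \<le> (k + 1)^4" by (rule self_le_power) auto
      finally show ?thesis .
    qed
    have "\<bar>u ((k + 1)^4 + (n - (k + 1)^4)) - u ((k + 1)^4)\<bar>
      \<le> real m * real (n - (k + 1)^4) / real ((k + 1)^4)" by (rule slow[OF mk]) simp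
    also have "\<dots> \<le> real m * ((real k + 2)^4 - (real k + 1)^4) / (real k + 1)^4"
    proof -
      have "real n \<le> real ((k + 2)^4)" using k1 by (simp only: of_nat_le_iff)
      then have "real (n - (k + 1)^4) \<le> (real k + 2)^4 - (real k + 1)^4"
        using k2 by (simp add: of_nat_diff add.commute)
      then show ?thesis
        by (auto intro!: divide_right_mono mult_left_mono simp: add.commute)
    qed
    also have "\<dots> < e / 2" using K2[of k] kK by (simp add: K_def)
    finally have "\<bar>u n - u ((k + 1)^4)\<bar> < e / 2" using k2 by simp
    moreover have "\<bar>u ((k + 1)^4) - l\<bar> < e / 2" using K1[of k] kK by (simp add: K_def)
    ultimately show "norm (u n - l) < e" unfolding real_norm_def by linarith
  qed
qed

text \<open>
  Along the fourth powers the increments of \<open>U\<close> have \<open>L\<^sup>1\<close> norm of order \<open>1/k\<^sup>2\<close>, so they are almost surely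
  summable.  This elementary argument takes the place of reverse martingale convergence.
\<close>

lemma AE_convergent_of_variance:
  fixes U :: "nat \<Rightarrow> 'a \<Rightarrow> real"
  assumes fin: "finite_measure \<rho>"
    and meas [measurable]: "\<And>n. U n \<in> borel_measurable \<rho>"
    and bnd: "\<And>n M. 0 \<le> U n M" "\<And>n M. U n M \<le> 1"
    and var: "\<And>n N. 1 \<le> n \<Longrightarrow> n \<le> N \<Longrightarrow> (\<integral>M. (U n M - U N M)\<^sup>2 \<partial>\<rho>) \<le> C / n"
    and slow: "\<And>M n d. m \<le> n \<Longrightarrow> 0 < n \<Longrightarrow> \<bar>U (n + d) M - U n M\<bar> \<le> real m * real d / real n"
  shows "AE M in \<rho>. convergent (\<lambda>n. U n M)"
proof -
  interpret finite_measure \<rho> by (rule fin)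
  define c where "c = measure \<rho> (space \<rho>)"
  define D where "D k M = \<bar>U ((k + 1)^4) M - U ((Suc k + 1)^4) M\<bar>" for k M
  have [measurable]: "D k \<in> borel_measurable \<rho>" for k unfolding D_def by measurable
  have D: "0 \<le> D k M" "D k M \<le> 1" for k M
    using bnd[of "(k + 1)^4" M] bnd[of "(Suc k + 1)^4" M] unfolding D_def by linarith+
  have iD: "integrable \<rho> (D k)" for k
    by (rule integrable_const_bound[of _ 1]) (use D in \<open>auto simp: abs_of_nonneg\<close>)
  have iD2: "integrable \<rho> (\<lambda>M. (D k M)\<^sup>2)" for k
    by (rule integrable_const_bound[of _ 1]) (use D in \<open>auto simp: abs_square_le_1\<close>)
  have ED: "(\<integral>M. D k M \<partial>\<rho>) \<le> (C + c) / (real k + 1)\<^sup>2" for k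
  proof -
    let ?a = "(real k + 1)\<^sup>2"
    have a: "?a > 0" by simp
    have "(\<integral>M. D k M \<partial>\<rho>) \<le> (\<integral>M. ?a * (D k M)\<^sup>2 + 1 / ?a \<partial>\<rho>)"
    proof (rule integral_mono[OF iD])
      show "integrable \<rho> (\<lambda>M. ?a * (D k M)\<^sup>2 + 1 / ?a)"
        by (intro Bochner_Integration.integrable_add integrable_mult_right iD2) simp
      fix M
      (* expanding 0 <= (b x - 1/b)^2 gives x <= b^2 x^2 + 1/b^2, a substitute for Cauchy-Schwarz *)
      define b where "b = real k + 1"
      have b: "b > 0" unfolding b_def by simp
      have "0 \<le> (b * D k M - 1 / b)\<^sup>2 + D k M" using D by simp
      then have "D k M \<le> b\<^sup>2 * (D k M)\<^sup>2 + 1 / b\<^sup>2"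
        using b by (simp add: power2_diff power_mult_distrib power_divide)
      then show "D k M \<le> ?a * (D k M)\<^sup>2 + 1 / ?a" by (simp add: b_def)
    qed
    also have "\<dots> = ?a * (\<integral>M. (D k M)\<^sup>2 \<partial>\<rho>) + c / ?a"
      using iD2 by (simp add: c_def)
    also have "(\<integral>M. (D k M)\<^sup>2 \<partial>\<rho>) \<le> C / real ((k + 1)^4)"
      unfolding D_def power2_abs by (rule var) (auto intro!: power_mono)
    also have "?a * (C / real ((k + 1)^4)) = C / ?a"
    proof -
      have e: "real ((k + 1)^4) = ?a * ?a"
        unfolding of_nat_power power2_eq_square power4_eq_xxxx by (simp add: algebra_simps)
      show ?thesis unfolding e using a by (simp add: divide_simps)
    qed
    finally show ?thesis by (simp add: add_divide_distrib)
  qed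
  have C0: "0 \<le> C" using var[of 1 1] by simp
  have c0: "0 \<le> c" by (simp add: c_def)
  have sums: "summable (\<lambda>k. (C + c) / (real k + 1)\<^sup>2)"
  proof -
    have "summable (\<lambda>k. 1 / (real (k + 1))\<^sup>2)"
      using inverse_power_summable[of 2, where 'a = real]
      by (subst summable_iff_shift[of "\<lambda>k. 1 / (real k)\<^sup>2" 1]) (simp add: field_simps)
    from summable_mult[OF this, of "C + c"] show ?thesis by (simp add: add.commute)
  qed
  have "(\<integral>\<^sup>+M. (\<Sum>k. ennreal (D k M)) \<partial>\<rho>) = (\<Sum>k. \<integral>\<^sup>+M. ennreal (D k M) \<partial>\<rho>)"
    by (rule nn_integral_suminf) measurable
  also have "\<dots> \<le> (\<Sum>k. ennreal ((C + c) / (real k + 1)\<^sup>2))"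
  proof (rule suminf_le)
    fix k
    show "(\<integral>\<^sup>+M. ennreal (D k M) \<partial>\<rho>) \<le> ennreal ((C + c) / (real k + 1)\<^sup>2)"
      using ED[of k] D by (subst nn_integral_eq_integral[OF iD]) (auto intro: ennreal_leI)
  qed auto
  also have "\<dots> = ennreal (\<Sum>k. (C + c) / (real k + 1)\<^sup>2)"
    by (rule suminf_ennreal2[OF _ sums]) (use C0 c0 in simp)
  also have "\<dots> < \<infinity>" by simp
  finally have "AE M in \<rho>. (\<Sum>k. ennreal (D k M)) \<noteq> \<infinity>"
    by (intro nn_integral_PInf_AE) auto
  then show ?thesis
  proof eventually_elim
    case (elim M)
    have "summable (\<lambda>k. D k M)" by (rule summable_suminf_not_top) (use D elim in auto)
    then have "summable (\<lambda>k. U ((Suc k + 1)^4) M - U ((k + 1)^4) M)"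
      by (rule summable_rabs_cancel[of "\<lambda>k. U ((Suc k + 1)^4) M - U ((k + 1)^4) M", OF summable_cong[THEN iffD1, rotated]])
         (simp add: D_def abs_minus_commute)
    then have "convergent (\<lambda>n. \<Sum>k<n. U ((Suc k + 1)^4) M - U ((k + 1)^4) M)"
      by (simp add: summable_iff_convergent)
    then have "convergent (\<lambda>n. U ((n + 1)^4) M - U ((0 + 1)^4) M)"
      by (subst (asm) sum_lessThan_telescope)
    then obtain l where "(\<lambda>n. U ((n + 1)^4) M - U ((0 + 1)^4) M) \<longlonglongrightarrow> l" by (auto simp: convergent_def)
    from tendsto_add[OF this tendsto_const[of "U ((0 + 1)^4) M"]]
    have "(\<lambda>k. U ((k + 1)^4) M) \<longlonglongrightarrow> l + U ((0 + 1)^4) M" by simp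
    from tendsto_of_fourth_powers[OF this slow] show ?case by (auto simp: convergent_def)
  qed
qed

text \<open>
  By invariance, the law of a pattern seen at labels outside \<open>S\<close> does not depend on these labels, because they
  can be moved to any others by a finite permutation that fixes \<open>S\<close>.
\<close>

lemma align_permutation:
  assumes T: "finite T" "T \<subseteq> NN" "T \<inter> S = {}" and \<phi>: "inj_on \<phi> T" "\<phi> ` T \<subseteq> NN" "\<phi> ` T \<inter> S = {}"
  obtains \<sigma> N where "\<sigma> permutes {1..N}" "\<And>i. i \<in> S \<Longrightarrow> \<sigma> i = i" "\<And>x. x \<in> T \<Longrightarrow> \<sigma> x = \<phi> x"
proof -
  define N where "N = Max (insert 0 (T \<union> \<phi> ` T))"
  have le: "x \<le> N" if "x \<in> T \<union> \<phi> ` T" for x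
    unfolding N_def by (rule Max_ge) (use T(1) that in auto)
  have sub: "T \<subseteq> {1..N} - S" "\<phi> ` T \<subseteq> {1..N} - S"
    using le T \<phi> by (auto 0 3)
  obtain \<sigma> where \<sigma>: "\<sigma> permutes {1..N} - S" "\<And>x. x \<in> T \<Longrightarrow> \<sigma> x = \<phi> x"
    using extend_to_permutation[OF _ \<phi>(1) sub] by blast
  show ?thesis
  proof (rule that[of \<sigma> N])
    show "\<sigma> permutes {1..N}" by (rule permutes_subset[OF \<sigma>(1)]) blast
    show "\<sigma> i = i" if "i \<in> S" for i using permutes_not_in[OF \<sigma>(1), of i] that by blast
  qed (rule \<sigma>(2))
qed

text \<open>
  The value \<open>h \<tau> M\<close> is read off from \<open>M\<close> at the labels \<open>\<tau> 1, \<dots>, \<tau> m\<close> and, possibly, at the labels in \<open>S\<close>.  The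
  law \<open>\<rho>\<close> of \<open>M\<close> is only required to be invariant under finite permutations that fix \<open>S\<close>, as it is for an
  exchangeable measure restricted to an event that concerns the labels in \<open>S\<close>.
\<close>

locale equivariant_sample =
  fixes L :: "nat list" and \<rho> :: "struc measure" and S :: "nat set" and m :: nat
    and h :: "(nat \<Rightarrow> nat) \<Rightarrow> struc \<Rightarrow> real"
  assumes finite_\<rho>: "finite_measure \<rho>" and sets_\<rho>: "sets \<rho> = sets (SB L)" and finite_S: "finite S"
    and invariant: "\<And>\<sigma> N. \<sigma> permutes {1..N} \<Longrightarrow> (\<And>i. i \<in> S \<Longrightarrow> \<sigma> i = i) \<Longrightarrow>
      distr \<rho> (SB L) (relabel L NN \<sigma>) = \<rho>"
    and dep: "\<And>M. depends_on m (\<lambda>\<tau>. h \<tau> M)"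
    and h_ge: "\<And>\<tau> M. 0 \<le> h \<tau> M" and h_le: "\<And>\<tau> M. h \<tau> M \<le> 1"
    and h_meas: "\<And>\<tau>. \<tau> permutes NN \<Longrightarrow> h \<tau> \<in> borel_measurable (SB L)"
    and equivariant: "\<And>\<sigma> N \<tau> M. \<sigma> permutes {1..N} \<Longrightarrow> (\<And>i. i \<in> S \<Longrightarrow> \<sigma> i = i) \<Longrightarrow>
      \<tau> permutes NN \<Longrightarrow> M \<in> structures L NN \<Longrightarrow> h \<tau> (relabel L NN \<sigma> M) = h (\<sigma> \<circ> \<tau>) M"
begin

sublocale finite_measure \<rho> by (rule finite_\<rho>)

abbreviation U :: "nat \<Rightarrow> struc \<Rightarrow> real" where
  "U n M \<equiv> perm_avg n (\<lambda>\<tau>. h \<tau> M)"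

lemma meas_h [measurable]: "\<tau> permutes NN \<Longrightarrow> h \<tau> \<in> borel_measurable \<rho>"
  using h_meas measurable_cong_sets[OF sets_\<rho> refl] by blast

lemma space_\<rho>: "space \<rho> = structures L NN"
  using sets_eq_imp_space_eq[OF sets_\<rho>] by simp

lemma meas_U [measurable]: "U n \<in> borel_measurable \<rho>"
  by (intro measurable_perm_avg meas_h permutes_NN)

lemma U_ge: "0 \<le> U n M" and U_le: "U n M \<le> 1"
  by (intro perm_avg_nonneg perm_avg_le h_ge h_le)+

lemma integrable_h: "\<tau> permutes NN \<Longrightarrow> integrable \<rho> (h \<tau>)"
  by (rule integrable_const_bound[of _ 1]) (auto simp: h_ge h_le)

lemma hh_bounds: "0 \<le> h \<tau> M * h \<tau>' M" "h \<tau> M * h \<tau>' M \<le> 1"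
  using h_ge h_le by (auto intro: mult_le_one)

lemma integrable_hh: "\<tau> permutes NN \<Longrightarrow> \<tau>' permutes NN \<Longrightarrow> integrable \<rho> (\<lambda>M. h \<tau> M * h \<tau>' M)"
  by (rule integrable_const_bound[of _ 1]) (use hh_bounds in \<open>auto simp: abs_of_nonneg\<close>)

lemma integral_invariant:
  assumes "\<sigma> permutes {1..N}" "\<And>i. i \<in> S \<Longrightarrow> \<sigma> i = i" "f \<in> borel_measurable (SB L)"
  shows "(\<integral>M. f (relabel L NN \<sigma> M) \<partial>\<rho>) = (\<integral>M. f M \<partial>\<rho> :: real)"
proof -
  have "relabel L NN \<sigma> \<in> measurable \<rho> (SB L)"
    using measurable_relabel[OF permutes_NN[OF assms(1)]] measurable_cong_sets[OF sets_\<rho> refl] by blast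
  then have "integral\<^sup>L (distr \<rho> (SB L) (relabel L NN \<sigma>)) f = (\<integral>M. f (relabel L NN \<sigma> M) \<partial>\<rho>)"
    using assms(3) by (rule integral_distr)
  then show ?thesis using invariant[OF assms(1,2)] by simp
qed

lemma h_aligned:
  assumes "\<And>i. i \<in> {1..m} \<Longrightarrow> \<sigma> (\<tau> i) = \<tau>' i" shows "h \<tau>' M = h (\<sigma> \<circ> \<tau>) M"
  by (rule depends_onD[OF dep]) (simp add: assms)

lemma integral_h_const:
  assumes \<tau>: "\<tau> permutes NN" "\<tau> ` {1..m} \<inter> S = {}" and \<tau>': "\<tau>' permutes NN" "\<tau>' ` {1..m} \<inter> S = {}"
  shows "(\<integral>M. h \<tau>' M \<partial>\<rho>) = (\<integral>M. h \<tau> M \<partial>\<rho>)"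
proof -
  have inj: "\<tau>' (inv \<tau> (\<tau> i)) = \<tau>' i" for i using permutes_inverses(2)[OF \<tau>(1)] by simp
  have 1: "\<tau> ` {1..m} \<subseteq> NN" "\<tau>' ` {1..m} \<subseteq> NN"
    using permutes_NN_image[OF \<tau>(1)] permutes_NN_image[OF \<tau>'(1)] by simp_all
  have im: "(\<tau>' \<circ> inv \<tau>) ` \<tau> ` {1..m} = \<tau>' ` {1..m}"
    unfolding image_image by (simp add: inj)
  have ij: "inj_on (\<tau>' \<circ> inv \<tau>) (\<tau> ` {1..m})"
    using permutes_inj[OF permutes_compose[OF permutes_inv[OF \<tau>(1)] \<tau>'(1)]] by (rule inj_on_subset) simp
  obtain \<sigma> N where \<sigma>: "\<sigma> permutes {1..N}" "\<And>i. i \<in> S \<Longrightarrow> \<sigma> i = i"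
      "\<And>x. x \<in> \<tau> ` {1..m} \<Longrightarrow> \<sigma> x = (\<tau>' \<circ> inv \<tau>) x"
    by (rule align_permutation[of "\<tau> ` {1..m}" S "\<tau>' \<circ> inv \<tau>"]) (use 1 \<tau>(2) \<tau>'(2) im ij in auto)
  have "(\<integral>M. h \<tau>' M \<partial>\<rho>) = (\<integral>M. h \<tau> (relabel L NN \<sigma> M) \<partial>\<rho>)"
  proof (rule Bochner_Integration.integral_cong[OF refl])
    fix M assume "M \<in> space \<rho>"
    then show "h \<tau>' M = h \<tau> (relabel L NN \<sigma> M)"
      using equivariant[OF \<sigma>(1,2) \<tau>(1)] h_aligned[of \<sigma> \<tau> \<tau>' M] \<sigma>(3) inj by (simp add: space_\<rho>)
  qed
  also have "\<dots> = (\<integral>M. h \<tau> M \<partial>\<rho>)" by (rule integral_invariant[OF \<sigma>(1,2) h_meas[OF \<tau>(1)]])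
  finally show ?thesis .
qed

text \<open>
  By \<open>integral_hh_const\<close>, all such pairs of samples have the same correlation.
\<close>

definition separated :: "(nat \<Rightarrow> nat) \<Rightarrow> (nat \<Rightarrow> nat) \<Rightarrow> bool" where
  "separated \<tau> \<tau>' \<longleftrightarrow> \<tau> permutes NN \<and> \<tau>' permutes NN \<and> \<tau> ` {1..m} \<inter> S = {} \<and> \<tau>' ` {1..m} \<inter> S = {}
    \<and> \<tau> ` {1..m} \<inter> \<tau>' ` {1..m} = {}"

lemma integral_hh_const:
  assumes "separated \<tau> \<tau>'" "separated \<pi> \<pi>'"
  shows "(\<integral>M. h \<pi> M * h \<pi>' M \<partial>\<rho>) = (\<integral>M. h \<tau> M * h \<tau>' M \<partial>\<rho>)"
proof -
  from assms have p: "\<tau> permutes NN" "\<tau>' permutes NN" "\<pi> permutes NN" "\<pi>' permutes NN"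
    and d: "\<tau> ` {1..m} \<inter> S = {}" "\<tau>' ` {1..m} \<inter> S = {}" "\<pi> ` {1..m} \<inter> S = {}" "\<pi>' ` {1..m} \<inter> S = {}"
      "\<tau> ` {1..m} \<inter> \<tau>' ` {1..m} = {}" "\<pi> ` {1..m} \<inter> \<pi>' ` {1..m} = {}"
    by (auto simp: separated_def)
  define \<phi> where "\<phi> x = (if x \<in> \<tau> ` {1..m} then \<pi> (inv \<tau> x) else \<pi>' (inv \<tau>' x))" for x
  have \<phi>1: "\<phi> (\<tau> i) = \<pi> i" if "i \<in> {1..m}" for i
    using that permutes_inverses(2)[OF p(1)] by (simp add: \<phi>_def)
  have \<phi>2: "\<phi> (\<tau>' i) = \<pi>' i" if "i \<in> {1..m}" for i
  proof -
    have "\<tau>' i \<notin> \<tau> ` {1..m}" using that d(5) by blast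
    then show ?thesis using permutes_inverses(2)[OF p(2)] by (simp add: \<phi>_def)
  qed
  let ?T = "\<tau> ` {1..m} \<union> \<tau>' ` {1..m}"
  have im: "\<phi> ` ?T = \<pi> ` {1..m} \<union> \<pi>' ` {1..m}"
    unfolding image_Un image_image using \<phi>1 \<phi>2 by (intro arg_cong2[where f = "(\<union>)"] image_cong) auto
  have "card (\<phi> ` ?T) = card ?T"
  proof -
    have "card (f ` {1..m}) = m" if "f permutes NN" for f
      using card_image[OF permutes_inj_on[OF that], of "{1..m}"] by simp
    then show ?thesis unfolding im using d(5,6) p by (simp add: card_Un_disjoint)
  qed
  then have ij: "inj_on \<phi> ?T" by (intro eq_card_imp_inj_on) auto
  have sub: "f ` {1..m} \<subseteq> NN" if "f permutes NN" for f by (rule permutes_NN_image[OF that]) auto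
  obtain \<sigma> N where \<sigma>: "\<sigma> permutes {1..N}" "\<And>i. i \<in> S \<Longrightarrow> \<sigma> i = i" "\<And>x. x \<in> ?T \<Longrightarrow> \<sigma> x = \<phi> x"
    by (rule align_permutation[of ?T S \<phi>]) (use d sub[OF p(1)] sub[OF p(2)] sub[OF p(3)] sub[OF p(4)] in \<open>simp_all only: im ij, auto\<close>)
  have "(\<integral>M. h \<pi> M * h \<pi>' M \<partial>\<rho>) = (\<integral>M. h \<tau> (relabel L NN \<sigma> M) * h \<tau>' (relabel L NN \<sigma> M) \<partial>\<rho>)"
  proof (rule Bochner_Integration.integral_cong[OF refl])
    fix M assume "M \<in> space \<rho>"
    then show "h \<pi> M * h \<pi>' M = h \<tau> (relabel L NN \<sigma> M) * h \<tau>' (relabel L NN \<sigma> M)"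
      using equivariant[OF \<sigma>(1,2)] p h_aligned[of \<sigma> \<tau> \<pi> M] h_aligned[of \<sigma> \<tau>' \<pi>' M] \<sigma>(3) \<phi>1 \<phi>2
      by (simp add: space_\<rho>)
  qed
  also have "\<dots> = (\<integral>M. h \<tau> M * h \<tau>' M \<partial>\<rho>)"
    by (rule integral_invariant[OF \<sigma>(1,2)]) (simp_all add: \<sigma>(2) borel_measurable_times h_meas p)
  finally show ?thesis .
qed

abbreviation (input) K :: real where "K \<equiv> real m * (real (card S) + real m)"
abbreviation (input) c :: real where "c \<equiv> measure \<rho> (space \<rho>)"

lemma integral_hh_bounds:
  assumes "\<tau> permutes NN" "\<tau>' permutes NN"
  shows "0 \<le> (\<integral>M. h \<tau> M * h \<tau>' M \<partial>\<rho>)" "(\<integral>M. h \<tau> M * h \<tau>' M \<partial>\<rho>) \<le> c"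
proof -
  show "0 \<le> (\<integral>M. h \<tau> M * h \<tau>' M \<partial>\<rho>)" by (rule Bochner_Integration.integral_nonneg) (rule hh_bounds)
  have "(\<integral>M. h \<tau> M * h \<tau>' M \<partial>\<rho>) \<le> (\<integral>M. 1 \<partial>\<rho>)"
    by (rule integral_mono[OF integrable_hh[OF assms]]) (auto intro: hh_bounds)
  then show "(\<integral>M. h \<tau> M * h \<tau>' M \<partial>\<rho>) \<le> c" by simp
qed

lemma integral_UU_eq:
  "(\<integral>M. U n M * U N M \<partial>\<rho>) = perm_avg n (\<lambda>\<tau>. perm_avg N (\<lambda>\<tau>'. \<integral>M. h \<tau> M * h \<tau>' M \<partial>\<rho>))"
proof -
  have "U n M * U N M = perm_avg n (\<lambda>\<tau>. perm_avg N (\<lambda>\<tau>'. h \<tau> M * h \<tau>' M))" for M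
    by (simp add: perm_avg_cmult perm_avg_multc)
  then have "(\<integral>M. U n M * U N M \<partial>\<rho>) = (\<integral>M. perm_avg n (\<lambda>\<tau>. perm_avg N (\<lambda>\<tau>'. h \<tau> M * h \<tau>' M)) \<partial>\<rho>)"
    by simp
  also have "\<dots> = perm_avg n (\<lambda>\<tau>. \<integral>M. perm_avg N (\<lambda>\<tau>'. h \<tau> M * h \<tau>' M) \<partial>\<rho>)"
    by (intro integrable_perm_avg integrable_hh permutes_NN)
  also have "\<dots> = perm_avg n (\<lambda>\<tau>. perm_avg N (\<lambda>\<tau>'. \<integral>M. h \<tau> M * h \<tau>' M \<partial>\<rho>))"
    by (intro perm_avg_cong integrable_perm_avg integrable_hh permutes_NN)
  finally show ?thesis .
qed

text \<open>
  Two independent samples are disjoint and avoid \<open>S\<close> up to probability \<open>O(1/n)\<close>, so their correlation is almost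
  the common value for separated pairs.
\<close>

lemma correlation_bound:
  assumes \<gamma>: "\<And>\<tau> \<tau>'. separated \<tau> \<tau>' \<Longrightarrow> (\<integral>M. h \<tau> M * h \<tau>' M \<partial>\<rho>) = \<gamma>" and \<gamma>b: "0 \<le> \<gamma>" "\<gamma> \<le> c"
    and n: "1 \<le> n" "n \<le> N"
  shows "\<bar>(\<integral>M. U n M * U N M \<partial>\<rho>) - \<gamma>\<bar> \<le> 2 * c * K / n"
proof -
  let ?k = "\<lambda>\<tau> \<tau>'. \<integral>M. h \<tau> M * h \<tau>' M \<partial>\<rho>"
  let ?F = "\<lambda>\<tau>. perm_avg N (\<lambda>\<tau>'. ?k \<tau> \<tau>')"
  have kb: "\<bar>?k \<tau> \<tau>' - \<gamma>\<bar> \<le> c" if "\<tau> permutes NN" "\<tau>' permutes NN" for \<tau> \<tau>'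
    using integral_hh_bounds[OF that] \<gamma>b by linarith
  have Fb: "\<bar>?F \<tau> - \<gamma>\<bar> \<le> c * of_bool (\<tau> ` {1..m} \<inter> S \<noteq> {}) + c * K / n" if \<tau>: "\<tau> permutes {1..n}" for \<tau>
  proof (cases "\<tau> ` {1..m} \<inter> S = {}")
    case True
    have "\<bar>?F \<tau> - perm_avg N (\<lambda>_. \<gamma>)\<bar> \<le> c * (m * card (S \<union> \<tau> ` {1..m}) / N)"
    proof (rule perm_avg_close)
      fix \<tau>' assume \<tau>': "\<tau>' permutes {1..N}"
      show "\<bar>?k \<tau> \<tau>' - \<gamma>\<bar> \<le> c" by (rule kb[OF permutes_NN[OF \<tau>] permutes_NN[OF \<tau>']])
      assume "\<tau>' ` {1..m} \<inter> (S \<union> \<tau> ` {1..m}) = {}"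
      then show "?k \<tau> \<tau>' = \<gamma>"
        using True permutes_NN[OF \<tau>] permutes_NN[OF \<tau>'] by (intro \<gamma>) (auto simp: separated_def)
    qed (use finite_S n in auto)
    also have "\<dots> \<le> c * (K / n)"
    proof (intro mult_left_mono)
      have "card (S \<union> \<tau> ` {1..m}) \<le> card S + m"
        using card_Un_le[of S "\<tau> ` {1..m}"] card_image_le[of "{1..m}" \<tau>] by simp
      then have "real (m * card (S \<union> \<tau> ` {1..m})) \<le> K"
        unfolding of_nat_mult of_nat_add[symmetric] by (intro mult_left_mono) auto
      then show "m * card (S \<union> \<tau> ` {1..m}) / N \<le> K / n"
        using n by (intro frac_le) auto
    qed simp
    finally show ?thesis using True by simp
  next
    case False
    have "\<bar>?F \<tau> - perm_avg N (\<lambda>_. \<gamma>)\<bar> \<le> perm_avg N (\<lambda>\<tau>'. \<bar>?k \<tau> \<tau>' - \<gamma>\<bar>)"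
      unfolding perm_avg_diff[symmetric] by (rule perm_avg_abs)
    also have "\<dots> \<le> c" by (rule perm_avg_le) (rule kb[OF permutes_NN[OF \<tau>] permutes_NN])
    finally have "\<bar>?F \<tau> - \<gamma>\<bar> \<le> c" by simp
    moreover have "0 \<le> c * K / n" by simp
    ultimately have "\<bar>?F \<tau> - \<gamma>\<bar> \<le> c + c * K / n" by linarith
    then show ?thesis using False by simp
  qed
  have "\<bar>perm_avg n ?F - perm_avg n (\<lambda>_. \<gamma>)\<bar> \<le> perm_avg n (\<lambda>\<tau>. \<bar>?F \<tau> - \<gamma>\<bar>)"
    unfolding perm_avg_diff[symmetric] by (rule perm_avg_abs)
  also have "\<dots> \<le> perm_avg n (\<lambda>\<tau>. c * of_bool (\<tau> ` {1..m} \<inter> S \<noteq> {}) + c * K / n)"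
    by (rule perm_avg_mono) (rule Fb)
  also have "\<dots> = c * perm_avg n (\<lambda>\<tau>. of_bool (\<tau> ` {1..m} \<inter> S \<noteq> {})) + c * K / n"
    by (simp only: perm_avg_add perm_avg_cmult perm_avg_const)
  also have "perm_avg n (\<lambda>\<tau>. of_bool (\<tau> ` {1..m} \<inter> S \<noteq> {})) \<le> m * card S / n"
    by (rule perm_avg_hit_le[OF finite_S n(1)])
  also have "m * card S / n \<le> K / n" by (intro divide_right_mono) (auto simp: algebra_simps)
  finally have "\<bar>perm_avg n ?F - \<gamma>\<bar> \<le> c * (K / n) + c * K / n"
    by (simp add: mult_left_mono)
  then show ?thesis unfolding integral_UU_eq by (simp add: field_simps)
qed

lemma integrable_UU: "integrable \<rho> (\<lambda>M. U n M * U N M)"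
proof (rule integrable_const_bound[of _ 1])
  have "norm (U n M * U N M) \<le> 1" for M
    using mult_le_one[OF U_le U_ge U_le] U_ge by (simp add: abs_mult abs_of_nonneg)
  then show "AE M in \<rho>. norm (U n M * U N M) \<le> 1" by simp
qed measurable

text \<open>
  The correlations of \<open>U n\<close> and \<open>U N\<close> are all close to the same \<open>\<gamma>\<close>, hence \<open>U n - U N\<close> has second moment
  \<open>O(1/n)\<close>.
\<close>

theorem AE_convergent: "AE M in \<rho>. convergent (\<lambda>n. U n M)"
proof -
  obtain \<gamma> where \<gamma>: "\<And>\<tau> \<tau>'. separated \<tau> \<tau>' \<Longrightarrow> (\<integral>M. h \<tau> M * h \<tau>' M \<partial>\<rho>) = \<gamma>" "0 \<le> \<gamma>" "\<gamma> \<le> c"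
  proof (cases "\<exists>\<tau> \<tau>'. separated \<tau> \<tau>'")
    case True
    then obtain \<tau> \<tau>' where g: "separated \<tau> \<tau>'" by blast
    then have p: "\<tau> permutes NN" "\<tau>' permutes NN" by (simp_all add: separated_def)
    show ?thesis
      by (rule that[of "\<integral>M. h \<tau> M * h \<tau>' M \<partial>\<rho>", OF integral_hh_const[OF g] integral_hh_bounds[OF p]])
  next
    case False
    show ?thesis by (rule that[of 0]) (use False in auto)
  qed
  show ?thesis
  proof (rule AE_convergent_of_variance[where C = "8 * c * K" and m = m, OF finite_\<rho> meas_U])
    show "0 \<le> U n M" "U n M \<le> 1" for n M by (rule U_ge, rule U_le)
    show "\<bar>U (n + d) M - U n M\<bar> \<le> real m * real d / real n" if "m \<le> n" "0 < n" for M n d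
      by (rule perm_avg_interpolate[OF dep h_ge h_le that])
    fix n N :: nat assume n: "1 \<le> n" "n \<le> N"
    have e: "(U n M - U N M)\<^sup>2 = U n M * U n M - 2 * (U n M * U N M) + U N M * U N M" for M
      by (simp add: power2_eq_square algebra_simps)
    have "(\<integral>M. (U n M - U N M)\<^sup>2 \<partial>\<rho>) =
      (\<integral>M. U n M * U n M \<partial>\<rho>) - 2 * (\<integral>M. U n M * U N M \<partial>\<rho>) + (\<integral>M. U N M * U N M \<partial>\<rho>)"
      unfolding e using integrable_UU by simp
    also have "\<dots> \<le> (\<gamma> + 2 * c * K / n) - 2 * (\<gamma> - 2 * c * K / n) + (\<gamma> + 2 * c * K / n)"
    proof -
      have "2 * c * K / N \<le> 2 * c * K / n" using n by (intro divide_left_mono) auto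
      moreover have cb: "\<gamma> - 2 * c * K / a \<le> (\<integral>M. U a M * U b M \<partial>\<rho>)"
        "(\<integral>M. U a M * U b M \<partial>\<rho>) \<le> \<gamma> + 2 * c * K / a" if "1 \<le> a" "a \<le> b" for a b
      proof -
        have "\<bar>(\<integral>M. U a M * U b M \<partial>\<rho>) - \<gamma>\<bar> \<le> 2 * c * K / a"
          by (rule correlation_bound[of \<gamma> a b]) (use \<gamma> that in blast)+
        then show "\<gamma> - 2 * c * K / a \<le> (\<integral>M. U a M * U b M \<partial>\<rho>)"
          "(\<integral>M. U a M * U b M \<partial>\<rho>) \<le> \<gamma> + 2 * c * K / a"
          unfolding abs_le_iff by linarith+
      qed
      ultimately show ?thesis
        using cb(2)[OF n(1) order_refl] cb(1)[OF n] cb(2)[OF order_trans[OF n] order_refl] by argo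
    qed
    finally show "(\<integral>M. (U n M - U N M)\<^sup>2 \<partial>\<rho>) \<le> 8 * c * K / n" by (simp add: field_simps)
  qed
qed

lemma integral_U_tendsto:
  assumes \<tau>: "\<tau> permutes NN" "\<tau> ` {1..m} \<inter> S = {}"
  shows "(\<lambda>n. \<integral>M. U n M \<partial>\<rho>) \<longlonglongrightarrow> (\<integral>M. h \<tau> M \<partial>\<rho>)"
proof -
  have b: "0 \<le> (\<integral>M. h \<pi> M \<partial>\<rho>)" "(\<integral>M. h \<pi> M \<partial>\<rho>) \<le> c" if "\<pi> permutes NN" for \<pi>
  proof -
    show "0 \<le> (\<integral>M. h \<pi> M \<partial>\<rho>)" by (rule Bochner_Integration.integral_nonneg) (rule h_ge)
    have "(\<integral>M. h \<pi> M \<partial>\<rho>) \<le> (\<integral>M. 1 \<partial>\<rho>)"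
      by (rule integral_mono[OF integrable_h[OF that]]) (auto intro: h_le)
    then show "(\<integral>M. h \<pi> M \<partial>\<rho>) \<le> c" by simp
  qed
  have "(\<lambda>n. (\<integral>M. U n M \<partial>\<rho>) - (\<integral>M. h \<tau> M \<partial>\<rho>)) \<longlonglongrightarrow> 0"
  proof (rule Lim_null_comparison)
    show "\<forall>\<^sub>F n in sequentially. norm ((\<integral>M. U n M \<partial>\<rho>) - (\<integral>M. h \<tau> M \<partial>\<rho>)) \<le> (c * (m * card S)) / n"
      using eventually_ge_at_top[of 1]
    proof eventually_elim
      case (elim n)
      have "\<bar>perm_avg n (\<lambda>\<pi>. \<integral>M. h \<pi> M \<partial>\<rho>) - perm_avg n (\<lambda>_. \<integral>M. h \<tau> M \<partial>\<rho>)\<bar> \<le> c * (m * card S / n)"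
      proof (rule perm_avg_close[OF finite_S elim])
        fix \<pi> assume \<pi>: "\<pi> permutes {1..n}"
        show "\<bar>(\<integral>M. h \<pi> M \<partial>\<rho>) - (\<integral>M. h \<tau> M \<partial>\<rho>)\<bar> \<le> c"
          using b[OF permutes_NN[OF \<pi>]] b[OF \<tau>(1)] by linarith
        assume "\<pi> ` {1..m} \<inter> S = {}"
        then show "(\<integral>M. h \<pi> M \<partial>\<rho>) = (\<integral>M. h \<tau> M \<partial>\<rho>)"
          by (rule integral_h_const[OF \<tau> permutes_NN[OF \<pi>]])
      qed
      moreover have "(\<integral>M. U n M \<partial>\<rho>) = perm_avg n (\<lambda>\<pi>. \<integral>M. h \<pi> M \<partial>\<rho>)"
        by (intro integrable_perm_avg integrable_h permutes_NN)
      ultimately show ?case by simp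
    qed
    show "(\<lambda>n. (c * (m * card S)) / real n) \<longlonglongrightarrow> 0" by (rule lim_const_over_n)
  qed
  then show ?thesis by (simp add: LIM_zero_iff)
qed

text \<open>
  The probability of a pattern at fixed labels outside \<open>S\<close> is its mean density.  It plays the part of
  de Finetti's theorem in the decomposition.
\<close>

theorem integral_h_eq_limit:
  assumes \<tau>: "\<tau> permutes NN" "\<tau> ` {1..m} \<inter> S = {}"
    and u: "u \<in> borel_measurable \<rho>" "AE M in \<rho>. (\<lambda>n. U n M) \<longlonglongrightarrow> u M"
  shows "(\<integral>M. h \<tau> M \<partial>\<rho>) = (\<integral>M. u M \<partial>\<rho>)"
proof (rule LIMSEQ_unique[OF integral_U_tendsto[OF \<tau>]])
  show "(\<lambda>n. \<integral>M. U n M \<partial>\<rho>) \<longlonglongrightarrow> (\<integral>M. u M \<partial>\<rho>)"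
    by (rule integral_dominated_convergence[of _ _ _ "\<lambda>_. 1"])
       (use u U_ge U_le in \<open>auto simp: abs_of_nonneg\<close>)
qed

end

section \<open>Prescribed entries with positive density\<close>

text \<open>
  The relation \<open>j\<close> of \<open>M\<^sup>*\<^sub>s\<close>, encoded and sampled at the labels \<open>\<tau> 1, \<dots>, \<tau> m\<close>, is nonempty; compare
  \<open>encoded_nonzero_iff_hit\<close>.  No word or filling occurs in this form.
\<close>

definition hit :: "nat multiset \<Rightarrow> nat \<Rightarrow> nat \<Rightarrow> (nat \<Rightarrow> nat) \<Rightarrow> struc \<Rightarrow> bool" where
  "hit s j m \<tau> M \<longleftrightarrow> (\<exists>a\<in>M ! j. s \<subseteq># mset a \<and> set_mset (mset a - s) \<subseteq> \<tau> ` {1..m})"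

lemma depends_on_hit: "depends_on m (\<lambda>\<tau>. of_bool (hit s j m \<tau> M) :: real)"
  unfolding depends_on_def
proof (intro allI impI)
  fix \<tau> \<tau>' :: "nat \<Rightarrow> nat" assume "\<forall>i\<in>{1..m}. \<tau> i = \<tau>' i"
  then have "\<tau> ` {1..m} = \<tau>' ` {1..m}" by (intro image_cong) auto
  then show "of_bool (hit s j m \<tau> M) = (of_bool (hit s j m \<tau>' M) :: real)" by (simp add: hit_def)
qed

lemma fin_det_hit:
  assumes j: "j < length L" shows "fin_det L (hit s j m \<tau>)"
proof (rule fin_det_cong)
  let ?F = "{a. set a \<subseteq> set_mset s \<union> \<tau> ` {1..m} \<and> length a = L ! j}"
  let ?c = "\<lambda>a. s \<subseteq># mset a \<and> set_mset (mset a - s) \<subseteq> \<tau> ` {1..m}"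
  show "fin_det L (\<lambda>M. \<exists>a\<in>?F. a \<in> M ! j \<and> ?c a)"
  proof (rule fin_det_bex)
    show "finite ?F" by (rule finite_lists_length_eq) simp
    show "fin_det L (\<lambda>M. a \<in> M ! j \<and> ?c a)" for a
      by (rule fin_det_conj[OF fin_det_mem[OF j] fin_det_const])
  qed
  fix M assume M: "M \<in> structures L NN"
  show "(\<exists>a\<in>?F. a \<in> M ! j \<and> ?c a) \<longleftrightarrow> hit s j m \<tau> M"
  proof
    assume "hit s j m \<tau> M"
    then obtain a where a: "a \<in> M ! j" "s \<subseteq># mset a" "set_mset (mset a - s) \<subseteq> \<tau> ` {1..m}"
      unfolding hit_def by blast
    have "length a = L ! j" using nth_structures[OF M j] a(1) by (auto simp: tuples_def)
    moreover have "set a \<subseteq> set_mset s \<union> \<tau> ` {1..m}"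
    proof -
      have "mset a = s + (mset a - s)" using a(2) by simp
      then have "set_mset (mset a) = set_mset s \<union> set_mset (mset a - s)" by (metis set_mset_union)
      then show ?thesis using a(3) by auto
    qed
    ultimately show "\<exists>a\<in>?F. a \<in> M ! j \<and> ?c a" using a by blast
  qed (auto simp: hit_def)
qed

lemma hit_relabel_imp:
  assumes \<sigma>: "\<sigma> permutes NN" and j: "j < length L" and h: "hit s j m \<tau> (relabel L NN \<sigma> M)"
  shows "hit (image_mset \<sigma> s) j m (\<sigma> \<circ> \<tau>) M"
proof -
  from h j obtain a where a: "map \<sigma> a \<in> M ! j" "s \<subseteq># mset a" "set_mset (mset a - s) \<subseteq> \<tau> ` {1..m}"
    unfolding hit_def by auto
  have "mset (map \<sigma> a) - image_mset \<sigma> s = image_mset \<sigma> (mset a - s)"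
    using image_mset_Diff[OF a(2), of \<sigma>] by simp
  then have "set_mset (mset (map \<sigma> a) - image_mset \<sigma> s) \<subseteq> (\<sigma> \<circ> \<tau>) ` {1..m}"
    using a(3) by (auto simp: image_comp[symmetric])
  moreover have "image_mset \<sigma> s \<subseteq># mset (map \<sigma> a)"
    using image_mset_subseteq_mono[OF a(2)] by simp
  ultimately show ?thesis using a(1) unfolding hit_def by blast
qed

lemma hit_relabel:
  assumes \<sigma>: "\<sigma> permutes NN" and j: "j < length L" and M: "M \<in> structures L NN"
  shows "hit s j m \<tau> (relabel L NN \<sigma> M) \<longleftrightarrow> hit (image_mset \<sigma> s) j m (\<sigma> \<circ> \<tau>) M"
proof
  assume h: "hit (image_mset \<sigma> s) j m (\<sigma> \<circ> \<tau>) M"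
  have "M = relabel L NN (inv \<sigma>) (relabel L NN \<sigma> M)"
    using relabel_perm_relabel[OF permutes_inv[OF \<sigma>], of L \<sigma> M] relabel_id[OF M]
      permutes_inv_o(1)[OF \<sigma>] by simp
  with h have "hit (image_mset \<sigma> s) j m (\<sigma> \<circ> \<tau>) (relabel L NN (inv \<sigma>) (relabel L NN \<sigma> M))" by simp
  from hit_relabel_imp[OF permutes_inv[OF \<sigma>] j this]
  have "hit (image_mset (inv \<sigma>) (image_mset \<sigma> s)) j m (inv \<sigma> \<circ> (\<sigma> \<circ> \<tau>)) (relabel L NN \<sigma> M)" .
  moreover have "inv \<sigma> \<circ> (\<sigma> \<circ> \<tau>) = \<tau>" by (simp add: comp_assoc[symmetric] permutes_inv_o(2)[OF \<sigma>])
  moreover have "image_mset (inv \<sigma>) (image_mset \<sigma> s) = s"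
    by (simp add: multiset.map_comp permutes_inv_o(2)[OF \<sigma>])
  ultimately show "hit s j m \<tau> (relabel L NN \<sigma> M)" by simp
qed (rule hit_relabel_imp[OF \<sigma> j])

lemma mset_fill:
  "length b = length (filter (\<lambda>x. x = None) w) \<Longrightarrow>
   mset (fill w b) = mset (map the (filter (\<lambda>x. x \<noteq> None) w)) + mset b"
proof (induction w arbitrary: b)
  case (Cons x w)
  show ?case
  proof (cases x)
    case None
    then obtain y b' where "b = y # b'" using Cons.prems by (cases b) auto
    then show ?thesis using Cons None by simp
  qed (use Cons in simp)
qed simp

lemma words_facts:
  assumes "w \<in> words s i"
  shows "length (filter (\<lambda>x. x = None) w) = i - size s" "mset (map the (filter (\<lambda>x. x \<noteq> None) w)) = s"
proof -
  have w: "mset w = image_mset Some s + replicate_mset (i - size s) None" using assms by (simp add: words_def)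
  have "length (filter (\<lambda>x. x = None) w) = size (filter_mset (\<lambda>x. x = None) (mset w))"
    by (metis mset_filter size_mset)
  also have "filter_mset (\<lambda>x. x = None) (mset w) = replicate_mset (i - size s) None"
    unfolding w by (simp add: filter_mset_image_mset filter_mset_eq_conv)
  finally show "length (filter (\<lambda>x. x = None) w) = i - size s" by simp
  have "filter_mset (\<lambda>x. x \<noteq> None) (mset w) = image_mset Some s"
    unfolding w by (simp add: filter_mset_image_mset filter_mset_eq_conv)
  then show "mset (map the (filter (\<lambda>x. x \<noteq> None) w)) = s"
    by (simp add: multiset.map_comp comp_def)
qed

text \<open>
  Conversely to \<open>mset_fill\<close>, every tuple whose entries include \<open>s\<close> arises from filling a word.
\<close>

lemma ex_fill:
  "s \<subseteq># mset a \<Longrightarrow> \<exists>w b. a = fill w b \<and> w \<in> words s (length a) \<and> mset b = mset a - s"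
proof (induction a arbitrary: s)
  case Nil then show ?case by (intro exI[of _ "[]"]) (simp add: words_def)
next
  case (Cons x a)
  show ?case
  proof (cases "x \<in># s")
    case True
    define s' where "s' = s - {#x#}"
    have s: "s = add_mset x s'" using True by (simp add: s'_def)
    then have "s' \<subseteq># mset a" using Cons.prems by simp
    from Cons.IH[OF this] obtain w b where w: "a = fill w b" "w \<in> words s' (length a)" "mset b = mset a - s'"
      by blast
    show ?thesis
      by (rule exI[of _ "Some x # w"], rule exI[of _ b]) (use w s in \<open>simp add: words_def\<close>)
  next
    case False
    then have sub: "s \<subseteq># mset a" using Cons.prems by (simp add: subset_mset.add_increasing insert_subset_eq_iff subseteq_mset_def)
       (metis not_in_iff le0 nat_less_le)
    from Cons.IH[OF sub] obtain w b where w: "a = fill w b" "w \<in> words s (length a)" "mset b = mset a - s"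
      by blast
    have "size s \<le> length a" using size_mset_mono[OF sub] by simp
    then have "Suc (length a) - size s = Suc (length a - size s)" by simp
    then show ?thesis
      by (intro exI[of _ "None # w"] exI[of _ "x # b"]) (use w False sub in \<open>simp add: words_def multiset_diff_union_assoc\<close>)
  qed
qed

lemma finite_words: "finite (words s i)"
proof (rule finite_subset)
  let ?X = "image_mset Some s + replicate_mset (i - size s) None"
  show "words s i \<subseteq> {w. set w \<subseteq> set_mset ?X \<and> length w = size ?X}"
    unfolding words_def by (auto simp del: set_mset_union size_union) (metis set_mset_mset, metis size_mset)
qed (rule finite_lists_length_eq, simp)

lemma set_word_list: "set (word_list s i) = words s i"
proof -
  have "\<exists>ws. distinct ws \<and> set ws = words s i" using finite_distinct_list[OF finite_words] by blast
  from someI_ex[OF this] show ?thesis by (simp add: word_list_def)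
qed

lemma length_encoded_sub: "length (encoded_sub L s M j) = length (encode_sig s (L ! j))"
  by (simp add: encoded_sub_def encode_rel_def encode_sig_def)

lemma substruct_mem_iff:
  assumes M: "M \<in> structures L NN" and j: "j < length L" and s: "s \<subseteq># mset a"
  shows "a \<in> substruct s M ! j \<longleftrightarrow> a \<in> M ! j"
proof -
  have "size s \<le> length a" using size_mset_mono[OF s] by simp
  moreover have "mset a = s" if "length a = size s"
    using that s by (metis mset_subset_size order_less_irrefl size_mset subset_mset.le_imp_less_or_eq)
  ultimately have "(length a \<le> size s \<and> mset a \<subseteq># s \<and> set a = set_mset s) \<or> (length a > size s \<and> s \<subseteq># mset a)"
    using s by (cases "length a = size s") (auto simp flip: set_mset_mset)
  then show ?thesis using j length_structures[OF M] by (simp add: substruct_def)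
qed

lemma encoded_mem:
  assumes l: "l < length (word_list s (L ! j))" and b: "b \<in> tuples NN (L ! j - size s)"
    and M: "M \<in> structures L NN" and j: "j < length L"
  shows "b \<in> encoded_sub L s M j ! l \<longleftrightarrow> fill (word_list s (L ! j) ! l) b \<in> M ! j"
    and "mset (fill (word_list s (L ! j) ! l) b) = s + mset b"
proof -
  let ?w = "word_list s (L ! j) ! l"
  have w: "?w \<in> words s (L ! j)" using l set_word_list nth_mem by blast
  show m: "mset (fill ?w b) = s + mset b"
    using mset_fill[of b ?w] words_facts[OF w] b by (simp add: tuples_def)
  then have "s \<subseteq># mset (fill ?w b)" by simp
  from substruct_mem_iff[OF M j this] show "b \<in> encoded_sub L s M j ! l \<longleftrightarrow> fill ?w b \<in> M ! j"
    using b l by (simp add: encoded_sub_def encode_rel_def)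
qed

lemma encoded_nonzero_iff_hit:
  assumes M: "M \<in> structures L NN" and j: "j < length L" and \<tau>: "\<tau> permutes NN"
  shows "relabel (encode_sig s (L ! j)) {1..m} \<tau> (encoded_sub L s M j) \<noteq> zero_struct (encode_sig s (L ! j))
    \<longleftrightarrow> hit s j m \<tau> M"
proof -
  let ?L = "encode_sig s (L ! j)" and ?k = "L ! j - size s" and ?ws = "word_list s (L ! j)"
  have len: "length ?L = length ?ws" "\<And>l. l < length ?ws \<Longrightarrow> ?L ! l = ?k"
    by (simp_all add: encode_sig_def)
  have tup: "map \<tau> b \<in> tuples NN ?k" if "b \<in> tuples {1..m} ?k" for b
  proof -
    have "\<tau> ` set b \<subseteq> NN" by (rule permutes_NN_image[OF \<tau>]) (use that in \<open>auto simp: tuples_def\<close>)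
    then show ?thesis using that by (simp add: tuples_def)
  qed
  have "relabel ?L {1..m} \<tau> (encoded_sub L s M j) \<noteq> zero_struct ?L \<longleftrightarrow>
    (\<exists>l<length ?ws. \<exists>b\<in>tuples {1..m} ?k. map \<tau> b \<in> encoded_sub L s M j ! l)"
    by (subst eq_zero_iff) (auto simp: len)
  also have "\<dots> \<longleftrightarrow> (\<exists>l<length ?ws. \<exists>b\<in>tuples {1..m} ?k. fill (?ws ! l) (map \<tau> b) \<in> M ! j)"
    using encoded_mem(1)[OF _ tup M j] by blast
  also have "\<dots> \<longleftrightarrow> hit s j m \<tau> M"
  proof
    assume "\<exists>l<length ?ws. \<exists>b\<in>tuples {1..m} ?k. fill (?ws ! l) (map \<tau> b) \<in> M ! j"
    then obtain l b where l: "l < length ?ws" and b: "b \<in> tuples {1..m} ?k" and f: "fill (?ws ! l) (map \<tau> b) \<in> M ! j"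
      by blast
    have "mset (fill (?ws ! l) (map \<tau> b)) = s + mset (map \<tau> b)" by (rule encoded_mem(2)[OF l tup[OF b] M j])
    then have "s \<subseteq># mset (fill (?ws ! l) (map \<tau> b))"
      "set_mset (mset (fill (?ws ! l) (map \<tau> b)) - s) \<subseteq> \<tau> ` {1..m}"
      using b by (auto simp: tuples_def)
    then show "hit s j m \<tau> M" using f unfolding hit_def by blast
  next
    assume "hit s j m \<tau> M"
    then obtain a where a: "a \<in> M ! j" "s \<subseteq># mset a" "set_mset (mset a - s) \<subseteq> \<tau> ` {1..m}"
      unfolding hit_def by blast
    have la: "length a = L ! j" using nth_structures[OF M j] a(1) by (auto simp: tuples_def)
    obtain w c where w: "a = fill w c" "w \<in> words s (L ! j)" "mset c = mset a - s"
      using ex_fill[OF a(2)] la by auto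
    define b where "b = map (inv_into {1..m} \<tau>) c"
    have c: "set c \<subseteq> \<tau> ` {1..m}" using a(3) w(3) by (metis set_mset_mset)
    have "map \<tau> b = c"
      unfolding b_def map_map comp_def by (rule map_idI) (use c in \<open>auto intro!: f_inv_into_f\<close>)
    moreover have "b \<in> tuples {1..m} ?k"
    proof -
      have "length c = ?k" using w(3) la a(2) by (metis size_Diff_submset size_mset)
      moreover have "set b \<subseteq> {1..m}" unfolding b_def using c inv_into_into[of _ \<tau> "{1..m}"] by auto
      ultimately show ?thesis by (simp add: tuples_def b_def)
    qed
    moreover obtain l where "l < length ?ws" "?ws ! l = w"
      using w(2) set_word_list by (metis in_set_conv_nth)
    ultimately show "\<exists>l<length ?ws. \<exists>b\<in>tuples {1..m} ?k. fill (?ws ! l) (map \<tau> b) \<in> M ! j"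
      using a(1) w(1) by blast
  qed
  finally show ?thesis .
qed

text \<open>
  The condition \<open>\<parallel>M\<parallel>\<^sub>s \<noteq> 0\<close>, in a form that makes sense for all \<open>M\<close> and transforms well under relabelling.  For
  \<open>j\<close> with \<open>L ! j < size s\<close> nothing is ever hit, in accordance with the convention that such components count
  as zero.
\<close>

definition dense :: "nat list \<Rightarrow> nat multiset \<Rightarrow> struc \<Rightarrow> bool" where
  "dense L s M \<longleftrightarrow> (\<exists>j<length L. \<exists>m. \<not> (\<lambda>n. perm_avg n (\<lambda>\<tau>. of_bool (hit s j m \<tau> M))) \<longlonglongrightarrow> 0)"

lemma sub_limit_zero_iff:
  assumes M: "M \<in> structures L NN" and ex: "sub_limit_exists L s M"
  shows "sub_limit_zero L s M \<longleftrightarrow> \<not> dense L s M"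
proof -
  have "comb_limit (encode_sig s (L ! j)) (encoded_sub L s M j) = zero_limit (encode_sig s (L ! j)) \<longleftrightarrow>
    (\<forall>m. (\<lambda>n. perm_avg n (\<lambda>\<tau>. of_bool (hit s j m \<tau> M))) \<longlonglongrightarrow> 0)"
    if j: "j < length L" "size s \<le> L ! j" for j
  proof -
    have "has_limit (encode_sig s (L ! j)) (encoded_sub L s M j)"
      using ex j by (simp add: sub_limit_exists_def)
    note z = comb_limit_eq_zero_iff[OF this length_encoded_sub]
    have "perm_avg n (\<lambda>\<tau>. of_bool (relabel (encode_sig s (L ! j)) {1..m} \<tau> (encoded_sub L s M j)
        \<noteq> zero_struct (encode_sig s (L ! j)))) = perm_avg n (\<lambda>\<tau>. of_bool (hit s j m \<tau> M))" for m n
      by (rule perm_avg_cong) (simp only: encoded_nonzero_iff_hit[OF M j(1) permutes_NN])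
    then show ?thesis unfolding z by simp
  qed
  moreover have "(\<lambda>n. perm_avg n (\<lambda>\<tau>. of_bool (hit s j m \<tau> M))) \<longlonglongrightarrow> 0"
    if j: "j < length L" "\<not> size s \<le> L ! j" for j m
  proof -
    have "\<not> hit s j m \<tau> M" for \<tau>
    proof
      assume "hit s j m \<tau> M"
      then obtain a where a: "a \<in> M ! j" "s \<subseteq># mset a" unfolding hit_def by blast
      have "length a = L ! j" using nth_structures[OF M j(1)] a(1) by (auto simp: tuples_def)
      then show False using size_mset_mono[OF a(2)] j(2) by simp
    qed
    then show ?thesis by simp
  qed
  ultimately show ?thesis unfolding sub_limit_zero_def dense_def by blast
qed

text \<open>
  If all entries of a tuple are prescribed, then no label is left to sample.
\<close>

lemma dense_of_mem:
  assumes "a \<in> M ! j" "j < length L" shows "dense L (mset a) M"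
proof -
  have "hit (mset a) j 0 \<tau> M" for \<tau> using assms(1) unfolding hit_def by (intro bexI[of _ a]) auto
  then have "(\<lambda>n. perm_avg n (\<lambda>\<tau>. of_bool (hit (mset a) j 0 \<tau> M))) \<longlonglongrightarrow> 1" by simp
  then have "\<not> (\<lambda>n. perm_avg n (\<lambda>\<tau>. of_bool (hit (mset a) j 0 \<tau> M))) \<longlonglongrightarrow> 0"
    using LIMSEQ_unique by fastforce
  then show ?thesis using assms(2) unfolding dense_def by blast
qed

lemma denseE:
  assumes "dense L s M" obtains j a where "j < length L" "a \<in> M ! j" "s \<subseteq># mset a"
proof -
  obtain j m where j: "j < length L" "\<not> (\<lambda>n. perm_avg n (\<lambda>\<tau>. of_bool (hit s j m \<tau> M))) \<longlonglongrightarrow> 0"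
    using assms unfolding dense_def by blast
  have "\<exists>a\<in>M ! j. s \<subseteq># mset a"
  proof (rule ccontr)
    assume "\<not> ?thesis"
    then have "\<not> hit s j m \<tau> M" for \<tau> unfolding hit_def by blast
    then show False using j(2) by simp
  qed
  then show ?thesis using that j(1) by blast
qed

lemma dense_nonzero: "dense L s M \<Longrightarrow> M \<in> structures L NN \<Longrightarrow> M \<noteq> zero_struct L"
  by (auto elim!: denseE)

lemma sorted_nth_le_last: "sorted L \<Longrightarrow> j < length L \<Longrightarrow> L ! j \<le> last L"
  by (cases "L = []") (auto simp: last_conv_nth sorted_iff_nth_mono)

lemma dense_in:
  assumes "dense L s M" "M \<in> structures L NN"
  shows "s \<in> nat_multisets" "sorted L \<Longrightarrow> size s \<le> last L"
proof -
  obtain j a where ja: "j < length L" "a \<in> M ! j" "s \<subseteq># mset a" using denseE[OF assms(1)] .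
  then have a: "length a = L ! j" "set a \<subseteq> NN" using nth_structures[OF assms(2)] by (auto simp: tuples_def)
  then show "s \<in> nat_multisets" using set_mset_mono[OF ja(3)] by (auto simp: nat_multisets_def)
  show "size s \<le> last L" if "sorted L"
    using size_mset_mono[OF ja(3)] a(1) sorted_nth_le_last[OF that ja(1)] by simp
qed

lemma dense_relabel:
  assumes \<sigma>: "\<sigma> permutes NN" and r: "\<And>n. card {i \<in> {1..n}. \<sigma> i \<notin> {1..n}} \<le> r"
    and M: "M \<in> structures L NN"
  shows "dense L s (relabel L NN \<sigma> M) \<longleftrightarrow> dense L (image_mset \<sigma> s) M"
proof -
  have "(\<lambda>n. perm_avg n (\<lambda>\<tau>. of_bool (hit s j m \<tau> (relabel L NN \<sigma> M)))) \<longlonglongrightarrow> 0 \<longleftrightarrow>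
    (\<lambda>n. perm_avg n (\<lambda>\<tau>. of_bool (hit (image_mset \<sigma> s) j m \<tau> M))) \<longlonglongrightarrow> (0::real)"
    if "j < length L" for j m
    unfolding hit_relabel[OF \<sigma> that M]
    by (rule perm_avg_relabel_tendsto[OF depends_on_hit _ _ permutes_inj[OF \<sigma>] r]) auto
  then show ?thesis unfolding dense_def by blast
qed

text \<open>
  The condition \<open>s\<^sub>M = s\<close>, with the intersection expressed as a greatest lower bound.  Only countable
  quantifiers occur, which gives measurability.
\<close>

definition is_index :: "nat list \<Rightarrow> struc \<Rightarrow> nat multiset \<Rightarrow> bool" where
  "is_index L M s \<longleftrightarrow> (\<exists>s'. dense L s' M) \<and> (\<forall>s'. dense L s' M \<longrightarrow> s \<subseteq># s') \<and>
     (\<forall>u. (\<forall>s'. dense L s' M \<longrightarrow> u \<subseteq># s') \<longrightarrow> u \<subseteq># s)"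

lemma is_index_unique: "is_index L M s \<Longrightarrow> is_index L M s' \<Longrightarrow> s = s'"
  unfolding is_index_def by (metis subset_mset.antisym)

lemma Inf_eq_iff:
  fixes C :: "nat multiset set" assumes "C \<noteq> {}"
  shows "Inf C = s \<longleftrightarrow> (\<forall>s'\<in>C. s \<subseteq># s') \<and> (\<forall>u. (\<forall>s'\<in>C. u \<subseteq># s') \<longrightarrow> u \<subseteq># s)"
proof -
  have 1: "Inf C \<subseteq># s'" if "s' \<in> C" for s' by (rule subset_mset.cInf_lower[OF that]) (auto intro: subset_mset.bdd_belowI[of _ "{#}"])
  have 2: "u \<subseteq># Inf C" if "\<And>s'. s' \<in> C \<Longrightarrow> u \<subseteq># s'" for u by (rule subset_mset.cInf_greatest[OF assms that])
  show ?thesis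
  proof
    assume "(\<forall>s'\<in>C. s \<subseteq># s') \<and> (\<forall>u. (\<forall>s'\<in>C. u \<subseteq># s') \<longrightarrow> u \<subseteq># s)"
    then show "Inf C = s" using 1 2 by (intro subset_mset.antisym) auto
  qed (use 1 2 in auto)
qed

lemma is_index_ex:
  assumes "dense L s' M" shows "is_index L M (Inf {s'. dense L s' M})"
proof -
  have "{s'. dense L s' M} \<noteq> {}" using assms by blast
  from Inf_eq_iff[OF this, of "Inf {s'. dense L s' M}"] show ?thesis
    using assms unfolding is_index_def by blast
qed

lemma s_index_is_iff:
  assumes M: "M \<in> structures L NN"
  shows "s_index_is L M s \<longleftrightarrow> (\<forall>s'\<in>nat_multisets. sub_limit_exists L s' M) \<and> is_index L M s"
proof (cases "\<forall>s'\<in>nat_multisets. sub_limit_exists L s' M")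
  case True
  then have eq: "{s' \<in> nat_multisets. \<not> sub_limit_zero L s' M} = {s'. dense L s' M}"
    using sub_limit_zero_iff[OF M] dense_in(1)[OF _ M] by blast
  show ?thesis
  proof (cases "\<exists>s'. dense L s' M")
    case D: True
    then have "{s'. dense L s' M} \<noteq> {}" by blast
    from Inf_eq_iff[OF this, of s] show ?thesis
      using True D unfolding s_index_is_def is_index_def eq by blast
  next
    case False
    then show ?thesis unfolding s_index_is_def is_index_def eq by blast
  qed
next
  case False
  then show ?thesis unfolding s_index_is_def by blast
qed

lemma image_mset_perm_inv:
  assumes "\<sigma> permutes NN"
  shows "image_mset \<sigma> (image_mset (inv \<sigma>) s) = s" "image_mset (inv \<sigma>) (image_mset \<sigma> s) = s"
  using permutes_inv_o[OF assms] by (simp_all add: multiset.map_comp)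

lemma image_mset_perm_subset:
  assumes "\<sigma> permutes NN" shows "image_mset \<sigma> s \<subseteq># t \<longleftrightarrow> s \<subseteq># image_mset (inv \<sigma>) t"
  using image_mset_subseteq_mono[of "image_mset \<sigma> s" t "inv \<sigma>"]
    image_mset_subseteq_mono[of s "image_mset (inv \<sigma>) t" \<sigma>] image_mset_perm_inv[OF assms] by auto

lemma is_index_relabel:
  assumes \<sigma>: "\<sigma> permutes NN" and r: "\<And>n. card {i \<in> {1..n}. \<sigma> i \<notin> {1..n}} \<le> r"
    and M: "M \<in> structures L NN"
  shows "is_index L (relabel L NN \<sigma> M) s \<longleftrightarrow> is_index L M (image_mset \<sigma> s)"
proof -
  note d = dense_relabel[OF \<sigma> r M]
  note i = image_mset_perm_inv[OF \<sigma>] image_mset_perm_subset[OF \<sigma>]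
  have A: "(\<forall>s'. dense L s' (relabel L NN \<sigma> M) \<longrightarrow> u \<subseteq># s') \<longleftrightarrow> (\<forall>s'. dense L s' M \<longrightarrow> image_mset \<sigma> u \<subseteq># s')" for u
    unfolding d by (metis i)
  have B: "(\<exists>s'. dense L s' (relabel L NN \<sigma> M)) \<longleftrightarrow> (\<exists>s'. dense L s' M)"
    unfolding d by (metis i(1))
  show ?thesis unfolding is_index_def A B by (metis i)
qed

lemma measurable_avg_hit [measurable]:
  assumes "j < length L"
  shows "(\<lambda>M. perm_avg n (\<lambda>\<tau>. of_bool (hit s j m \<tau> M))) \<in> borel_measurable (SB L)"
proof (rule measurable_perm_avg)
  fix \<tau>
  have [measurable]: "Measurable.pred (SB L) (hit s j m \<tau>)" by (rule pred_fin_det[OF fin_det_hit[OF assms]])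
  show "(\<lambda>M. of_bool (hit s j m \<tau> M) :: real) \<in> borel_measurable (SB L)" by measurable
qed

lemma pred_dense [measurable]: "Measurable.pred (SB L) (dense L s)"
proof -
  have "Measurable.pred (SB L) (\<lambda>M. (\<lambda>n. perm_avg n (\<lambda>\<tau>. of_bool (hit s j m \<tau> M))) \<longlonglongrightarrow> (0::real))"
    if "j < length L" for j m
    by (rule measurable_limit) (rule measurable_avg_hit[OF that])
  then have "Measurable.pred (SB L) (\<lambda>M. \<exists>j\<in>{..<length L}. \<exists>m. \<not> (\<lambda>n. perm_avg n (\<lambda>\<tau>. of_bool (hit s j m \<tau> M))) \<longlonglongrightarrow> (0::real))"
    by (intro pred_intros_finite pred_intros_countable pred_intros_logic) auto
  then show ?thesis unfolding dense_def by (simp add: Bex_def)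
qed

lemma all_multiset_iff: "(\<forall>s::nat multiset. P s) \<longleftrightarrow> (\<forall>xs. P (mset xs))"
  by (metis ex_mset)

lemma ex_multiset_iff: "(\<exists>s::nat multiset. P s) \<longleftrightarrow> (\<exists>xs. P (mset xs))"
  by (metis ex_mset)

lemma pred_is_index [measurable]: "Measurable.pred (SB L) (\<lambda>M. is_index L M s)"
  unfolding is_index_def all_multiset_iff ex_multiset_iff by measurable

section \<open>The rate measure is exchangeable\<close>

lemma singleton_zero_sets: "{zero_struct L} \<in> sets (SB L)"
proof -
  have "{zero_struct L} = (\<Inter>n\<in>{1..}. {M \<in> structures L NN. restr {1..n} M = zero_struct L})"
    (is "_ = ?R")
  proof
    show "?R \<subseteq> {zero_struct L}"
    proof
      fix M assume M: "M \<in> ?R"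
      then have "M \<in> structures L NN" by auto
      then have "M = zero_struct L"
        by (rule structures_eqI[OF _ zero_in_structures order_refl]) (use M in auto)
      then show "M \<in> {zero_struct L}" by simp
    qed
  qed auto
  also have "?R \<in> sets (SB L)"
  proof (rule sets.countable_INT')
    show "(\<lambda>n. {M \<in> structures L NN. restr {1..n} M = zero_struct L}) ` {1..} \<subseteq> sets (SB L)"
      using sets_fin_det[OF fin_det_restr[where R = "\<lambda>N. N = zero_struct L"]] by blast
  qed auto
  finally show ?thesis .
qed

lemma nonzero_restr:
  assumes "M \<in> structures L NN" "M \<noteq> zero_struct L"
  obtains n where "n \<ge> 1" "n \<ge> k" "restr {1..n} M \<noteq> zero_struct L"
proof -
  obtain n where n: "1 \<le> n" "restr {1..n} M \<noteq> restr {1..n} (zero_struct L)"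
    using structures_eqI[OF assms(1) zero_in_structures order_refl] assms(2) by blast
  have "restr {1..n + k} M \<noteq> zero_struct L"
    using n(2) restr_mono[of "n + k" M "zero_struct L" n] by auto
  then show ?thesis using that[of "n + k"] n(1) by simp
qed

text \<open>
  The clopen events that exclude the zero structure, together with the zero structure itself, form a
  generator stable under intersection that covers the space by countably many sets of finite measure.
\<close>

lemma measure_eqI_fin_det:
  assumes sets: "sets M1 = sets (SB L)" "sets M2 = sets (SB L)"
    and zero: "emeasure M1 {zero_struct L} = 0" "emeasure M2 {zero_struct L} = 0"
    and eq: "\<And>Q. fin_det L Q \<Longrightarrow> \<not> Q (zero_struct L) \<Longrightarrow>
      emeasure M1 {M \<in> structures L NN. Q M} = emeasure M2 {M \<in> structures L NN. Q M}"
    and fin: "\<And>Q. fin_det L Q \<Longrightarrow> \<not> Q (zero_struct L) \<Longrightarrow> emeasure M1 {M \<in> structures L NN. Q M} \<noteq> \<infinity>"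
  shows "M1 = M2"
proof -
  let ?\<Omega> = "structures L NN"
  define E where "E = insert {zero_struct L} {{M \<in> ?\<Omega>. Q M} |Q. fin_det L Q \<and> \<not> Q (zero_struct L)}"
  define A where "A = insert {zero_struct L} ((\<lambda>n. {M \<in> ?\<Omega>. restr {1..n} M \<noteq> zero_struct L}) ` {1..})"
  have EI: "{M \<in> ?\<Omega>. Q M} \<in> E" if "fin_det L Q" "\<not> Q (zero_struct L)" for Q
    unfolding E_def using that by blast
  have Ecases: "B = {zero_struct L} \<or> (\<exists>Q. fin_det L Q \<and> \<not> Q (zero_struct L) \<and> B = {M \<in> ?\<Omega>. Q M})" if "B \<in> E" for B
    using that unfolding E_def by blast
  have "B \<subseteq> ?\<Omega>" if "B \<in> E" for B using Ecases[OF that] by auto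
  then have EP: "E \<subseteq> Pow ?\<Omega>" by blast
  have Esets: "E \<subseteq> sets (SB L)"
  proof
    fix B assume "B \<in> E"
    from Ecases[OF this] show "B \<in> sets (SB L)" using singleton_zero_sets sets_fin_det by auto
  qed
  have sig: "sets (SB L) = sigma_sets ?\<Omega> E"
  proof
    show "sigma_sets ?\<Omega> E \<subseteq> sets (SB L)" using sets.sigma_sets_subset[OF Esets] by simp
    have "det_sets L \<subseteq> sigma_sets ?\<Omega> E"
    proof
      fix B assume "B \<in> det_sets L"
      then obtain Q where Q: "B = {M \<in> ?\<Omega>. Q M}" "fin_det L Q" unfolding det_sets_def by auto
      show "B \<in> sigma_sets ?\<Omega> E"
      proof (cases "Q (zero_struct L)")
        case True
        have "{M \<in> ?\<Omega>. \<not> Q M} \<in> E" using EI[OF fin_det_not[OF Q(2)]] True by simp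
        then have "?\<Omega> - {M \<in> ?\<Omega>. \<not> Q M} \<in> sigma_sets ?\<Omega> E"
          by (intro sigma_sets.Compl sigma_sets.Basic)
        moreover have "?\<Omega> - {M \<in> ?\<Omega>. \<not> Q M} = B" using Q(1) by blast
        ultimately show ?thesis by simp
      next
        case False
        then show ?thesis using EI[OF Q(2)] Q(1) by (auto intro: sigma_sets.Basic)
      qed
    qed
    then show "sets (SB L) \<subseteq> sigma_sets ?\<Omega> E"
      unfolding sigma_det_sets[symmetric] by (rule sigma_sets_mono)
  qed
  have nz: "{M \<in> ?\<Omega>. restr {1..n} M \<noteq> zero_struct L} \<in> E" for n
    using EI[OF fin_det_restr[where R = "\<lambda>N. N \<noteq> zero_struct L"]] by simp
  show ?thesis
  proof (rule measure_eqI_generator_eq_countable[where E = E and \<Omega> = ?\<Omega> and A = A])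
    show "Int_stable E"
    proof (rule Int_stableI)
      fix a b assume ab: "a \<in> E" "b \<in> E"
      have empty: "{} \<in> E" using EI[OF fin_det_const[of L False]] by simp
      have z: "{zero_struct L} \<inter> c \<in> E" if "c \<in> E" for c
        using Ecases[OF that] empty that by (auto simp: Int_insert_left)
      from Ecases[OF ab(1)] Ecases[OF ab(2)] show "a \<inter> b \<in> E"
      proof (elim disjE exE conjE)
        fix Q R assume "fin_det L Q" "\<not> Q (zero_struct L)" "a = {M \<in> ?\<Omega>. Q M}"
          "fin_det L R" "\<not> R (zero_struct L)" "b = {M \<in> ?\<Omega>. R M}"
        moreover from this have "a \<inter> b = {M \<in> ?\<Omega>. Q M \<and> R M}" by blast
        ultimately show ?thesis using EI[OF fin_det_conj, of Q R] by simp
      qed (use z[OF ab(1)] z[OF ab(2)] in \<open>simp_all add: Int_commute\<close>)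
    qed
    show "E \<subseteq> Pow ?\<Omega>" by (rule EP)
    show "sets M1 = sigma_sets ?\<Omega> E" "sets M2 = sigma_sets ?\<Omega> E" using sets sig by simp_all
    show "emeasure M1 B = emeasure M2 B" if "B \<in> E" for B
      using Ecases[OF that] zero eq by auto
    show "A \<subseteq> E" unfolding A_def using nz by (auto simp: E_def)
    show "countable A" unfolding A_def by simp
    show "emeasure M1 a \<noteq> \<infinity>" if "a \<in> A" for a
      using that zero fin[OF fin_det_restr[where R = "\<lambda>N. N \<noteq> zero_struct L"]] unfolding A_def by auto
    show "\<Union>A = ?\<Omega>"
    proof
      show "\<Union>A \<subseteq> ?\<Omega>" unfolding A_def by auto
      show "?\<Omega> \<subseteq> \<Union>A"
      proof
        fix M assume M: "M \<in> ?\<Omega>"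
        show "M \<in> \<Union>A"
        proof (cases "M = zero_struct L")
          case False
          obtain n where "n \<ge> 1" "restr {1..n} M \<noteq> zero_struct L" using nonzero_restr[OF M False] by metis
          then show ?thesis using M unfolding A_def by blast
        qed (auto simp: A_def)
      qed
    qed
  qed
qed

text \<open>
  The indicator of a clopen event that excludes the zero structure is a test function.
\<close>

lemma rate_measure_limit:
  assumes rate: "rate_measure L P X \<mu>" and X: "\<And>t. 0 \<le> t \<Longrightarrow> X t \<in> measurable P (SB L)"
    and Q: "fin_det L Q" "\<not> Q (zero_struct L)"
  shows "((\<lambda>t. measure P {\<omega> \<in> space P. Q (X t \<omega>)} / t) \<longlongrightarrow> measure \<mu> {M \<in> structures L NN. Q M}) (at_right 0)"
proof -
  let ?T = "subtopology (struct_top L NN) (structures L NN - {zero_struct L})"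
  let ?K = "{M \<in> structures L NN. Q M}"
  let ?f = "indicator ?K :: struc \<Rightarrow> real"
  have sets\<mu>: "sets \<mu> = sets (SB L)" using rate by (simp add: rate_measure_def)
  have sp: "space \<mu> = structures L NN" using sets_eq_imp_space_eq[OF sets\<mu>] by simp
  have "continuous_map (struct_top L NN) euclideanreal ?f"
    unfolding continuous_map
  proof (intro conjI allI impI)
    fix U :: "real set"
    have "{M \<in> topspace (struct_top L NN). ?f M \<in> U} = {M \<in> structures L NN. Q M \<and> 1 \<in> U \<or> \<not> Q M \<and> 0 \<in> U}"
      by (auto simp: topspace_struct_top indicator_def)
    moreover have "fin_det L (\<lambda>M. Q M \<and> 1 \<in> U \<or> \<not> Q M \<and> 0 \<in> U)"
      by (intro fin_det_disj fin_det_conj fin_det_not fin_det_const Q(1))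
    ultimately show "openin (struct_top L NN) {M \<in> topspace (struct_top L NN). ?f M \<in> U}"
      using openin_fin_det by simp
  qed simp
  then have 1: "continuous_map ?T euclideanreal ?f" by (rule continuous_map_from_subtopology)
  have 2: "compactin ?T ?K"
    unfolding compactin_subtopology using compactin_fin_det[OF Q(1)] Q(2) by auto
  have 3: "\<forall>M \<in> structures L NN - ?K. ?f M = 0" by auto
  have "((\<lambda>t. (\<integral>\<omega>. ?f (X t \<omega>) \<partial>P) / t) \<longlongrightarrow> (\<integral>M. ?f M \<partial>\<mu>)) (at_right 0)"
    using rate 1 2 3 unfolding rate_measure_def Let_def by blast
  moreover have "(\<integral>M. ?f M \<partial>\<mu>) = measure \<mu> ?K" by (simp add: sp Int_absorb2 Collect_restrict)
  moreover have "\<forall>\<^sub>F t in at_right 0. (\<integral>\<omega>. ?f (X t \<omega>) \<partial>P) / t = measure P {\<omega> \<in> space P. Q (X t \<omega>)} / t"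
    using eventually_at_right_less[of 0]
  proof eventually_elim
    case (elim t)
    have m: "X t \<in> measurable P (SB L)" using X elim by simp
    have "(\<integral>\<omega>. ?f (X t \<omega>) \<partial>P) = (\<integral>\<omega>. indicator {\<omega> \<in> space P. Q (X t \<omega>)} \<omega> \<partial>P)"
      by (intro Bochner_Integration.integral_cong refl)
         (use measurable_space[OF m] in \<open>auto simp: indicator_def\<close>)
    then show ?case by (simp add: Int_absorb2 Collect_restrict)
  qed
  ultimately show ?thesis by (simp add: tendsto_cong)
qed

text \<open>
  The properties of the rate measure of an exchangeable process on which the decomposition rests.
\<close>

locale exchangeable_rate =
  fixes L :: "nat list" and \<mu> :: "struc measure"
  assumes sets_\<mu>: "sets \<mu> = sets (SB L)"
    and zero_null: "emeasure \<mu> {zero_struct L} = 0"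
    and finite_nonzero: "\<And>n. n \<ge> 1 \<Longrightarrow> emeasure \<mu> {M \<in> structures L NN. restr {1..n} M \<noteq> zero_struct L} < \<infinity>"
    and exch: "\<And>\<sigma>. \<sigma> permutes NN \<Longrightarrow> distr \<mu> (SB L) (relabel L NN \<sigma>) = \<mu>"

lemma fin_det_finite:
  assumes "\<And>n. n \<ge> 1 \<Longrightarrow> emeasure \<mu> {M \<in> structures L NN. restr {1..n} M \<noteq> zero_struct L} < \<infinity>"
    and "sets \<mu> = sets (SB L)" and Q: "fin_det L Q" "\<not> Q (zero_struct L)"
  shows "emeasure \<mu> {M \<in> structures L NN. Q M} < \<infinity>"
proof -
  obtain n where n: "n \<ge> 1" "\<And>M M'. M \<in> structures L NN \<Longrightarrow> M' \<in> structures L NN \<Longrightarrow>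
     restr {1..n} M = restr {1..n} M' \<Longrightarrow> Q M = Q M'" using fin_detE[OF Q(1)] by metis
  have "emeasure \<mu> {M \<in> structures L NN. Q M} \<le> emeasure \<mu> {M \<in> structures L NN. restr {1..n} M \<noteq> zero_struct L}"
  proof (rule emeasure_mono)
    show "{M \<in> structures L NN. Q M} \<subseteq> {M \<in> structures L NN. restr {1..n} M \<noteq> zero_struct L}"
      using n(2)[OF _ zero_in_structures] Q(2) by auto
    show "{M \<in> structures L NN. restr {1..n} M \<noteq> zero_struct L} \<in> sets \<mu>"
      unfolding assms(2) by (rule sets_fin_det[OF fin_det_restr[where R = "\<lambda>N. N \<noteq> zero_struct L"]])
  qed
  also have "\<dots> < \<infinity>" by (rule assms(1)[OF n(1)])
  finally show ?thesis .
qed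

text \<open>
  Exchangeability of the one-dimensional marginals passes to the limit \<open>t \<down> 0\<close> on clopen events, and these
  determine \<open>\<mu>\<close>.
\<close>

lemma rate_measure_exchangeable:
  assumes levy: "combinatorial_levy L P X" and ex: "exchangeable_process L P X"
    and rate: "rate_measure L P X \<mu>"
  shows "exchangeable_rate L \<mu>"
proof
  have X: "X t \<in> measurable P (SB L)" if "0 \<le> t" for t
    using levy that by (simp add: combinatorial_levy_def)
  interpret P: prob_space P using levy by (simp add: combinatorial_levy_def)
  show sets\<mu>: "sets \<mu> = sets (SB L)" and z: "emeasure \<mu> {zero_struct L} = 0"
    using rate by (simp_all add: rate_measure_def)
  show fin: "emeasure \<mu> {M \<in> structures L NN. restr {1..n} M \<noteq> zero_struct L} < \<infinity>" if "n \<ge> 1" for n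
    using rate that by (simp add: rate_measure_def)
  have sp: "space \<mu> = structures L NN" using sets_eq_imp_space_eq[OF sets\<mu>] by simp
  fix \<sigma> :: "nat \<Rightarrow> nat" assume \<sigma>: "\<sigma> permutes NN"
  have mr: "relabel L NN \<sigma> \<in> measurable \<mu> (SB L)"
    using measurable_relabel[OF \<sigma>] measurable_cong_sets[OF sets\<mu> refl] by blast
  have main: "emeasure \<mu> {M \<in> structures L NN. Q (relabel L NN \<sigma> M)} = emeasure \<mu> {M \<in> structures L NN. Q M}"
    if Q: "fin_det L Q" "\<not> Q (zero_struct L)" for Q
  proof -
    have Q': "fin_det L (\<lambda>M. Q (relabel L NN \<sigma> M))" "\<not> Q (relabel L NN \<sigma> (zero_struct L))"
      using fin_det_relabel[OF Q(1) \<sigma>] Q(2) by auto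
    have eq: "measure P {\<omega> \<in> space P. Q (relabel L NN \<sigma> (X t \<omega>))} = measure P {\<omega> \<in> space P. Q (X t \<omega>)}"
      if t: "0 \<le> t" for t
    proof -
      let ?PM = "Pi\<^sub>M {t} (\<lambda>_. SB L)"
      let ?B = "{x \<in> space ?PM. Q (x t)}"
      have "Measurable.pred (SB L) Q" by (rule pred_fin_det[OF Q(1)])
      then have B: "?B \<in> sets ?PM" by measurable
      have m1: "(\<lambda>\<omega>. \<lambda>u\<in>{t}. relabel L NN \<sigma> (X u \<omega>)) \<in> measurable P ?PM"
        by (intro measurable_restrict) (use measurable_compose[OF X[OF t] measurable_relabel[OF \<sigma>]] in auto)
      have m2: "(\<lambda>\<omega>. \<lambda>u\<in>{t}. X u \<omega>) \<in> measurable P ?PM"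
        by (intro measurable_restrict) (use X[OF t] in auto)
      have "distr P ?PM (\<lambda>\<omega>. \<lambda>u\<in>{t}. relabel L NN \<sigma> (X u \<omega>)) = distr P ?PM (\<lambda>\<omega>. \<lambda>u\<in>{t}. X u \<omega>)"
        using ex \<sigma> t unfolding exchangeable_process_def by auto
      then have "measure (distr P ?PM (\<lambda>\<omega>. \<lambda>u\<in>{t}. relabel L NN \<sigma> (X u \<omega>))) ?B
        = measure (distr P ?PM (\<lambda>\<omega>. \<lambda>u\<in>{t}. X u \<omega>)) ?B" by simp
      moreover have "(\<lambda>\<omega>. \<lambda>u\<in>{t}. relabel L NN \<sigma> (X u \<omega>)) -` ?B \<inter> space P = {\<omega> \<in> space P. Q (relabel L NN \<sigma> (X t \<omega>))}"
        using measurable_space[OF m1] by auto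
      moreover have "(\<lambda>\<omega>. \<lambda>u\<in>{t}. X u \<omega>) -` ?B \<inter> space P = {\<omega> \<in> space P. Q (X t \<omega>)}"
        using measurable_space[OF m2] by auto
      ultimately show ?thesis using measure_distr[OF m1 B] measure_distr[OF m2 B] by simp
    qed
    have "((\<lambda>t. measure P {\<omega> \<in> space P. Q (relabel L NN \<sigma> (X t \<omega>))} / t)
        \<longlongrightarrow> measure \<mu> {M \<in> structures L NN. Q M}) (at_right 0)"
    proof (rule Lim_transform_eventually[OF rate_measure_limit[OF rate X Q]])
      show "\<forall>\<^sub>F t in at_right 0. measure P {\<omega> \<in> space P. Q (X t \<omega>)} / t
          = measure P {\<omega> \<in> space P. Q (relabel L NN \<sigma> (X t \<omega>))} / t"
        using eventually_at_right_less[of 0] by eventually_elim (simp add: eq)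
    qed
    from tendsto_unique[OF trivial_limit_at_right_real this rate_measure_limit[OF rate X Q'(1,2)]]
    have "measure \<mu> {M \<in> structures L NN. Q M} = measure \<mu> {M \<in> structures L NN. Q (relabel L NN \<sigma> M)}" .
    moreover have "emeasure \<mu> {M \<in> structures L NN. Q M} < \<infinity>" "emeasure \<mu> {M \<in> structures L NN. Q (relabel L NN \<sigma> M)} < \<infinity>"
      using fin_det_finite[OF fin sets\<mu>] Q Q' by blast+
    ultimately show ?thesis by (simp add: emeasure_eq_ennreal_measure less_top)
  qed
  have em: "emeasure (distr \<mu> (SB L) (relabel L NN \<sigma>)) {M \<in> structures L NN. Q M} = emeasure \<mu> {M \<in> structures L NN. Q (relabel L NN \<sigma> M)}"
    if "{M \<in> structures L NN. Q M} \<in> sets (SB L)" for Q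
  proof -
    have "relabel L NN \<sigma> -` {M \<in> structures L NN. Q M} \<inter> space \<mu> = {M \<in> structures L NN. Q (relabel L NN \<sigma> M)}"
      by (auto simp: sp)
    then show ?thesis using emeasure_distr[OF mr that] by simp
  qed
  show "distr \<mu> (SB L) (relabel L NN \<sigma>) = \<mu>"
  proof (rule measure_eqI_fin_det[where L = L])
    have "{M \<in> structures L NN. M = zero_struct L} = {zero_struct L}" by auto
    moreover have "{M \<in> structures L NN. relabel L NN \<sigma> M = zero_struct L} = {zero_struct L}"
      using relabel_eq_zero_iff[OF \<sigma>] by auto
    ultimately show "emeasure (distr \<mu> (SB L) (relabel L NN \<sigma>)) {zero_struct L} = 0"
      using em[of "\<lambda>M. M = zero_struct L"] singleton_zero_sets z by simp
    fix Q assume Q: "fin_det L Q" "\<not> Q (zero_struct L)"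
    show "emeasure (distr \<mu> (SB L) (relabel L NN \<sigma>)) {M \<in> structures L NN. Q M} = emeasure \<mu> {M \<in> structures L NN. Q M}"
      using em[OF sets_fin_det[OF Q(1)]] main[OF Q] by simp
    then show "emeasure (distr \<mu> (SB L) (relabel L NN \<sigma>)) {M \<in> structures L NN. Q M} \<noteq> \<infinity>"
      using fin_det_finite[OF fin sets\<mu> Q] by simp
  qed (use sets\<mu> z in auto)
qed

section \<open>Almost every structure has all limits\<close>

context exchangeable_rate
begin

lemma space_\<mu>: "space \<mu> = structures L NN"
  using sets_eq_imp_space_eq[OF sets_\<mu>] by simp

lemma measurable_\<mu>: "measurable \<mu> N = measurable (SB L) N"
  by (rule measurable_cong_sets[OF sets_\<mu> refl])

lemma AE_\<mu>_structure: "AE M in \<mu>. M \<in> structures L NN \<and> M \<noteq> zero_struct L"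
proof -
  have "AE M in \<mu>. M \<notin> {zero_struct L}"
    using singleton_zero_sets zero_null by (intro AE_not_in null_setsI) (simp_all add: sets_\<mu>)
  moreover have "AE M in \<mu>. M \<in> space \<mu>" by (rule AE_space)
  ultimately show ?thesis by eventually_elim (simp add: space_\<mu>)
qed

lemma emeasure_relabel:
  assumes "\<sigma> permutes NN" "B \<in> sets (SB L)"
  shows "emeasure \<mu> {M \<in> structures L NN. relabel L NN \<sigma> M \<in> B} = emeasure \<mu> B"
proof -
  have m: "relabel L NN \<sigma> \<in> measurable \<mu> (SB L)" unfolding measurable_\<mu> by (rule measurable_relabel[OF assms(1)])
  have "emeasure \<mu> B = emeasure (distr \<mu> (SB L) (relabel L NN \<sigma>)) B" using exch[OF assms(1)] by simp
  also have "\<dots> = emeasure \<mu> (relabel L NN \<sigma> -` B \<inter> space \<mu>)" by (rule emeasure_distr[OF m assms(2)])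
  also have "relabel L NN \<sigma> -` B \<inter> space \<mu> = {M \<in> structures L NN. relabel L NN \<sigma> M \<in> B}"
    by (auto simp: space_\<mu>)
  finally show ?thesis by simp
qed

text \<open>
  An event that does not distinguish the labels outside \<open>S\<close> leaves enough invariance for sampling.
\<close>

lemma restricted_sample:
  assumes G: "G \<in> sets (SB L)" "emeasure \<mu> G < \<infinity>" and S: "finite S"
    and inv: "\<And>\<sigma> N M. \<sigma> permutes {1..N} \<Longrightarrow> (\<And>i. i \<in> S \<Longrightarrow> \<sigma> i = i) \<Longrightarrow> M \<in> structures L NN \<Longrightarrow>
      relabel L NN \<sigma> M \<in> G \<longleftrightarrow> M \<in> G"
    and h: "\<And>M. depends_on m (\<lambda>\<tau>. h \<tau> M)" "\<And>\<tau> M. 0 \<le> h \<tau> M" "\<And>\<tau> M. h \<tau> M \<le> 1"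
      "\<And>\<tau>. \<tau> permutes NN \<Longrightarrow> h \<tau> \<in> borel_measurable (SB L)"
    and eqv: "\<And>\<sigma> N \<tau> M. \<sigma> permutes {1..N} \<Longrightarrow> (\<And>i. i \<in> S \<Longrightarrow> \<sigma> i = i) \<Longrightarrow>
      \<tau> permutes NN \<Longrightarrow> M \<in> structures L NN \<Longrightarrow> h \<tau> (relabel L NN \<sigma> M) = h (\<sigma> \<circ> \<tau>) M"
  shows "equivariant_sample L (density \<mu> (indicator G)) S m h"
proof (rule equivariant_sample.intro)
  let ?\<rho> = "density \<mu> (indicator G)"
  have G': "G \<in> sets \<mu>" using G(1) sets_\<mu> by simp
  have em: "emeasure ?\<rho> B = emeasure \<mu> (G \<inter> B)" if "B \<in> sets (SB L)" for B
    using emeasure_restricted[OF G', of B] that sets_\<mu> by simp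
  show "sets ?\<rho> = sets (SB L)" by (simp add: sets_\<mu>)
  have "G \<inter> space \<mu> = G" using sets.sets_into_space[OF G'] by blast
  then have "emeasure ?\<rho> (space \<mu>) = emeasure \<mu> G" using em[of "space \<mu>"] sets.top[of "SB L"] by (simp add: space_\<mu>)
  then show "finite_measure ?\<rho>"
    using G(2) by (intro finite_measureI) simp
  fix \<sigma> N assume \<sigma>: "\<sigma> permutes {1..N}" "\<And>i. i \<in> S \<Longrightarrow> \<sigma> i = i"
  have mr: "relabel L NN \<sigma> \<in> measurable ?\<rho> (SB L)"
    using measurable_relabel[OF permutes_NN[OF \<sigma>(1)]] by (simp add: measurable_\<mu>)
  show "distr ?\<rho> (SB L) (relabel L NN \<sigma>) = ?\<rho>"
  proof (rule measure_eqI)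
    fix B assume "B \<in> sets (distr ?\<rho> (SB L) (relabel L NN \<sigma>))"
    then have B: "B \<in> sets (SB L)" by simp
    have "emeasure (distr ?\<rho> (SB L) (relabel L NN \<sigma>)) B = emeasure ?\<rho> (relabel L NN \<sigma> -` B \<inter> space ?\<rho>)"
      by (rule emeasure_distr[OF mr B])
    also have "\<dots> = emeasure \<mu> (G \<inter> (relabel L NN \<sigma> -` B \<inter> space ?\<rho>))"
      using measurable_sets[OF mr B] by (intro em) (simp add: sets_\<mu>)
    also have "G \<inter> (relabel L NN \<sigma> -` B \<inter> space ?\<rho>) = {M \<in> structures L NN. relabel L NN \<sigma> M \<in> G \<inter> B}"
      using inv[OF \<sigma>] sets.sets_into_space[OF G'] by (auto simp: space_\<mu>)
    also have "emeasure \<mu> \<dots> = emeasure \<mu> (G \<inter> B)"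
      by (rule emeasure_relabel[OF permutes_NN[OF \<sigma>(1)]]) (use G(1) B in auto)
    also have "\<dots> = emeasure ?\<rho> B" using em[OF B] by simp
    finally show "emeasure (distr ?\<rho> (SB L) (relabel L NN \<sigma>)) B = emeasure ?\<rho> B" .
  qed (simp add: sets_\<mu>)
qed (use S h eqv in auto)

lemma AE_restricted:
  assumes "G \<in> sets (SB L)" "AE M in density \<mu> (indicator G). Q M"
  shows "AE M in \<mu>. M \<in> G \<longrightarrow> Q M"
proof -
  have "indicator G \<in> borel_measurable \<mu>" using assms(1) sets_\<mu> by simp
  from AE_density[OF this, of Q] assms(2) have "AE M in \<mu>. 0 < (indicator G M :: ennreal) \<longrightarrow> Q M" by simp
  then show ?thesis by eventually_elim simp
qed

lemma nonzero_invariant: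
  assumes "\<And>i. i \<in> {1..n} \<Longrightarrow> \<sigma> i = i" "M \<in> structures L NN"
  shows "restr {1..n} (relabel L NN \<sigma> M) = restr {1..n} M"
proof -
  have "relabel L {1..n} \<sigma> M = relabel L {1..n} id M" by (rule relabel_cong) (use assms(1) in simp)
  also have "\<dots> = restr {1..n} (relabel L NN id M)" by (simp add: restr_relabel_nat)
  also have "\<dots> = restr {1..n} M" by (simp add: relabel_id[OF assms(2)])
  finally show ?thesis by (simp add: restr_relabel_nat)
qed

text \<open>
  The events \<open>M|[n] \<noteq> 0\<close> have finite measure, concern the labels in \<open>[n]\<close> only, and cover \<open>\<mu>\<close>-almost everything.
\<close>

lemma AE_\<mu>_convergent:
  assumes S: "finite S"
    and h: "\<And>M. depends_on m (\<lambda>\<tau>. h \<tau> M)" "\<And>\<tau> M. 0 \<le> h \<tau> M" "\<And>\<tau> M. h \<tau> M \<le> 1"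
      "\<And>\<tau>. \<tau> permutes NN \<Longrightarrow> h \<tau> \<in> borel_measurable (SB L)"
    and eqv: "\<And>\<sigma> N \<tau> M. \<sigma> permutes {1..N} \<Longrightarrow> (\<And>i. i \<in> S \<Longrightarrow> \<sigma> i = i) \<Longrightarrow>
      \<tau> permutes NN \<Longrightarrow> M \<in> structures L NN \<Longrightarrow> h \<tau> (relabel L NN \<sigma> M) = h (\<sigma> \<circ> \<tau>) M"
  shows "AE M in \<mu>. convergent (\<lambda>n. perm_avg n (\<lambda>\<tau>. h \<tau> M))"
proof -
  define G where "G n = {M \<in> structures L NN. restr {1..n} M \<noteq> zero_struct L}" for n
  have Gs: "G n \<in> sets (SB L)" for n
    unfolding G_def by (rule sets_fin_det[OF fin_det_restr[where R = "\<lambda>N. N \<noteq> zero_struct L"]])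
  have "AE M in \<mu>. M \<in> G n \<longrightarrow> convergent (\<lambda>n. perm_avg n (\<lambda>\<tau>. h \<tau> M))" if n: "n \<ge> 1" for n
  proof -
    interpret equivariant_sample L "density \<mu> (indicator (G n))" "S \<union> {1..n}" m h
    proof (rule restricted_sample[OF Gs])
      show "emeasure \<mu> (G n) < \<infinity>" unfolding G_def by (rule finite_nonzero[OF n])
      show "relabel L NN \<sigma> M \<in> G n \<longleftrightarrow> M \<in> G n"
        if "\<And>i. i \<in> S \<union> {1..n} \<Longrightarrow> \<sigma> i = i" "M \<in> structures L NN" for \<sigma> :: "nat \<Rightarrow> nat" and M
        using nonzero_invariant[of n \<sigma> M] that by (auto simp: G_def)
    qed (use S h eqv in auto)
    show ?thesis by (rule AE_restricted[OF Gs AE_convergent])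
  qed
  then have "AE M in \<mu>. \<forall>n. n \<ge> 1 \<longrightarrow> M \<in> G n \<longrightarrow> convergent (\<lambda>n. perm_avg n (\<lambda>\<tau>. h \<tau> M))"
    by (simp add: AE_all_countable)
  with AE_\<mu>_structure show ?thesis
  proof eventually_elim
    case (elim M)
    then obtain n where "n \<ge> 1" "restr {1..n} M \<noteq> zero_struct L" using nonzero_restr[of M L] by metis
    then show ?case using elim by (auto simp: G_def)
  qed
qed

lemma AE_has_limit: "AE M in \<mu>. has_limit L M"
proof -
  have "AE M in \<mu>. convergent (\<lambda>n. perm_avg n (\<lambda>\<tau>. of_bool (relabel L {1..m} \<tau> M = A) :: real))" for m A
  proof (rule AE_\<mu>_convergent[of "{}" m "\<lambda>\<tau> M. of_bool (relabel L {1..m} \<tau> M = A)"])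
    show "depends_on m (\<lambda>\<tau>. of_bool (relabel L {1..m} \<tau> M = A) :: real)" for M by (rule depends_on_relabel)
    fix \<tau> :: "nat \<Rightarrow> nat" assume \<tau>: "\<tau> permutes NN"
    have [measurable]: "Measurable.pred (SB L) (\<lambda>M. relabel L {1..m} \<tau> M = A)"
      by (rule pred_fin_det[OF fin_det_relabel_eq[OF \<tau>]])
    show "(\<lambda>M. of_bool (relabel L {1..m} \<tau> M = A) :: real) \<in> borel_measurable (SB L)" by measurable
    have "\<tau> ` {1..m} \<subseteq> NN" by (rule permutes_NN_image[OF \<tau>]) auto
    then show "of_bool (relabel L {1..m} \<tau> (relabel L NN \<sigma> M) = A) = (of_bool (relabel L {1..m} (\<sigma> \<circ> \<tau>) M = A) :: real)" for \<sigma> M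
      by (simp add: relabel_relabel)
  qed auto
  then have "AE M in \<mu>. \<forall>m. \<forall>A\<in>structures L {1..m}. convergent (\<lambda>n. perm_avg n (\<lambda>\<tau>. of_bool (relabel L {1..m} \<tau> M = A) :: real))"
    unfolding AE_all_countable by (intro allI AE_finite_allI finite_structures) auto
  with AE_\<mu>_structure show ?thesis
  proof eventually_elim
    case (elim M)
    then have "length M = length L" using length_structures by blast
    then show ?case using elim by (simp add: has_limit_iff)
  qed
qed

end

lemma map_fill:
  assumes "length c = length (filter (\<lambda>x. x = None) w)" "\<And>x. Some x \<in> set w \<Longrightarrow> \<sigma> x = x"
  shows "map \<sigma> (fill w c) = fill w (map \<sigma> c)"
  using assms
proof (induction w arbitrary: c)
  case (Cons x w)
  show ?case
  proof (cases x)
    case None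
    then obtain y c' where "c = y # c'" using Cons.prems by (cases c) auto
    then show ?thesis using Cons None by simp
  qed (use Cons in simp)
qed simp

lemma relabel_encoded_eqI:
  assumes "\<And>l b. l < length (word_list s (L ! j)) \<Longrightarrow> b \<in> tuples {1..m} (L ! j - size s) \<Longrightarrow>
     map \<tau> b \<in> encoded_sub L s M j ! l \<longleftrightarrow> map \<tau>' b \<in> encoded_sub L s M' j ! l"
  shows "relabel (encode_sig s (L ! j)) {1..m} \<tau> (encoded_sub L s M j)
    = relabel (encode_sig s (L ! j)) {1..m} \<tau>' (encoded_sub L s M' j)"
  using assms by (intro nth_equalityI) (auto simp: encode_sig_def)

lemma map_tuples:
  assumes "\<tau> permutes NN" "b \<in> tuples {1..m} k" shows "map \<tau> b \<in> tuples NN k"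
proof -
  have "\<tau> ` set b \<subseteq> NN" by (rule permutes_NN_image[OF assms(1)]) (use assms(2) in \<open>auto simp: tuples_def\<close>)
  then show ?thesis using assms(2) by (simp add: tuples_def)
qed

text \<open>
  The words of \<open>s\<close> are not affected by a permutation that fixes the elements of \<open>s\<close>.
\<close>

lemma relabel_encoded_relabel:
  assumes \<sigma>: "\<sigma> permutes NN" "\<And>i. i \<in># s \<Longrightarrow> \<sigma> i = i" and \<tau>: "\<tau> permutes NN"
    and M: "M \<in> structures L NN" and j: "j < length L" and s: "s \<in> nat_multisets" and sz: "size s \<le> L ! j"
  shows "relabel (encode_sig s (L ! j)) {1..m} \<tau> (encoded_sub L s (relabel L NN \<sigma> M) j)
    = relabel (encode_sig s (L ! j)) {1..m} (\<sigma> \<circ> \<tau>) (encoded_sub L s M j)"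
proof (rule relabel_encoded_eqI)
  fix l b assume l: "l < length (word_list s (L ! j))" and b: "b \<in> tuples {1..m} (L ! j - size s)"
  let ?w = "word_list s (L ! j) ! l"
  have w: "?w \<in> words s (L ! j)" using l set_word_list nth_mem by blast
  have t1: "map \<tau> b \<in> tuples NN (L ! j - size s)" by (rule map_tuples[OF \<tau> b])
  have t2: "map (\<sigma> \<circ> \<tau>) b \<in> tuples NN (L ! j - size s)" by (rule map_tuples[OF permutes_compose[OF \<tau> \<sigma>(1)] b])
  have ms: "mset (fill ?w (map \<tau> b)) = s + mset (map \<tau> b)" by (rule encoded_mem(2)[OF l t1 M j])
  have "fill ?w (map \<tau> b) \<in> tuples NN (L ! j)"
  proof -
    have "length (fill ?w (map \<tau> b)) = L ! j"
      using arg_cong[OF ms, of size] t1 sz by (simp add: tuples_def)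
    moreover have "set (fill ?w (map \<tau> b)) = set_mset s \<union> set (map \<tau> b)"
      using arg_cong[OF ms, of set_mset] by simp
    ultimately show ?thesis using s t1 by (auto simp: tuples_def nat_multisets_def)
  qed
  moreover have "map \<sigma> (fill ?w (map \<tau> b)) = fill ?w (map (\<sigma> \<circ> \<tau>) b)"
  proof -
    have "map \<sigma> (fill ?w (map \<tau> b)) = fill ?w (map \<sigma> (map \<tau> b))"
    proof (rule map_fill)
      show "length (map \<tau> b) = length (filter (\<lambda>x. x = None) ?w)" using words_facts(1)[OF w] b by (simp add: tuples_def)
      fix x assume "Some x \<in> set ?w"
      then have "Some x \<in># image_mset Some s + replicate_mset (L ! j - size s) None"
        using w unfolding words_def by (metis mem_Collect_eq set_mset_mset)
      then show "\<sigma> x = x" using \<sigma>(2) by (auto split: if_splits)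
    qed
    then show ?thesis by simp
  qed
  ultimately show "map \<tau> b \<in> encoded_sub L s (relabel L NN \<sigma> M) j ! l \<longleftrightarrow> map (\<sigma> \<circ> \<tau>) b \<in> encoded_sub L s M j ! l"
    using encoded_mem(1)[OF l t1 relabel_in_structures j] encoded_mem(1)[OF l t2 M j] j by simp
qed

lemma fin_det_encoded:
  assumes \<tau>: "\<tau> permutes NN" and j: "j < length L" and s: "s \<in> nat_multisets"
  shows "fin_det L (\<lambda>M. relabel (encode_sig s (L ! j)) {1..m} \<tau> (encoded_sub L s M j) = A)"
proof -
  define n where "n = Max (insert 0 (set_mset s \<union> \<tau> ` {1..m}))"
  have le: "x \<le> n" if "x \<in> set_mset s \<union> \<tau> ` {1..m}" for x
    unfolding n_def by (rule Max_ge) (use that in auto)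
  have "\<tau> ` {1..m} \<subseteq> NN" by (rule permutes_NN_image[OF \<tau>]) auto
  then have sub: "set_mset s \<union> \<tau> ` {1..m} \<subseteq> {1..n}" using le s by (auto 0 3 simp: nat_multisets_def)
  show ?thesis
  proof (rule fin_detI[of L n])
    fix M M' assume M: "M \<in> structures L NN" "M' \<in> structures L NN" "restr {1..n} M = restr {1..n} M'"
    have "relabel (encode_sig s (L ! j)) {1..m} \<tau> (encoded_sub L s M j)
      = relabel (encode_sig s (L ! j)) {1..m} \<tau> (encoded_sub L s M' j)"
    proof (rule relabel_encoded_eqI)
      fix l b assume l: "l < length (word_list s (L ! j))" and b: "b \<in> tuples {1..m} (L ! j - size s)"
      let ?a = "fill (word_list s (L ! j) ! l) (map \<tau> b)"
      have t: "map \<tau> b \<in> tuples NN (L ! j - size s)" by (rule map_tuples[OF \<tau> b])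
      have "mset ?a = s + mset (map \<tau> b)" by (rule encoded_mem(2)[OF l t M(1) j])
      from arg_cong[OF this, of set_mset] have "set ?a = set_mset s \<union> \<tau> ` set b" by simp
      moreover have "\<tau> ` set b \<subseteq> \<tau> ` {1..m}" using b by (intro image_mono) (simp add: tuples_def)
      ultimately have a: "set ?a \<subseteq> {1..n}" using sub by blast
      have "?a \<in> N ! j \<longleftrightarrow> ?a \<in> restr {1..n} N ! j" if "N \<in> structures L NN" for N
        using a j length_structures[OF that] by simp
      then have "?a \<in> M ! j \<longleftrightarrow> ?a \<in> M' ! j" using M by metis
      then show "map \<tau> b \<in> encoded_sub L s M j ! l \<longleftrightarrow> map \<tau> b \<in> encoded_sub L s M' j ! l"
        using encoded_mem(1)[OF l t _ j] M by simp
    qed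
    then show "(relabel (encode_sig s (L ! j)) {1..m} \<tau> (encoded_sub L s M j) = A)
      = (relabel (encode_sig s (L ! j)) {1..m} \<tau> (encoded_sub L s M' j) = A)" by simp
  qed
qed

lemma (in exchangeable_rate) AE_sub_limit_exists:
  assumes s: "s \<in> nat_multisets" shows "AE M in \<mu>. sub_limit_exists L s M"
proof -
  have "AE M in \<mu>. convergent (\<lambda>n. perm_avg n
     (\<lambda>\<tau>. of_bool (relabel (encode_sig s (L ! j)) {1..m} \<tau> (encoded_sub L s M j) = A) :: real))"
    if j: "j < length L" and sz: "size s \<le> L ! j" for j m A
  proof (rule AE_\<mu>_convergent[of "set_mset s" m "\<lambda>\<tau> M. of_bool (relabel (encode_sig s (L ! j)) {1..m} \<tau> (encoded_sub L s M j) = A)"])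
    show "depends_on m (\<lambda>\<tau>. of_bool (relabel (encode_sig s (L ! j)) {1..m} \<tau> (encoded_sub L s M j) = A) :: real)" for M
      by (rule depends_on_relabel)
    fix \<tau> :: "nat \<Rightarrow> nat" assume \<tau>: "\<tau> permutes NN"
    have [measurable]: "Measurable.pred (SB L) (\<lambda>M. relabel (encode_sig s (L ! j)) {1..m} \<tau> (encoded_sub L s M j) = A)"
      by (rule pred_fin_det[OF fin_det_encoded[OF \<tau> j s]])
    show "(\<lambda>M. of_bool (relabel (encode_sig s (L ! j)) {1..m} \<tau> (encoded_sub L s M j) = A) :: real) \<in> borel_measurable (SB L)"
      by measurable
    fix \<sigma> N M assume "\<sigma> permutes {1..N}" "\<And>i. i \<in># s \<Longrightarrow> \<sigma> i = i" "M \<in> structures L NN"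
    then show "of_bool (relabel (encode_sig s (L ! j)) {1..m} \<tau> (encoded_sub L s (relabel L NN \<sigma> M) j) = A)
      = (of_bool (relabel (encode_sig s (L ! j)) {1..m} (\<sigma> \<circ> \<tau>) (encoded_sub L s M j) = A) :: real)"
      using relabel_encoded_relabel[OF permutes_NN _ \<tau> _ j s sz] by simp
  qed auto
  then have "AE M in \<mu>. \<forall>j\<in>{..<length L}. \<forall>m. \<forall>A\<in>structures (encode_sig s (L ! j)) {1..m}. size s \<le> L ! j \<longrightarrow>
     convergent (\<lambda>n. perm_avg n (\<lambda>\<tau>. of_bool (relabel (encode_sig s (L ! j)) {1..m} \<tau> (encoded_sub L s M j) = A) :: real))"
    by (intro AE_finite_allI AE_all_countable[THEN iffD2] allI finite_structures finite_lessThan finite_atLeastAtMost) auto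
  then show ?thesis
    by eventually_elim (simp add: sub_limit_exists_def has_limit_iff length_encoded_sub)
qed

section \<open>Dense multisets are closed under intersection of supports\<close>

lemma finite_perm_displacement:
  assumes "\<sigma> permutes {1..N}" shows "card {i \<in> {1..n}. \<sigma> i \<notin> {1..n}} \<le> N"
proof -
  have "{i \<in> {1..n}. \<sigma> i \<notin> {1..n}} \<subseteq> {1..N}"
  proof
    fix i assume i: "i \<in> {i \<in> {1..n}. \<sigma> i \<notin> {1..n}}"
    show "i \<in> {1..N}"
    proof (rule ccontr)
      assume "i \<notin> {1..N}"
      then have "\<sigma> i = i" using permutes_not_in[OF assms] by blast
      then show False using i by auto
    qed
  qed
  from card_mono[OF _ this] show ?thesis by simp
qed

lemma perm_avg_finite_relabel:
  assumes "\<sigma> permutes {1..N}" shows "\<forall>\<^sub>F n in sequentially. perm_avg n (\<lambda>\<tau>. h (\<sigma> \<circ> \<tau>)) = perm_avg n h"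
  using eventually_ge_at_top[of N]
proof eventually_elim
  case (elim n)
  then have "\<sigma> permutes {1..n}" by (intro permutes_subset[OF assms]) auto
  then show ?case by (rule perm_avg_compose_left)
qed

lemma image_mset_fixed: "(\<And>x. x \<in># s \<Longrightarrow> \<sigma> x = x) \<Longrightarrow> image_mset \<sigma> s = s"
  by (metis image_mset_cong multiset.map_ident)

lemma permutation_onto_block:
  assumes F: "finite F" "F \<subseteq> NN"
  obtains \<sigma> N where "\<sigma> permutes {1..N::nat}" "\<sigma> ` {1..card F} = F"
proof -
  obtain g where g: "bij_betw g {1..card F} F" using ex_bij_betw_nat_finite_1[OF F(1)] by blast
  define N where "N = Max (insert (card F) F)"
  have le: "x \<le> N" if "x \<in> insert (card F) F" for x unfolding N_def by (rule Max_ge) (use F that in auto)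
  have "{1..card F} \<subseteq> {1..N}" using le[of "card F"] by auto
  moreover have "g ` {1..card F} \<subseteq> {1..N}"
    using bij_betw_imp_surj_on[OF g] le F(2) by (auto 0 3)
  ultimately obtain \<sigma> where \<sigma>: "\<sigma> permutes {1..N}" "\<And>i. i \<in> {1..card F} \<Longrightarrow> \<sigma> i = g i"
    using extend_to_permutation[OF _ bij_betw_imp_inj_on[OF g]] by blast
  have "\<sigma> ` {1..card F} = g ` {1..card F}" using \<sigma>(2) by (intro image_cong) auto
  then show ?thesis using that[OF \<sigma>(1)] bij_betw_imp_surj_on[OF g] by simp
qed

lemma nn_integral_perm_avg_le:
  assumes Q: "\<And>\<tau>. \<tau> permutes {1..n} \<Longrightarrow> {M \<in> space \<mu>. Q \<tau> M} \<in> sets \<mu>"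
    and C: "\<And>\<tau>. \<tau> permutes {1..n} \<Longrightarrow> emeasure \<mu> {M \<in> space \<mu>. Q \<tau> M} \<le> C"
  shows "(\<integral>\<^sup>+M. ennreal (perm_avg n (\<lambda>\<tau>. of_bool (Q \<tau> M))) \<partial>\<mu>) \<le> C"
proof -
  let ?P = "{\<tau>. \<tau> permutes {1..n}}"
  have "(\<integral>\<^sup>+M. ennreal (perm_avg n (\<lambda>\<tau>. of_bool (Q \<tau> M))) \<partial>\<mu>)
    = (\<integral>\<^sup>+M. ennreal (1 / fact n) * (\<Sum>\<tau>\<in>?P. indicator {M \<in> space \<mu>. Q \<tau> M} M) \<partial>\<mu>)"
  proof (rule nn_integral_cong)
    fix M assume "M \<in> space \<mu>"
    then have "(\<Sum>\<tau>\<in>?P. indicator {M \<in> space \<mu>. Q \<tau> M} M) = (\<Sum>\<tau>\<in>?P. ennreal (of_bool (Q \<tau> M)))"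
      by (intro sum.cong) (auto simp: indicator_def)
    also have "\<dots> = ennreal (\<Sum>\<tau>\<in>?P. of_bool (Q \<tau> M))" by (rule sum_ennreal) simp
    finally show "ennreal (perm_avg n (\<lambda>\<tau>. of_bool (Q \<tau> M)))
      = ennreal (1 / fact n) * (\<Sum>\<tau>\<in>?P. indicator {M \<in> space \<mu>. Q \<tau> M} M)"
      unfolding perm_avg_def by (simp add: ennreal_mult[symmetric] sum_nonneg)
  qed
  also have "\<dots> = ennreal (1 / fact n) * (\<Sum>\<tau>\<in>?P. emeasure \<mu> {M \<in> space \<mu>. Q \<tau> M})"
  proof -
    have "(\<integral>\<^sup>+M. (\<Sum>\<tau>\<in>?P. indicator {M \<in> space \<mu>. Q \<tau> M} M) \<partial>\<mu>)
      = (\<Sum>\<tau>\<in>?P. \<integral>\<^sup>+M. indicator {M \<in> space \<mu>. Q \<tau> M} M \<partial>\<mu>)"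
      by (rule nn_integral_sum) (use Q in simp)
    also have "\<dots> = (\<Sum>\<tau>\<in>?P. emeasure \<mu> {M \<in> space \<mu>. Q \<tau> M})"
      using Q by (intro sum.cong refl) simp
    finally show ?thesis
      using Q by (subst nn_integral_cmult) (auto intro!: borel_measurable_sum)
  qed
  also have "\<dots> \<le> ennreal (1 / fact n) * (\<Sum>\<tau>\<in>?P. C)"
    using C by (intro mult_left_mono sum_mono) auto
  also have "\<dots> = (ennreal (1 / fact n) * ennreal (fact n)) * C"
    using card_perms[of n] by (simp add: ennreal_of_nat_eq_real_of_nat mult.assoc)
  also have "ennreal (1 / fact n) * ennreal (fact n) = 1" by (simp add: ennreal_mult[symmetric])
  finally show ?thesis by simp
qed

text \<open>
  A sample that avoids \<open>S\<close> cannot supply the elements of \<open>S\<close> that distinguish the tuples of \<open>M\<close> from \<open>s\<close>.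
\<close>

lemma not_dense_if_no_tuple:
  assumes "finite S"
    and no: "\<And>j a. j < length L \<Longrightarrow> a \<in> M ! j \<Longrightarrow> filter_mset (\<lambda>x. x \<in> S) (mset a) \<noteq> filter_mset (\<lambda>x. x \<in> S) s"
  shows "\<not> dense L s M"
proof -
  have "(\<lambda>n. perm_avg n (\<lambda>\<tau>. of_bool (hit s j m \<tau> M) :: real)) \<longlonglongrightarrow> 0" if j: "j < length L" for j m
  proof (rule Lim_null_comparison)
    have imp: "\<tau> ` {1..m} \<inter> S \<noteq> {}" if h: "hit s j m \<tau> M" for \<tau>
    proof
      assume e: "\<tau> ` {1..m} \<inter> S = {}"
      obtain a where a: "a \<in> M ! j" "s \<subseteq># mset a" "set_mset (mset a - s) \<subseteq> \<tau> ` {1..m}"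
        using h unfolding hit_def by blast
      have "mset a = s + (mset a - s)" using a(2) by simp
      then have "filter_mset (\<lambda>x. x \<in> S) (mset a) = filter_mset (\<lambda>x. x \<in> S) s + filter_mset (\<lambda>x. x \<in> S) (mset a - s)"
        by (metis filter_union_mset)
      moreover have "filter_mset (\<lambda>x. x \<in> S) (mset a - s) = {#}"
      proof -
        have "set_mset (filter_mset (\<lambda>x. x \<in> S) (mset a - s)) = {}" using a(3) e by (auto simp del: filter_diff_mset)
        then show ?thesis by (simp only: set_mset_eq_empty_iff)
      qed
      ultimately show False using no[OF j a(1)] by simp
    qed
    show "\<forall>\<^sub>F n in sequentially. norm (perm_avg n (\<lambda>\<tau>. of_bool (hit s j m \<tau> M) :: real)) \<le> real (m * card S) / n"
      using eventually_ge_at_top[of 1]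
    proof eventually_elim
      case (elim n)
      have "perm_avg n (\<lambda>\<tau>. of_bool (hit s j m \<tau> M) :: real) \<le> perm_avg n (\<lambda>\<tau>. of_bool (\<tau> ` {1..m} \<inter> S \<noteq> {}))"
        by (rule perm_avg_mono) (use imp in simp)
      also have "\<dots> \<le> real (m * card S) / n" using perm_avg_hit_le[OF assms(1) elim, of m] by simp
      finally show ?case using perm_avg_nonneg[of n "\<lambda>\<tau>. of_bool (hit s j m \<tau> M)"] by simp
    qed
    show "(\<lambda>n. real (m * card S) / n) \<longlonglongrightarrow> 0" by (rule lim_const_over_n)
  qed
  then show ?thesis unfolding dense_def by blast
qed

context exchangeable_rate
begin

lemma sets_hit: "j < length L \<Longrightarrow> {M \<in> structures L NN. hit s j m \<tau> M} \<in> sets (SB L)"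
  by (rule sets_fin_det[OF fin_det_hit])

text \<open>
  A hit concerns at most \<open>q\<close> labels, which exchangeability moves into \<open>[q]\<close>.
\<close>

lemma emeasure_hit_le:
  assumes j: "j < length L" and s: "s \<in> nat_multisets" and \<tau>: "\<tau> permutes NN"
    and q: "card (set_mset s) + m \<le> q"
  shows "emeasure \<mu> {M \<in> structures L NN. hit s j m \<tau> M}
    \<le> emeasure \<mu> {M \<in> structures L NN. restr {1..q} M \<noteq> zero_struct L}"
proof -
  let ?F = "set_mset s \<union> \<tau> ` {1..m}" and ?B = "{M \<in> structures L NN. restr {1..q} M \<noteq> zero_struct L}"
  have "\<tau> ` {1..m} \<subseteq> NN" by (rule permutes_NN_image[OF \<tau>]) auto
  then have F: "finite ?F" "?F \<subseteq> NN" using s by (auto simp: nat_multisets_def)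
  have "card ?F \<le> q"
    using card_Un_le[of "set_mset s" "\<tau> ` {1..m}"] card_image_le[of "{1..m}" \<tau>] q by simp
  obtain \<sigma> N where \<sigma>: "\<sigma> permutes {1..N}" "\<sigma> ` {1..card ?F} = ?F" using permutation_onto_block[OF F] by blast
  have \<sigma>N: "\<sigma> permutes NN" by (rule permutes_NN[OF \<sigma>(1)])
  have B: "?B \<in> sets (SB L)" by (rule sets_fin_det[OF fin_det_restr[where R = "\<lambda>N. N \<noteq> zero_struct L"]])
  have "{M \<in> structures L NN. hit s j m \<tau> M} \<subseteq> {M \<in> structures L NN. relabel L NN \<sigma> M \<in> ?B}"
  proof
    fix M assume "M \<in> {M \<in> structures L NN. hit s j m \<tau> M}"
    then have M: "M \<in> structures L NN" and "hit s j m \<tau> M" by auto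
    then obtain a where a: "a \<in> M ! j" "s \<subseteq># mset a" "set_mset (mset a - s) \<subseteq> \<tau> ` {1..m}"
      unfolding hit_def by blast
    have "mset a = s + (mset a - s)" using a(2) by simp
    then have "set a = set_mset s \<union> set_mset (mset a - s)" by (metis set_mset_mset set_mset_union)
    then have aF: "set a \<subseteq> \<sigma> ` {1..card ?F}" unfolding \<sigma>(2) using a(3) by blast
    define b where "b = map (inv \<sigma>) a"
    have b: "map \<sigma> b = a" unfolding b_def map_map by (rule map_idI) (simp add: permutes_inverses(1)[OF \<sigma>N])
    have "inv \<sigma> ` \<sigma> ` {1..card ?F} = {1..card ?F}"
      unfolding image_comp permutes_inv_o(2)[OF \<sigma>N] by simp
    then have "set b \<subseteq> {1..card ?F}" unfolding b_def set_map using image_mono[OF aF, of "inv \<sigma>"] by simp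
    then have bq: "set b \<subseteq> {1..q}" using \<open>card ?F \<le> q\<close> by (meson atLeastatMost_subset_iff order_trans order_refl)
    have "length b = L ! j" using nth_structures[OF M j] a(1) by (auto simp: tuples_def b_def)
    then have "b \<in> relabel L {1..q} \<sigma> M ! j" using j b bq a(1) by (simp add: tuples_def)
    then have "relabel L {1..q} \<sigma> M ! j \<noteq> zero_struct L ! j" using j by (metis empty_iff nth_zero_struct)
    then have "relabel L {1..q} \<sigma> M \<noteq> zero_struct L" by metis
    then show "M \<in> {M \<in> structures L NN. relabel L NN \<sigma> M \<in> ?B}" using M by (simp add: restr_relabel_nat)
  qed
  then have "emeasure \<mu> {M \<in> structures L NN. hit s j m \<tau> M} \<le> emeasure \<mu> {M \<in> structures L NN. relabel L NN \<sigma> M \<in> ?B}"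
    by (rule emeasure_mono) (use measurable_sets[OF measurable_relabel[OF \<sigma>N] B] in \<open>simp add: sets_\<mu> vimage_def Int_def conj_commute\<close>)
  also have "\<dots> = emeasure \<mu> ?B" by (rule emeasure_relabel[OF \<sigma>N B])
  finally show ?thesis .
qed

definition hit_liminf :: "nat multiset \<Rightarrow> nat \<Rightarrow> nat \<Rightarrow> struc \<Rightarrow> ennreal" where
  "hit_liminf s j m M = liminf (\<lambda>n. ennreal (perm_avg n (\<lambda>\<tau>. of_bool (hit s j m \<tau> M))))"

lemma measurable_hit_liminf:
  "j < length L \<Longrightarrow> hit_liminf s j m \<in> borel_measurable (SB L)"
  unfolding hit_liminf_def by (intro borel_measurable_liminf measurable_compose[OF measurable_avg_hit measurable_ennreal])

text \<open>
  By Fatou's lemma.  In combination with Markov's inequality, it makes \<open>s\<close> dense only on a countable union of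
  events of finite measure.
\<close>

lemma nn_integral_hit_liminf:
  assumes j: "j < length L" and s: "s \<in> nat_multisets"
  shows "(\<integral>\<^sup>+M. hit_liminf s j m M \<partial>\<mu>) < \<infinity>"
proof -
  let ?q = "Suc (card (set_mset s) + m)"
  let ?C = "emeasure \<mu> {M \<in> structures L NN. restr {1..?q} M \<noteq> zero_struct L}"
  have "(\<integral>\<^sup>+M. hit_liminf s j m M \<partial>\<mu>) \<le> liminf (\<lambda>n. \<integral>\<^sup>+M. ennreal (perm_avg n (\<lambda>\<tau>. of_bool (hit s j m \<tau> M))) \<partial>\<mu>)"
    unfolding hit_liminf_def
    by (rule nn_integral_liminf) (simp add: measurable_\<mu> measurable_compose[OF measurable_avg_hit[OF j] measurable_ennreal])
  also have "\<dots> \<le> limsup (\<lambda>n. \<integral>\<^sup>+M. ennreal (perm_avg n (\<lambda>\<tau>. of_bool (hit s j m \<tau> M))) \<partial>\<mu>)"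
    by (rule Liminf_le_Limsup) simp
  also have "\<dots> \<le> ?C"
  proof (rule Limsup_bounded[OF always_eventually], rule allI, rule nn_integral_perm_avg_le)
    fix n :: nat and \<tau> :: "nat \<Rightarrow> nat" assume \<tau>: "\<tau> permutes {1..n}"
    show "{M \<in> space \<mu>. hit s j m \<tau> M} \<in> sets \<mu>" using sets_hit[OF j] by (simp add: space_\<mu> sets_\<mu>)
    show "emeasure \<mu> {M \<in> space \<mu>. hit s j m \<tau> M} \<le> ?C"
      unfolding space_\<mu> by (rule emeasure_hit_le[OF j s permutes_NN[OF \<tau>]]) simp
  qed
  also have "\<dots> < \<infinity>" by (rule finite_nonzero) simp
  finally show ?thesis .
qed

lemma hit_relabel_fixed:
  assumes "\<sigma> permutes NN" "\<And>i. i \<in># s \<Longrightarrow> \<sigma> i = i" "j < length L" "M \<in> structures L NN"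
  shows "hit s j m \<tau> (relabel L NN \<sigma> M) = hit s j m (\<sigma> \<circ> \<tau>) M"
  using hit_relabel[OF assms(1,3,4), of s] image_mset_fixed[of s \<sigma>] assms(2) by simp

lemma hit_liminf_relabel:
  assumes "\<sigma> permutes {1..N}" "\<And>i. i \<in># s \<Longrightarrow> \<sigma> i = i" "j < length L" "M \<in> structures L NN"
  shows "hit_liminf s j m (relabel L NN \<sigma> M) = hit_liminf s j m M"
  unfolding hit_liminf_def
proof (rule Liminf_eq)
  have e: "hit s j m \<tau> (relabel L NN \<sigma> M) = hit s j m (\<sigma> \<circ> \<tau>) M" for \<tau>
    by (rule hit_relabel_fixed) (use assms permutes_NN in auto)
  show "\<forall>\<^sub>F n in sequentially. ennreal (perm_avg n (\<lambda>\<tau>. of_bool (hit s j m \<tau> (relabel L NN \<sigma> M))))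
      = ennreal (perm_avg n (\<lambda>\<tau>. of_bool (hit s j m \<tau> M)))"
    unfolding e using perm_avg_finite_relabel[OF assms(1), of "\<lambda>\<tau>. of_bool (hit s j m \<tau> M)"]
    by eventually_elim simp
qed

lemma AE_hit_convergent:
  assumes j: "j < length L"
  shows "AE M in \<mu>. convergent (\<lambda>n. perm_avg n (\<lambda>\<tau>. of_bool (hit s j m \<tau> M) :: real))"
proof (rule AE_\<mu>_convergent[of "set_mset s" m "\<lambda>\<tau> M. of_bool (hit s j m \<tau> M)"])
  show "depends_on m (\<lambda>\<tau>. of_bool (hit s j m \<tau> M) :: real)" for M by (rule depends_on_hit)
  fix \<tau> :: "nat \<Rightarrow> nat"
  have [measurable]: "Measurable.pred (SB L) (hit s j m \<tau>)" by (rule pred_fin_det[OF fin_det_hit[OF j]])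
  show "(\<lambda>M. of_bool (hit s j m \<tau> M) :: real) \<in> borel_measurable (SB L)" by measurable
  fix \<sigma> N M assume "\<sigma> permutes {1..N}" "\<And>i. i \<in># s \<Longrightarrow> \<sigma> i = i" "M \<in> structures L NN"
  then show "of_bool (hit s j m \<tau> (relabel L NN \<sigma> M)) = (of_bool (hit s j m (\<sigma> \<circ> \<tau>) M) :: real)"
    by (simp add: hit_relabel_fixed[OF permutes_NN _ j])
qed auto

text \<open>
  On such an event the mean density of a pattern is its probability at any fixed place outside \<open>S\<close>.  If the
  density is zero, the pattern does not occur at all.
\<close>

lemma AE_no_tuple:
  assumes G: "G \<in> sets (SB L)" "emeasure \<mu> G < \<infinity>" and S: "finite S"
    and inv: "\<And>\<sigma> N M. \<sigma> permutes {1..N} \<Longrightarrow> (\<And>i. i \<in> S \<Longrightarrow> \<sigma> i = i) \<Longrightarrow> M \<in> structures L NN \<Longrightarrow>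
      relabel L NN \<sigma> M \<in> G \<longleftrightarrow> M \<in> G"
    and t: "set_mset t \<subseteq> S" and nd: "\<And>M. M \<in> G \<Longrightarrow> \<not> dense L t M"
    and a: "filter_mset (\<lambda>x. x \<in> S) (mset a) = t" "set a \<subseteq> NN" and j: "j < length L"
  shows "AE M in \<mu>. M \<in> G \<longrightarrow> a \<notin> M ! j"
proof -
  define F where "F = set a - S"
  define m where "m = card F"
  let ?h = "\<lambda>\<tau> M. of_bool (hit t j m \<tau> M) :: real"
  let ?\<rho> = "density \<mu> (indicator G)"
  have F: "finite F" "F \<subseteq> NN" using a(2) by (auto simp: F_def)
  obtain \<tau> N where \<tau>: "\<tau> permutes {1..N}" "\<tau> ` {1..m} = F" using permutation_onto_block[OF F] by (auto simp: m_def)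
  have pm: "Measurable.pred (SB L) (hit t j m \<pi>)" for \<pi> by (rule pred_fin_det[OF fin_det_hit[OF j]])
  interpret equivariant_sample L ?\<rho> S m ?h
  proof (rule restricted_sample[OF G S inv])
    show "depends_on m (\<lambda>\<tau>. ?h \<tau> M)" for M by (rule depends_on_hit)
    show "?h \<pi> \<in> borel_measurable (SB L)" for \<pi>
      using pm[of \<pi>] by measurable
    show "?h \<pi> (relabel L NN \<sigma> M) = ?h (\<sigma> \<circ> \<pi>) M"
      if "\<sigma> permutes {1..N}" "\<And>i. i \<in> S \<Longrightarrow> \<sigma> i = i" "M \<in> structures L NN" for \<sigma> N \<pi> M
    proof -
      have "hit t j m \<pi> (relabel L NN \<sigma> M) = hit t j m (\<sigma> \<circ> \<pi>) M"
        using that t by (intro hit_relabel_fixed[OF permutes_NN[OF that(1)] _ j]) auto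
      then show ?thesis by simp
    qed
  qed auto
  have "AE M in ?\<rho>. (\<lambda>n. perm_avg n (\<lambda>\<tau>. ?h \<tau> M)) \<longlonglongrightarrow> 0"
  proof -
    have m1: "(indicator G :: struc \<Rightarrow> ennreal) \<in> borel_measurable \<mu>" using G(1) sets_\<mu> by simp
    have "(\<lambda>n. perm_avg n (\<lambda>\<tau>. ?h \<tau> M)) \<longlonglongrightarrow> 0" if "M \<in> G" for M
      using nd[OF that] j unfolding dense_def by blast
    moreover have "M \<in> G" if "0 < (indicator G M :: ennreal)" for M
      using that by (cases "M \<in> G") auto
    ultimately show ?thesis unfolding AE_density[OF m1] by (intro AE_I2 impI) blast
  qed
  from integral_h_eq_limit[OF permutes_NN[OF \<tau>(1)] _ _ this] \<tau>(2)
  have "(\<integral>M. ?h \<tau> M \<partial>?\<rho>) = 0" by (auto simp: F_def)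
  then have "AE M in ?\<rho>. ?h \<tau> M = 0"
    by (subst (asm) integral_nonneg_eq_0_iff_AE) (auto intro!: integrable_h permutes_NN[OF \<tau>(1)])
  from AE_restricted[OF G(1) this] show ?thesis
  proof eventually_elim
    case (elim M)
    show ?case
    proof (intro impI notI)
      assume M: "M \<in> G" "a \<in> M ! j"
      have "mset a = filter_mset (\<lambda>x. x \<in> S) (mset a) + filter_mset (\<lambda>x. x \<notin> S) (mset a)"
        by (rule multiset_partition)
      then have e: "mset a = t + filter_mset (\<lambda>x. x \<notin> S) (mset a)" using a(1) by simp
      then have "mset a - t = filter_mset (\<lambda>x. x \<notin> S) (mset a)" by (metis add_diff_cancel_left')
      then have "set_mset (mset a - t) \<subseteq> \<tau> ` {1..m}" unfolding \<tau>(2) by (auto simp: F_def)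
      moreover have "t \<subseteq># mset a" using e by (metis mset_subset_eq_add_left)
      ultimately have "hit t j m \<tau> M" using M(2) unfolding hit_def by blast
      then show False using elim M(1) by simp
    qed
  qed
qed

text \<open>
  Assume that \<open>s\<close> is dense, but not the part of \<open>s'\<close> supported by \<open>s\<close>.  This event splits into countably many of
  finite measure that depend on no label outside \<open>s\<close>, and by \<open>AE_no_tuple\<close> no tuple has exactly this part in
  common with \<open>s\<close>.  Then almost every sample misses \<open>s'\<close>.
\<close>

lemma AE_dense_restrict:
  assumes s: "s \<in> nat_multisets"
  shows "AE M in \<mu>. dense L s M \<and> dense L s' M \<longrightarrow> dense L (filter_mset (\<lambda>x. x \<in># s) s') M"
proof -
  let ?t = "filter_mset (\<lambda>x. x \<in># s) s'"
  define G where "G j m k = {M \<in> structures L NN. hit_liminf s j m M \<ge> ennreal (1 / Suc k) \<and> \<not> dense L ?t M}" for j m k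
  have *: "AE M in \<mu>. M \<in> G j m k \<longrightarrow> \<not> dense L s' M" if j: "j < length L" for j m k
  proof -
    note [measurable] = measurable_hit_liminf[OF j, of s m]
    have "{M \<in> space (SB L). hit_liminf s j m M \<ge> ennreal (1 / Suc k) \<and> \<not> dense L ?t M} \<in> sets (SB L)"
      by measurable
    then have Gs: "G j m k \<in> sets (SB L)" unfolding G_def by simp
    have fin: "emeasure \<mu> (G j m k) < \<infinity>"
    proof -
      have mv: "hit_liminf s j m \<in> borel_measurable \<mu>" unfolding measurable_\<mu> by (rule measurable_hit_liminf[OF j])
      have sub: "{M \<in> space \<mu>. 1 \<le> ennreal (real (Suc k)) * hit_liminf s j m M} \<in> sets \<mu>" using mv by measurable
      have "emeasure \<mu> (G j m k) \<le> emeasure \<mu> {M \<in> space \<mu>. 1 \<le> ennreal (real (Suc k)) * hit_liminf s j m M}"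
      proof (rule emeasure_mono[OF _ sub])
        show "G j m k \<subseteq> {M \<in> space \<mu>. 1 \<le> ennreal (real (Suc k)) * hit_liminf s j m M}"
        proof
          fix M assume M: "M \<in> G j m k"
          have "1 = ennreal (real (Suc k)) * ennreal (1 / Suc k)" by (simp add: ennreal_mult[symmetric] del: of_nat_Suc)
          also have "\<dots> \<le> ennreal (real (Suc k)) * hit_liminf s j m M" using M by (intro mult_left_mono) (auto simp: G_def)
          finally show "M \<in> {M \<in> space \<mu>. 1 \<le> ennreal (real (Suc k)) * hit_liminf s j m M}"
            using M by (simp add: G_def space_\<mu>)
        qed
      qed
      also have "\<dots> \<le> ennreal (real (Suc k)) * (\<integral>\<^sup>+M. hit_liminf s j m M \<partial>\<mu>)"
      proof -
        have "emeasure \<mu> {M \<in> space \<mu>. 1 \<le> ennreal (real (Suc k)) * hit_liminf s j m M}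
          \<le> ennreal (real (Suc k)) * (\<integral>\<^sup>+M. hit_liminf s j m M * indicator (space \<mu>) M \<partial>\<mu>)"
          by (rule nn_integral_Markov_inequality) (use mv in measurable)
        also have "(\<integral>\<^sup>+M. hit_liminf s j m M * indicator (space \<mu>) M \<partial>\<mu>) = (\<integral>\<^sup>+M. hit_liminf s j m M \<partial>\<mu>)"
          by (rule nn_integral_cong) simp
        finally show ?thesis .
      qed
      also have "\<dots> < \<infinity>" using nn_integral_hit_liminf[OF j s, of m] by (simp add: ennreal_mult_less_top)
      finally show ?thesis .
    qed
    have inv: "relabel L NN \<sigma> M \<in> G j m k \<longleftrightarrow> M \<in> G j m k"
      if "\<sigma> permutes {1..N}" "\<And>i. i \<in> set_mset s \<Longrightarrow> \<sigma> i = i" "M \<in> structures L NN" for \<sigma> N M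
    proof -
      have "image_mset \<sigma> ?t = ?t" by (rule image_mset_fixed) (use that(2) in auto)
      then have "dense L ?t (relabel L NN \<sigma> M) = dense L ?t M"
        using dense_relabel[OF permutes_NN[OF that(1)] finite_perm_displacement[OF that(1)] that(3), of ?t] by simp
      then show ?thesis using hit_liminf_relabel[OF that(1) _ j that(3), of s m] that(2,3) by (simp add: G_def)
    qed
    have nd: "\<not> dense L ?t M" if "M \<in> G j m k" for M using that by (simp add: G_def)
    have "AE M in \<mu>. \<forall>a. \<forall>j'. j' < length L \<longrightarrow> set a \<subseteq> NN \<longrightarrow> filter_mset (\<lambda>x. x \<in># s) (mset a) = ?t \<longrightarrow>
        M \<in> G j m k \<longrightarrow> a \<notin> M ! j'"
      unfolding AE_all_countable
    proof (intro allI)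
      fix a j'
      show "AE M in \<mu>. j' < length L \<longrightarrow> set a \<subseteq> NN \<longrightarrow> filter_mset (\<lambda>x. x \<in># s) (mset a) = ?t \<longrightarrow>
        M \<in> G j m k \<longrightarrow> a \<notin> M ! j'"
      proof (cases "j' < length L \<and> set a \<subseteq> NN \<and> filter_mset (\<lambda>x. x \<in># s) (mset a) = ?t")
        case True
        have "AE M in \<mu>. M \<in> G j m k \<longrightarrow> a \<notin> M ! j'"
          by (rule AE_no_tuple[OF Gs fin _ inv _ nd]) (use True in auto)
        then show ?thesis by eventually_elim simp
      qed auto
    qed
    then show ?thesis
    proof eventually_elim
      case (elim M)
      show ?case
      proof
        assume M: "M \<in> G j m k"
        then have Ms: "M \<in> structures L NN" by (simp add: G_def)
        show "\<not> dense L s' M"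
        proof (rule not_dense_if_no_tuple[of "set_mset s"])
          fix j' a assume "j' < length L" "a \<in> M ! j'"
          then show "filter_mset (\<lambda>x. x \<in># s) (mset a) \<noteq> ?t"
            using elim M nth_structures[OF Ms, of j'] by (auto simp: tuples_def)
        qed simp
      qed
    qed
  qed
  have "AE M in \<mu>. \<forall>j\<in>{..<length L}. \<forall>m k. M \<in> G j m k \<longrightarrow> \<not> dense L s' M"
    by (intro AE_finite_allI AE_all_countable[THEN iffD2] allI) (use * in auto)
  moreover have "AE M in \<mu>. \<forall>j\<in>{..<length L}. \<forall>m. convergent (\<lambda>n. perm_avg n (\<lambda>\<tau>. of_bool (hit s j m \<tau> M) :: real))"
    by (intro AE_finite_allI AE_all_countable[THEN iffD2] allI) (use AE_hit_convergent in auto)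
  ultimately show ?thesis using AE_\<mu>_structure
  proof eventually_elim
    case (elim M)
    show ?case
    proof (intro impI; rule ccontr)
      assume d: "dense L s M \<and> dense L s' M" and nt: "\<not> dense L ?t M"
      then obtain j m where j: "j < length L" and n0: "\<not> (\<lambda>n. perm_avg n (\<lambda>\<tau>. of_bool (hit s j m \<tau> M) :: real)) \<longlonglongrightarrow> 0"
        unfolding dense_def by blast
      obtain l where l: "(\<lambda>n. perm_avg n (\<lambda>\<tau>. of_bool (hit s j m \<tau> M) :: real)) \<longlonglongrightarrow> l"
        using elim(2) j by (auto simp: convergent_def)
      have "0 \<le> l" by (rule LIMSEQ_le_const[OF l]) (auto intro!: perm_avg_nonneg)
      moreover have "l \<noteq> 0" using l n0 by blast
      ultimately have "0 < l" by simp
      then obtain k where k: "1 / real (Suc k) < l" using nat_approx_posE by blast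
      have "hit_liminf s j m M = ennreal l"
        unfolding hit_liminf_def by (intro lim_imp_Liminf tendsto_ennrealI l) simp
      then have "M \<in> G j m k" using k nt elim(3) by (simp add: G_def ennreal_leI)
      then show False using elim(1) j d by blast
    qed
  qed
qed

text \<open>
  The supports of dense multisets are closed under intersection, so one that is minimal in cardinality is
  contained in all others.  If the empty multiset is not dense, it has an element, and this belongs to all
  dense multisets.
\<close>

theorem AE_index:
  "AE M in \<mu>. \<not> dense L {#} M \<longrightarrow> (\<exists>s. s \<noteq> {#} \<and> is_index L M s)"
proof -
  have "AE M in \<mu>. \<forall>xs ys. mset xs \<in> nat_multisets \<longrightarrow> dense L (mset xs) M \<and> dense L (mset ys) M \<longrightarrow>
      dense L (filter_mset (\<lambda>x. x \<in># mset xs) (mset ys)) M"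
    unfolding AE_all_countable
  proof (intro allI)
    fix xs ys :: "nat list"
    show "AE M in \<mu>. mset xs \<in> nat_multisets \<longrightarrow> dense L (mset xs) M \<and> dense L (mset ys) M \<longrightarrow>
      dense L (filter_mset (\<lambda>x. x \<in># mset xs) (mset ys)) M"
    proof (cases "mset xs \<in> nat_multisets")
      case True
      from AE_dense_restrict[OF True, of "mset ys"] show ?thesis by eventually_elim simp
    qed simp
  qed
  with AE_\<mu>_structure show ?thesis
  proof eventually_elim
    case (elim M)
    then have M: "M \<in> structures L NN" "M \<noteq> zero_struct L" by auto
    have cl: "dense L (filter_mset (\<lambda>x. x \<in># s) s') M" if "dense L s M" "dense L s' M" for s s'
      using elim(2) that dense_in(1)[OF that(1) M(1)] ex_mset[of s] ex_mset[of s'] by metis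
    show ?case
    proof
      assume n0: "\<not> dense L {#} M"
      have "\<exists>j<length L. M ! j \<noteq> {}" using M eq_zero_iff[OF length_structures[OF M(1)]] by blast
      then obtain s0 where "dense L s0 M" using dense_of_mem by blast
      then obtain s1 where s1: "dense L s1 M" "\<And>s. dense L s M \<Longrightarrow> card (set_mset s1) \<le> card (set_mset s)"
        using ex_has_least_nat[of "\<lambda>s. dense L s M" s0 "\<lambda>s. card (set_mset s)"] by blast
      have sub: "set_mset s1 \<subseteq> set_mset s'" if "dense L s' M" for s'
      proof -
        let ?t = "filter_mset (\<lambda>x. x \<in># s1) s'"
        have "card (set_mset s1) \<le> card (set_mset ?t)" by (rule s1(2)[OF cl[OF s1(1) that]])
        moreover have "set_mset ?t \<subseteq> set_mset s1" by auto
        ultimately have "set_mset ?t = set_mset s1" by (intro card_seteq) auto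
        then show ?thesis by auto
      qed
      have "s1 \<noteq> {#}" using s1(1) n0 by auto
      then obtain x where x: "x \<in># s1" by blast
      have i: "is_index L M (Inf {s'. dense L s' M})" by (rule is_index_ex[OF s1(1)])
      have "{#x#} \<subseteq># Inf {s'. dense L s' M}"
      proof -
        have "{#x#} \<subseteq># s'" if "dense L s' M" for s' using sub[OF that] x by auto
        then show ?thesis using i unfolding is_index_def by blast
      qed
      then have "Inf {s'. dense L s' M} \<noteq> {#}" by auto
      then show "\<exists>s. s \<noteq> {#} \<and> is_index L M s" using i by blast
    qed
  qed
qed

end

section \<open>The Borel sets of the space of limits\<close>

lemma space_ergodic_borel [simp]: "space (ergodic_borel L) = ergodic_measures L"
proof -
  interpret Metric_space "ergodic_measures L" "limit_dist L" by (rule Metric_space_ergodic)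
  show ?thesis by (simp add: ergodic_borel_def borel_sigma_def space_measure_of_conv)
qed

lemma sets_ergodic_borel:
  "sets (ergodic_borel L) = sigma_sets (ergodic_measures L)
     {U. openin (Metric_space.mtopology (ergodic_measures L) (limit_dist L)) U}"
proof -
  interpret Metric_space "ergodic_measures L" "limit_dist L" by (rule Metric_space_ergodic)
  have "{U. openin mtopology U} \<subseteq> Pow (ergodic_measures L)" using openin_subset by fastforce
  then show ?thesis by (simp add: ergodic_borel_def borel_sigma_def)
qed

lemma ergodicD:
  assumes "W \<in> ergodic_measures L"
  shows "prob_space W" "sets W = sets (SB L)" "exchangeable_measure L W" "dissociated L W"
  using assms by (simp_all add: ergodic_measures_def)

definition level_dist :: "nat list \<Rightarrow> nat \<Rightarrow> struc measure \<Rightarrow> struc measure \<Rightarrow> real" where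
  "level_dist L n W W' = (\<Sum>A \<in> structures L {1..n}. \<bar>measure W (cylinder L n A) - measure W' (cylinder L n A)\<bar>)"

lemma limit_dist_levels: "limit_dist L W W' = (\<Sum>\<^sub>\<infinity>n\<in>{1..}. (1/2)^n * level_dist L n W W')"
  by (simp add: limit_dist_def level_dist_def)

lemma level_dist_nonneg: "0 \<le> level_dist L n W W'"
  unfolding level_dist_def by (intro sum_nonneg) auto

lemma level_summable:
  "W \<in> ergodic_measures L \<Longrightarrow> W' \<in> ergodic_measures L \<Longrightarrow> (\<lambda>n. (1/2)^n * level_dist L n W W') summable_on {1..}"
  unfolding level_dist_def by (intro limit_dist_summand ergodicD)

lemma sum_cylinders_le:
  assumes "W \<in> ergodic_measures L" shows "(\<Sum>A \<in> structures L {1..n}. measure W (cylinder L n A)) \<le> 1"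
proof -
  interpret prob_space W by (rule ergodicD[OF assms])
  have "(\<Sum>A \<in> structures L {1..n}. measure W (cylinder L n A)) = measure W (\<Union>A \<in> structures L {1..n}. cylinder L n A)"
    by (intro finite_measure_finite_Union[symmetric] finite_structures)
       (auto simp: disjoint_family_on_def cylinder_def[abs_def] ergodicD(2)[OF assms] sets_cylinder[unfolded cylinder_def])
  then show ?thesis by simp
qed

lemma level_dist_le_2:
  assumes "W \<in> ergodic_measures L" "W' \<in> ergodic_measures L" shows "level_dist L n W W' \<le> 2"
proof -
  have "level_dist L n W W' \<le> (\<Sum>A \<in> structures L {1..n}. measure W (cylinder L n A) + measure W' (cylinder L n A))"
    unfolding level_dist_def
  proof (rule sum_mono)
    fix A
    show "\<bar>measure W (cylinder L n A) - measure W' (cylinder L n A)\<bar> \<le> measure W (cylinder L n A) + measure W' (cylinder L n A)"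
      using measure_nonneg[of W "cylinder L n A"] measure_nonneg[of W' "cylinder L n A"] by linarith
  qed
  also have "\<dots> \<le> 2" using sum_cylinders_le[OF assms(1), of n] sum_cylinders_le[OF assms(2), of n]
    by (simp add: sum.distrib)
  finally show ?thesis .
qed

lemma cylinder_le_limit_dist:
  assumes W: "W \<in> ergodic_measures L" "W' \<in> ergodic_measures L" and n: "1 \<le> n" and A: "A \<in> structures L {1..n}"
  shows "\<bar>measure W (cylinder L n A) - measure W' (cylinder L n A)\<bar> \<le> 2^n * limit_dist L W W'"
proof -
  have "\<bar>measure W (cylinder L n A) - measure W' (cylinder L n A)\<bar> \<le> level_dist L n W W'"
    unfolding level_dist_def by (rule member_le_sum[OF A]) (auto intro: finite_structures)
  moreover have "(\<Sum>k\<in>{n}. (1/2)^k * level_dist L k W W') \<le> limit_dist L W W'"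
    unfolding limit_dist_levels
    by (rule finite_sum_le_infsum[OF level_summable[OF W]]) (use n level_dist_nonneg in auto)
  then have "level_dist L n W W' \<le> 2^n * limit_dist L W W'"
    by (simp add: power_divide field_simps)
  ultimately show ?thesis by linarith
qed

text \<open>
  The tail of the series is at most geometric, so finitely many cylinder probabilities control the distance.
\<close>

lemma limit_dist_le_levels:
  assumes W: "W \<in> ergodic_measures L" "W' \<in> ergodic_measures L"
  shows "limit_dist L W W' \<le> (\<Sum>l\<in>{1..n}. level_dist L l W W') + 2 * (1/2)^n"
proof -
  let ?f = "\<lambda>l. (1/2::real)^l * level_dist L l W W'"
  have un: "{1..} = {1..n} \<union> {n<..}" by auto
  have s: "?f summable_on {1..}" by (rule level_summable[OF W])
  have s2: "?f summable_on {n<..}" by (rule summable_on_subset[OF s]) auto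
  have g: "((\<lambda>l. (1/2::real)^l) has_sum 1) {1..}" using has_sum_geometric_from_1[of "1/2::real"] by simp
  have reidx: "{n<..} = (\<lambda>l. l + n) ` {1..}"
  proof
    show "{n<..} \<subseteq> (\<lambda>l. l + n) ` {1..}"
    proof
      fix x assume "x \<in> {n<..}"
      then show "x \<in> (\<lambda>l. l + n) ` {1..}" by (intro image_eqI[of _ _ "x - n"]) auto
    qed
  qed auto
  have h: "((\<lambda>l. 2 * (1/2::real)^l) has_sum (2 * (1/2)^n)) {n<..}"
    unfolding reidx
  proof (subst has_sum_reindex)
    have "((\<lambda>l. (2 * (1/2)^n) * (1/2::real)^l) has_sum (2 * (1/2)^n * 1)) {1..}" by (rule has_sum_cmult_right[OF g])
    then show "((\<lambda>l. 2 * (1/2::real)^l) \<circ> (\<lambda>l. l + n) has_sum (2 * (1/2)^n)) {1..}"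
      by (simp add: comp_def power_add mult_ac)
  qed (auto simp: inj_on_def)
  have "limit_dist L W W' = infsum ?f {1..n} + infsum ?f {n<..}"
    unfolding limit_dist_levels un by (rule infsum_Un_disjoint[OF _ s2]) auto
  also have "infsum ?f {n<..} \<le> infsum (\<lambda>l. 2 * (1/2::real)^l) {n<..}"
  proof (rule infsum_mono[OF s2 has_sum_imp_summable[OF h]])
    fix l show "?f l \<le> 2 * (1/2)^l"
      using mult_left_mono[OF level_dist_le_2[OF W, of l], of "(1/2)^l"] by (simp add: mult.commute)
  qed
  also have "\<dots> = 2 * (1/2)^n" by (rule infsumI[OF h])
  also have "infsum ?f {1..n} \<le> (\<Sum>l\<in>{1..n}. level_dist L l W W')"
  proof -
    have "(1/2::real)^l * level_dist L l W W' \<le> level_dist L l W W'" for l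
      using mult_right_mono[OF power_le_one[of "1/2::real" l] level_dist_nonneg] by simp
    then show ?thesis by (simp add: sum_mono)
  qed
  finally show ?thesis by simp
qed

lemma measurable_eval_cylinder:
  assumes n: "1 \<le> n" and A: "A \<in> structures L {1..n}"
  shows "(\<lambda>W. measure W (cylinder L n A)) \<in> borel_measurable (ergodic_borel L)"
proof (rule borel_measurableI)
  interpret Metric_space "ergodic_measures L" "limit_dist L" by (rule Metric_space_ergodic)
  fix U :: "real set" assume U: "open U"
  let ?V = "(\<lambda>W. measure W (cylinder L n A)) -` U \<inter> space (ergodic_borel L)"
  have "openin mtopology ?V"
    unfolding openin_mtopology
  proof (intro conjI allI impI)
    show "?V \<subseteq> ergodic_measures L" by simp
    fix W assume W: "W \<in> ?V"
    then obtain e where e: "e > 0" "\<And>y. dist y (measure W (cylinder L n A)) < e \<Longrightarrow> y \<in> U"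
      using U unfolding open_dist by auto
    show "\<exists>r>0. mball W r \<subseteq> ?V"
    proof (intro exI[of _ "e / 2^n"] conjI subsetI)
      fix W' assume W': "W' \<in> mball W (e / 2^n)"
      then have W'': "W \<in> ergodic_measures L" "W' \<in> ergodic_measures L" "limit_dist L W W' < e / 2^n" by auto
      have "\<bar>measure W (cylinder L n A) - measure W' (cylinder L n A)\<bar> \<le> 2^n * limit_dist L W W'"
        by (rule cylinder_le_limit_dist[OF W''(1,2) n A])
      also have "\<dots> < e" using W''(3) by (simp add: field_simps)
      finally have "measure W' (cylinder L n A) \<in> U" by (intro e(2)) (simp add: dist_real_def abs_minus_commute)
      then show "W' \<in> ?V" using W''(2) by simp
    qed (use e in simp)
  qed
  then show "?V \<in> sets (ergodic_borel L)" unfolding sets_ergodic_borel by (intro sigma_sets.Basic) simp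
qed

text \<open>
  The neighbourhoods given by finitely many cylinder probabilities with rational centres and radii of the form
  \<open>1/(k + 1)\<close> are a countable base, and their preimages are measurable.
\<close>

lemma measurable_ergodic_borelI:
  assumes f: "\<And>x. x \<in> space N \<Longrightarrow> f x \<in> ergodic_measures L"
    and m: "\<And>n A. 1 \<le> n \<Longrightarrow> A \<in> structures L {1..n} \<Longrightarrow> (\<lambda>x. measure (f x) (cylinder L n A)) \<in> borel_measurable N"
  shows "f \<in> measurable N (ergodic_borel L)"
proof -
  interpret Metric_space "ergodic_measures L" "limit_dist L" by (rule Metric_space_ergodic)
  define I where "I n = Sigma {1..n} (\<lambda>l. structures L {1..l})" for n
  define ev where "ev W p = measure W (cylinder L (fst p) (snd p))" for W and p :: "nat \<times> struc"
  have fI: "finite (I n)" for n unfolding I_def by (intro finite_SigmaI) (auto intro: finite_structures)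
  define C where "C n = PiE (I n) (\<lambda>_. \<rat> :: real set)" for n
  have cC: "countable (C n)" for n unfolding C_def by (intro countable_PiE fI countable_rat)
  define Bs where "Bs n k c = {W \<in> ergodic_measures L. (\<Sum>p\<in>I n. \<bar>ev W p - c p\<bar>) < 1 / real (Suc k)}" for n k c
  have levels: "(\<Sum>l\<in>{1..n}. level_dist L l W W') = (\<Sum>p\<in>I n. \<bar>ev W p - ev W' p\<bar>)" for n W W'
    unfolding level_dist_def I_def ev_def by (subst sum.Sigma) (auto intro: finite_structures simp: case_prod_beta)
  have mB: "f -` Bs n k c \<inter> space N \<in> sets N" for n k c
  proof -
    have [measurable]: "(\<lambda>x. ev (f x) p) \<in> borel_measurable N" if "p \<in> I n" for p
      using that m[of "fst p" "snd p"] unfolding I_def ev_def by auto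
    have "(\<lambda>x. \<Sum>p\<in>I n. \<bar>ev (f x) p - c p\<bar>) \<in> borel_measurable N" by (intro borel_measurable_sum) measurable
    then have "{x \<in> space N. (\<Sum>p\<in>I n. \<bar>ev (f x) p - c p\<bar>) < 1 / real (Suc k)} \<in> sets N" by measurable
    also have "{x \<in> space N. (\<Sum>p\<in>I n. \<bar>ev (f x) p - c p\<bar>) < 1 / real (Suc k)} = f -` Bs n k c \<inter> space N"
      using f by (auto simp: Bs_def)
    finally show ?thesis .
  qed
  have cover: "\<exists>n k. \<exists>c\<in>C n. W \<in> Bs n k c \<and> Bs n k c \<subseteq> U" if U: "openin mtopology U" "W \<in> U" for U W
  proof -
    obtain r where r: "r > 0" "mball W r \<subseteq> U" and WE: "W \<in> ergodic_measures L" using U unfolding openin_mtopology by blast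
    obtain n where n: "(1/2::real)^n < r / 4" using real_arch_pow_inv[of "r / 4" "1/2"] r(1) by auto
    obtain k where k: "1 / real (Suc k) < r / 4" using nat_approx_posE[of "r / 4"] r(1) by auto
    \<comment> \<open>rational approximation up to \<open>d\<close> at every index keeps the sum below \<open>1/(k + 1)\<close>\<close>
    define d where "d = 1 / (real (Suc k) * (real (card (I n)) + 1))"
    have d: "d > 0" unfolding d_def by (simp add: add_pos_nonneg)
    have "\<exists>q\<in>\<rat>. \<bar>ev W p - q\<bar> < d" for p
    proof -
      obtain q where "q \<in> \<rat>" "ev W p - d < q" "q < ev W p + d"
        using Rats_dense_in_real[of "ev W p - d" "ev W p + d"] d by auto
      then show ?thesis by (intro bexI[of _ q]) auto
    qed
    then obtain q where q: "\<And>p. q p \<in> \<rat>" "\<And>p. \<bar>ev W p - q p\<bar> < d" by metis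
    define c where "c = restrict q (I n)"
    have c: "c \<in> C n" unfolding c_def C_def using q(1) by auto
    have "(\<Sum>p\<in>I n. \<bar>ev W p - c p\<bar>) \<le> (\<Sum>p\<in>I n. d)"
      using q(2) by (intro sum_mono) (auto simp: c_def intro: less_imp_le)
    also have "\<dots> < 1 / real (Suc k)"
      unfolding d_def by (simp add: field_simps del: of_nat_Suc) (simp add: add_pos_nonneg)
    finally have "W \<in> Bs n k c" using WE by (simp add: Bs_def)
    moreover have "Bs n k c \<subseteq> U"
    proof
      fix W' assume W': "W' \<in> Bs n k c"
      then have W'E: "W' \<in> ergodic_measures L" by (simp add: Bs_def)
      have "(\<Sum>p\<in>I n. \<bar>ev W p - ev W' p\<bar>) \<le> (\<Sum>p\<in>I n. \<bar>ev W p - c p\<bar> + \<bar>ev W' p - c p\<bar>)"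
        by (rule sum_mono) linarith
      also have "\<dots> < 2 / real (Suc k)"
        using \<open>W \<in> Bs n k c\<close> W' by (simp add: Bs_def sum.distrib del: of_nat_Suc)
      also have "\<dots> < r / 2" using k by (simp del: of_nat_Suc)
      finally have "limit_dist L W W' < r"
        using limit_dist_le_levels[OF WE W'E, of n] n unfolding levels by linarith
      then show "W' \<in> U" using r(2) WE W'E by auto
    qed
    ultimately show ?thesis using c by blast
  qed
  show ?thesis
  proof (rule measurable_sigma_sets[OF sets_ergodic_borel])
    show "{U. openin mtopology U} \<subseteq> Pow (ergodic_measures L)" using openin_subset by fastforce
    show "f \<in> space N \<rightarrow> ergodic_measures L" using f by blast
    fix U assume "U \<in> {U. openin mtopology U}"
    then have U: "openin mtopology U" by simp
    have "f -` U \<inter> space N = (\<Union>n. \<Union>k. \<Union>c\<in>{c \<in> C n. Bs n k c \<subseteq> U}. f -` Bs n k c \<inter> space N)"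
    proof (intro equalityI subsetI)
      fix x assume x: "x \<in> f -` U \<inter> space N"
      then obtain n k c where "c \<in> C n" "f x \<in> Bs n k c" "Bs n k c \<subseteq> U" using cover[OF U, of "f x"] by auto
      then show "x \<in> (\<Union>n. \<Union>k. \<Union>c\<in>{c \<in> C n. Bs n k c \<subseteq> U}. f -` Bs n k c \<inter> space N)"
        using x by blast
    qed auto
    also have "\<dots> \<in> sets N"
    proof (intro sets.countable_UN'' countableI_type mB)
      show "countable {c \<in> C n. Bs n k c \<subseteq> U}" for n k by (rule countable_subset[OF _ cC[of n]]) auto
    qed
    finally show "f -` U \<inter> space N \<in> sets N" .
  qed
qed

text \<open>
  The choice of the cylinders does not depend on the measure, which makes the value at a clopen event a
  measurable function of the measure.
\<close>

lemma measure_fin_det_cylinders: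
  assumes Q: "fin_det L Q"
  obtains n I where "n \<ge> 1" "I \<subseteq> structures L {1..n}"
    "\<And>W. prob_space W \<Longrightarrow> sets W = sets (SB L) \<Longrightarrow> measure W {N \<in> structures L NN. Q N} = (\<Sum>A\<in>I. measure W (cylinder L n A))"
proof -
  obtain n where n: "n \<ge> 1" "\<And>M M'. M \<in> structures L NN \<Longrightarrow> M' \<in> structures L NN \<Longrightarrow>
     restr {1..n} M = restr {1..n} M' \<Longrightarrow> Q M = Q M'" using fin_detE[OF Q] by metis
  define I where "I = {A \<in> structures L {1..n}. \<exists>M\<in>structures L NN. restr {1..n} M = A \<and> Q M}"
  have "measure W {N \<in> structures L NN. Q N} = (\<Sum>A\<in>I. measure W (cylinder L n A))"
    if W: "prob_space W" "sets W = sets (SB L)" for W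
  proof -
    interpret prob_space W by (rule W(1))
    have fin: "finite I" unfolding I_def by (rule finite_subset[OF _ finite_structures[of "{1..n}" L]]) auto
    have "{N \<in> structures L NN. Q N} = (\<Union>A\<in>I. cylinder L n A)"
    proof (intro equalityI subsetI)
      fix N assume N: "N \<in> {N \<in> structures L NN. Q N}"
      then have "restr {1..n} N \<in> I" unfolding I_def using restr_in_structures_nat by blast
      then show "N \<in> (\<Union>A\<in>I. cylinder L n A)" using N by (auto simp: cylinder_def)
    next
      fix N assume "N \<in> (\<Union>A\<in>I. cylinder L n A)"
      then obtain A where A: "A \<in> I" "N \<in> structures L NN" "restr {1..n} N = A" by (auto simp: cylinder_def)
      then obtain M where "M \<in> structures L NN" "restr {1..n} M = A" "Q M" unfolding I_def by blast
      then show "N \<in> {N \<in> structures L NN. Q N}" using n(2)[of M N] A by simp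
    qed
    also have "measure W \<dots> = (\<Sum>A\<in>I. measure W (cylinder L n A))"
    proof (rule finite_measure_finite_Union[OF fin])
      show "cylinder L n ` I \<subseteq> sets W" unfolding W(2) using sets_cylinder by blast
      show "disjoint_family_on (cylinder L n) I" by (auto simp: disjoint_family_on_def cylinder_def)
    qed
    finally show ?thesis .
  qed
  then show ?thesis using that[of n I] n(1) by (auto simp: I_def)
qed

text \<open>
  Integrals over \<open>\<nu>\<close> of values at arbitrary Borel sets become accessible, and mixtures can be formed as
  monadic bind.
\<close>

lemma ergodic_to_subprob: "(\<lambda>W. W) \<in> measurable (ergodic_borel L) (subprob_algebra (SB L))"
proof (rule measurable_subprob_algebra_generated[where G = "det_sets L" and \<Omega> = "structures L NN"])
  show "sets (SB L) = sigma_sets (structures L NN) (det_sets L)" by (rule sigma_det_sets[symmetric])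
  interpret ring_of_sets "structures L NN" "det_sets L" by (rule ring_det_sets)
  show "Int_stable (det_sets L)" by (rule Int_stableI) (rule Int)
  show "det_sets L \<subseteq> Pow (structures L NN)" by (rule space_closed)
  show "subprob_space W" if "W \<in> space (ergodic_borel L)" for W
    using that ergodicD(1)[of W L] by (simp add: prob_space_imp_subprob_space)
  show "sets W = sets (SB L)" if "W \<in> space (ergodic_borel L)" for W
    using that ergodicD(2)[of W L] by simp
  have *: "(\<lambda>W. emeasure W B) \<in> borel_measurable (ergodic_borel L)" if B: "B \<in> det_sets L" for B
  proof -
    obtain Q where Q: "B = {N \<in> structures L NN. Q N}" "fin_det L Q" using B unfolding det_sets_def by auto
    from measure_fin_det_cylinders[OF Q(2)]
    obtain n I where I: "n \<ge> 1" "I \<subseteq> structures L {1..n}"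
      "\<And>W. prob_space W \<Longrightarrow> sets W = sets (SB L) \<Longrightarrow> measure W {N \<in> structures L NN. Q N} = (\<Sum>A\<in>I. measure W (cylinder L n A))"
      by blast
    have "(\<lambda>W. ennreal (\<Sum>A\<in>I. measure W (cylinder L n A))) \<in> borel_measurable (ergodic_borel L)"
      using measurable_eval_cylinder[OF I(1)] I(2) by (intro measurable_compose[OF _ measurable_ennreal] borel_measurable_sum) auto
    moreover have "emeasure W B = ennreal (\<Sum>A\<in>I. measure W (cylinder L n A))" if "W \<in> space (ergodic_borel L)" for W
    proof -
      interpret prob_space W using that ergodicD(1)[of W L] by simp
      show ?thesis using I(3)[of W] ergodicD[of W L] that by (simp add: emeasure_eq_measure Q(1))
    qed
    ultimately show ?thesis by (subst measurable_cong)
  qed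
  show "(\<lambda>W. emeasure W A) \<in> borel_measurable (ergodic_borel L)" if "A \<in> det_sets L" for A by (rule *[OF that])
  show "(\<lambda>W. emeasure W (structures L NN)) \<in> borel_measurable (ergodic_borel L)"
    by (rule *) (auto simp: det_sets_iff intro: fin_detI)
qed

lemma measurable_emeasure_ergodic:
  "B \<in> sets (SB L) \<Longrightarrow> (\<lambda>W. emeasure W B) \<in> borel_measurable (ergodic_borel L)"
  by (rule measurable_compose[OF ergodic_to_subprob measurable_emeasure_subprob_algebra])

lemma zero_limit_ergodic: "zero_limit L \<in> ergodic_measures L"
  using comb_limit_ergodic[OF has_limit_zero] comb_limit_zero by simp

lemma zero_limit_sets: "{zero_limit L} \<in> sets (ergodic_borel L)"
proof -
  interpret Metric_space "ergodic_measures L" "limit_dist L" by (rule Metric_space_ergodic)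
  have "closedin mtopology {zero_limit L}"
    by (rule closedin_t1_singleton) (use zero_limit_ergodic in \<open>auto intro: Hausdorff_imp_t1_space Hausdorff_space_mtopology\<close>)
  then have "openin mtopology (ergodic_measures L - {zero_limit L})" unfolding closedin_def by simp
  then have "ergodic_measures L - {zero_limit L} \<in> sets (ergodic_borel L)"
    unfolding sets_ergodic_borel by (intro sigma_sets.Basic) simp
  then have "space (ergodic_borel L) - (ergodic_measures L - {zero_limit L}) \<in> sets (ergodic_borel L)" by (rule sets.compl_sets)
  moreover have "space (ergodic_borel L) - (ergodic_measures L - {zero_limit L}) = {zero_limit L}"
    using zero_limit_ergodic by auto
  ultimately show ?thesis by simp
qed

section \<open>Law of large numbers for dissociated structures\<close>

lemma restr_eq_self:
  assumes "N \<in> structures L T" "T \<subseteq> S" shows "restr S N = N"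
  using assms by (intro nth_equalityI) (auto simp: structures_def tuples_def)

lemma sets_struct_borel_finite:
  assumes T: "T \<subseteq> NN" "finite T" and D: "D \<subseteq> structures L T" shows "D \<in> sets (struct_borel L T)"
proof -
  define n where "n = Max (insert 1 T)"
  have le: "x \<le> n" if "x \<in> insert 1 T" for x unfolding n_def by (rule Max_ge) (use T that in auto)
  have n: "T \<subseteq> {1..n}" "1 \<le> n" using le T(1) by (auto 0 3)
  have "openin (struct_top L T) D"
    unfolding openin_struct_top_iff[OF T(1)]
  proof (intro conjI ballI D exI[of _ n] n(2) subsetI)
    fix N N' assume N: "N \<in> D" "N' \<in> {M' \<in> structures L T. restr {1..n} M' = restr {1..n} N}"
    then show "N' \<in> D" using restr_eq_self[OF _ n(1), of N L] restr_eq_self[OF _ n(1), of N' L] D by auto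
  qed
  then show ?thesis unfolding sets_struct_borel[OF T(1)] by (intro sigma_sets.Basic) simp
qed

text \<open>
  The copies of \<open>M\<close> seen by two disjoint samples are independent.
\<close>

lemma dissociated_product:
  assumes W: "W \<in> ergodic_measures L" and \<tau>: "\<tau> permutes NN" "\<tau>' permutes NN" "\<tau> ` {1..m} \<inter> \<tau>' ` {1..m} = {}"
  shows "measure W {M \<in> structures L NN. relabel L {1..m} \<tau> M = A \<and> relabel L {1..m} \<tau>' M = A}
    = measure W {M \<in> structures L NN. relabel L {1..m} \<tau> M = A} * measure W {M \<in> structures L NN. relabel L {1..m} \<tau>' M = A}"
proof -
  interpret prob_space W by (rule ergodicD[OF W])
  have sp: "space W = structures L NN" using sets_eq_imp_space_eq[OF ergodicD(2)[OF W]] by simp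
  let ?T = "\<tau> ` {1..m}" and ?T' = "\<tau>' ` {1..m}"
  let ?D = "{N \<in> structures L ?T. relabel L {1..m} \<tau> N = A}" and ?D' = "{N \<in> structures L ?T'. relabel L {1..m} \<tau>' N = A}"
  have T: "?T \<subseteq> NN" "?T' \<subseteq> NN" using permutes_NN_image[OF \<tau>(1)] permutes_NN_image[OF \<tau>(2)] by simp_all
  have ind: "indep_var (struct_borel L ?T) (restr ?T) (struct_borel L ?T') (restr ?T')"
    using ergodicD(4)[OF W] T \<tau>(3) unfolding dissociated_def by blast
  have D: "?D \<in> sets (struct_borel L ?T)" by (rule sets_struct_borel_finite[OF T(1)]) auto
  have D': "?D' \<in> sets (struct_borel L ?T')" by (rule sets_struct_borel_finite[OF T(2)]) auto
  have r: "restr U M \<in> structures L U" if "M \<in> structures L NN" "U \<subseteq> NN" for M U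
    using restr_in_structures[OF that(1), of U] that(2) by (simp add: Int_absorb1)
  have e: "relabel L {1..m} \<pi> (restr (\<pi> ` {1..m}) M) = relabel L {1..m} \<pi> M" if "M \<in> structures L NN" for \<pi> M
    by (rule relabel_restr[OF length_structures[OF that]]) simp
  have 1: "restr ?T -` ?D \<inter> space W = {M \<in> structures L NN. relabel L {1..m} \<tau> M = A}"
    using r T(1) e unfolding sp by auto
  have 2: "restr ?T' -` ?D' \<inter> space W = {M \<in> structures L NN. relabel L {1..m} \<tau>' M = A}"
    using r T(2) e unfolding sp by auto
  have "(\<lambda>x. (restr ?T x, restr ?T' x)) -` (?D \<times> ?D') \<inter> space W = (restr ?T -` ?D \<inter> space W) \<inter> (restr ?T' -` ?D' \<inter> space W)"
    by auto
  also have "\<dots> = {M \<in> structures L NN. relabel L {1..m} \<tau> M = A \<and> relabel L {1..m} \<tau>' M = A}"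
    unfolding 1 2 by auto
  finally show ?thesis using indep_varD[OF ind D D'] unfolding 1 2 by simp
qed

text \<open>
  Dissociation makes the correlation of separated samples \<open>w\<^sup>2\<close>, where \<open>w\<close> is the mean, so the variance of the
  density tends to zero.
\<close>

lemma AE_density_limit:
  assumes W: "W \<in> ergodic_measures L"
  shows "AE M in W. (\<lambda>n. perm_avg n (\<lambda>\<tau>. of_bool (relabel L {1..m} \<tau> M = A))) \<longlonglongrightarrow> measure W (cylinder L m A)"
proof -
  let ?h = "\<lambda>\<tau> M. of_bool (relabel L {1..m} \<tau> M = A) :: real"
  define w where "w = measure W (cylinder L m A)"
  interpret W: prob_space W by (rule ergodicD[OF W])
  note sW = ergodicD(2)[OF W]
  have sp: "space W = structures L NN" using sets_eq_imp_space_eq[OF sW] by simp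
  interpret equivariant_sample L W "{}" m ?h
  proof (rule equivariant_sample.intro)
    show "finite_measure W" by unfold_locales
    show "sets W = sets (SB L)" by (rule sW)
    show "depends_on m (\<lambda>\<tau>. ?h \<tau> M)" for M by (rule depends_on_relabel)
    show "distr W (SB L) (relabel L NN \<sigma>) = W" if "\<sigma> permutes {1..N}" for \<sigma> N
      using ergodicD(3)[OF W] permutes_NN[OF that] unfolding exchangeable_measure_def by blast
    fix \<tau> :: "nat \<Rightarrow> nat" assume \<tau>: "\<tau> permutes NN"
    have [measurable]: "Measurable.pred (SB L) (\<lambda>M. relabel L {1..m} \<tau> M = A)"
      by (rule pred_fin_det[OF fin_det_relabel_eq[OF \<tau>]])
    show "?h \<tau> \<in> borel_measurable (SB L)" by measurable
    have "\<tau> ` {1..m} \<subseteq> NN" by (rule permutes_NN_image[OF \<tau>]) auto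
    then show "?h \<tau> (relabel L NN \<sigma> M) = ?h (\<sigma> \<circ> \<tau>) M" for \<sigma> M by (simp add: relabel_relabel)
  qed auto
  have mh: "measure W {M \<in> structures L NN. relabel L {1..m} \<tau> M = A} = w" if \<tau>: "\<tau> permutes NN" for \<tau>
  proof -
    have "distr W (SB L) (relabel L NN \<tau>) = W"
      using ergodicD(3)[OF W] \<tau> unfolding exchangeable_measure_def by blast
    then show ?thesis using measure_distr_cylinder[OF sW \<tau>, of m A] by (simp add: w_def)
  qed
  have ind: "(\<integral>M. of_bool (Q M) \<partial>W) = measure W {M \<in> structures L NN. Q M}" for Q :: "struc \<Rightarrow> bool"
  proof -
    have "(\<integral>M. of_bool (Q M) \<partial>W) = (\<integral>M. indicator {M \<in> structures L NN. Q M} M \<partial>W)"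
      by (rule Bochner_Integration.integral_cong) (auto simp: sp indicator_def)
    also have "\<dots> = measure W ({M \<in> structures L NN. Q M} \<inter> space W)" by (rule Bochner_Integration.integral_indicator)
    also have "{M \<in> structures L NN. Q M} \<inter> space W = {M \<in> structures L NN. Q M}" by (auto simp: sp)
    finally show ?thesis .
  qed
  have g: "(\<integral>M. ?h \<tau> M * ?h \<tau>' M \<partial>W) = w\<^sup>2" if "separated \<tau> \<tau>'" for \<tau> \<tau>'
  proof -
    have p: "\<tau> permutes NN" "\<tau>' permutes NN" "\<tau> ` {1..m} \<inter> \<tau>' ` {1..m} = {}" using that by (auto simp: separated_def)
    have "(\<integral>M. ?h \<tau> M * ?h \<tau>' M \<partial>W) = (\<integral>M. of_bool (relabel L {1..m} \<tau> M = A \<and> relabel L {1..m} \<tau>' M = A) \<partial>W)"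
      by (simp only: of_bool_conj)
    also have "\<dots> = w\<^sup>2" unfolding ind dissociated_product[OF W p] mh[OF p(1)] mh[OF p(2)] by (simp add: power2_eq_square)
    finally show ?thesis .
  qed
  have w: "0 \<le> w" "w \<le> 1" by (simp_all add: w_def)
  have EU: "(\<integral>M. U n M \<partial>W) = w" for n
  proof -
    have "(\<integral>M. U n M \<partial>W) = perm_avg n (\<lambda>\<tau>. \<integral>M. ?h \<tau> M \<partial>W)"
      by (intro integrable_perm_avg integrable_h permutes_NN)
    also have "\<dots> = perm_avg n (\<lambda>\<tau>. w)" by (rule perm_avg_cong) (simp only: ind mh[OF permutes_NN])
    finally show ?thesis by simp
  qed
  have iU: "integrable W (U n)" for n by (intro integrable_perm_avg integrable_h permutes_NN)
  have var: "(\<integral>M. (U n M - w)\<^sup>2 \<partial>W) \<le> 2 * (real m * real m) / n" if n: "1 \<le> n" for n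
  proof -
    have "(\<integral>M. (U n M - w)\<^sup>2 \<partial>W) = (\<integral>M. U n M * U n M - 2 * w * U n M + w\<^sup>2 \<partial>W)"
      by (simp add: power2_eq_square algebra_simps)
    also have "\<dots> = (\<integral>M. U n M * U n M \<partial>W) - 2 * w * w + w\<^sup>2"
      using integrable_UU[of n n] iU EU W.prob_space by simp
    also have "\<dots> = (\<integral>M. U n M * U n M \<partial>W) - w\<^sup>2" by (simp add: power2_eq_square)
    also have "\<dots> \<le> 2 * (real m * real m) / n"
      using correlation_bound[OF g _ _ n order_refl] w W.prob_space by (simp add: power_le_one)
    finally show ?thesis .
  qed
  define l where "l M = lim (\<lambda>n. U n M)" for M
  have ml: "l \<in> borel_measurable W" unfolding l_def by (intro borel_measurable_lim_metric meas_U)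
  have Ul: "AE M in W. (\<lambda>n. U n M) \<longlonglongrightarrow> l M"
    using AE_convergent by eventually_elim (simp add: l_def convergent_LIMSEQ_iff)
  have Ub: "norm ((U n M - w)\<^sup>2) \<le> 1" for n M
    using U_ge[of n M] U_le[of n M] w by (auto simp: abs_square_le_1)
  have lim: "(\<lambda>n. \<integral>M. (U n M - w)\<^sup>2 \<partial>W) \<longlonglongrightarrow> (\<integral>M. (l M - w)\<^sup>2 \<partial>W)"
  proof (rule integral_dominated_convergence[where w = "\<lambda>_. 1"])
    show "AE M in W. (\<lambda>n. (U n M - w)\<^sup>2) \<longlonglongrightarrow> (l M - w)\<^sup>2"
      using Ul by eventually_elim (intro tendsto_intros)
  qed (use ml Ub in auto)
  have "(\<lambda>n. \<integral>M. (U n M - w)\<^sup>2 \<partial>W) \<longlonglongrightarrow> 0"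
  proof (rule Lim_null_comparison)
    show "\<forall>\<^sub>F n in sequentially. norm (\<integral>M. (U n M - w)\<^sup>2 \<partial>W) \<le> (2 * (real m * real m)) / real n"
      using eventually_ge_at_top[of 1] by eventually_elim (use var in \<open>simp add: Bochner_Integration.integral_nonneg\<close>)
    show "(\<lambda>n. (2 * (real m * real m)) / real n) \<longlonglongrightarrow> 0" by (rule lim_const_over_n)
  qed
  with lim have 0: "(\<integral>M. (l M - w)\<^sup>2 \<partial>W) = 0" using LIMSEQ_unique by blast
  have "AE M in W. norm ((l M - w)\<^sup>2) \<le> 1"
    using Ul
  proof eventually_elim
    case (elim M)
    have "(\<lambda>n. norm ((U n M - w)\<^sup>2)) \<longlonglongrightarrow> norm ((l M - w)\<^sup>2)" by (intro tendsto_intros elim)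
    then show ?case by (rule LIMSEQ_le_const2) (use Ub in blast)
  qed
  moreover have "(\<lambda>M. (l M - w)\<^sup>2) \<in> borel_measurable W"
    by (intro borel_measurable_power borel_measurable_diff borel_measurable_const ml)
  ultimately have "integrable W (\<lambda>M. (l M - w)\<^sup>2)" by (rule W.integrable_const_bound)
  from integral_nonneg_eq_0_iff_AE[OF this] 0 have "AE M in W. (l M - w)\<^sup>2 = 0" by simp
  with Ul show ?thesis by eventually_elim (simp add: w_def)
qed

theorem AE_comb_limit_eq:
  assumes W: "W \<in> ergodic_measures L"
  shows "AE M in W. has_limit L M \<and> comb_limit L M = W"
proof -
  note sW = ergodicD(2)[OF W]
  have sp: "space W = structures L NN" using sets_eq_imp_space_eq[OF sW] by simp
  have "AE M in W. \<forall>m. \<forall>A\<in>structures L {1..m}.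
     (\<lambda>n. perm_avg n (\<lambda>\<tau>. of_bool (relabel L {1..m} \<tau> M = A))) \<longlonglongrightarrow> measure W (cylinder L m A)"
    unfolding AE_all_countable
    by (intro allI AE_finite_allI finite_structures finite_atLeastAtMost AE_density_limit[OF W])
  with AE_space[of W] show ?thesis
  proof eventually_elim
    case (elim M)
    then have len: "length M = length L" using length_structures unfolding sp by blast
    have lim: "has_limit L M" unfolding has_limit_iff[OF len] using elim(2) by (auto simp: convergent_def)
    note c = comb_limit_props[OF lim len]
    have "comb_limit L M = W"
    proof (rule measure_eqI_cylinder[OF c(1) ergodicD(1)[OF W] c(2) sW])
      fix n :: nat and A assume A: "A \<in> structures L {1..n}"
      have "(\<lambda>k. perm_avg k (\<lambda>\<tau>. of_bool (relabel L {1..n} \<tau> M = A))) \<longlonglongrightarrow> measure (comb_limit L M) (cylinder L n A)"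
        using c(3)[OF fin_det_restr[where R = "\<lambda>N. N = A"], of n] by (simp add: cylinder_def restr_relabel_nat)
      then show "measure (comb_limit L M) (cylinder L n A) = measure W (cylinder L n A)"
        using elim(2) A LIMSEQ_unique by blast
    qed
    then show ?case using lim by simp
  qed
qed

text \<open>
  The zero structure has trivial limit, whereas \<open>W\<close>-almost every structure has limit \<open>W\<close>.
\<close>

lemma ergodic_zero_null:
  assumes W: "W \<in> ergodic_measures L" "W \<noteq> zero_limit L" shows "emeasure W {zero_struct L} = 0"
proof -
  have "AE M in W. M \<noteq> zero_struct L"
    using AE_comb_limit_eq[OF W(1)] by eventually_elim (use comb_limit_zero[of L] W(2) in auto)
  then have "emeasure W {M \<in> space W. M = zero_struct L} = 0" by (intro emeasure_eq_0_AE) simp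
  moreover have "space W = structures L NN" using sets_eq_imp_space_eq[OF ergodicD(2)[OF W(1)]] by simp
  then have "{M \<in> space W. M = zero_struct L} = {zero_struct L}"
    using zero_in_structures[of L NN] by blast
  ultimately show ?thesis by simp
qed

section \<open>The part of the rate measure with nontrivial limit\<close>

lemma restr_nonzero_iff:
  "length M = length L \<Longrightarrow> restr F M \<noteq> zero_struct L \<longleftrightarrow> (\<exists>j<length L. \<exists>a\<in>M ! j. set a \<subseteq> F)"
  by (subst eq_zero_iff) auto

text \<open>
  The condition on \<open>\<parallel>M\<parallel>\<^sub>\<emptyset>\<close> is imposed on each relation separately, the one on \<open>\<parallel>M\<parallel>\<close> on all of them jointly.
  Sampling a nonempty structure means sampling some nonempty relation, so both amount to the same.
\<close>

lemma comb_limit_zero_iff_not_dense: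
  assumes M: "M \<in> structures L NN" and lim: "has_limit L M"
  shows "comb_limit L M = zero_limit L \<longleftrightarrow> \<not> dense L {#} M"
proof -
  let ?p = "\<lambda>m n. perm_avg n (\<lambda>\<tau>. of_bool (relabel L {1..m} \<tau> M \<noteq> zero_struct L)) :: real"
  let ?q = "\<lambda>j m n. perm_avg n (\<lambda>\<tau>. of_bool (hit {#} j m \<tau> M)) :: real"
  have nz: "relabel L {1..m} \<tau> M \<noteq> zero_struct L \<longleftrightarrow> (\<exists>j<length L. hit {#} j m \<tau> M)" if \<tau>: "\<tau> permutes {1..n}" for m n \<tau>
  proof -
    have \<tau>N: "\<tau> permutes NN" by (rule permutes_NN[OF \<tau>])
    have "relabel L {1..m} \<tau> M \<noteq> zero_struct L \<longleftrightarrow> (\<exists>j<length L. \<exists>b\<in>tuples {1..m} (L ! j). map \<tau> b \<in> M ! j)"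
      by (subst eq_zero_iff) auto
    also have "\<dots> \<longleftrightarrow> (\<exists>j<length L. hit {#} j m \<tau> M)"
    proof -
      have "(\<exists>b\<in>tuples {1..m} (L ! j). map \<tau> b \<in> M ! j) \<longleftrightarrow> hit {#} j m \<tau> M" if j: "j < length L" for j
      proof
        assume "\<exists>b\<in>tuples {1..m} (L ! j). map \<tau> b \<in> M ! j"
        then obtain b where b: "b \<in> tuples {1..m} (L ! j)" "map \<tau> b \<in> M ! j" by blast
        then show "hit {#} j m \<tau> M" unfolding hit_def by (intro bexI[of _ "map \<tau> b"]) (auto simp: tuples_def)
      next
        assume "hit {#} j m \<tau> M"
        then obtain a where a: "a \<in> M ! j" "set a \<subseteq> \<tau> ` {1..m}" unfolding hit_def by auto
        have 1: "map \<tau> (map (inv \<tau>) a) = a" unfolding map_map by (rule map_idI) (simp add: permutes_inverses(1)[OF \<tau>])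
        have "inv \<tau> ` set a \<subseteq> inv \<tau> ` \<tau> ` {1..m}" using a(2) by (rule image_mono)
        also have "inv \<tau> ` \<tau> ` {1..m} = {1..m}" unfolding image_comp permutes_inv_o(2)[OF \<tau>] by simp
        finally have "map (inv \<tau>) a \<in> tuples {1..m} (L ! j)"
          using nth_structures[OF M j] a(1) by (auto simp: tuples_def)
        then show "\<exists>b\<in>tuples {1..m} (L ! j). map \<tau> b \<in> M ! j" using 1 a(1) by (intro bexI[of _ "map (inv \<tau>) a"]) simp_all
      qed
      then show ?thesis by blast
    qed
    finally show ?thesis .
  qed
  have le: "?p m n \<le> (\<Sum>j<length L. ?q j m n)" for m n
    unfolding perm_avg_sum[symmetric]
  proof (rule perm_avg_mono)
    fix \<tau> assume \<tau>: "\<tau> permutes {1..n}"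
    show "of_bool (relabel L {1..m} \<tau> M \<noteq> zero_struct L) \<le> (\<Sum>j<length L. of_bool (hit {#} j m \<tau> M) :: real)"
    proof (cases "\<exists>j<length L. hit {#} j m \<tau> M")
      case True
      then obtain j where j: "j < length L" "hit {#} j m \<tau> M" by blast
      then have "1 \<le> (of_bool (hit {#} j m \<tau> M) :: real)" by simp
      also have "\<dots> \<le> (\<Sum>j<length L. of_bool (hit {#} j m \<tau> M) :: real)"
        using j(1) by (intro member_le_sum) auto
      finally show ?thesis by (simp add: of_bool_def)
    next
      case False
      then show ?thesis using nz[OF \<tau>, of m] by (simp add: sum_nonneg)
    qed
  qed
  have ge: "?q j m n \<le> ?p m n" if "j < length L" for j m n
    by (rule perm_avg_mono) (use nz that in auto)
  have nn: "0 \<le> ?p m n" "0 \<le> ?q j m n" for j m n by (intro perm_avg_nonneg; simp)+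
  show ?thesis
    unfolding comb_limit_eq_zero_iff[OF lim length_structures[OF M]] dense_def
  proof
    assume 0: "\<forall>m. ?p m \<longlonglongrightarrow> 0"
    have "?q j m \<longlonglongrightarrow> 0" if "j < length L" for j m
      by (rule tendsto_sandwich[OF _ _ tendsto_const 0[rule_format, of m]]) (use nn ge[OF that] in auto)
    then show "\<not> (\<exists>j<length L. \<exists>m. \<not> ?q j m \<longlonglongrightarrow> 0)" by blast
  next
    assume "\<not> (\<exists>j<length L. \<exists>m. \<not> ?q j m \<longlonglongrightarrow> 0)"
    then have 0: "?q j m \<longlonglongrightarrow> 0" if "j < length L" for j m using that by blast
    have "?p m \<longlonglongrightarrow> 0" for m
    proof (rule tendsto_sandwich[OF _ _ tendsto_const])
      show "(\<lambda>n. \<Sum>j<length L. ?q j m n) \<longlonglongrightarrow> 0" by (rule tendsto_null_sum) (use 0 in auto)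
    qed (use nn le in auto)
    then show "\<forall>m. ?p m \<longlonglongrightarrow> 0" by blast
  qed
qed

lemma has_limit_relabel:
  assumes \<sigma>: "\<sigma> permutes {1..N}" and M: "M \<in> structures L NN"
  shows "has_limit L (relabel L NN \<sigma> M) \<longleftrightarrow> has_limit L M"
proof -
  have "convergent (\<lambda>n. perm_avg n (\<lambda>\<tau>. of_bool (relabel L {1..m} \<tau> (relabel L NN \<sigma> M) = A) :: real)) \<longleftrightarrow>
      convergent (\<lambda>n. perm_avg n (\<lambda>\<tau>. of_bool (relabel L {1..m} \<tau> M = A) :: real))" for m A
  proof (rule convergent_cong)
    show "\<forall>\<^sub>F n in sequentially. perm_avg n (\<lambda>\<tau>. of_bool (relabel L {1..m} \<tau> (relabel L NN \<sigma> M) = A) :: real)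
        = perm_avg n (\<lambda>\<tau>. of_bool (relabel L {1..m} \<tau> M = A))"
      using perm_avg_finite_relabel[OF \<sigma>, of "\<lambda>\<tau>. of_bool (relabel L {1..m} \<tau> M = A)"]
    proof eventually_elim
      case (elim n)
      have "perm_avg n (\<lambda>\<tau>. of_bool (relabel L {1..m} \<tau> (relabel L NN \<sigma> M) = A) :: real)
        = perm_avg n (\<lambda>\<tau>. of_bool (relabel L {1..m} (\<sigma> \<circ> \<tau>) M = A))"
      proof (rule perm_avg_cong)
        fix \<tau> assume "\<tau> permutes {1..n}"
        then have "\<tau> ` {1..m} \<subseteq> NN" by (intro permutes_NN_image permutes_NN) auto
        then show "of_bool (relabel L {1..m} \<tau> (relabel L NN \<sigma> M) = A) = (of_bool (relabel L {1..m} (\<sigma> \<circ> \<tau>) M = A) :: real)"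
          by (simp add: relabel_relabel)
      qed
      then show ?case using elim by simp
    qed
  qed
  then show ?thesis using length_structures[OF M] by (simp add: has_limit_iff)
qed

lemma measurable_density_avg:
  "(\<lambda>M. perm_avg n (\<lambda>\<tau>. of_bool (relabel L {1..m} \<tau> M = A)) :: real) \<in> borel_measurable (SB L)"
proof (rule measurable_perm_avg)
  fix \<tau> assume "\<tau> permutes {1..n}"
  then have [measurable]: "Measurable.pred (SB L) (\<lambda>M. relabel L {1..m} \<tau> M = A)"
    by (intro pred_fin_det fin_det_relabel_eq permutes_NN)
  show "(\<lambda>M. of_bool (relabel L {1..m} \<tau> M = A) :: real) \<in> borel_measurable (SB L)" by measurable
qed

lemma pred_has_limit [measurable]: "Measurable.pred (SB L) (has_limit L)"
proof -
  have "Measurable.pred (SB L) (\<lambda>M. Cauchy (\<lambda>n. perm_avg n (\<lambda>\<tau>. of_bool (relabel L {1..m} \<tau> M = A)) :: real))" for m A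
    using sets_Collect_Cauchy[of "\<lambda>n M. perm_avg n (\<lambda>\<tau>. of_bool (relabel L {1..m} \<tau> M = A)) :: real" "SB L",
        OF measurable_density_avg] by (simp add: pred_def)
  then have "Measurable.pred (SB L) (\<lambda>M. \<forall>m. \<forall>A\<in>structures L {1..m}. 1 \<le> m \<longrightarrow>
      Cauchy (\<lambda>n. perm_avg n (\<lambda>\<tau>. of_bool (relabel L {1..m} \<tau> M = A)) :: real))"
    by (intro pred_intros_countable pred_intros_finite pred_intros_imp' finite_structures finite_atLeastAtMost)
  moreover have "has_limit L M \<longleftrightarrow> (\<forall>m. \<forall>A\<in>structures L {1..m}. 1 \<le> m \<longrightarrow>
      Cauchy (\<lambda>n. perm_avg n (\<lambda>\<tau>. of_bool (relabel L {1..m} \<tau> M = A)) :: real))"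
    if "M \<in> space (SB L)" for M
    using that length_structures by (auto simp: has_limit_iff Cauchy_convergent_iff)
  ultimately show ?thesis by (subst measurable_cong)
qed

text \<open>
  Structures without limit, which form a null set, are sent to the trivial limit so that all values are
  exchangeable and dissociated.
\<close>

definition limit_map :: "nat list \<Rightarrow> struc \<Rightarrow> struc measure" where
  "limit_map L M = comb_limit L (if has_limit L M then M else zero_struct L)"

lemma limit_map_ergodic: "M \<in> structures L NN \<Longrightarrow> limit_map L M \<in> ergodic_measures L"
  unfolding limit_map_def by (auto intro!: comb_limit_ergodic has_limit_zero length_structures)

lemma measurable_limit_map: "limit_map L \<in> measurable (SB L) (ergodic_borel L)"
proof (rule measurable_ergodic_borelI)
  show "limit_map L M \<in> ergodic_measures L" if "M \<in> space (SB L)" for M using that by (simp add: limit_map_ergodic)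
  fix n :: nat and A assume "1 \<le> n" "A \<in> structures L {1..n}"
  let ?l = "\<lambda>M. lim (\<lambda>k. perm_avg k (\<lambda>\<tau>. of_bool (relabel L {1..n} \<tau> M = A)) :: real)"
  have [measurable]: "?l \<in> borel_measurable (SB L)"
    by (intro borel_measurable_lim_metric measurable_density_avg)
  have "(\<lambda>M. if has_limit L M then ?l M else of_bool (A = zero_struct L)) \<in> borel_measurable (SB L)" by measurable
  moreover have "measure (limit_map L M) (cylinder L n A) = (if has_limit L M then ?l M else of_bool (A = zero_struct L))"
    if "M \<in> space (SB L)" for M
  proof (cases "has_limit L M")
    case True
    have "length M = length L" using that length_structures by auto
    from comb_limit_props(3)[OF True this fin_det_restr[where R = "\<lambda>N. N = A"], of n]
    have "(\<lambda>k. perm_avg k (\<lambda>\<tau>. of_bool (relabel L {1..n} \<tau> M = A))) \<longlonglongrightarrow> measure (comb_limit L M) (cylinder L n A)"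
      by (simp add: cylinder_def restr_relabel_nat)
    then show ?thesis using True by (simp add: limit_map_def limI)
  next
    case False
    then show ?thesis by (simp add: limit_map_def comb_limit_zero measure_zero_limit_cylinder)
  qed
  ultimately show "(\<lambda>M. measure (limit_map L M) (cylinder L n A)) \<in> borel_measurable (SB L)"
    by (subst measurable_cong)
qed

definition dense_part :: "nat list \<Rightarrow> struc set" where
  "dense_part L = {M \<in> structures L NN. has_limit L M \<and> dense L {#} M}"

lemma sets_dense_part: "dense_part L \<in> sets (SB L)"
proof -
  have "{M \<in> space (SB L). has_limit L M \<and> dense L {#} M} \<in> sets (SB L)" by measurable
  then show ?thesis by (simp add: dense_part_def)
qed

lemma limit_map_nonzero_iff:
  "M \<in> structures L NN \<Longrightarrow> limit_map L M \<noteq> zero_limit L \<longleftrightarrow> M \<in> dense_part L"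
  by (auto simp: limit_map_def dense_part_def comb_limit_zero comb_limit_zero_iff_not_dense)

lemma dense_part_relabel:
  assumes "\<sigma> permutes {1..N}" "M \<in> structures L NN"
  shows "relabel L NN \<sigma> M \<in> dense_part L \<longleftrightarrow> M \<in> dense_part L"
  using has_limit_relabel[OF assms] dense_relabel[OF permutes_NN[OF assms(1)] finite_perm_displacement[OF assms(1)] assms(2), of "{#}"]
  by (simp add: dense_part_def assms(2))

text \<open>
  If every tuple met \<open>[m]\<close>, almost every sample would be empty.
\<close>

lemma dense_part_far:
  assumes "M \<in> dense_part L" obtains n where "restr {m + 1..m + Suc n} M \<noteq> zero_struct L"
proof -
  have M: "M \<in> structures L NN" and d: "dense L {#} M" using assms by (auto simp: dense_part_def)
  have "\<exists>j<length L. \<exists>a\<in>M ! j. set a \<inter> {1..m} = {}"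
  proof (rule ccontr)
    assume n: "\<not> ?thesis"
    have "\<not> dense L {#} M"
    proof (rule not_dense_if_no_tuple[of "{1..m}"])
      fix j a assume "j < length L" "a \<in> M ! j"
      then have "set a \<inter> {1..m} \<noteq> {}" using n by blast
      then have "set_mset (filter_mset (\<lambda>x. x \<in> {1..m}) (mset a)) \<noteq> {}"
        unfolding set_mset_filter set_mset_mset by blast
      then show "filter_mset (\<lambda>x. x \<in> {1..m}) (mset a) \<noteq> filter_mset (\<lambda>x. x \<in> {1..m}) {#}"
        by (metis filter_empty_mset set_mset_empty)
    qed simp
    then show False using d by simp
  qed
  then obtain j a where a: "j < length L" "a \<in> M ! j" "set a \<inter> {1..m} = {}" by blast
  have "set a \<subseteq> NN" using nth_structures[OF M a(1)] a(2) by (auto simp: tuples_def)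
  define n where "n = Max (insert 0 (set a))"
  have "x \<le> n" if "x \<in> set a" for x unfolding n_def by (rule Max_ge) (use that in auto)
  then have "set a \<subseteq> {m + 1..m + Suc n}" using a(3) \<open>set a \<subseteq> NN\<close> by (fastforce simp: disjoint_iff)
  then have "restr {m + 1..m + Suc n} M \<noteq> zero_struct L"
    unfolding restr_nonzero_iff[OF length_structures[OF M]] using a by blast
  then show ?thesis by (rule that)
qed

lemma block_swap:
  obtains \<tau> :: "nat \<Rightarrow> nat" where "\<tau> permutes {1..m + n}" "\<tau> ` {1..m} = {n + 1..n + m}" "\<tau> ` {m + 1..m + n} = {1..n}"
proof -
  define \<phi> where "\<phi> i = (if i \<le> m then i + n else i - m)" for i :: nat
  have "inj_on \<phi> {1..m + n}" by (rule inj_onI) (auto simp: \<phi>_def split: if_splits)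
  moreover have "\<phi> ` {1..m + n} \<subseteq> {1..m + n}" by (auto simp: \<phi>_def)
  ultimately obtain \<tau> where \<tau>: "\<tau> permutes {1..m + n}" "\<And>i. i \<in> {1..m + n} \<Longrightarrow> \<tau> i = \<phi> i"
    using extend_to_permutation[of "{1..m + n}" \<phi> "{1..m + n}"] by auto
  have "\<tau> ` {1..m} = (\<lambda>i. i + n) ` {1..m}" by (rule image_cong) (auto simp: \<tau>(2) \<phi>_def)
  also have "\<dots> = {n + 1..n + m}" by (simp add: add.commute)
  finally have 1: "\<tau> ` {1..m} = {n + 1..n + m}" .
  have "\<tau> ` {m + 1..m + n} = (\<lambda>i. i - m) ` {m + 1..m + n}" by (rule image_cong) (auto simp: \<tau>(2) \<phi>_def)
  also have "\<dots> = {1..n}"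
  proof
    show "{1..n} \<subseteq> (\<lambda>i. i - m) ` {m + 1..m + n}"
    proof
      fix x assume "x \<in> {1..n}"
      then show "x \<in> (\<lambda>i. i - m) ` {m + 1..m + n}" by (intro image_eqI[of _ _ "x + m"]) auto
    qed
  qed auto
  finally show ?thesis using that[OF \<tau>(1) 1] by blast
qed

context exchangeable_rate
begin

text \<open>
  On the right, the density of \<open>Q\<close> is integrated over the event \<open>M|[n] \<noteq> 0\<close> of finite measure; by
  \<open>integral_h_eq_limit\<close> this is the measure of the event that \<open>Q\<close> holds for the copy of \<open>M|[m]\<close> on
  \<open>n + 1, \<dots>, n + m\<close>.  Exchanging the two blocks of labels gives the left-hand side.
\<close>

lemma block_shift_identity:
  assumes Q: "fin_det L Q" and m: "\<And>M M'. M \<in> structures L NN \<Longrightarrow> M' \<in> structures L NN \<Longrightarrow>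
     restr {1..m} M = restr {1..m} M' \<Longrightarrow> Q M = Q M'" and n: "n \<ge> 1"
  shows "emeasure \<mu> {M \<in> dense_part L. restr {m + 1..m + n} M \<noteq> zero_struct L \<and> Q M}
    = (\<integral>\<^sup>+M. ennreal (measure (limit_map L M) {N \<in> structures L NN. Q N}) *
        indicator {M \<in> dense_part L. restr {1..n} M \<noteq> zero_struct L} M \<partial>\<mu>)"
proof -
  let ?h = "\<lambda>\<tau> M. of_bool (Q (relabel L NN \<tau> M)) :: real"
  let ?u = "\<lambda>M. measure (limit_map L M) {N \<in> structures L NN. Q N}"
  let ?G = "{M \<in> dense_part L. restr {1..n} M \<noteq> zero_struct L}"
  let ?\<rho> = "density \<mu> (indicator ?G)"
  have "?G = dense_part L \<inter> {M \<in> structures L NN. restr {1..n} M \<noteq> zero_struct L}" by (auto simp: dense_part_def)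
  also have "\<dots> \<in> sets (SB L)"
    by (intro sets.Int sets_dense_part sets_fin_det fin_det_restr[where R = "\<lambda>N. N \<noteq> zero_struct L"])
  finally have Gs: "?G \<in> sets (SB L)" .
  have Gfin: "emeasure \<mu> ?G < \<infinity>"
  proof -
    have "emeasure \<mu> ?G \<le> emeasure \<mu> {M \<in> structures L NN. restr {1..n} M \<noteq> zero_struct L}"
      by (rule emeasure_mono)
         (auto simp: dense_part_def sets_\<mu> intro!: sets_fin_det fin_det_restr[where R = "\<lambda>N. N \<noteq> zero_struct L"])
    also have "\<dots> < \<infinity>" by (rule finite_nonzero[OF n])
    finally show ?thesis .
  qed
  interpret equivariant_sample L ?\<rho> "{1..n}" m ?h
  proof (rule restricted_sample[OF Gs Gfin])
    show "relabel L NN \<sigma> M \<in> ?G \<longleftrightarrow> M \<in> ?G"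
      if "\<sigma> permutes {1..N}" "\<And>i. i \<in> {1..n} \<Longrightarrow> \<sigma> i = i" "M \<in> structures L NN" for \<sigma> N M
      using dense_part_relabel[OF that(1,3)] nonzero_invariant[OF that(2,3)] by simp
    show "depends_on m (\<lambda>\<tau>. ?h \<tau> M)" for M
      unfolding depends_on_def
    proof (intro allI impI)
      fix \<tau> \<tau>' :: "nat \<Rightarrow> nat" assume "\<forall>i\<in>{1..m}. \<tau> i = \<tau>' i"
      then have "relabel L {1..m} \<tau> M = relabel L {1..m} \<tau>' M" by (intro relabel_cong) simp
      then have "Q (relabel L NN \<tau> M) = Q (relabel L NN \<tau>' M)"
        by (intro m) (simp_all add: restr_relabel_nat)
      then show "?h \<tau> M = ?h \<tau>' M" by simp
    qed
    fix \<tau> :: "nat \<Rightarrow> nat" assume \<tau>: "\<tau> permutes NN"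
    have [measurable]: "Measurable.pred (SB L) (\<lambda>M. Q (relabel L NN \<tau> M))" by (rule pred_fin_det[OF fin_det_relabel[OF Q \<tau>]])
    show "?h \<tau> \<in> borel_measurable (SB L)" by measurable
    show "?h \<tau> (relabel L NN \<sigma> M) = ?h (\<sigma> \<circ> \<tau>) M" for \<sigma> M by (simp add: relabel_perm_relabel[OF \<tau>])
  qed auto
  have QS: "{N \<in> structures L NN. Q N} \<in> sets (SB L)" by (rule sets_fin_det[OF Q])
  have "(\<lambda>M. emeasure (limit_map L M) {N \<in> structures L NN. Q N}) \<in> borel_measurable (SB L)"
    by (rule measurable_compose[OF measurable_limit_map measurable_emeasure_ergodic[OF QS]])
  then have mu: "?u \<in> borel_measurable (SB L)" unfolding measure_def by measurable
  have mu\<rho>: "?u \<in> borel_measurable ?\<rho>" using mu by (simp add: measurable_\<mu>)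
  have "AE M in ?\<rho>. (\<lambda>k. U k M) \<longlonglongrightarrow> ?u M"
  proof -
    have m1: "(indicator ?G :: struc \<Rightarrow> ennreal) \<in> borel_measurable \<mu>" using Gs sets_\<mu> by simp
    have "(\<lambda>k. U k M) \<longlonglongrightarrow> ?u M" if M: "0 < (indicator ?G M :: ennreal)" for M
    proof -
      have "M \<in> ?G" using M by (cases "M \<in> ?G") auto
      then have "has_limit L M" "length M = length L" using length_structures by (auto simp: dense_part_def)
      from comb_limit_props(3)[OF this Q] this show ?thesis by (simp add: limit_map_def)
    qed
    then show ?thesis unfolding AE_density[OF m1] by (intro AE_I2 impI)
  qed
  note lim = this
  obtain \<tau> where \<tau>: "\<tau> permutes {1..m + n}" "\<tau> ` {1..m} = {n + 1..n + m}" "\<tau> ` {m + 1..m + n} = {1..n}"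
    by (rule block_swap)
  have \<tau>N: "\<tau> permutes NN" by (rule permutes_NN[OF \<tau>(1)])
  have "\<tau> ` {1..m} \<inter> {1..n} = {}" unfolding \<tau>(2) by auto
  from integral_h_eq_limit[OF \<tau>N this mu\<rho> lim]
  have eq: "(\<integral>M. ?h \<tau> M \<partial>?\<rho>) = (\<integral>M. ?u M \<partial>?\<rho>)" .
  have ub: "?u M \<le> 1" if "M \<in> structures L NN" for M
    using prob_space.prob_le_1[OF ergodicD(1)[OF limit_map_ergodic[OF that]]] .
  have nn: "ennreal (\<integral>M. f M \<partial>?\<rho>) = (\<integral>\<^sup>+M. ennreal (f M) * indicator ?G M \<partial>\<mu>)"
    if f: "f \<in> borel_measurable (SB L)" "\<And>M. 0 \<le> f M" "\<And>M. M \<in> structures L NN \<Longrightarrow> f M \<le> 1" for f :: "struc \<Rightarrow> real"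
  proof -
    have f\<rho>: "f \<in> borel_measurable ?\<rho>" using f(1) by (simp add: measurable_\<mu>)
    have "integrable ?\<rho> f"
      by (rule integrable_const_bound[of _ 1, OF AE_I2 f\<rho>]) (use f in \<open>auto simp: space_\<mu>\<close>)
    then have "ennreal (\<integral>M. f M \<partial>?\<rho>) = (\<integral>\<^sup>+M. ennreal (f M) \<partial>?\<rho>)"
      using f(2) by (subst nn_integral_eq_integral) auto
    also have "\<dots> = (\<integral>\<^sup>+M. indicator ?G M * ennreal (f M) \<partial>\<mu>)"
      using Gs f(1) by (intro nn_integral_density) (auto simp: measurable_\<mu> sets_\<mu>)
    finally show ?thesis by (simp add: mult.commute)
  qed
  let ?B = "{M \<in> dense_part L. restr {m + 1..m + n} M \<noteq> zero_struct L \<and> Q M}"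
  have Bs: "?B \<in> sets (SB L)"
  proof -
    have "restr {m + 1..m + n} M = restr {m + 1..m + n} (restr {1..m + n} M)" for M
    proof -
      have "{1..m + n} \<inter> {m + 1..m + n} = {m + 1..m + n}" by auto
      then show ?thesis by (simp only: restr_restr)
    qed
    then have "fin_det L (\<lambda>M. restr {m + 1..m + n} M \<noteq> zero_struct L)"
      using fin_det_restr[of L "\<lambda>N. restr {m + 1..m + n} N \<noteq> zero_struct L" "m + n"] by simp
    then have "{M \<in> structures L NN. restr {m + 1..m + n} M \<noteq> zero_struct L \<and> Q M} \<in> sets (SB L)"
      by (intro sets_fin_det fin_det_conj Q)
    from sets.Int[OF sets_dense_part this] show ?thesis
      by (rule back_subst[of "\<lambda>X. X \<in> sets (SB L)"]) (auto simp: dense_part_def)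
  qed
  have shift: "{M \<in> ?G. Q (relabel L NN \<tau> M)} = {M \<in> structures L NN. relabel L NN \<tau> M \<in> ?B}"
  proof -
    have "restr {1..n} M \<noteq> zero_struct L \<longleftrightarrow> restr {m + 1..m + n} (relabel L NN \<tau> M) \<noteq> zero_struct L"
      if M: "M \<in> structures L NN" for M
    proof -
      have "restr {m + 1..m + n} (relabel L NN \<tau> M) \<noteq> zero_struct L \<longleftrightarrow>
        (\<exists>j<length L. \<exists>b\<in>tuples NN (L ! j). set b \<subseteq> {m + 1..m + n} \<and> map \<tau> b \<in> M ! j)"
      proof -
        have "(\<exists>b\<in>relabel L NN \<tau> M ! j. set b \<subseteq> {m + 1..m + n}) \<longleftrightarrow>
            (\<exists>b\<in>tuples NN (L ! j). set b \<subseteq> {m + 1..m + n} \<and> map \<tau> b \<in> M ! j)" if "j < length L" for j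
          unfolding nth_relabel[OF that] by blast
        then show ?thesis unfolding restr_nonzero_iff[OF length_relabel] by blast
      qed
      also have "\<dots> \<longleftrightarrow> (\<exists>j<length L. \<exists>a\<in>M ! j. set a \<subseteq> {1..n})"
      proof -
        have "(\<exists>b\<in>tuples NN (L ! j). set b \<subseteq> {m + 1..m + n} \<and> map \<tau> b \<in> M ! j) \<longleftrightarrow> (\<exists>a\<in>M ! j. set a \<subseteq> {1..n})"
          if j: "j < length L" for j
        proof
          assume "\<exists>b\<in>tuples NN (L ! j). set b \<subseteq> {m + 1..m + n} \<and> map \<tau> b \<in> M ! j"
          then obtain b where b: "set b \<subseteq> {m + 1..m + n}" "map \<tau> b \<in> M ! j" by blast
          have "set (map \<tau> b) \<subseteq> {1..n}" using image_mono[OF b(1), of \<tau>] \<tau>(3) by simp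
          then show "\<exists>a\<in>M ! j. set a \<subseteq> {1..n}" using b(2) by blast
        next
          assume "\<exists>a\<in>M ! j. set a \<subseteq> {1..n}"
          then obtain a where a: "a \<in> M ! j" "set a \<subseteq> {1..n}" by blast
          define b where "b = map (inv \<tau>) a"
          have b: "map \<tau> b = a" unfolding b_def map_map by (rule map_idI) (simp add: permutes_inverses(1)[OF \<tau>(1)])
          have "inv \<tau> ` {1..n} = {m + 1..m + n}" unfolding \<tau>(3)[symmetric] image_comp permutes_inv_o(2)[OF \<tau>(1)] by simp
          then have sb: "set b \<subseteq> {m + 1..m + n}" using image_mono[OF a(2), of "inv \<tau>"] by (simp add: b_def)
          then have "set b \<subseteq> NN" by auto
          moreover have "length b = L ! j" using nth_structures[OF M j] a(1) by (auto simp: tuples_def b_def)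
          ultimately have "b \<in> tuples NN (L ! j)" by (simp add: tuples_def)
          then show "\<exists>b\<in>tuples NN (L ! j). set b \<subseteq> {m + 1..m + n} \<and> map \<tau> b \<in> M ! j" using b a(1) sb by metis
        qed
        then show ?thesis by blast
      qed
      finally show ?thesis using restr_nonzero_iff[OF length_structures[OF M], of "{1..n}"] by simp
    qed
    then show ?thesis using dense_part_relabel[OF \<tau>(1)] by (auto simp: dense_part_def)
  qed
  have "emeasure \<mu> ?B = emeasure \<mu> {M \<in> ?G. Q (relabel L NN \<tau> M)}"
    unfolding shift by (rule emeasure_relabel[OF \<tau>N Bs, symmetric])
  also have "\<dots> = (\<integral>\<^sup>+M. indicator {M \<in> ?G. Q (relabel L NN \<tau> M)} M \<partial>\<mu>)"
  proof (rule nn_integral_indicator[symmetric])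
    have "{M \<in> structures L NN. relabel L NN \<tau> M \<in> ?B} = relabel L NN \<tau> -` ?B \<inter> space (SB L)" by auto
    then show "{M \<in> ?G. Q (relabel L NN \<tau> M)} \<in> sets \<mu>"
      unfolding shift sets_\<mu> using measurable_sets[OF measurable_relabel[OF \<tau>N] Bs] by simp
  qed
  also have "\<dots> = (\<integral>\<^sup>+M. ennreal (?h \<tau> M) * indicator ?G M \<partial>\<mu>)"
    by (rule nn_integral_cong) (auto simp: indicator_def)
  also have "\<dots> = ennreal (\<integral>M. ?h \<tau> M \<partial>?\<rho>)"
    by (rule nn[symmetric]) (use h_meas[OF \<tau>N] in auto)
  also have "\<dots> = (\<integral>\<^sup>+M. ennreal (?u M) * indicator ?G M \<partial>\<mu>)"
    unfolding eq by (rule nn) (use mu ub in auto)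
  finally show ?thesis .
qed

text \<open>
  Let \<open>n\<close> tend to infinity in \<open>block_shift_identity\<close>: a structure in \<open>dense_part\<close> is nonzero, and it has a tuple
  that avoids \<open>[m]\<close>.
\<close>

lemma mixture_fin_det:
  assumes Q: "fin_det L Q"
  shows "(\<integral>\<^sup>+M. emeasure (limit_map L M) {N \<in> structures L NN. Q N} * indicator (dense_part L) M \<partial>\<mu>)
    = emeasure \<mu> {M \<in> dense_part L. Q M}"
proof -
  obtain m where m: "\<And>M M'. M \<in> structures L NN \<Longrightarrow> M' \<in> structures L NN \<Longrightarrow>
     restr {1..m} M = restr {1..m} M' \<Longrightarrow> Q M = Q M'" using fin_detE[OF Q] by metis
  let ?u = "\<lambda>M. ennreal (measure (limit_map L M) {N \<in> structures L NN. Q N})"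
  let ?G = "\<lambda>n. {M \<in> dense_part L. restr {1..Suc n} M \<noteq> zero_struct L}"
  let ?B = "\<lambda>n. {M \<in> dense_part L. restr {m + 1..m + Suc n} M \<noteq> zero_struct L \<and> Q M}"
  have em: "emeasure (limit_map L M) {N \<in> structures L NN. Q N} = ?u M" if "M \<in> structures L NN" for M
  proof -
    interpret prob_space "limit_map L M" by (rule ergodicD(1)[OF limit_map_ergodic[OF that]])
    show ?thesis by (simp add: emeasure_eq_measure)
  qed
  have QS: "{N \<in> structures L NN. Q N} \<in> sets (SB L)" by (rule sets_fin_det[OF Q])
  have mu: "?u \<in> borel_measurable \<mu>"
  proof -
    have "(\<lambda>M. emeasure (limit_map L M) {N \<in> structures L NN. Q N}) \<in> borel_measurable (SB L)"
      by (rule measurable_compose[OF measurable_limit_map measurable_emeasure_ergodic[OF QS]])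
    then show ?thesis unfolding measurable_\<mu> by (subst measurable_cong[OF em[symmetric]]) auto
  qed
  have rs: "{M \<in> dense_part L. R M} \<in> sets \<mu>" if "fin_det L R" for R
    using sets.Int[OF sets_dense_part sets_fin_det[OF that]] unfolding sets_\<mu>
    by (rule back_subst[of "\<lambda>X. X \<in> sets (SB L)"]) (auto simp: dense_part_def)
  have Gs: "?G n \<in> sets \<mu>" for n by (rule rs[OF fin_det_restr[where R = "\<lambda>N. N \<noteq> zero_struct L"]])
  have Bs: "?B n \<in> sets \<mu>" for n
  proof -
    have "restr {m + 1..m + Suc n} M = restr {m + 1..m + Suc n} (restr {1..m + Suc n} M)" for M
    proof -
      have "{1..m + Suc n} \<inter> {m + 1..m + Suc n} = {m + 1..m + Suc n}" by auto
      then show ?thesis by (simp only: restr_restr)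
    qed
    then have "fin_det L (\<lambda>M. restr {m + 1..m + Suc n} M \<noteq> zero_struct L)"
      using fin_det_restr[of L "\<lambda>N. restr {m + 1..m + Suc n} N \<noteq> zero_struct L" "m + Suc n"] by simp
    then show ?thesis by (intro rs fin_det_conj Q)
  qed
  have mono: "restr F' M \<noteq> zero_struct L" if "restr F M \<noteq> zero_struct L" "F \<subseteq> F'" "M \<in> dense_part L" for F F' M
  proof -
    have "length M = length L" using that(3) length_structures by (auto simp: dense_part_def)
    then show ?thesis using that(1,2) unfolding restr_nonzero_iff[OF \<open>length M = length L\<close>] by blast
  qed
  have Gi: "incseq ?G"
    by (rule incseq_SucI) (use mono[of "{1..Suc _}" _ "{1..Suc (Suc _)}"] in auto)
  have Bi: "incseq ?B"
    by (rule incseq_SucI) (use mono[of "{m + 1..m + Suc _}" _ "{m + 1..m + Suc (Suc _)}"] in auto)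
  have GU: "(\<Union>n. ?G n) = dense_part L"
  proof (intro equalityI subsetI)
    fix M assume M: "M \<in> dense_part L"
    then have "M \<in> structures L NN" "M \<noteq> zero_struct L" using dense_nonzero by (auto simp: dense_part_def)
    then obtain n where n: "1 \<le> n" "restr {1..n} M \<noteq> zero_struct L" using nonzero_restr by metis
    then have "M \<in> ?G (n - 1)" using M by simp
    then show "M \<in> (\<Union>n. ?G n)" by blast
  qed auto
  have BU: "(\<Union>n. ?B n) = {M \<in> dense_part L. Q M}"
  proof (intro equalityI subsetI)
    fix M assume M: "M \<in> {M \<in> dense_part L. Q M}"
    then obtain n where "restr {m + 1..m + Suc n} M \<noteq> zero_struct L" using dense_part_far[of M L m] by blast
    then show "M \<in> (\<Union>n. ?B n)" using M by blast
  qed auto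
  have D: "emeasure (density \<mu> ?u) A = (\<integral>\<^sup>+M. ?u M * indicator A M \<partial>\<mu>)" if "A \<in> sets \<mu>" for A
    by (rule emeasure_density[OF mu that])
  have "(\<integral>\<^sup>+M. emeasure (limit_map L M) {N \<in> structures L NN. Q N} * indicator (dense_part L) M \<partial>\<mu>)
    = (\<integral>\<^sup>+M. ?u M * indicator (dense_part L) M \<partial>\<mu>)"
    by (rule nn_integral_cong) (simp add: em space_\<mu>)
  also have "\<dots> = emeasure (density \<mu> ?u) (\<Union>n. ?G n)"
    unfolding GU by (rule D[symmetric]) (simp add: sets_\<mu> sets_dense_part)
  also have "\<dots> = (SUP n. emeasure (density \<mu> ?u) (?G n))"
    by (rule SUP_emeasure_incseq[symmetric]) (use Gs Gi in auto)
  also have "\<dots> = (SUP n. emeasure \<mu> (?B n))"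
  proof -
    have "emeasure \<mu> (?B n) = emeasure (density \<mu> ?u) (?G n)" for n
      unfolding D[OF Gs] by (rule block_shift_identity[OF Q], rule m, assumption+) simp
    then show ?thesis by simp
  qed
  also have "\<dots> = emeasure \<mu> (\<Union>n. ?B n)"
    by (rule SUP_emeasure_incseq) (use Bs Bi in auto)
  finally show ?thesis unfolding BU .
qed

definition limit_law :: "struc measure measure" where
  "limit_law = distr (density \<mu> (indicator (dense_part L))) (ergodic_borel L) (limit_map L)"

lemma sets_limit_law [simp]: "sets limit_law = sets (ergodic_borel L)"
  by (simp add: limit_law_def)

lemma nn_integral_limit_law:
  assumes f: "f \<in> borel_measurable (ergodic_borel L)"
  shows "(\<integral>\<^sup>+W. f W \<partial>limit_law) = (\<integral>\<^sup>+M. f (limit_map L M) * indicator (dense_part L) M \<partial>\<mu>)"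
proof -
  have m: "limit_map L \<in> measurable (density \<mu> (indicator (dense_part L))) (ergodic_borel L)"
    using measurable_limit_map by (simp add: measurable_\<mu>)
  have "(\<integral>\<^sup>+W. f W \<partial>limit_law) = (\<integral>\<^sup>+M. f (limit_map L M) \<partial>density \<mu> (indicator (dense_part L)))"
    unfolding limit_law_def by (rule nn_integral_distr[OF m]) (use f in simp)
  also have "\<dots> = (\<integral>\<^sup>+M. indicator (dense_part L) M * f (limit_map L M) \<partial>\<mu>)"
    using sets_dense_part measurable_compose[OF measurable_limit_map f]
    by (intro nn_integral_density) (auto simp: measurable_\<mu> sets_\<mu>)
  finally show ?thesis by (simp add: mult.commute)
qed

text \<open>
  Both sides are measures in \<open>B\<close> that agree on clopen events.  The mixture does not charge the zero structure
  because no nontrivial limit does.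
\<close>

lemma mixture_limit_law:
  assumes "B \<in> sets (SB L)" shows "mixture limit_law B = emeasure \<mu> (dense_part L \<inter> B)"
proof -
  let ?M1 = "density \<mu> (indicator (dense_part L))" and ?M2 = "limit_law \<bind> (\<lambda>W. W)"
  have dp: "dense_part L \<in> sets \<mu>" by (simp add: sets_\<mu> sets_dense_part)
  have M1: "emeasure ?M1 C = emeasure \<mu> (dense_part L \<inter> C)" if "C \<in> sets (SB L)" for C
    using emeasure_restricted[OF dp, of C] that by (simp add: sets_\<mu>)
  have ne: "space limit_law \<noteq> {}" using zero_limit_ergodic[of L] sets_eq_imp_space_eq[OF sets_limit_law] by auto
  have ms: "(\<lambda>W. W) \<in> measurable limit_law (subprob_algebra (SB L))"
    using ergodic_to_subprob measurable_cong_sets[OF sets_limit_law refl] by blast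
  have M2: "emeasure ?M2 C = mixture limit_law C" if "C \<in> sets (SB L)" for C
    unfolding mixture_def by (rule emeasure_bind[OF ne ms that])
  have mix: "mixture limit_law C = (\<integral>\<^sup>+M. emeasure (limit_map L M) C * indicator (dense_part L) M \<partial>\<mu>)" if "C \<in> sets (SB L)" for C
    unfolding mixture_def by (rule nn_integral_limit_law[OF measurable_emeasure_ergodic[OF that]])
  have "?M1 = ?M2"
  proof (rule measure_eqI_fin_det[where L = L])
    show "sets ?M1 = sets (SB L)" by (simp add: sets_\<mu>)
    show "sets ?M2 = sets (SB L)"
      by (rule sets_bind[OF _ ne]) (use sets_eq_imp_space_eq[OF sets_limit_law] ergodicD(2) in auto)
    have "emeasure \<mu> (dense_part L \<inter> {zero_struct L}) \<le> emeasure \<mu> {zero_struct L}"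
      by (rule emeasure_mono) (auto simp: sets_\<mu> singleton_zero_sets)
    then show "emeasure ?M1 {zero_struct L} = 0" using M1[OF singleton_zero_sets] zero_null by simp
    have "(\<integral>\<^sup>+M. emeasure (limit_map L M) {zero_struct L} * indicator (dense_part L) M \<partial>\<mu>) = (\<integral>\<^sup>+M. 0 \<partial>\<mu>)"
    proof (rule nn_integral_cong)
      fix M assume "M \<in> space \<mu>"
      then have M: "M \<in> structures L NN" by (simp add: space_\<mu>)
      show "emeasure (limit_map L M) {zero_struct L} * indicator (dense_part L) M = 0"
        using ergodic_zero_null[OF limit_map_ergodic[OF M]] limit_map_nonzero_iff[OF M]
        by (cases "M \<in> dense_part L") auto
    qed
    then show "emeasure ?M2 {zero_struct L} = 0" using M2[OF singleton_zero_sets] mix[OF singleton_zero_sets] by simp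
    fix Q assume Q: "fin_det L Q" "\<not> Q (zero_struct L)"
    let ?C = "{M \<in> structures L NN. Q M}"
    have C: "?C \<in> sets (SB L)" by (rule sets_fin_det[OF Q(1)])
    have eq: "dense_part L \<inter> ?C = {M \<in> dense_part L. Q M}" by (auto simp: dense_part_def)
    show "emeasure ?M1 ?C = emeasure ?M2 ?C"
      unfolding M1[OF C] M2[OF C] mix[OF C] eq mixture_fin_det[OF Q(1)] ..
    have "emeasure \<mu> (dense_part L \<inter> ?C) \<le> emeasure \<mu> ?C" by (rule emeasure_mono) (use C in \<open>auto simp: sets_\<mu>\<close>)
    also have "\<dots> < \<infinity>" by (rule fin_det_finite[OF finite_nonzero sets_\<mu> Q])
    finally show "emeasure ?M1 ?C \<noteq> \<infinity>" unfolding M1[OF C] by simp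
  qed
  then show ?thesis using M1[OF assms] M2[OF assms] by simp
qed

lemma limit_law_zero: "emeasure limit_law {zero_limit L} = 0"
proof -
  have "emeasure limit_law {zero_limit L} = (\<integral>\<^sup>+W. indicator {zero_limit L} W \<partial>limit_law)"
    by (rule nn_integral_indicator[symmetric]) (simp add: zero_limit_sets)
  also have "\<dots> = (\<integral>\<^sup>+M. indicator {zero_limit L} (limit_map L M) * indicator (dense_part L) M \<partial>\<mu>)"
    by (rule nn_integral_limit_law[OF borel_measurable_indicator[OF zero_limit_sets]])
  also have "\<dots> = (\<integral>\<^sup>+M. 0 \<partial>\<mu>)"
  proof (rule nn_integral_cong)
    fix M assume "M \<in> space \<mu>"
    then have M: "M \<in> structures L NN" by (simp add: space_\<mu>)
    show "indicator {zero_limit L} (limit_map L M) * indicator (dense_part L) M = (0::ennreal)"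
      using limit_map_nonzero_iff[OF M] by (auto simp: indicator_def)
  qed
  finally show ?thesis by simp
qed

lemma limit_law_integral:
  assumes n: "1 \<le> n"
  shows "(\<integral>\<^sup>+W. ennreal (1 - measure W (cylinder L n (zero_struct L))) \<partial>limit_law) < \<infinity>"
proof -
  let ?C = "{M \<in> structures L NN. restr {1..n} M \<noteq> zero_struct L}"
  have C: "?C \<in> sets (SB L)" by (rule sets_fin_det[OF fin_det_restr[where R = "\<lambda>N. N \<noteq> zero_struct L"]])
  have "(\<integral>\<^sup>+W. ennreal (1 - measure W (cylinder L n (zero_struct L))) \<partial>limit_law) = mixture limit_law ?C"
    unfolding mixture_def
  proof (rule nn_integral_cong)
    fix W assume "W \<in> space limit_law"
    then have W: "W \<in> ergodic_measures L" using sets_eq_imp_space_eq[OF sets_limit_law] by simp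
    interpret prob_space W by (rule ergodicD(1)[OF W])
    have "?C = space W - cylinder L n (zero_struct L)"
      using sets_eq_imp_space_eq[OF ergodicD(2)[OF W]] by (auto simp: cylinder_def)
    then show "ennreal (1 - measure W (cylinder L n (zero_struct L))) = emeasure W ?C"
      by (simp add: emeasure_eq_measure prob_compl ergodicD(2)[OF W] sets_cylinder)
  qed
  also have "\<dots> = emeasure \<mu> (dense_part L \<inter> ?C)" by (rule mixture_limit_law[OF C])
  also have "\<dots> \<le> emeasure \<mu> ?C" by (rule emeasure_mono) (use C in \<open>auto simp: sets_\<mu>\<close>)
  also have "\<dots> < \<infinity>" by (rule finite_nonzero[OF n])
  finally show ?thesis .
qed

end

section \<open>The sorting permutation\<close>

lemma distinct_by_mult: "distinct (by_mult s)" and set_by_mult: "set (by_mult s) = set_mset s"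
  by (simp_all add: by_mult_def)

lemma length_by_mult: "length (by_mult s) = card (set_mset s)"
  using distinct_card[OF distinct_by_mult, of s] by (simp add: set_by_mult)

lemma mult_partition_in:
  shows "mult_partition s \<in> partitions (size s)"
proof -
  let ?f = "\<lambda>x. - int (count s x)"
  have "sorted (map ?f (by_mult s))" unfolding by_mult_def by (rule sorted_sort_key)
  then have "sorted_wrt (\<ge>) (mult_partition s)" by (simp add: mult_partition_def sorted_wrt_map)
  moreover have "\<forall>x\<in>set (mult_partition s). 1 \<le> x"
    by (auto simp: mult_partition_def set_by_mult Suc_le_eq One_nat_def)
  moreover have "sum_list (mult_partition s) = size s"
    unfolding mult_partition_def size_multiset_overloaded_eq
    using sum_list_distinct_conv_sum_set[OF distinct_by_mult, of "count s" s] by (simp add: set_by_mult)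
  ultimately show ?thesis by (simp add: partitions_def)
qed

lemma partitions_unique: "p \<in> partitions q \<Longrightarrow> p \<in> partitions q' \<Longrightarrow> q = q'"
  by (auto simp only: partitions_def mem_Collect_eq)

lemma finite_partitions: "finite (partitions q)"
proof (rule finite_subset)
  show "partitions q \<subseteq> {p. set p \<subseteq> {..q} \<and> length p \<le> q}"
  proof
    fix p assume p: "p \<in> partitions q"
    have "x \<le> q" if "x \<in> set p" for x using member_le_sum_list[OF that] p by (simp add: partitions_def)
    moreover have "length p \<le> q"
    proof -
      have "sum_list (map (\<lambda>_. 1) p) \<le> sum_list (map id p)"
        by (rule sum_list_mono) (use p in \<open>auto simp: partitions_def\<close>)
      then show ?thesis using p by (simp add: partitions_def sum_list_triv)
    qed
    ultimately show "p \<in> {p. set p \<subseteq> {..q} \<and> length p \<le> q}" by auto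
  qed
qed (rule finite_lists_length_le, simp)

text \<open>
  The numbers below the \<open>k\<close>th element of the complement are elements of \<open>S\<close> or one of the \<open>k\<close> earlier elements.
\<close>

lemma enumerate_complement_le:
  assumes S: "finite S" shows "enumerate (NN - S) k \<le> k + card S + 1"
proof -
  let ?A = "NN - S"
  have inf: "infinite ?A" by (rule Diff_infinite_finite[OF S]) (rule infinite_Ici)
  define e where "e = enumerate ?A k"
  have "{1..<e} \<subseteq> S \<union> enumerate ?A ` {..<k}"
  proof
    fix x assume x: "x \<in> {1..<e}"
    show "x \<in> S \<union> enumerate ?A ` {..<k}"
    proof (cases "x \<in> S")
      case False
      then have "x \<in> ?A" using x by simp
      then obtain j where j: "enumerate ?A j = x" using enumerate_Ex[OF inf] by blast
      have "j < k" using j x strict_mono_less[OF strict_mono_enumerate[OF inf], of j k] by (simp add: e_def)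
      then show ?thesis using j by blast
    qed simp
  qed
  then have "card {1..<e} \<le> card (S \<union> enumerate ?A ` {..<k})" by (intro card_mono) (use S in auto)
  also have "\<dots> \<le> card S + k"
    using card_Un_le[of S "enumerate ?A ` {..<k}"] card_image_le[of "{..<k}" "enumerate ?A"] by simp
  finally show ?thesis by (simp add: e_def)
qed

lemma sort_perm_first:
  assumes "i \<in> {1..card (set_mset s)}" shows "sort_perm s i = by_mult s ! (i - 1)"
  using assms by (simp add: sort_perm_def Let_def length_by_mult)

lemma sort_perm_rest:
  assumes "i > card (set_mset s)" shows "sort_perm s i = enumerate (NN - set_mset s) (i - card (set_mset s) - 1)"
  using assms by (simp add: sort_perm_def Let_def length_by_mult)

lemma sort_perm_permutes:
  assumes s: "s \<in> nat_multisets" shows "sort_perm s permutes NN"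
proof (rule bij_imp_permutes)
  let ?S = "set_mset s" let ?r = "card ?S"
  have S: "?S \<subseteq> NN" using s by (simp add: nat_multisets_def)
  have inf: "infinite (NN - ?S)" by (rule Diff_infinite_finite[OF finite_set_mset]) (rule infinite_Ici)
  have "bij_betw (\<lambda>i. i - 1) {1..?r} {..<?r}"
    by (rule bij_betw_byWitness[where f' = Suc]) (auto simp: One_nat_def)
  moreover have "bij_betw ((!) (by_mult s)) {..<?r} ?S"
    by (rule bij_betw_nth[OF distinct_by_mult]) (simp_all add: length_by_mult set_by_mult)
  ultimately have "bij_betw ((!) (by_mult s) \<circ> (\<lambda>i. i - 1)) {1..?r} ?S" by (rule bij_betw_trans)
  then have 1: "bij_betw (sort_perm s) {1..?r} ?S"
    by (subst bij_betw_cong[of _ _ "(!) (by_mult s) \<circ> (\<lambda>i. i - 1)"]) (simp_all add: sort_perm_first)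
  have "bij_betw (\<lambda>i. i - ?r - 1) {?r<..} UNIV"
    by (rule bij_betw_byWitness[where f' = "\<lambda>k. k + ?r + 1"]) auto
  moreover have "bij_betw (enumerate (NN - ?S)) UNIV (NN - ?S)" by (rule bij_enumerate[OF inf])
  ultimately have "bij_betw (enumerate (NN - ?S) \<circ> (\<lambda>i. i - ?r - 1)) {?r<..} (NN - ?S)" by (rule bij_betw_trans)
  then have 2: "bij_betw (sort_perm s) {?r<..} (NN - ?S)"
    by (subst bij_betw_cong[of _ _ "enumerate (NN - ?S) \<circ> (\<lambda>i. i - ?r - 1)"]) (simp_all add: sort_perm_rest)
  have "bij_betw (sort_perm s) ({1..?r} \<union> {?r<..}) (?S \<union> (NN - ?S))"
    by (rule bij_betw_combine[OF 1 2]) blast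
  moreover have "{1..?r} \<union> {?r<..} = NN" by auto
  moreover have "?S \<union> (NN - ?S) = NN" using S by blast
  ultimately show "bij_betw (sort_perm s) NN NN" by simp
  show "sort_perm s i = i" if "i \<notin> NN" for i using that by (simp add: sort_perm_def not_le)
qed

text \<open>
  Labels above the number \<open>r\<close> of distinct elements are never increased, so at most \<open>1, \<dots>, r\<close> leave an initial
  segment.
\<close>

lemma sort_perm_displacement:
  assumes s: "s \<in> nat_multisets"
  shows "card {i \<in> {1..n}. sort_perm s i \<notin> {1..n}} \<le> card (set_mset s)"
proof -
  have "{i \<in> {1..n}. sort_perm s i \<notin> {1..n}} \<subseteq> {1..card (set_mset s)}"
  proof
    fix i assume i: "i \<in> {i \<in> {1..n}. sort_perm s i \<notin> {1..n}}"
    show "i \<in> {1..card (set_mset s)}"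
    proof (rule ccontr)
      assume "i \<notin> {1..card (set_mset s)}"
      then have r: "i > card (set_mset s)" using i by auto
      have "sort_perm s i \<le> (i - card (set_mset s) - 1) + card (set_mset s) + 1"
        unfolding sort_perm_rest[OF r] by (rule enumerate_complement_le) simp
      then have "sort_perm s i \<le> n" using r i by simp
      moreover have "sort_perm s i \<in> NN" using permutes_in_image[OF sort_perm_permutes[OF s], of i] i by simp
      ultimately show False using i by simp
    qed
  qed
  from card_mono[OF _ this] show ?thesis by simp
qed

lemma image_mset_sum: "image_mset f (sum g A) = (\<Sum>x\<in>A. image_mset f (g x))"
  by (induction A rule: infinite_finite_induct) auto

lemma sort_perm_canonical:
  "image_mset (sort_perm s) (canonical_mset (mult_partition s)) = s"
proof -
  let ?r = "card (set_mset s)" and ?xs = "by_mult s"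
  have "image_mset (sort_perm s) (canonical_mset (mult_partition s))
    = (\<Sum>i<?r. replicate_mset (count s (?xs ! i)) (?xs ! i))"
    unfolding canonical_mset_def image_mset_sum mult_partition_def length_map length_by_mult
  proof (rule sum.cong[OF refl])
    fix i assume "i \<in> {..<?r}"
    then show "image_mset (sort_perm s) (replicate_mset (map (count s) ?xs ! i) (Suc i))
      = replicate_mset (count s (?xs ! i)) (?xs ! i)"
      using sort_perm_first[of "Suc i" s] by (simp add: length_by_mult)
  qed
  also have "\<dots> = (\<Sum>x\<in>set_mset s. replicate_mset (count s x) x)"
    by (rule sum.reindex_bij_betw[OF bij_betw_nth[OF distinct_by_mult]]) (simp_all add: length_by_mult set_by_mult)
  also have "\<dots> = s"
  proof (rule multiset_eqI)
    fix y
    have "count (\<Sum>x\<in>set_mset s. replicate_mset (count s x) x) y = (\<Sum>x\<in>set_mset s. if x = y then count s x else 0)"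
      by (simp add: count_sum)
    also have "\<dots> = count s y" by (simp add: sum.delta not_in_iff)
    finally show "count (\<Sum>x\<in>set_mset s. replicate_mset (count s x) x) y = count s y" .
  qed
  finally show ?thesis .
qed

text \<open>
  The relabelled structure is the image of \<open>M\<close> under the sorting permutation, which maps the canonical
  multiset to \<open>s\<close>.
\<close>

lemma is_index_sort_perm:
  assumes s: "s \<in> nat_multisets" and M: "M \<in> structures L NN"
  shows "is_index L (relabel L NN (inv (sort_perm s)) M) s \<longleftrightarrow> is_index L M (canonical_mset (mult_partition s))"
proof -
  let ?\<sigma> = "sort_perm s"
  have \<sigma>: "?\<sigma> permutes NN" by (rule sort_perm_permutes[OF s])
  let ?N = "relabel L NN (inv ?\<sigma>) M"
  have "relabel L NN ?\<sigma> ?N = M"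
    using relabel_perm_relabel[OF \<sigma>, of L "inv ?\<sigma>" M] permutes_inv_o(2)[OF \<sigma>] relabel_id[OF M] by simp
  then show ?thesis
    using is_index_relabel[OF \<sigma> sort_perm_displacement[OF s] relabel_in_structures, of L "inv ?\<sigma>" M "canonical_mset (mult_partition s)"]
    by (simp add: sort_perm_canonical)
qed

section \<open>The decomposition\<close>

definition index_part :: "nat list \<Rightarrow> nat multiset \<Rightarrow> struc set" where
  "index_part L s = {M \<in> structures L NN. is_index L M s}"

lemma sets_index_part: "index_part L s \<in> sets (SB L)"
proof -
  have "{M \<in> space (SB L). is_index L M s} \<in> sets (SB L)" by measurable
  then show ?thesis by (simp add: index_part_def)
qed

lemma is_index_in:
  assumes "is_index L M s" "M \<in> structures L NN"
  shows "s \<in> nat_multisets" "sorted L \<Longrightarrow> size s \<le> last L" "dense L {#} M \<Longrightarrow> s = {#}"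
proof -
  obtain s' where s': "dense L s' M" "s \<subseteq># s'" using assms(1) unfolding is_index_def by blast
  show "s \<in> nat_multisets" using dense_in(1)[OF s'(1) assms(2)] set_mset_mono[OF s'(2)] by (auto simp: nat_multisets_def)
  show "size s \<le> last L" if "sorted L" using dense_in(2)[OF s'(1) assms(2) that] size_mset_mono[OF s'(2)] by simp
  show "s = {#}" if "dense L {#} M" using assms(1) that unfolding is_index_def by auto
qed

text \<open>
  The entries of each tuple form a dense multiset and therefore include \<open>s\<^sub>M\<close>.
\<close>

lemma substruct_index:
  assumes "is_index L M s" "M \<in> structures L NN" shows "substruct s M = M"
proof (rule nth_equalityI)
  show len: "length (substruct s M) = length M" by (simp add: substruct_def)
  fix j assume "j < length (substruct s M)"
  then have j: "j < length L" "j < length M" using len length_structures[OF assms(2)] by simp_all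
  have "s \<subseteq># mset a" if "a \<in> M ! j" for a
    using dense_of_mem[OF that j(1)] assms(1) unfolding is_index_def by blast
  then have "a \<in> substruct s M ! j" if "a \<in> M ! j" for a
    using substruct_mem_iff[OF assms(2) j(1)] that by blast
  moreover have "substruct s M ! j \<subseteq> M ! j" using j by (auto simp: substruct_def)
  ultimately show "substruct s M ! j = M ! j" by blast
qed

definition with_partition :: "nat list \<Rightarrow> nat multiset set" where
  "with_partition p = {s \<in> nat_multisets. mult_partition s = p}"

lemma countable_multisets: "countable (S :: nat multiset set)"
proof -
  have "S \<subseteq> range (mset :: nat list \<Rightarrow> nat multiset)" by (metis ex_mset rangeI subsetI)
  then show ?thesis by (rule countable_subset) (rule countable_image, rule countableI_type)
qed

context exchangeable_rate
begin

definition index_measure :: "nat list \<Rightarrow> struc measure" where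
  "index_measure p = density \<mu> (indicator (index_part L (canonical_mset p)))"

lemma sets_index_measure [simp]: "sets (index_measure p) = sets (SB L)"
  by (simp add: index_measure_def sets_\<mu>)

lemma emeasure_index_measure:
  "B \<in> sets (SB L) \<Longrightarrow> emeasure (index_measure p) B = emeasure \<mu> (index_part L (canonical_mset p) \<inter> B)"
  unfolding index_measure_def using emeasure_restricted[of "index_part L (canonical_mset p)" \<mu> B]
  by (simp add: sets_\<mu> sets_index_part)

lemma emeasure_index_measure_le:
  assumes "B \<in> sets (SB L)" shows "emeasure (index_measure p) B \<le> emeasure \<mu> B"
  unfolding emeasure_index_measure[OF assms] by (rule emeasure_mono) (use assms in \<open>auto simp: sets_\<mu>\<close>)

lemma AE_index_measure:
  assumes "AE M in \<mu>. M \<in> index_part L (canonical_mset p) \<longrightarrow> Q M" shows "AE M in index_measure p. Q M"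
proof -
  have m: "(indicator (index_part L (canonical_mset p)) :: struc \<Rightarrow> ennreal) \<in> borel_measurable \<mu>"
    by (rule borel_measurable_indicator) (simp add: sets_\<mu> sets_index_part)
  show ?thesis unfolding index_measure_def AE_density[OF m]
    using assms by eventually_elim (simp add: indicator_def split: if_splits)
qed

lemma AE_all_sub_limits: "AE M in \<mu>. \<forall>s\<in>nat_multisets. sub_limit_exists L s M"
proof -
  have "AE M in \<mu>. \<forall>xs. mset xs \<in> nat_multisets \<longrightarrow> sub_limit_exists L (mset xs) M"
    unfolding AE_all_countable
  proof
    fix xs
    show "AE M in \<mu>. mset xs \<in> nat_multisets \<longrightarrow> sub_limit_exists L (mset xs) M"
      using AE_sub_limit_exists[of "mset xs"] by (cases "mset xs \<in> nat_multisets") auto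
  qed
  then show ?thesis by eventually_elim (metis ex_mset)
qed

lemma index_measure_props:
  "emeasure (index_measure p) {zero_struct L} = 0"
  "n \<ge> 1 \<Longrightarrow> emeasure (index_measure p) {M \<in> structures L NN. restr {1..n} M \<noteq> zero_struct L} < \<infinity>"
  "AE M in index_measure p. substruct (canonical_mset p) M = M"
  "AE M in index_measure p. s_index_is L M (canonical_mset p)"
proof -
  show "emeasure (index_measure p) {zero_struct L} = 0"
    using emeasure_index_measure_le[OF singleton_zero_sets, of p] zero_null by simp
  show "emeasure (index_measure p) {M \<in> structures L NN. restr {1..n} M \<noteq> zero_struct L} < \<infinity>" if "n \<ge> 1"
    using emeasure_index_measure_le[OF sets_fin_det[OF fin_det_restr[where R = "\<lambda>N. N \<noteq> zero_struct L"]]]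
      finite_nonzero[OF that] by (rule le_less_trans)
  show "AE M in index_measure p. substruct (canonical_mset p) M = M"
    by (rule AE_index_measure) (auto simp: index_part_def substruct_index)
  show "AE M in index_measure p. s_index_is L M (canonical_mset p)"
  proof (rule AE_index_measure)
    show "AE M in \<mu>. M \<in> index_part L (canonical_mset p) \<longrightarrow> s_index_is L M (canonical_mset p)"
      using AE_all_sub_limits
    proof eventually_elim
      case (elim M)
      show ?case
      proof
        assume M: "M \<in> index_part L (canonical_mset p)"
        then have "M \<in> structures L NN" by (simp add: index_part_def)
        from s_index_is_iff[OF this] show "s_index_is L M (canonical_mset p)"
          using elim M by (auto simp: index_part_def)
      qed
    qed
  qed
qed

text \<open>
  By exchangeability, each summand of the symmetrization is the measure of the event \<open>s\<^sub>M = s\<close>, and these events are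
  disjoint for different \<open>s\<close>.
\<close>

lemma symmetrized_index_measure:
  assumes B: "B \<in> sets (SB L)"
  shows "symmetrized L p (index_measure p) B = emeasure \<mu> (\<Union>s\<in>with_partition p. index_part L s \<inter> B)"
proof -
  have "symmetrized L p (index_measure p) B = (\<integral>\<^sup>+s. emeasure \<mu> (index_part L s \<inter> B) \<partial>count_space (with_partition p))"
    unfolding symmetrized_def with_partition_def
  proof (rule nn_integral_cong)
    fix s assume "s \<in> space (count_space {s \<in> nat_multisets. mult_partition s = p})"
    then have s: "s \<in> nat_multisets" "mult_partition s = p" by auto
    let ?\<sigma> = "inv (sort_perm s)"
    have \<sigma>: "?\<sigma> permutes NN" by (rule permutes_inv[OF sort_perm_permutes[OF s(1)]])
    have eq: "{M \<in> structures L NN. relabel L NN ?\<sigma> M \<in> B} = relabel L NN ?\<sigma> -` B \<inter> space (SB L)" by auto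
    have m: "{M \<in> structures L NN. relabel L NN ?\<sigma> M \<in> B} \<in> sets (SB L)"
      unfolding eq by (rule measurable_sets[OF measurable_relabel[OF \<sigma>] B])
    have "emeasure (index_measure p) {M \<in> structures L NN. relabel L NN ?\<sigma> M \<in> B}
      = emeasure \<mu> {M \<in> structures L NN. relabel L NN ?\<sigma> M \<in> index_part L s \<inter> B}"
      unfolding emeasure_index_measure[OF m]
      by (rule arg_cong[where f = "emeasure \<mu>"])
         (use is_index_sort_perm[OF s(1), of _ L] s(2) in \<open>auto simp: index_part_def\<close>)
    also have "\<dots> = emeasure \<mu> (index_part L s \<inter> B)"
      by (rule emeasure_relabel[OF \<sigma>]) (intro sets.Int sets_index_part B)
    finally show "emeasure (index_measure p) {M \<in> structures L NN. relabel L NN ?\<sigma> M \<in> B} = emeasure \<mu> (index_part L s \<inter> B)" .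
  qed
  also have "\<dots> = emeasure \<mu> (\<Union>s\<in>with_partition p. index_part L s \<inter> B)"
  proof (rule emeasure_UN_countable[symmetric])
    show "index_part L s \<inter> B \<in> sets \<mu>" for s unfolding sets_\<mu> by (intro sets.Int sets_index_part B)
    show "countable (with_partition p)" by (rule countable_multisets)
    show "disjoint_family_on (\<lambda>s. index_part L s \<inter> B) (with_partition p)"
      unfolding disjoint_family_on_def index_part_def using is_index_unique by fast
  qed
  finally show ?thesis .
qed

text \<open>
  Almost every \<open>M\<close> lies in \<open>dense_part\<close> or has a nonempty \<open>s\<^sub>M\<close>, whose size is bounded by the largest arity since
  it is contained in the entries of some tuple.
\<close>

lemma rate_measure_decomposition:
  assumes L: "sorted L" and B: "B \<in> sets (SB L)"
  shows "emeasure \<mu> B = mixture limit_law B + (\<Sum>q = 1..last L. \<Sum>p\<in>partitions q. symmetrized L p (index_measure p) B)"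
proof -
  let ?A = "\<lambda>p. \<Union>s\<in>with_partition p. index_part L s \<inter> B"
  let ?I = "Sigma {1..last L} partitions"
  have A: "?A p \<in> sets \<mu>" for p
    unfolding sets_\<mu> by (intro sets.countable_UN'' countable_multisets sets.Int sets_index_part B)
  have finI: "finite ?I" by (intro finite_SigmaI finite_partitions) simp
  have disj: "disjoint_family_on (\<lambda>x. ?A (snd x)) ?I"
    unfolding disjoint_family_on_def
  proof (intro ballI impI)
    fix x y assume xy: "x \<in> ?I" "y \<in> ?I" "x \<noteq> y"
    have "snd x \<noteq> snd y"
    proof
      assume "snd x = snd y"
      moreover have "fst x = sum_list (snd x)" "fst y = sum_list (snd y)" using xy(1,2) by (auto simp: partitions_def)
      ultimately show False using xy(3) by (simp add: prod_eq_iff)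
    qed
    then show "?A (snd x) \<inter> ?A (snd y) = {}"
      using is_index_unique by (fastforce simp: with_partition_def index_part_def)
  qed
  have "(\<Sum>q = 1..last L. \<Sum>p\<in>partitions q. symmetrized L p (index_measure p) B) = (\<Sum>x\<in>?I. emeasure \<mu> (?A (snd x)))"
    by (subst sum.Sigma) (auto simp: symmetrized_index_measure[OF B] finite_partitions case_prod_beta)
  also have "\<dots> = emeasure \<mu> (\<Union>x\<in>?I. ?A (snd x))"
    by (rule sum_emeasure[OF _ disj finI]) (use A in auto)
  finally have sum: "(\<Sum>q = 1..last L. \<Sum>p\<in>partitions q. symmetrized L p (index_measure p) B) = emeasure \<mu> (\<Union>x\<in>?I. ?A (snd x))" .
  have U: "(\<Union>x\<in>?I. ?A (snd x)) \<in> sets \<mu>" by (intro sets.finite_UN finI A)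
  have D: "dense_part L \<inter> B \<in> sets \<mu>" unfolding sets_\<mu> by (intro sets.Int sets_dense_part B)
  have dj: "(dense_part L \<inter> B) \<inter> (\<Union>x\<in>?I. ?A (snd x)) = {}"
  proof (rule equals0I)
    fix M assume M: "M \<in> (dense_part L \<inter> B) \<inter> (\<Union>x\<in>?I. ?A (snd x))"
    then obtain q p s where qp: "q \<in> {1..last L}" "p \<in> partitions q" "s \<in> with_partition p" "M \<in> index_part L s" by auto
    then have "s = {#}" using M is_index_in(3)[of L M s] by (auto simp: dense_part_def index_part_def)
    then have "p \<in> partitions 0" using qp(3) mult_partition_in[of s] by (simp add: with_partition_def)
    then show False using partitions_unique[OF qp(2)] qp(1) by fastforce
  qed
  have "emeasure \<mu> B = emeasure \<mu> ((dense_part L \<inter> B) \<union> (\<Union>x\<in>?I. ?A (snd x)))"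
  proof (rule emeasure_eq_AE)
    show "AE M in \<mu>. M \<in> B \<longleftrightarrow> M \<in> (dense_part L \<inter> B) \<union> (\<Union>x\<in>?I. ?A (snd x))"
      using AE_\<mu>_structure AE_has_limit AE_index
    proof eventually_elim
      case (elim M)
      then have M: "M \<in> structures L NN" by blast
      have "M \<in> (\<Union>x\<in>?I. ?A (snd x))" if "M \<in> B" "M \<notin> dense_part L"
      proof -
        have "\<not> dense L {#} M" using that(2) M elim(2) by (simp add: dense_part_def)
        then obtain s where s: "s \<noteq> {#}" "is_index L M s" using elim(3) by blast
        have "s \<in> nat_multisets" "size s \<le> last L" using is_index_in[OF s(2) M] L by auto
        moreover have "1 \<le> size s" using s(1) by (simp add: Suc_le_eq One_nat_def nonempty_has_size)
        ultimately have "(size s, mult_partition s) \<in> ?I" "s \<in> with_partition (mult_partition s)"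
          using mult_partition_in by (auto simp: with_partition_def)
        then show ?thesis using s(2) M that(1) by (intro UN_I[of "(size s, mult_partition s)"]) (auto simp: index_part_def)
      qed
      then show ?case by blast
    qed
  qed (use B D U in \<open>auto simp: sets_\<mu>\<close>)
  also have "\<dots> = emeasure \<mu> (dense_part L \<inter> B) + emeasure \<mu> (\<Union>x\<in>?I. ?A (snd x))"
    by (rule plus_emeasure[OF D U dj, symmetric])
  finally show ?thesis unfolding sum mixture_limit_law[OF B] .
qed

text \<open>
  The law of large numbers makes \<open>W {M. \<parallel>M\<parallel> \<in> E}\<close> the indicator of \<open>E\<close> at \<open>W\<close>.  The symmetrized measures do not
  contribute: they charge only structures in which the empty multiset is not dense.
\<close>

lemma measure_eq_preimage_of_limit:
  fixes \<mu>p :: "nat list \<Rightarrow> struc measure"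
  assumes \<nu>: "sets \<nu> = sets (ergodic_borel L)" "emeasure \<nu> {zero_limit L} = 0"
    and \<mu>p: "\<And>q p. q \<in> {1..last L} \<Longrightarrow> p \<in> partitions q \<Longrightarrow> sets (\<mu>p p) = sets (SB L) \<and>
      (AE M in \<mu>p p. s_index_is L M (canonical_mset p))"
    and dec: "\<And>B. B \<in> sets (SB L) \<Longrightarrow> emeasure \<mu> B = mixture \<nu> B + (\<Sum>q = 1..last L. \<Sum>p\<in>partitions q. symmetrized L p (\<mu>p p) B)"
    and E: "E \<in> sets (ergodic_borel L)"
  shows "emeasure \<nu> E = emeasure \<mu> {M \<in> structures L NN. has_limit L M \<and> limit_map L M \<in> E - {zero_limit L}}"
proof -
  let ?E = "E - {zero_limit L}"
  let ?B = "{M \<in> structures L NN. has_limit L M \<and> limit_map L M \<in> ?E}"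
  have E': "?E \<in> sets (ergodic_borel L)" by (intro sets.Diff E zero_limit_sets)
  have Beq: "?B = {M \<in> space (SB L). has_limit L M} \<inter> (limit_map L -` ?E \<inter> space (SB L))" by auto
  have B: "?B \<in> sets (SB L)"
    unfolding Beq by (intro sets.Int measurable_sets[OF measurable_limit_map E']) measurable
  have zero: "symmetrized L p (\<mu>p p) ?B = 0" if qp: "q \<in> {1..last L}" "p \<in> partitions q" for q p
  proof -
    have sp: "space (\<mu>p p) = structures L NN" using \<mu>p[OF qp] sets_eq_imp_space_eq[of "\<mu>p p" "SB L"] by simp
    have "symmetrized L p (\<mu>p p) ?B = (\<integral>\<^sup>+s. 0 \<partial>count_space {s \<in> nat_multisets. mult_partition s = p})"
      unfolding symmetrized_def
    proof (rule nn_integral_cong)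
      fix s assume "s \<in> space (count_space {s \<in> nat_multisets. mult_partition s = p})"
      then have s: "s \<in> nat_multisets" "mult_partition s = p" by auto
      let ?N = "\<lambda>M. relabel L NN (inv (sort_perm s)) M"
      have "AE M in \<mu>p p. ?N M \<notin> ?B"
        using conjunct2[OF \<mu>p[OF qp]] AE_space[of "\<mu>p p"]
      proof eventually_elim
        case (elim M)
        then have M: "M \<in> structures L NN" by (simp add: sp)
        have "is_index L (?N M) s"
          using elim(1) s_index_is_iff[OF M] is_index_sort_perm[OF s(1) M] s(2) by simp
        moreover have "s \<noteq> {#}"
        proof
          assume "s = {#}"
          then have "p \<in> partitions 0" using s(2) mult_partition_in[of s] by simp
          then show False using partitions_unique[OF qp(2)] qp(1) by fastforce
        qed
        ultimately have "\<not> dense L {#} (?N M)" using is_index_in(3)[OF _ relabel_in_structures] by blast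
        then have "?N M \<notin> dense_part L" by (simp add: dense_part_def)
        then have "limit_map L (?N M) = zero_limit L" using limit_map_nonzero_iff[of "?N M" L] by simp
        then show ?case by simp
      qed
      then have "emeasure (\<mu>p p) {M \<in> space (\<mu>p p). ?N M \<in> ?B} = 0" by (intro emeasure_eq_0_AE) simp
      then show "emeasure (\<mu>p p) {M \<in> structures L NN. ?N M \<in> ?B} = 0" by (simp only: sp)
    qed
    then show ?thesis by simp
  qed
  have "emeasure \<mu> ?B = mixture \<nu> ?B" unfolding dec[OF B] using zero by simp
  also have "\<dots> = (\<integral>\<^sup>+W. indicator ?E W \<partial>\<nu>)"
    unfolding mixture_def
  proof (rule nn_integral_cong)
    fix W assume "W \<in> space \<nu>"
    then have W: "W \<in> ergodic_measures L" using sets_eq_imp_space_eq[OF \<nu>(1)] by simp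
    interpret prob_space W by (rule ergodicD(1)[OF W])
    have BW: "?B \<in> sets W" using B ergodicD(2)[OF W] by simp
    have ae: "AE M in W. M \<in> ?B \<longleftrightarrow> W \<in> ?E"
      using AE_comb_limit_eq[OF W] AE_space[of W]
    proof eventually_elim
      case (elim M)
      then show ?case using sets_eq_imp_space_eq[OF ergodicD(2)[OF W]] by (simp add: limit_map_def)
    qed
    show "emeasure W ?B = indicator ?E W"
    proof (cases "W \<in> ?E")
      case True
      have "AE M in W. M \<in> ?B" using ae by eventually_elim (use True in simp)
      then show ?thesis using emeasure_eq_1_AE[OF BW] True by simp
    next
      case False
      have "AE M in W. M \<notin> ?B" using ae by eventually_elim (use False in simp)
      then have "?B \<in> null_sets W" using BW by (simp add: AE_iff_null_sets)
      then show ?thesis using False by (simp add: null_setsD1)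
    qed
  qed
  also have "\<dots> = emeasure \<nu> ?E" using E' by (simp add: \<nu>(1))
  also have "\<dots> = emeasure \<nu> E"
    by (rule emeasure_Diff_null_set) (use E \<nu> zero_limit_sets in \<open>auto simp: null_sets_def\<close>)
  finally show ?thesis by simp
qed

end

theorem theorem4p18:
  fixes L :: "nat list"
    and P :: "'w measure"
    and X :: "real \<Rightarrow> 'w \<Rightarrow> struc"
    and \<mu> :: "struc measure"
  assumes "is_signature L" and "L \<noteq> []" and "last L \<ge> 1"
    and "combinatorial_levy L P X"
    and "exchangeable_process L P X"
    and "rate_measure L P X \<mu>"
  shows "\<exists>!\<nu>\<^sub>0 :: struc measure measure.
           sets \<nu>\<^sub>0 = sets (ergodic_borel L) \<and>
           emeasure \<nu>\<^sub>0 {zero_limit L} = 0 \<and>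
           (\<integral>\<^sup>+ W. ennreal (1 - measure W (cylinder L (last L) (zero_struct L))) \<partial>\<nu>\<^sub>0) < \<infinity> \<and>
           (\<exists>\<mu>\<^sub>p :: nat list \<Rightarrow> struc measure.
              (\<forall>q \<in> {1..last L}. \<forall>p \<in> partitions q.
                 sets (\<mu>\<^sub>p p) = sets (struct_borel L NN) \<and>
                 emeasure (\<mu>\<^sub>p p) {zero_struct L} = 0 \<and>
                 (\<forall>n\<ge>1. emeasure (\<mu>\<^sub>p p)
                    {M \<in> structures L NN. restr {1..n} M \<noteq> zero_struct L} < \<infinity>) \<and>
                 (AE M in \<mu>\<^sub>p p. substruct (canonical_mset p) M = M) \<and>
                 (AE M in \<mu>\<^sub>p p. s_index_is L M (canonical_mset p))) \<and>
              (\<forall>B \<in> sets (struct_borel L NN).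
                 emeasure \<mu> B =
                   mixture \<nu>\<^sub>0 B + (\<Sum>q = 1..last L. \<Sum>p \<in> partitions q. symmetrized L p (\<mu>\<^sub>p p) B)))"
    (is "\<exists>!\<nu>. ?P \<nu>")
proof -
  interpret exchangeable_rate L \<mu> by (rule rate_measure_exchangeable) fact+
  have L: "sorted L" using assms(1) by (simp add: is_signature_def)
  have ex: "?P limit_law"
    by (intro conjI exI[of _ index_measure] ballI allI impI sets_limit_law limit_law_zero
        limit_law_integral assms(3) sets_index_measure index_measure_props rate_measure_decomposition[OF L])
  have det: "emeasure \<nu> E = emeasure \<mu> {M \<in> structures L NN. has_limit L M \<and> limit_map L M \<in> E - {zero_limit L}}"
    if P: "?P \<nu>" and E: "E \<in> sets (ergodic_borel L)" for \<nu> E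
  proof -
    obtain \<mu>p where \<mu>p: "\<And>q p. q \<in> {1..last L} \<Longrightarrow> p \<in> partitions q \<Longrightarrow> sets (\<mu>p p) = sets (SB L) \<and>
        (AE M in \<mu>p p. s_index_is L M (canonical_mset p))"
      "\<And>B. B \<in> sets (SB L) \<Longrightarrow> emeasure \<mu> B = mixture \<nu> B + (\<Sum>q = 1..last L. \<Sum>p\<in>partitions q. symmetrized L p (\<mu>p p) B)"
      using P by blast
    show ?thesis by (rule measure_eq_preimage_of_limit[OF _ _ \<mu>p E]) (use P in blast)+
  qed
  show ?thesis
  proof (rule ex1I[of ?P, OF ex])
    fix \<nu> assume P: "?P \<nu>"
    then have s: "sets \<nu> = sets (ergodic_borel L)" by blast
    show "\<nu> = limit_law"
    proof (rule measure_eqI)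
      fix E assume "E \<in> sets \<nu>"
      then have "E \<in> sets (ergodic_borel L)" using s by simp
      then show "emeasure \<nu> E = emeasure limit_law E" using det[OF P] det[OF ex] by simp
    qed (simp add: s)
  qed
qed

end
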